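(* Let $E$ be a Hilbert $\mathcal{B}$-module, let $F$ be a Hilbert $\mathcal{C}$-module and let $\vartheta\colon B^a(E)\to B^a(F)$ be a strict unital homomorphism. (In other words, $F$ is a correspondence from $B^a(E)$ to $\mathcal{C}$ with strict left action and, thus, also a correspondence from $\mathcal{K}(E)$ to $\mathcal{C}$.) Then $F_\vartheta:=E^*\odot F$ is a correspondence from $\mathcal{B}$ to $\mathcal{C}$ and the formula $$u(x_1\odot(x_2^*\odot y)):=\vartheta(x_1x_2^* )y\qquad(x_1,x_2\in E,\ y\in F)$$ defines a unitary $u\colon E\odot F_\vartheta\to F$ such that $$\vartheta(a)=u(a\odot\mathrm{id}_{F_\vartheta})u^*\qquad\text{for all }a\in B^a(E).$$
   Context: $\mathcal{B},\mathcal{C}$ are (not necessarily unital) $C^*$-algebras. Hilbert modules are right Hilbert $C^*$-modules, not assumed full, with inner product linear in the second variable. $B^a(E)$ is the $C^*$-algebra of adjointable operators on $E$. For $x,y\in E$ the rank-one operator $xy^*\in B^a(E)$ is $z\mapsto x\langle y,z\rangle$; the span of these is $\mathcal{F}(E)$ (finite-rank operators) and its norm completion is $\mathcal{K}(E)$ (compact operators). Homomorphisms are $*$-homomorphisms. Strict: $B^a(E)$ is the multiplier algebra of $\mathcal{K}(E)$ and thus carries a strict topology, which on bounded subsets coincides with the $*$-strong topology. A bounded linear map $B^a(E)\to B^a(F)$ is strict if it is strictly continuous on bounded subsets. A correspondence from $\mathcal{A}$ to $\mathcal{B}$ is a Hilbert $\mathcal{B}$-module with a left action of $\mathcal{A}$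 given by a nondegenerate representation of $\mathcal{A}$ by adjointable operators. The tensor product (over $\mathcal{B}$) of a Hilbert $\mathcal{B}$-module (or a correspondence from $\mathcal{A}$ to $\mathcal{B}$) $E$ and a correspondence $F$ from $\mathcal{B}$ to $\mathcal{C}$ is the Hilbert $\mathcal{C}$-module (correspondence from $\mathcal{A}$ to $\mathcal{C}$) $E\odot F$ generated by elementary tensors $x\odot y$ with $\langle x\odot y,x'\odot y'\rangle=\langle y,\langle x,x'\rangle y'\rangle$. The dual module $E^*=\{x^*: x\in E\}$ is the correspondence from $\mathcal{B}$ to $B^a(E)$ with inner product $\langle x^*,y^*\rangle=xy^*$ and module operations $bx^*a=(a^*xb^* )^*$. In $E^*\odot F$ the tensor product is over $B^a(E)$, which acts on $F$ from the left via $\vartheta$. *)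

theory Defs
  imports
    "HOL-Analysis.Analysis"
    "HOL-Algebra.Module"
    "HOL-Library.Poly_Mapping"
begin

section \<open>Complex vector spaces\<close>

text \<open>
  Complex vector spaces, \<open>C\<^sup>*\<close>-algebras and Hilbert modules are carrier-based structures in the
  style of HOL-Algebra, since \<open>B\<^sup>a(E)\<close> and tensor products over it depend on the module \<open>E\<close>.
  A complex vector space is a \<^const>\<open>Module.module\<close> over the field of complex numbers.  The record
  \<open>(complex, 'a) module\<close> inherits the fields \<open>mult\<close> and \<open>one\<close> of rings; for vector spaces
  both are irrelevant, and for (possibly nonunital) \<open>C\<^sup>*\<close>-algebras \<open>one\<close> is irrelevant.
\<close>

definition complex_field :: "complex ring" where
  "complex_field = \<lparr>carrier = UNIV, mult = (*), one = 1, zero = 0, add = (+)\<rparr>"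

inductive_set lin_span :: "(complex, 'v, 'm) module_scheme \<Rightarrow> 'v set \<Rightarrow> 'v set"
  for V :: "(complex, 'v, 'm) module_scheme" and S :: "'v set" where
  zero: "\<zero>\<^bsub>V\<^esub> \<in> lin_span V S"
| add: "x \<in> S \<Longrightarrow> y \<in> lin_span V S \<Longrightarrow> (c \<odot>\<^bsub>V\<^esub> x) \<oplus>\<^bsub>V\<^esub> y \<in> lin_span V S"

definition norm_closure ::
  "(complex, 'v, 'm) module_scheme \<Rightarrow> ('v \<Rightarrow> real) \<Rightarrow> 'v set \<Rightarrow> 'v set" where
  "norm_closure V nV S = {x \<in> carrier V. \<forall>\<epsilon>>0. \<exists>s\<in>S. nV (x \<ominus>\<^bsub>V\<^esub> s) < \<epsilon>}"

definition cauchy_seqs ::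
  "(complex, 'v, 'm) module_scheme \<Rightarrow> ('v \<Rightarrow> real) \<Rightarrow> (nat \<Rightarrow> 'v) set" where
  "cauchy_seqs V nV = {s. (\<forall>n. s n \<in> carrier V) \<and>
     (\<forall>\<epsilon>>0. \<exists>N. \<forall>m\<ge>N. \<forall>n\<ge>N. nV (s m \<ominus>\<^bsub>V\<^esub> s n) < \<epsilon>)}"

definition norm_complete :: "(complex, 'v, 'm) module_scheme \<Rightarrow> ('v \<Rightarrow> real) \<Rightarrow> bool" where
  "norm_complete V nV \<longleftrightarrow>
     (\<forall>s\<in>cauchy_seqs V nV. \<exists>x\<in>carrier V. (\<lambda>n. nV (s n \<ominus>\<^bsub>V\<^esub> x)) \<longlonglongrightarrow> 0)"

definition bounded_linear_map ::
  "(complex, 'v, 'm) module_scheme \<Rightarrow> ('v \<Rightarrow> real) \<Rightarrow>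
   (complex, 'w, 'n) module_scheme \<Rightarrow> ('w \<Rightarrow> real) \<Rightarrow> ('v \<Rightarrow> 'w) \<Rightarrow> bool" where
  "bounded_linear_map V nV W nW T \<longleftrightarrow>
     T \<in> carrier V \<rightarrow> carrier W \<and>
     (\<forall>x\<in>carrier V. \<forall>y\<in>carrier V. T (x \<oplus>\<^bsub>V\<^esub> y) = T x \<oplus>\<^bsub>W\<^esub> T y) \<and>
     (\<forall>c. \<forall>x\<in>carrier V. T (c \<odot>\<^bsub>V\<^esub> x) = c \<odot>\<^bsub>W\<^esub> T x) \<and>
     (\<exists>K. \<forall>x\<in>carrier V. nW (T x) \<le> K * nV x)"


section \<open>\<open>C\<^sup>*\<close>-algebras\<close>

record 'a cstar = "(complex, 'a) module" +
  invol :: "'a \<Rightarrow> 'a"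
  cnorm :: "'a \<Rightarrow> real"

locale cstar_algebra = Module.module complex_field A
  for A :: "('a, 'm) cstar_scheme" (structure) +
  assumes mult_closed: "\<lbrakk>a \<in> carrier A; b \<in> carrier A\<rbrakk> \<Longrightarrow> a \<otimes> b \<in> carrier A"
    and mult_assoc: "\<lbrakk>a \<in> carrier A; b \<in> carrier A; c \<in> carrier A\<rbrakk> \<Longrightarrow>
          (a \<otimes> b) \<otimes> c = a \<otimes> (b \<otimes> c)"
    and mult_l_distr: "\<lbrakk>a \<in> carrier A; b \<in> carrier A; c \<in> carrier A\<rbrakk> \<Longrightarrow>
          (a \<oplus> b) \<otimes> c = a \<otimes> c \<oplus> b \<otimes> c"
    and mult_r_distr: "\<lbrakk>a \<in> carrier A; b \<in> carrier A; c \<in> carrier A\<rbrakk> \<Longrightarrow>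
          a \<otimes> (b \<oplus> c) = a \<otimes> b \<oplus> a \<otimes> c"
    and mult_smult_l: "\<lbrakk>a \<in> carrier A; b \<in> carrier A\<rbrakk> \<Longrightarrow>
          (z \<odot> a) \<otimes> b = z \<odot> (a \<otimes> b)"
    and mult_smult_r: "\<lbrakk>a \<in> carrier A; b \<in> carrier A\<rbrakk> \<Longrightarrow>
          a \<otimes> (z \<odot> b) = z \<odot> (a \<otimes> b)"
    and invol_closed: "a \<in> carrier A \<Longrightarrow> invol A a \<in> carrier A"
    and invol_invol: "a \<in> carrier A \<Longrightarrow> invol A (invol A a) = a"
    and invol_add: "\<lbrakk>a \<in> carrier A; b \<in> carrier A\<rbrakk> \<Longrightarrow>
          invol A (a \<oplus> b) = invol A a \<oplus> invol A b"
    and invol_smult: "a \<in> carrier A \<Longrightarrow> invol A (z \<odot> a) = cnj z \<odot> invol A a"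
    and invol_mult: "\<lbrakk>a \<in> carrier A; b \<in> carrier A\<rbrakk> \<Longrightarrow>
          invol A (a \<otimes> b) = invol A b \<otimes> invol A a"
    and cnorm_nonneg: "a \<in> carrier A \<Longrightarrow> 0 \<le> cnorm A a"
    and cnorm_eq_0: "a \<in> carrier A \<Longrightarrow> cnorm A a = 0 \<longleftrightarrow> a = \<zero>"
    and cnorm_triangle: "\<lbrakk>a \<in> carrier A; b \<in> carrier A\<rbrakk> \<Longrightarrow>
          cnorm A (a \<oplus> b) \<le> cnorm A a + cnorm A b"
    and cnorm_smult: "a \<in> carrier A \<Longrightarrow> cnorm A (z \<odot> a) = cmod z * cnorm A a"
    and cnorm_mult: "\<lbrakk>a \<in> carrier A; b \<in> carrier A\<rbrakk> \<Longrightarrow>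
          cnorm A (a \<otimes> b) \<le> cnorm A a * cnorm A b"
    and cstar_identity: "a \<in> carrier A \<Longrightarrow> cnorm A (invol A a \<otimes> a) = (cnorm A a)\<^sup>2"
    and complete: "norm_complete A (cnorm A)"

definition cstar_pos :: "('a, 'm) cstar_scheme \<Rightarrow> 'a \<Rightarrow> bool" where
  "cstar_pos A a \<longleftrightarrow> (\<exists>c\<in>carrier A. a = invol A c \<otimes>\<^bsub>A\<^esub> c)"

definition star_hom ::
  "('a, 'm) cstar_scheme \<Rightarrow> ('b, 'n) cstar_scheme \<Rightarrow> ('a \<Rightarrow> 'b) \<Rightarrow> bool" where
  "star_hom A B \<phi> \<longleftrightarrow>
     \<phi> \<in> carrier A \<rightarrow> carrier B \<and>
     (\<forall>a\<in>carrier A. \<forall>a'\<in>carrier A. \<phi> (a \<oplus>\<^bsub>A\<^esub> a') = \<phi> a \<oplus>\<^bsub>B\<^esub> \<phi> a') \<and>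
     (\<forall>c. \<forall>a\<in>carrier A. \<phi> (c \<odot>\<^bsub>A\<^esub> a) = c \<odot>\<^bsub>B\<^esub> \<phi> a) \<and>
     (\<forall>a\<in>carrier A. \<forall>a'\<in>carrier A. \<phi> (a \<otimes>\<^bsub>A\<^esub> a') = \<phi> a \<otimes>\<^bsub>B\<^esub> \<phi> a') \<and>
     (\<forall>a\<in>carrier A. \<phi> (invol A a) = invol B (\<phi> a))"

definition cstar_lim :: "('a, 'm) cstar_scheme \<Rightarrow> (nat \<Rightarrow> 'a) \<Rightarrow> 'a" where
  "cstar_lim A s = (THE a. a \<in> carrier A \<and> (\<lambda>n. cnorm A (s n \<ominus>\<^bsub>A\<^esub> a)) \<longlonglongrightarrow> 0)"


section \<open>Hilbert modules\<close>

record ('b, 'e) hmodule = "(complex, 'e) module" +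
  ract :: "'e \<Rightarrow> 'b \<Rightarrow> 'e"
  ip :: "'e \<Rightarrow> 'e \<Rightarrow> 'b"

definition hnorm :: "('b, 'm) cstar_scheme \<Rightarrow> ('b, 'e, 'n) hmodule_scheme \<Rightarrow> 'e \<Rightarrow> real" where
  "hnorm B E x = sqrt (cnorm B (ip E x x))"

locale hilbert_module = B: cstar_algebra B + E: Module.module complex_field E
  for B :: "('b, 'm) cstar_scheme" and E :: "('b, 'e, 'n) hmodule_scheme" +
  assumes ract_closed: "\<lbrakk>x \<in> carrier E; b \<in> carrier B\<rbrakk> \<Longrightarrow> ract E x b \<in> carrier E"
    and ract_add_l: "\<lbrakk>x \<in> carrier E; y \<in> carrier E; b \<in> carrier B\<rbrakk> \<Longrightarrow>
          ract E (x \<oplus>\<^bsub>E\<^esub> y) b = ract E x b \<oplus>\<^bsub>E\<^esub> ract E y b"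
    and ract_add_r: "\<lbrakk>x \<in> carrier E; b \<in> carrier B; b' \<in> carrier B\<rbrakk> \<Longrightarrow>
          ract E x (b \<oplus>\<^bsub>B\<^esub> b') = ract E x b \<oplus>\<^bsub>E\<^esub> ract E x b'"
    and ract_mult: "\<lbrakk>x \<in> carrier E; b \<in> carrier B; b' \<in> carrier B\<rbrakk> \<Longrightarrow>
          ract E x (b \<otimes>\<^bsub>B\<^esub> b') = ract E (ract E x b) b'"
    and ract_smult_l: "\<lbrakk>x \<in> carrier E; b \<in> carrier B\<rbrakk> \<Longrightarrow>
          ract E (z \<odot>\<^bsub>E\<^esub> x) b = z \<odot>\<^bsub>E\<^esub> ract E x b"
    and ract_smult_r: "\<lbrakk>x \<in> carrier E; b \<in> carrier B\<rbrakk> \<Longrightarrow>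
          ract E x (z \<odot>\<^bsub>B\<^esub> b) = z \<odot>\<^bsub>E\<^esub> ract E x b"
    and ip_closed: "\<lbrakk>x \<in> carrier E; y \<in> carrier E\<rbrakk> \<Longrightarrow> ip E x y \<in> carrier B"
    and ip_add: "\<lbrakk>x \<in> carrier E; y \<in> carrier E; y' \<in> carrier E\<rbrakk> \<Longrightarrow>
          ip E x (y \<oplus>\<^bsub>E\<^esub> y') = ip E x y \<oplus>\<^bsub>B\<^esub> ip E x y'"
    and ip_smult: "\<lbrakk>x \<in> carrier E; y \<in> carrier E\<rbrakk> \<Longrightarrow>
          ip E x (z \<odot>\<^bsub>E\<^esub> y) = z \<odot>\<^bsub>B\<^esub> ip E x y"
    and ip_ract: "\<lbrakk>x \<in> carrier E; y \<in> carrier E; b \<in> carrier B\<rbrakk> \<Longrightarrow>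
          ip E x (ract E y b) = ip E x y \<otimes>\<^bsub>B\<^esub> b"
    and ip_invol: "\<lbrakk>x \<in> carrier E; y \<in> carrier E\<rbrakk> \<Longrightarrow> invol B (ip E x y) = ip E y x"
    and ip_pos: "x \<in> carrier E \<Longrightarrow> cstar_pos B (ip E x x)"
    and ip_definite: "x \<in> carrier E \<Longrightarrow> ip E x x = \<zero>\<^bsub>B\<^esub> \<Longrightarrow> x = \<zero>\<^bsub>E\<^esub>"
    and complete: "norm_complete E (hnorm B E)"


section \<open>Adjointable operators\<close>

text \<open>
  Operators are extensional functions on the carrier.  Linearity and boundedness of an adjointable
  map are automatic and therefore not part of the definition.
\<close>

definition adjointable ::
  "('b, 'e, 'm) hmodule_scheme \<Rightarrow> ('b, 'f, 'n) hmodule_scheme \<Rightarrow> ('e \<Rightarrow> 'f) set" where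
  "adjointable E F = {a \<in> carrier E \<rightarrow>\<^sub>E carrier F. \<exists>a'\<in>carrier F \<rightarrow> carrier E.
     \<forall>x\<in>carrier E. \<forall>y\<in>carrier F. ip F (a x) y = ip E x (a' y)}"

definition hm_adjoint ::
  "('b, 'e, 'm) hmodule_scheme \<Rightarrow> ('b, 'f, 'n) hmodule_scheme \<Rightarrow> ('e \<Rightarrow> 'f) \<Rightarrow> 'f \<Rightarrow> 'e" where
  "hm_adjoint E F a = (\<lambda>y\<in>carrier F.
     THE x'. x' \<in> carrier E \<and> (\<forall>x\<in>carrier E. ip F (a x) y = ip E x x'))"

definition unitary ::
  "('b, 'e, 'm) hmodule_scheme \<Rightarrow> ('b, 'f, 'n) hmodule_scheme \<Rightarrow> ('e \<Rightarrow> 'f) \<Rightarrow> bool" where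
  "unitary E F u \<longleftrightarrow> u \<in> adjointable E F \<and>
     compose (carrier E) (hm_adjoint E F u) u = (\<lambda>x\<in>carrier E. x) \<and>
     compose (carrier F) u (hm_adjoint E F u) = (\<lambda>y\<in>carrier F. y)"

definition Ba :: "('b, 'm) cstar_scheme \<Rightarrow> ('b, 'e, 'n) hmodule_scheme \<Rightarrow> ('e \<Rightarrow> 'e) cstar" where
  "Ba B E = \<lparr>
     carrier = adjointable E E,
     mult = (\<lambda>a a'. compose (carrier E) a a'),
     one = (\<lambda>x\<in>carrier E. x),
     zero = (\<lambda>x\<in>carrier E. \<zero>\<^bsub>E\<^esub>),
     add = (\<lambda>a a'. \<lambda>x\<in>carrier E. a x \<oplus>\<^bsub>E\<^esub> a' x),
     smult = (\<lambda>c a. \<lambda>x\<in>carrier E. c \<odot>\<^bsub>E\<^esub> a x),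
     invol = hm_adjoint E E,
     cnorm = (\<lambda>a. Sup {hnorm B E (a x) | x. x \<in> carrier E \<and> hnorm B E x \<le> 1})\<rparr>"

definition rank_one :: "('b, 'e, 'm) hmodule_scheme \<Rightarrow> 'e \<Rightarrow> 'e \<Rightarrow> 'e \<Rightarrow> 'e" where
  "rank_one E x y = (\<lambda>z\<in>carrier E. ract E x (ip E y z))"

definition finite_rank ::
  "('b, 'm) cstar_scheme \<Rightarrow> ('b, 'e, 'n) hmodule_scheme \<Rightarrow> ('e \<Rightarrow> 'e) set" where
  "finite_rank B E =
     lin_span (Ba B E) {rank_one E x y | x y. x \<in> carrier E \<and> y \<in> carrier E}"

definition compacts ::
  "('b, 'm) cstar_scheme \<Rightarrow> ('b, 'e, 'n) hmodule_scheme \<Rightarrow> ('e \<Rightarrow> 'e) cstar" where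
  "compacts B E = (Ba B E)
     \<lparr>carrier := norm_closure (Ba B E) (cnorm (Ba B E)) (finite_rank B E)\<rparr>"

text \<open>
  The strict topology of \<open>B\<^sup>a(E)\<close> as multiplier algebra of the compact operators: the topology of
  the seminorms \<open>a \<mapsto> \<parallel>a k\<parallel>\<close> and \<open>a \<mapsto> \<parallel>k a\<parallel>\<close> with \<open>k\<close> compact.
\<close>

definition strict_topology ::
  "('b, 'm) cstar_scheme \<Rightarrow> ('b, 'e, 'n) hmodule_scheme \<Rightarrow> ('e \<Rightarrow> 'e) topology" where
  "strict_topology B E = (let A = Ba B E in topology_generated_by
     ({{a \<in> carrier A. cnorm A ((a \<ominus>\<^bsub>A\<^esub> a\<^sub>0) \<otimes>\<^bsub>A\<^esub> k) < \<epsilon>} | a\<^sub>0 k \<epsilon>.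
         a\<^sub>0 \<in> carrier A \<and> k \<in> carrier (compacts B E) \<and> 0 < \<epsilon>} \<union>
      {{a \<in> carrier A. cnorm A (k \<otimes>\<^bsub>A\<^esub> (a \<ominus>\<^bsub>A\<^esub> a\<^sub>0)) < \<epsilon>} | a\<^sub>0 k \<epsilon>.
         a\<^sub>0 \<in> carrier A \<and> k \<in> carrier (compacts B E) \<and> 0 < \<epsilon>}))"

definition strict_map ::
  "('b, 'm) cstar_scheme \<Rightarrow> ('b, 'e, 'n) hmodule_scheme \<Rightarrow>
   ('c, 'p) cstar_scheme \<Rightarrow> ('c, 'f, 'q) hmodule_scheme \<Rightarrow>
   (('e \<Rightarrow> 'e) \<Rightarrow> 'f \<Rightarrow> 'f) \<Rightarrow> bool" where
  "strict_map B E C F T \<longleftrightarrow>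
     bounded_linear_map (Ba B E) (cnorm (Ba B E)) (Ba C F) (cnorm (Ba C F)) T \<and>
     (\<forall>S \<subseteq> carrier (Ba B E). (\<exists>K. \<forall>a\<in>S. cnorm (Ba B E) a \<le> K) \<longrightarrow>
        continuous_map (subtopology (strict_topology B E) S) (strict_topology C F) T)"


section \<open>Correspondences\<close>

text \<open>
  The Hilbert \<open>C\<close>-module \<open>F\<close> with left action \<open>\<phi>\<close> (written \<open>\<phi> a y\<close> for \<open>ay\<close>) is a
  correspondence from \<open>A\<close> to \<open>C\<close>.
\<close>

definition correspondence ::
  "('a, 'm) cstar_scheme \<Rightarrow> ('c, 'n) cstar_scheme \<Rightarrow> ('c, 'f, 'p) hmodule_scheme \<Rightarrow>
   ('a \<Rightarrow> 'f \<Rightarrow> 'f) \<Rightarrow> bool" where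
  "correspondence A C F \<phi> \<longleftrightarrow>
     cstar_algebra A \<and> hilbert_module C F \<and> star_hom A (Ba C F) \<phi> \<and>
     norm_closure F (hnorm C F) (lin_span F {\<phi> a y | a y. a \<in> carrier A \<and> y \<in> carrier F})
       = carrier F"


section \<open>Tensor products\<close>

text \<open>
  The (Hausdorff) completion of a semi-Hilbert \<open>C\<close>-module \<open>P\<close> consists of the classes of Cauchy
  sequences in \<open>P\<close> modulo sequences converging to zero in the seminorm; in particular, it divides
  out the vectors of length zero.
\<close>

definition cauchy_class ::
  "('c, 'm) cstar_scheme \<Rightarrow> ('c, 'p, 'n) hmodule_scheme \<Rightarrow> (nat \<Rightarrow> 'p) \<Rightarrow> (nat \<Rightarrow> 'p) set" where
  "cauchy_class C P s =
     {t \<in> cauchy_seqs P (hnorm C P). (\<lambda>n. hnorm C P (s n \<ominus>\<^bsub>P\<^esub> t n)) \<longlonglongrightarrow> 0}"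

definition class_rep :: "(nat \<Rightarrow> 'p) set \<Rightarrow> nat \<Rightarrow> 'p" where
  "class_rep \<xi> = (SOME s. s \<in> \<xi>)"

definition completion ::
  "('c, 'm) cstar_scheme \<Rightarrow> ('c, 'p, 'n) hmodule_scheme \<Rightarrow> ('c, (nat \<Rightarrow> 'p) set) hmodule" where
  "completion C P = \<lparr>
     carrier = cauchy_class C P ` cauchy_seqs P (hnorm C P),
     mult = undefined,
     one = undefined,
     zero = cauchy_class C P (\<lambda>_. \<zero>\<^bsub>P\<^esub>),
     add = (\<lambda>\<xi> \<eta>. cauchy_class C P (\<lambda>n. class_rep \<xi> n \<oplus>\<^bsub>P\<^esub> class_rep \<eta> n)),
     smult = (\<lambda>z \<xi>. cauchy_class C P (\<lambda>n. z \<odot>\<^bsub>P\<^esub> class_rep \<xi> n)),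
     ract = (\<lambda>\<xi> c. cauchy_class C P (\<lambda>n. ract P (class_rep \<xi> n) c)),
     ip = (\<lambda>\<xi> \<eta>. cstar_lim C (\<lambda>n. ip P (class_rep \<xi> n) (class_rep \<eta> n)))\<rparr>"

text \<open>
  Elements of the free complex vector space over \<open>E \<times> F\<close> are the finitely supported functions
  \<open>('e \<times> 'f) \<Rightarrow>\<^sub>0 complex\<close> with keys in \<open>E \<times> F\<close>; \<open>free_map g\<close> is the linear extension of a map
  \<open>g\<close> between generators.
\<close>

definition free_map :: "('i \<Rightarrow> 'j) \<Rightarrow> ('i \<Rightarrow>\<^sub>0 complex) \<Rightarrow> ('j \<Rightarrow>\<^sub>0 complex)" where
  "free_map g t =
     (\<Sum>p\<in>Poly_Mapping.keys t. Poly_Mapping.single (g p) (Poly_Mapping.lookup t p))"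

text \<open>
  The semi-inner product is the sesquilinear extension of
  \<open>\<langle>(x, y), (x', y')\<rangle> = \<langle>y, \<langle>x, x'\<rangle>y'\<rangle>\<close>.  All relations of the algebraic tensor product,
  including \<open>xb \<otimes> y - x \<otimes> by\<close>, have length zero and are divided out in the completion.
\<close>

definition pre_tensor ::
  "('c, 'm) cstar_scheme \<Rightarrow> ('b, 'e, 'n) hmodule_scheme \<Rightarrow> ('c, 'f, 'p) hmodule_scheme \<Rightarrow>
   ('b \<Rightarrow> 'f \<Rightarrow> 'f) \<Rightarrow> ('c, ('e \<times> 'f) \<Rightarrow>\<^sub>0 complex) hmodule" where
  "pre_tensor C E F \<phi> = \<lparr>
     carrier = {t. Poly_Mapping.keys t \<subseteq> carrier E \<times> carrier F},
     mult = undefined,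
     one = undefined,
     zero = 0,
     add = (+),
     smult = (\<lambda>z t. Poly_Mapping.map (\<lambda>w. z * w) t),
     ract = (\<lambda>t c. free_map (\<lambda>(x, y). (x, ract F y c)) t),
     ip = (\<lambda>s t. \<Oplus>\<^bsub>C\<^esub>p\<in>Poly_Mapping.keys s. \<Oplus>\<^bsub>C\<^esub>q\<in>Poly_Mapping.keys t.
        (cnj (Poly_Mapping.lookup s p) * Poly_Mapping.lookup t q) \<odot>\<^bsub>C\<^esub>
          ip F (snd p) (\<phi> (ip E (fst p) (fst q)) (snd q)))\<rparr>"

text \<open>
  The tensor product \<open>E \<odot> F\<close> of a Hilbert module \<open>E\<close> over some \<open>C\<^sup>*\<close>-algebra and a
  correspondence \<open>F\<close> with left action \<open>\<phi>\<close> from that algebra to \<open>C\<close>, and the elementary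
  tensor \<open>x \<odot> y\<close>.
\<close>

definition tensor ::
  "('c, 'm) cstar_scheme \<Rightarrow> ('b, 'e, 'n) hmodule_scheme \<Rightarrow> ('c, 'f, 'p) hmodule_scheme \<Rightarrow>
   ('b \<Rightarrow> 'f \<Rightarrow> 'f) \<Rightarrow> ('c, (nat \<Rightarrow> ('e \<times> 'f) \<Rightarrow>\<^sub>0 complex) set) hmodule" where
  "tensor C E F \<phi> = completion C (pre_tensor C E F \<phi>)"

definition elem_tensor ::
  "('c, 'm) cstar_scheme \<Rightarrow> ('b, 'e, 'n) hmodule_scheme \<Rightarrow> ('c, 'f, 'p) hmodule_scheme \<Rightarrow>
   ('b \<Rightarrow> 'f \<Rightarrow> 'f) \<Rightarrow> 'e \<Rightarrow> 'f \<Rightarrow> (nat \<Rightarrow> ('e \<times> 'f) \<Rightarrow>\<^sub>0 complex) set" where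
  "elem_tensor C E F \<phi> x y =
     cauchy_class C (pre_tensor C E F \<phi>) (\<lambda>_. Poly_Mapping.single (x, y) 1)"

text \<open>
  The operator \<open>a \<odot> id\<close>, that is, \<open>x \<odot> y \<mapsto> ax \<odot> y\<close>, on \<open>E \<odot> F\<close>.  If \<open>E\<close> carries a left
  action, it is also the left action of the correspondence \<open>E \<odot> F\<close>.
\<close>

definition tensor_id ::
  "('c, 'm) cstar_scheme \<Rightarrow> ('b, 'e, 'n) hmodule_scheme \<Rightarrow> ('c, 'f, 'p) hmodule_scheme \<Rightarrow>
   ('b \<Rightarrow> 'f \<Rightarrow> 'f) \<Rightarrow> ('e \<Rightarrow> 'e) \<Rightarrow>
   (nat \<Rightarrow> ('e \<times> 'f) \<Rightarrow>\<^sub>0 complex) set \<Rightarrow> (nat \<Rightarrow> ('e \<times> 'f) \<Rightarrow>\<^sub>0 complex) set" where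
  "tensor_id C E F \<phi> a = (\<lambda>\<xi>\<in>carrier (tensor C E F \<phi>).
     cauchy_class C (pre_tensor C E F \<phi>)
       (\<lambda>n. free_map (\<lambda>(x, y). (a x, y)) (class_rep \<xi> n)))"


section \<open>The dual module\<close>

text \<open>\<open>Star x\<close> is the element \<open>x\<^sup>*\<close> of \<open>E\<^sup>*\<close>.\<close>

datatype 'e dual = Star (unstar: 'e)

definition dual_module :: "('b, 'e, 'm) hmodule_scheme \<Rightarrow> ('e \<Rightarrow> 'e, 'e dual) hmodule" where
  "dual_module E = \<lparr>
     carrier = Star ` carrier E,
     mult = undefined,
     one = undefined,
     zero = Star \<zero>\<^bsub>E\<^esub>,
     add = (\<lambda>\<xi> \<eta>. Star (unstar \<xi> \<oplus>\<^bsub>E\<^esub> unstar \<eta>)),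
     smult = (\<lambda>z \<xi>. Star (cnj z \<odot>\<^bsub>E\<^esub> unstar \<xi>)),
     ract = (\<lambda>\<xi> a. Star (hm_adjoint E E a (unstar \<xi>))),
     ip = (\<lambda>\<xi> \<eta>. rank_one E (unstar \<xi>) (unstar \<eta>))\<rparr>"

definition dual_lact ::
  "('b, 'm) cstar_scheme \<Rightarrow> ('b, 'e, 'n) hmodule_scheme \<Rightarrow> 'b \<Rightarrow> 'e dual \<Rightarrow> 'e dual" where
  "dual_lact B E b \<xi> = Star (ract E (unstar \<xi>) (invol B b))"

text \<open>\<open>F\<^sub>\<theta> = E\<^sup>* \<odot> F\<close>, its elements \<open>x\<^sup>* \<odot> y\<close>, and its left action of \<open>B\<close>.\<close>

definition F_theta ::
  "('c, 'm) cstar_scheme \<Rightarrow> ('b, 'e, 'n) hmodule_scheme \<Rightarrow> ('c, 'f, 'p) hmodule_scheme \<Rightarrow>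
   (('e \<Rightarrow> 'e) \<Rightarrow> 'f \<Rightarrow> 'f) \<Rightarrow>
   ('c, (nat \<Rightarrow> ('e dual \<times> 'f) \<Rightarrow>\<^sub>0 complex) set) hmodule" where
  "F_theta C E F \<theta> = tensor C (dual_module E) F \<theta>"

definition F_theta_elem ::
  "('c, 'm) cstar_scheme \<Rightarrow> ('b, 'e, 'n) hmodule_scheme \<Rightarrow> ('c, 'f, 'p) hmodule_scheme \<Rightarrow>
   (('e \<Rightarrow> 'e) \<Rightarrow> 'f \<Rightarrow> 'f) \<Rightarrow> 'e \<Rightarrow> 'f \<Rightarrow> (nat \<Rightarrow> ('e dual \<times> 'f) \<Rightarrow>\<^sub>0 complex) set" where
  "F_theta_elem C E F \<theta> x y = elem_tensor C (dual_module E) F \<theta> (Star x) y"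

definition F_theta_lact ::
  "('b, 'k) cstar_scheme \<Rightarrow> ('c, 'm) cstar_scheme \<Rightarrow> ('b, 'e, 'n) hmodule_scheme \<Rightarrow>
   ('c, 'f, 'p) hmodule_scheme \<Rightarrow> (('e \<Rightarrow> 'e) \<Rightarrow> 'f \<Rightarrow> 'f) \<Rightarrow> 'b \<Rightarrow>
   (nat \<Rightarrow> ('e dual \<times> 'f) \<Rightarrow>\<^sub>0 complex) set \<Rightarrow> (nat \<Rightarrow> ('e dual \<times> 'f) \<Rightarrow>\<^sub>0 complex) set" where
  "F_theta_lact B C E F \<theta> b = tensor_id C (dual_module E) F \<theta> (dual_lact B E b)"

end

theory Submission imports Defs begin

text \<open>
  The formula for \<open>u\<close> forces its properties.  From \<open>(x\<^sub>1 x\<^sub>2\<^sup>*)\<^sup>* (x\<^sub>1' x\<^sub>2'\<^sup>*) = x\<^sub>2 \<langle>x\<^sub>1, x\<^sub>1'\<rangle> x\<^sub>2'\<^sup>*\<close> one gets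
  \<open>\<langle>\<theta>(x\<^sub>1 x\<^sub>2\<^sup>*) y, \<theta>(x\<^sub>1' x\<^sub>2'\<^sup>*) y'\<rangle> = \<langle>y, \<theta>(x\<^sub>2 \<langle>x\<^sub>1, x\<^sub>1'\<rangle> x\<^sub>2'\<^sup>*) y'\<rangle>\<close>, which is the inner product of
  \<open>x\<^sub>1 \<odot> (x\<^sub>2\<^sup>* \<odot> y)\<close> and \<open>x\<^sub>1' \<odot> (x\<^sub>2'\<^sup>* \<odot> y')\<close>; so \<open>u\<close> is isometric (\<open>V_ip\<close>, \<open>W_ip\<close>, \<open>U_ip\<close>, \<open>u_ip\<close>).  Its range
  is closed and contains \<open>\<theta>(k) y\<close> for all finite-rank and hence all compact \<open>k\<close>.  The compact operators
  contain a bounded net that tends strictly to \<open>1\<close>, and \<open>\<theta>\<close> is strict and unital; so these vectors are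
  dense (\<open>strict_compacts_approximate_identity\<close>) and \<open>u\<close> is surjective (\<open>u_surj\<close>).  The identity
  \<open>a (x\<^sub>1 x\<^sub>2\<^sup>*) = (a x\<^sub>1) x\<^sub>2\<^sup>*\<close> gives \<open>u (a \<odot> id) = \<theta>(a) u\<close> (\<open>u_tensor_id\<close>), and the formula determines \<open>u\<close>
  because elementary tensors span dense subspaces (\<open>u_unique\<close>).

  Before this, the tensor products have to be seen to exist.  The crucial point is that the
  semi-inner product of \<open>E\<^sup>* \<odot> F\<close> is positive (\<open>P1_pos\<close>).  On \<open>E \<odot> F\<^sub>\<theta>\<close> positivity is then inherited from
  \<open>F\<close>.  The left action of the coefficient algebra on \<open>F\<^sub>\<theta>\<close> is bounded since \<open>r - b\<^sup>*b\<close> has a square root for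
  large \<open>r\<close> (\<open>bact_bounded\<close>), and nondegenerate since every \<open>x\<close> is a limit of vectors \<open>x \<langle>x, z\<rangle>\<close>
  (\<open>lact_nondegenerate\<close>).

  The theory of \<open>C\<^sup>*\<close>-algebras behind these facts is elementary and uses no spectra.  The square root of
  \<open>1 - x\<close> with \<open>\<parallel>x\<parallel> \<le> 1\<close> is obtained by iteration (\<open>sqrt_of_one_minus\<close>); it yields square roots of positive
  elements and, by Kaplansky's theorem that \<open>c\<^sup>*c\<close> is positive (\<open>npos_invol_mult\<close>), the order, the
  Cauchy-Schwarz inequality and the \<open>C\<^sup>*\<close>-algebra of adjointable operators, which are bounded by the
  theorem of Hellinger and Toeplitz (\<open>adjointable_bounded\<close>).  Nonunital algebras are treated in their
  multiplier algebra.  The second tool is the limit \<open>z (1 - b)\<^sup>n \<rightarrow> 0\<close> for \<open>z\<^sup>*z \<le> b \<le> 1\<close>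
  (\<open>mult_tail_tendsto_zero\<close> and, for modules, \<open>module_tail_tendsto_zero\<close>), which replaces roots and
  approximate units: it shows that square roots stay in nonunital algebras, that the compact operators
  approximate \<open>1\<close>, that vectors \<open>x \<langle>x, z\<rangle>\<close> approximate \<open>x\<close>, and that the inner product of \<open>E\<^sup>* \<odot> F\<close> is
  positive.
\<close>


section \<open>Complex vector spaces\<close>

lemma complex_field_simps [simp]:
  "carrier complex_field = UNIV" "mult complex_field = (*)" "\<one>\<^bsub>complex_field\<^esub> = 1"
  "\<zero>\<^bsub>complex_field\<^esub> = 0" "add complex_field = (+)"
  by (simp_all add: complex_field_def)

lemma cring_complex_field: "cring complex_field"
proof (rule cringI)
  show "abelian_group complex_field"
  proof (rule abelian_groupI)
    fix x :: complex
    show "\<exists>y\<in>carrier complex_field. y \<oplus>\<^bsub>complex_field\<^esub> x = \<zero>\<^bsub>complex_field\<^esub>"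
      by (auto intro: exI[of _ "- x"])
  qed simp_all
  show "Group.comm_monoid complex_field"
    by (rule comm_monoidI) simp_all
qed (simp_all add: algebra_simps)

locale cvec = Module.module complex_field V for V (structure)
begin

lemma scale_closed [simp]: "x \<in> carrier V \<Longrightarrow> c \<odot> x \<in> carrier V"
  using smult_closed by simp

lemma scale_add_left: "x \<in> carrier V \<Longrightarrow> (c + d) \<odot> x = c \<odot> x \<oplus> d \<odot> x"
  using smult_l_distr by simp

lemma scale_add_right: "x \<in> carrier V \<Longrightarrow> y \<in> carrier V \<Longrightarrow> c \<odot> (x \<oplus> y) = c \<odot> x \<oplus> c \<odot> y"
  using smult_r_distr by simp

lemma scale_scale: "x \<in> carrier V \<Longrightarrow> c \<odot> (d \<odot> x) = (c * d) \<odot> x"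
  using smult_assoc1 by simp

lemma scale_one [simp]: "x \<in> carrier V \<Longrightarrow> 1 \<odot> x = x"
  using smult_one by simp

lemma scale_zero_left [simp]: "x \<in> carrier V \<Longrightarrow> 0 \<odot> x = \<zero>"
  using smult_l_null by simp

lemma scale_zero_right [simp]: "c \<odot> \<zero> = \<zero>"
  using smult_r_null by simp

lemma uminus_eq_scale: "x \<in> carrier V \<Longrightarrow> \<ominus> x = (-1) \<odot> x"
proof -
  assume x: "x \<in> carrier V"
  have "(-1) \<odot> x \<oplus> x = ((-1) + 1) \<odot> x"
    using x scale_add_left[of x "-1" 1] by simp
  also have "\<dots> = \<zero>" using x by simp
  finally show ?thesis
    using x M.minus_equality by simp
qed

lemma diff_closed [simp]: "x \<in> carrier V \<Longrightarrow> y \<in> carrier V \<Longrightarrow> x \<ominus> y \<in> carrier V"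
  by simp

lemma diff_eq_scale: "x \<in> carrier V \<Longrightarrow> y \<in> carrier V \<Longrightarrow> x \<ominus> y = x \<oplus> (-1) \<odot> y"
  by (simp add: M.minus_eq uminus_eq_scale)

lemma diff_self [simp]: "x \<in> carrier V \<Longrightarrow> x \<ominus> x = \<zero>"
  by (simp add: M.minus_eq M.r_neg)

lemma diff_eq_zero: "x \<in> carrier V \<Longrightarrow> y \<in> carrier V \<Longrightarrow> x \<ominus> y = \<zero> \<longleftrightarrow> x = y"
  by (metis M.add.inv_closed M.add.inv_inv M.minus_equality M.minus_eq diff_self)

end

subsection \<open>Linear extension from the free vector space\<close>

definition lin_ext ::
  "(complex, 'v, 'm) module_scheme \<Rightarrow> ('i \<Rightarrow> 'v) \<Rightarrow> ('i \<Rightarrow>\<^sub>0 complex) \<Rightarrow> 'v" where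
  "lin_ext V g t = (\<Oplus>\<^bsub>V\<^esub>p\<in>Poly_Mapping.keys t. Poly_Mapping.lookup t p \<odot>\<^bsub>V\<^esub> g p)"

definition free_scale :: "complex \<Rightarrow> ('i \<Rightarrow>\<^sub>0 complex) \<Rightarrow> ('i \<Rightarrow>\<^sub>0 complex)" where
  "free_scale z t = Poly_Mapping.map (\<lambda>w. z * w) t"

lemma lookup_free_scale [simp]:
  "Poly_Mapping.lookup (free_scale z t) k = z * Poly_Mapping.lookup t k"
  by (simp add: free_scale_def Poly_Mapping.map.rep_eq when_def)

lemma keys_free_scale: "Poly_Mapping.keys (free_scale z t) \<subseteq> Poly_Mapping.keys t"
  by (auto simp: in_keys_iff)

lemma keys_sum_single:
  "Poly_Mapping.keys (\<Sum>i\<in>K. Poly_Mapping.single (f i) (c i)) \<subseteq> f ` K"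
proof
  fix k assume "k \<in> Poly_Mapping.keys (\<Sum>i\<in>K. Poly_Mapping.single (f i) (c i))"
  then have "(\<Sum>i\<in>K. Poly_Mapping.lookup (Poly_Mapping.single (f i) (c i)) k) \<noteq> 0"
    by (simp add: in_keys_iff lookup_sum)
  then obtain i where "i \<in> K" "Poly_Mapping.lookup (Poly_Mapping.single (f i) (c i)) k \<noteq> 0"
    by (meson sum.not_neutral_contains_not_neutral)
  then show "k \<in> f ` K" by (auto simp: lookup_single when_def split: if_splits)
qed

context cvec
begin

lemma lin_ext_superset:
  assumes "finite K" "Poly_Mapping.keys t \<subseteq> K" "\<And>p. p \<in> K \<Longrightarrow> g p \<in> carrier V"
  shows "lin_ext V g t = (\<Oplus>p\<in>K. Poly_Mapping.lookup t p \<odot> g p)"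
  unfolding lin_ext_def
  by (rule M.add.finprod_mono_neutral_cong_left) (use assms in \<open>auto simp: in_keys_iff Pi_def\<close>)

lemma lin_ext_closed [simp]:
  "(\<And>p. p \<in> Poly_Mapping.keys t \<Longrightarrow> g p \<in> carrier V) \<Longrightarrow> lin_ext V g t \<in> carrier V"
  unfolding lin_ext_def by (rule M.finsum_closed) auto

lemma lin_ext_cong:
  assumes "\<And>p. p \<in> Poly_Mapping.keys t \<Longrightarrow> g p = h p"
    and "\<And>p. p \<in> Poly_Mapping.keys t \<Longrightarrow> h p \<in> carrier V"
  shows "lin_ext V g t = lin_ext V h t"
  unfolding lin_ext_def by (rule M.finsum_cong') (use assms in auto)

lemma lin_ext_zero [simp]: "lin_ext V g 0 = \<zero>"
  by (simp add: lin_ext_def)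

lemma lin_ext_single [simp]: "g p \<in> carrier V \<Longrightarrow> lin_ext V g (Poly_Mapping.single p c) = c \<odot> g p"
  using lin_ext_superset[of "{p}" "Poly_Mapping.single p c" g] by (simp split: if_splits)

lemma lin_ext_add:
  assumes "\<And>p. p \<in> Poly_Mapping.keys s \<union> Poly_Mapping.keys t \<Longrightarrow> g p \<in> carrier V"
  shows "lin_ext V g (s + t) = lin_ext V g s \<oplus> lin_ext V g t"
proof -
  let ?K = "Poly_Mapping.keys s \<union> Poly_Mapping.keys t"
  have "lin_ext V g (s + t) = (\<Oplus>p\<in>?K. Poly_Mapping.lookup (s + t) p \<odot> g p)"
    by (rule lin_ext_superset) (use assms Poly_Mapping.keys_add[of s t] in auto)
  also have "\<dots> = (\<Oplus>p\<in>?K. Poly_Mapping.lookup s p \<odot> g p \<oplus> Poly_Mapping.lookup t p \<odot> g p)"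
    by (rule M.finsum_cong') (use assms in \<open>auto simp: lookup_add scale_add_left\<close>)
  also have "\<dots> = (\<Oplus>p\<in>?K. Poly_Mapping.lookup s p \<odot> g p) \<oplus> (\<Oplus>p\<in>?K. Poly_Mapping.lookup t p \<odot> g p)"
    by (rule M.finsum_addf) (use assms in auto)
  also have "\<dots> = lin_ext V g s \<oplus> lin_ext V g t"
    using lin_ext_superset[of ?K s g] lin_ext_superset[of ?K t g] assms by simp
  finally show ?thesis .
qed

lemma lin_ext_scale:
  assumes "\<And>p. p \<in> Poly_Mapping.keys t \<Longrightarrow> g p \<in> carrier V"
  shows "lin_ext V g (free_scale z t) = z \<odot> lin_ext V g t"
proof -
  let ?K = "Poly_Mapping.keys t"
  have "lin_ext V g (free_scale z t) = (\<Oplus>p\<in>?K. (z * Poly_Mapping.lookup t p) \<odot> g p)"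
    using lin_ext_superset[of ?K "free_scale z t" g] keys_free_scale[of z t] assms by auto
  also have "\<dots> = (\<Oplus>p\<in>?K. z \<odot> (Poly_Mapping.lookup t p \<odot> g p))"
    by (rule M.finsum_cong') (use assms in \<open>auto simp: scale_scale\<close>)
  also have "\<dots> = z \<odot> lin_ext V g t"
    unfolding lin_ext_def by (rule finsum_smult_ldistr[symmetric]) (use assms in auto)
  finally show ?thesis .
qed

lemma lin_ext_sum:
  assumes "finite K" "\<And>i. i \<in> K \<Longrightarrow> g (f i) \<in> carrier V"
  shows "lin_ext V g (\<Sum>i\<in>K. Poly_Mapping.single (f i) (c i)) = (\<Oplus>i\<in>K. c i \<odot> g (f i))"
  using assms
proof (induction K rule: finite_induct)
  case (insert i K)
  have "Poly_Mapping.keys (\<Sum>i\<in>K. Poly_Mapping.single (f i) (c i)) \<subseteq> f ` K"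
    by (rule keys_sum_single)
  with insert have "lin_ext V g (\<Sum>i\<in>insert i K. Poly_Mapping.single (f i) (c i))
      = lin_ext V g (Poly_Mapping.single (f i) (c i)) \<oplus> lin_ext V g (\<Sum>i\<in>K. Poly_Mapping.single (f i) (c i))"
    by (subst lin_ext_add[symmetric]) (auto split: if_splits)
  with insert show ?case by (subst M.finsum_insert) auto
qed simp

end

text \<open>
  Linear identities in a vector space given by a carrier are identities in a free vector space,
  where the arithmetic of the type of complex numbers decides them: \<open>free_rep V x p\<close> says that
  \<open>x\<close> is the formal combination \<open>p\<close> of vectors of \<open>V\<close>.  The rules \<open>lin\<close> below compute \<open>p\<close> from
  the shape of \<open>x\<close>, with every product or inner product as an atom, and \<open>lin_eqI\<close> compares coefficients.
\<close>

definition free_rep :: "(complex, 'v, 'm) module_scheme \<Rightarrow> 'v \<Rightarrow> ('v \<Rightarrow>\<^sub>0 complex) \<Rightarrow> bool" where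
  "free_rep V x p \<longleftrightarrow> Poly_Mapping.keys p \<subseteq> carrier V \<and> x = lin_ext V (\<lambda>v. v) p"

context cvec
begin

lemma lin_eqI:
  assumes "free_rep V x p" "free_rep V y q" "\<And>k. Poly_Mapping.lookup p k = Poly_Mapping.lookup q k"
  shows "x = y"
  using assms poly_mapping_eqI[of p q] by (simp add: free_rep_def)

lemma free_rep_zero: "free_rep V \<zero> 0"
  by (simp add: free_rep_def)

lemma free_rep_add:
  assumes "free_rep V x p" "free_rep V y q"
  shows "free_rep V (x \<oplus> y) (p + q)"
proof -
  have keys: "Poly_Mapping.keys p \<subseteq> carrier V" "Poly_Mapping.keys q \<subseteq> carrier V"
    and xy: "x = lin_ext V (\<lambda>v. v) p" "y = lin_ext V (\<lambda>v. v) q"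
    using assms by (simp_all add: free_rep_def)
  have "lin_ext V (\<lambda>v. v) (p + q) = lin_ext V (\<lambda>v. v) p \<oplus> lin_ext V (\<lambda>v. v) q"
    by (rule lin_ext_add) (use keys in blast)
  moreover have "Poly_Mapping.keys (p + q) \<subseteq> carrier V"
    using keys Poly_Mapping.keys_add[of p q] by blast
  ultimately show ?thesis
    by (simp add: free_rep_def xy)
qed

lemma free_rep_scale: "free_rep V x p \<Longrightarrow> free_rep V (c \<odot> x) (free_scale c p)"
  using keys_free_scale[of c p] lin_ext_scale[of p "\<lambda>v. v" c] by (auto simp: free_rep_def subset_iff)

lemma free_rep_closed: "free_rep V x p \<Longrightarrow> x \<in> carrier V"
  using lin_ext_closed[of p "\<lambda>v. v"] by (simp add: free_rep_def subset_iff)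

lemma free_rep_uminus: "free_rep V x p \<Longrightarrow> free_rep V (\<ominus> x) (free_scale (-1) p)"
  using free_rep_scale[of x p "-1"] free_rep_closed[of x p] by (simp add: uminus_eq_scale)

lemma free_rep_diff: "free_rep V x p \<Longrightarrow> free_rep V y q \<Longrightarrow> free_rep V (x \<ominus> y) (p + free_scale (-1) q)"
  unfolding a_minus_def by (intro free_rep_add free_rep_uminus)

lemma free_rep_atom: "x \<in> carrier V \<Longrightarrow> free_rep V x (Poly_Mapping.single x 1)"
  by (simp add: free_rep_def)

lemmas lin = free_rep_zero free_rep_add free_rep_diff free_rep_uminus free_rep_scale free_rep_atom

lemma scale_diff_right: "x \<in> carrier V \<Longrightarrow> y \<in> carrier V \<Longrightarrow> c \<odot> (x \<ominus> y) = c \<odot> x \<ominus> c \<odot> y"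
  by - (rule lin_eqI, (rule lin | simp add: lookup_add algebra_simps)+)

end

definition subspace_of :: "(complex, 'v, 'm) module_scheme \<Rightarrow> 'v set \<Rightarrow> bool" where
  "subspace_of V S \<longleftrightarrow> S \<subseteq> carrier V \<and> \<zero>\<^bsub>V\<^esub> \<in> S \<and>
     (\<forall>x\<in>S. \<forall>y\<in>S. x \<oplus>\<^bsub>V\<^esub> y \<in> S) \<and> (\<forall>c. \<forall>x\<in>S. c \<odot>\<^bsub>V\<^esub> x \<in> S)"

context cvec
begin

lemma subspace_lin_span:
  assumes "S \<subseteq> carrier V"
  shows "subspace_of V (lin_span V S)"
proof -
  have closed: "x \<in> carrier V" if "x \<in> lin_span V S" for x
    using that by induction (use assms in auto)
  have "x \<oplus> y \<in> lin_span V S" if "x \<in> lin_span V S" "y \<in> lin_span V S" for x y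
    using that
  proof (induction x rule: lin_span.induct)
    case (add x z c)
    have "(c \<odot> x \<oplus> z) \<oplus> y = c \<odot> x \<oplus> (z \<oplus> y)"
      using add.hyps assms closed[of z] closed[of y] add.prems by (intro M.a_assoc) auto
    with add.hyps(1) add.IH[OF add.prems] show ?case by (simp add: lin_span.add)
  qed (simp add: closed)
  moreover have "d \<odot> x \<in> lin_span V S" if "x \<in> lin_span V S" for d x
    using that
  proof induction
    case (add x z c)
    have "d \<odot> (c \<odot> x \<oplus> z) = (d * c) \<odot> x \<oplus> d \<odot> z"
      using add.hyps assms closed[of z] by (subst scale_add_right) (auto simp: scale_scale)
    with add.hyps(1) add.IH show ?case by (simp add: lin_span.add)
  qed (simp add: lin_span.zero)
  ultimately show ?thesis
    using closed by (auto simp: subspace_of_def lin_span.zero)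
qed

lemma lin_span_base: "S \<subseteq> carrier V \<Longrightarrow> x \<in> S \<Longrightarrow> x \<in> lin_span V S"
  using lin_span.add[where V = V and S = S and x = x and y = "\<zero>" and c = 1] by (auto simp: lin_span.zero)

lemma lin_span_subset: "subspace_of V W \<Longrightarrow> S \<subseteq> W \<Longrightarrow> lin_span V S \<subseteq> W"
proof
  fix x assume W: "subspace_of V W" "S \<subseteq> W" and "x \<in> lin_span V S"
  from this(3) show "x \<in> W"
    by induction (use W in \<open>auto simp: subspace_of_def subset_iff\<close>)
qed

lemma subspace_finsum:
  assumes "subspace_of V W" "finite K" "\<And>i. i \<in> K \<Longrightarrow> f i \<in> W"
  shows "(\<Oplus>i\<in>K. f i) \<in> W"
  using assms(2,3)
proof (induction K rule: finite_induct)
  case (insert i K)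
  then have "(\<Oplus>i\<in>insert i K. f i) = f i \<oplus> (\<Oplus>i\<in>K. f i)"
    using assms(1) by (intro M.finsum_insert) (auto simp: subspace_of_def)
  with insert assms(1) show ?case by (auto simp: subspace_of_def)
qed (use assms(1) in \<open>simp add: subspace_of_def\<close>)

lemma subspace_lin_ext:
  assumes "subspace_of V W" "\<And>i. i \<in> Poly_Mapping.keys t \<Longrightarrow> f i \<in> W"
  shows "lin_ext V f t \<in> W"
  unfolding lin_ext_def using assms by (intro subspace_finsum) (auto simp: subspace_of_def)

end

subsection \<open>Linear maps\<close>

definition linear_map ::
  "(complex, 'v, 'm) module_scheme \<Rightarrow> (complex, 'w, 'n) module_scheme \<Rightarrow> ('v \<Rightarrow> 'w) \<Rightarrow> bool" where
  "linear_map V W T \<longleftrightarrow> T \<in> carrier V \<rightarrow> carrier W \<and>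
     (\<forall>x\<in>carrier V. \<forall>y\<in>carrier V. T (x \<oplus>\<^bsub>V\<^esub> y) = T x \<oplus>\<^bsub>W\<^esub> T y) \<and>
     (\<forall>c. \<forall>x\<in>carrier V. T (c \<odot>\<^bsub>V\<^esub> x) = c \<odot>\<^bsub>W\<^esub> T x)"

lemma linear_mapD:
  assumes "linear_map V W T"
  shows "x \<in> carrier V \<Longrightarrow> T x \<in> carrier W"
    and "x \<in> carrier V \<Longrightarrow> y \<in> carrier V \<Longrightarrow> T (x \<oplus>\<^bsub>V\<^esub> y) = T x \<oplus>\<^bsub>W\<^esub> T y"
    and "x \<in> carrier V \<Longrightarrow> T (c \<odot>\<^bsub>V\<^esub> x) = c \<odot>\<^bsub>W\<^esub> T x"
  using assms by (auto simp: linear_map_def)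

lemma linear_map_diff:
  assumes "cvec V" "cvec W" "linear_map V W T" "x \<in> carrier V" "y \<in> carrier V"
  shows "T (x \<ominus>\<^bsub>V\<^esub> y) = T x \<ominus>\<^bsub>W\<^esub> T y"
proof -
  interpret V: cvec V by fact
  interpret W: cvec W by fact
  show ?thesis
    using assms(4,5) linear_mapD[OF assms(3)] by (simp add: V.diff_eq_scale W.diff_eq_scale)
qed

lemma linear_map_zero:
  assumes "cvec V" "cvec W" "linear_map V W T"
  shows "T \<zero>\<^bsub>V\<^esub> = \<zero>\<^bsub>W\<^esub>"
proof -
  interpret V: cvec V by fact
  interpret W: cvec W by fact
  show ?thesis
    using linear_mapD(3)[OF assms(3), of "\<zero>\<^bsub>V\<^esub>" 0] linear_mapD(1)[OF assms(3), of "\<zero>\<^bsub>V\<^esub>"] by simp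
qed

lemma linear_map_finsum:
  assumes "cvec V" "cvec W" "linear_map V W T" "finite K" "\<And>i. i \<in> K \<Longrightarrow> f i \<in> carrier V"
  shows "T (\<Oplus>\<^bsub>V\<^esub>i\<in>K. f i) = (\<Oplus>\<^bsub>W\<^esub>i\<in>K. T (f i))"
proof -
  interpret V: cvec V by fact
  interpret W: cvec W by fact
  show ?thesis
    using assms(4,5)
  proof (induction K rule: finite_induct)
    case empty
    then show ?case using linear_map_zero[OF assms(1-3)] by simp
  next
    case (insert i K)
    then show ?case
      using linear_mapD[OF assms(3)]
      by (subst V.M.finsum_insert, auto)
  qed
qed

lemma linear_map_lin_ext:
  assumes "cvec V" "cvec W" "linear_map V W T" "\<And>i. i \<in> Poly_Mapping.keys t \<Longrightarrow> f i \<in> carrier V"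
  shows "T (lin_ext V f t) = lin_ext W (\<lambda>i. T (f i)) t"
proof -
  interpret V: cvec V by fact
  interpret W: cvec W by fact
  have "T (lin_ext V f t) = (\<Oplus>\<^bsub>W\<^esub>i\<in>Poly_Mapping.keys t. T (Poly_Mapping.lookup t i \<odot>\<^bsub>V\<^esub> f i))"
    unfolding lin_ext_def by (rule linear_map_finsum) (use assms in auto)
  also have "\<dots> = lin_ext W (\<lambda>i. T (f i)) t"
    unfolding lin_ext_def
    by (rule W.M.finsum_cong') (use assms linear_mapD[OF assms(3)] in auto)
  finally show ?thesis .
qed

section \<open>Seminorms and convergence\<close>

definition tends ::
  "(complex, 'v, 'm) module_scheme \<Rightarrow> ('v \<Rightarrow> real) \<Rightarrow> (nat \<Rightarrow> 'v) \<Rightarrow> 'v \<Rightarrow> bool" where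
  "tends V nV s x \<longleftrightarrow> (\<forall>n. s n \<in> carrier V) \<and> x \<in> carrier V \<and> (\<lambda>n. nV (s n \<ominus>\<^bsub>V\<^esub> x)) \<longlonglongrightarrow> 0"

lemma tendsD:
  assumes "tends V nV s x"
  shows "s n \<in> carrier V" "x \<in> carrier V" "(\<lambda>n. nV (s n \<ominus>\<^bsub>V\<^esub> x)) \<longlonglongrightarrow> 0"
  using assms by (auto simp: tends_def)

locale seminormed = cvec V for V (structure) +
  fixes nV :: "'b \<Rightarrow> real"
  assumes norm_nonneg [simp]: "x \<in> carrier V \<Longrightarrow> 0 \<le> nV x"
    and norm_triangle: "x \<in> carrier V \<Longrightarrow> y \<in> carrier V \<Longrightarrow> nV (x \<oplus> y) \<le> nV x + nV y"
    and norm_scale: "x \<in> carrier V \<Longrightarrow> nV (c \<odot> x) = cmod c * nV x"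
begin

lemma norm_zero [simp]: "nV \<zero> = 0"
  using norm_scale[of \<zero> 0] by simp

lemma norm_uminus [simp]: "x \<in> carrier V \<Longrightarrow> nV (\<ominus> x) = nV x"
  by (simp add: uminus_eq_scale norm_scale)

lemma norm_diff_triangle: "x \<in> carrier V \<Longrightarrow> y \<in> carrier V \<Longrightarrow> nV (x \<ominus> y) \<le> nV x + nV y"
  using norm_triangle[of x "\<ominus> y"] by (simp add: M.minus_eq)

lemma norm_diff_commute: "x \<in> carrier V \<Longrightarrow> y \<in> carrier V \<Longrightarrow> nV (x \<ominus> y) = nV (y \<ominus> x)"
proof -
  assume xy: "x \<in> carrier V" "y \<in> carrier V"
  have "x \<ominus> y = (-1) \<odot> (y \<ominus> x)"
    using xy by - (rule lin_eqI, (rule lin | simp add: lookup_add algebra_simps)+)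
  then show ?thesis using xy by (simp add: norm_scale)
qed

lemma norm_triangle3:
  assumes "x \<in> carrier V" "y \<in> carrier V" "z \<in> carrier V"
  shows "nV (x \<ominus> z) \<le> nV (x \<ominus> y) + nV (y \<ominus> z)"
proof -
  have "x \<ominus> z = (x \<ominus> y) \<oplus> (y \<ominus> z)"
    using assms by - (rule lin_eqI, (rule lin | simp add: lookup_add algebra_simps)+)
  then show ?thesis using norm_triangle[of "x \<ominus> y" "y \<ominus> z"] assms by simp
qed

lemma norm_reverse_triangle:
  assumes "x \<in> carrier V" "y \<in> carrier V"
  shows "\<bar>nV x - nV y\<bar> \<le> nV (x \<ominus> y)"
proof -
  have "x = y \<oplus> (x \<ominus> y)"
    using assms by - (rule lin_eqI, (rule lin | simp add: lookup_add algebra_simps)+)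
  moreover have "y = x \<oplus> (y \<ominus> x)"
    using assms by - (rule lin_eqI, (rule lin | simp add: lookup_add algebra_simps)+)
  ultimately have "nV x \<le> nV y + nV (x \<ominus> y)" "nV y \<le> nV x + nV (y \<ominus> x)"
    using norm_triangle[of y "x \<ominus> y"] norm_triangle[of x "y \<ominus> x"] assms by auto
  then show ?thesis using norm_diff_commute[OF assms] by linarith
qed

abbreviation conv :: "(nat \<Rightarrow> 'b) \<Rightarrow> 'b \<Rightarrow> bool" where "conv \<equiv> tends V nV"

lemma convI:
  assumes "\<And>n. s n \<in> carrier V" "x \<in> carrier V" "\<And>n. nV (s n \<ominus> x) \<le> e n" "e \<longlonglongrightarrow> 0"
  shows "conv s x"
proof -
  have "(\<lambda>n. nV (s n \<ominus> x)) \<longlonglongrightarrow> 0"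
    by (rule tendsto_sandwich[of "\<lambda>_. 0" _ _ e]) (use assms in auto)
  then show ?thesis using assms by (auto simp: tends_def)
qed

lemma conv_const: "x \<in> carrier V \<Longrightarrow> conv (\<lambda>_. x) x"
  by (auto simp: tends_def)

lemma conv_add:
  assumes "conv s x" "conv t y"
  shows "conv (\<lambda>n. s n \<oplus> t n) (x \<oplus> y)"
proof (rule convI)
  note [simp] = tendsD(1,2)[OF assms(1)] tendsD(1,2)[OF assms(2)]
  show "nV ((s n \<oplus> t n) \<ominus> (x \<oplus> y)) \<le> nV (s n \<ominus> x) + nV (t n \<ominus> y)" for n
  proof -
    have "(s n \<oplus> t n) \<ominus> (x \<oplus> y) = (s n \<ominus> x) \<oplus> (t n \<ominus> y)"
      by (rule lin_eqI, (rule lin | simp add: lookup_add algebra_simps)+)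
    then show ?thesis using norm_triangle[of "s n \<ominus> x" "t n \<ominus> y"] by simp
  qed
  show "(\<lambda>n. nV (s n \<ominus> x) + nV (t n \<ominus> y)) \<longlonglongrightarrow> 0"
    using tendsto_add[OF tendsD(3)[OF assms(1)] tendsD(3)[OF assms(2)]] by simp
qed (use tendsD[OF assms(1)] tendsD[OF assms(2)] in auto)

lemma conv_scale:
  assumes "conv s x"
  shows "conv (\<lambda>n. c \<odot> s n) (c \<odot> x)"
proof (rule convI)
  note [simp] = tendsD(1,2)[OF assms]
  show "nV (c \<odot> s n \<ominus> c \<odot> x) \<le> cmod c * nV (s n \<ominus> x)" for n
    by (simp flip: scale_diff_right add: norm_scale)
  show "(\<lambda>n. cmod c * nV (s n \<ominus> x)) \<longlonglongrightarrow> 0"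
    using tendsto_mult_right_zero[OF tendsD(3)[OF assms]] by simp
qed (use tendsD[OF assms] in auto)

lemma conv_diff:
  assumes "conv s x" "conv t y"
  shows "conv (\<lambda>n. s n \<ominus> t n) (x \<ominus> y)"
  using conv_add[OF assms(1) conv_scale[OF assms(2), of "-1"]] tendsD[OF assms(1)] tendsD[OF assms(2)]
  by (simp add: diff_eq_scale)

lemma conv_norm: "conv s x \<Longrightarrow> (\<lambda>n. nV (s n)) \<longlonglongrightarrow> nV x"
proof -
  assume s: "conv s x"
  have "(\<lambda>n. nV (s n) - nV x) \<longlonglongrightarrow> 0"
    by (rule Lim_null_comparison[OF _ tendsD(3)[OF s]])
      (use tendsD[OF s] norm_reverse_triangle in auto)
  then show ?thesis by (simp add: LIM_zero_iff)
qed

lemma conv_unique_seminorm: "conv s x \<Longrightarrow> conv s y \<Longrightarrow> nV (x \<ominus> y) = 0"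
proof -
  assume s: "conv s x" "conv s y"
  have "conv (\<lambda>n. s n \<ominus> s n) (x \<ominus> y)" using conv_diff[OF s] .
  from conv_norm[OF this] tendsD(1)[OF s(1)] show ?thesis
    by (simp add: LIMSEQ_const_iff)
qed

lemma conv_norm_le: "conv s x \<Longrightarrow> (\<And>n. nV (s n) \<le> K) \<Longrightarrow> nV x \<le> K"
  using LIMSEQ_le_const2[OF conv_norm] by blast

lemma cauchyD: "s \<in> cauchy_seqs V nV \<Longrightarrow> s n \<in> carrier V"
  by (simp add: cauchy_seqs_def)

lemma cauchyI:
  assumes "\<And>n. s n \<in> carrier V"
    "\<And>e. e > 0 \<Longrightarrow> \<exists>N. \<forall>m\<ge>N. \<forall>n\<ge>N. nV (s m \<ominus> s n) < e"
  shows "s \<in> cauchy_seqs V nV"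
  using assms by (auto simp: cauchy_seqs_def)

lemma cauchyE:
  assumes "s \<in> cauchy_seqs V nV" "e > 0"
  obtains N where "\<And>m n. m \<ge> N \<Longrightarrow> n \<ge> N \<Longrightarrow> nV (s m \<ominus> s n) < e"
  using assms unfolding cauchy_seqs_def by blast

lemma conv_imp_cauchy: "conv s x \<Longrightarrow> s \<in> cauchy_seqs V nV"
proof (rule cauchyI)
  assume s: "conv s x"
  then show "s n \<in> carrier V" for n by (rule tendsD)
  fix e :: real assume "e > 0"
  then have "\<forall>\<^sub>F n in sequentially. nV (s n \<ominus> x) < e / 2"
    using order_tendstoD(2)[OF tendsD(3)[OF s], of "e / 2"] by simp
  then obtain N where N: "\<And>n. n \<ge> N \<Longrightarrow> nV (s n \<ominus> x) < e / 2"
    by (auto simp: eventually_sequentially)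
  have "nV (s m \<ominus> s n) < e" if "m \<ge> N" "n \<ge> N" for m n
    using norm_triangle3[of "s m" x "s n"] N[OF that(1)] N[OF that(2)] tendsD[OF s]
      norm_diff_commute[of x "s n"] by auto
  then show "\<exists>N. \<forall>m\<ge>N. \<forall>n\<ge>N. nV (s m \<ominus> s n) < e" by blast
qed

lemma cauchy_dominated:
  assumes "s \<in> cauchy_seqs W nW" "\<And>n. t n \<in> carrier V" "K \<ge> 0"
    "\<And>m n. nV (t m \<ominus> t n) \<le> K * nW (s m \<ominus>\<^bsub>W\<^esub> s n)"
  shows "t \<in> cauchy_seqs V nV"
proof (rule cauchyI)
  fix e :: real assume "e > 0"
  then have "e / (K + 1) > 0" using assms(3) by auto
  then obtain N where N: "\<And>m n. m \<ge> N \<Longrightarrow> n \<ge> N \<Longrightarrow> nW (s m \<ominus>\<^bsub>W\<^esub> s n) < e / (K + 1)"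
    using assms(1) unfolding cauchy_seqs_def by blast
  have "nV (t m \<ominus> t n) < e" if "m \<ge> N" "n \<ge> N" for m n
  proof -
    have "nV (t m \<ominus> t n) \<le> K * (e / (K + 1))"
      using assms(4)[of m n] N[OF that] assms(3) by (smt (verit, ccfv_SIG) mult_left_mono)
    also have "\<dots> < e" using assms(3) \<open>e > 0\<close> by (simp add: field_simps)
    finally show ?thesis .
  qed
  then show "\<exists>N. \<forall>m\<ge>N. \<forall>n\<ge>N. nV (t m \<ominus> t n) < e" by blast
qed (use assms in auto)

lemma cauchy_bounded:
  assumes "s \<in> cauchy_seqs V nV"
  obtains K where "K \<ge> 0" "\<And>n. nV (s n) \<le> K"
proof -
  obtain N where N: "\<And>m n. m \<ge> N \<Longrightarrow> n \<ge> N \<Longrightarrow> nV (s m \<ominus> s n) < 1"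
    using cauchyE[OF assms, of 1] by auto
  define K where "K = Max ((\<lambda>n. nV (s n)) ` {..N}) + 1"
  have le: "nV (s n) \<le> K - 1" if "n \<le> N" for n
    unfolding K_def using that by auto
  have "nV (s n) \<le> K" for n
  proof (cases "n \<le> N")
    case False
    then show ?thesis
      using N[of n N] norm_reverse_triangle[of "s n" "s N"] cauchyD[OF assms] le[of N] by fastforce
  qed (use le in fastforce)
  moreover have "K \<ge> 0" using le[of 0] norm_nonneg[OF cauchyD[OF assms, of 0]] by simp
  ultimately show thesis by (rule that[rotated])
qed

lemma cauchy_const: "x \<in> carrier V \<Longrightarrow> (\<lambda>_. x) \<in> cauchy_seqs V nV"
  by (rule conv_imp_cauchy, rule conv_const)

lemma cauchy_scale: "s \<in> cauchy_seqs V nV \<Longrightarrow> (\<lambda>n. c \<odot> s n) \<in> cauchy_seqs V nV"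
  by (rule cauchy_dominated[where K = "cmod c" and W = V and nW = nV])
    (auto simp: cauchyD norm_scale simp flip: scale_diff_right)

lemma cauchy_add:
  assumes "s \<in> cauchy_seqs V nV" "t \<in> cauchy_seqs V nV"
  shows "(\<lambda>n. s n \<oplus> t n) \<in> cauchy_seqs V nV"
proof (rule cauchyI)
  note [simp] = cauchyD[OF assms(1)] cauchyD[OF assms(2)]
  fix e :: real assume "e > 0"
  then have e: "e / 2 > 0" by simp
  obtain N M where N: "\<And>m n. m \<ge> N \<Longrightarrow> n \<ge> N \<Longrightarrow> nV (s m \<ominus> s n) < e / 2"
    and M: "\<And>m n. m \<ge> M \<Longrightarrow> n \<ge> M \<Longrightarrow> nV (t m \<ominus> t n) < e / 2"
    using cauchyE[OF assms(1) e] cauchyE[OF assms(2) e] by metis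
  have "nV ((s m \<oplus> t m) \<ominus> (s n \<oplus> t n)) < e" if "m \<ge> max N M" "n \<ge> max N M" for m n
  proof -
    have "(s m \<oplus> t m) \<ominus> (s n \<oplus> t n) = (s m \<ominus> s n) \<oplus> (t m \<ominus> t n)"
      by (rule lin_eqI, (rule lin | simp add: lookup_add algebra_simps)+)
    then show ?thesis
      using norm_triangle[of "s m \<ominus> s n" "t m \<ominus> t n"] N[of m n] M[of m n] that by simp
  qed
  then show "\<exists>N. \<forall>m\<ge>N. \<forall>n\<ge>N. nV ((s m \<oplus> t m) \<ominus> (s n \<oplus> t n)) < e" by blast
qed (use assms cauchyD in auto)

text \<open>
  The bounds of the steps are given as differences of a real sequence, so that they telescope.
\<close>

lemma norm_by_steps:
  assumes "\<And>n. s n \<in> carrier V" "\<And>n. nV (s (Suc n) \<ominus> s n) \<le> r (Suc n) - r n"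
  shows "nV (s (n + k) \<ominus> s n) \<le> r (n + k) - r n"
proof (induction k)
  case (Suc k)
  then show ?case
    using norm_triangle3[of "s (Suc (n + k))" "s (n + k)" "s n"] assms(1) assms(2)[of "n + k"] by simp
qed (use assms in simp)

lemma cauchy_by_steps:
  assumes "\<And>n. s n \<in> carrier V" "\<And>n. nV (s (Suc n) \<ominus> s n) \<le> r (Suc n) - r n" "convergent r"
  shows "s \<in> cauchy_seqs V nV"
proof (rule cauchyI)
  note step = norm_by_steps[of s r, OF assms(1,2)]
  fix e :: real assume "e > 0"
  then obtain N where N: "\<And>m n. m \<ge> N \<Longrightarrow> n \<ge> N \<Longrightarrow> norm (r m - r n) < e"
    using assms(3) by (metis Cauchy_iff convergent_eq_Cauchy convergent_def)
  have "nV (s m \<ominus> s n) < e" if "m \<ge> N" "n \<ge> N" for m n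
  proof -
    have "nV (s m \<ominus> s n) \<le> \<bar>r m - r n\<bar>"
    proof (cases "n \<le> m")
      case True
      then show ?thesis using step[of n "m - n"] by simp
    next
      case False
      then show ?thesis using step[of m "n - m"] norm_diff_commute assms(1) by simp
    qed
    then show ?thesis using N[OF that] by simp
  qed
  then show "\<exists>N. \<forall>m\<ge>N. \<forall>n\<ge>N. nV (s m \<ominus> s n) < e" by blast
qed (rule assms)

lemma norm_closure_conv:
  assumes "S \<subseteq> carrier V"
  shows "x \<in> norm_closure V nV S \<longleftrightarrow> (\<exists>s. (\<forall>n. s n \<in> S) \<and> conv s x)"
proof
  assume x: "x \<in> norm_closure V nV S"
  then have "\<exists>y\<in>S. nV (x \<ominus> y) < inverse (Suc n)" for n
    unfolding norm_closure_def by (auto simp del: of_nat_Suc)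
  then obtain s where s: "\<And>n. s n \<in> S" "\<And>n. nV (x \<ominus> s n) < inverse (Suc n)" by metis
  moreover have "conv s x"
  proof (rule convI[OF _ _ _ LIMSEQ_inverse_real_of_nat])
    show "nV (s n \<ominus> x) \<le> inverse (Suc n)" for n
      using s(2)[of n] s(1)[of n] x assms norm_diff_commute[of x "s n"]
      by (auto simp: norm_closure_def simp del: of_nat_Suc)
  qed (use s assms x in \<open>auto simp: norm_closure_def\<close>)
  ultimately show "\<exists>s. (\<forall>n. s n \<in> S) \<and> conv s x" by blast
next
  assume "\<exists>s. (\<forall>n. s n \<in> S) \<and> conv s x"
  then obtain s where s: "\<And>n. s n \<in> S" "conv s x" by blast
  have "\<exists>y\<in>S. nV (x \<ominus> y) < e" if "e > 0" for e
  proof -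
    have "\<forall>\<^sub>F n in sequentially. nV (s n \<ominus> x) < e"
      using order_tendstoD(2)[OF tendsD(3)[OF s(2)]] that by simp
    then obtain n where "nV (s n \<ominus> x) < e" by (meson eventually_sequentially order_refl)
    then have "nV (x \<ominus> s n) < e"
      using norm_diff_commute[of x "s n"] tendsD(1,2)[OF s(2)] by simp
    then show ?thesis using s(1) by blast
  qed
  then show "x \<in> norm_closure V nV S"
    using tendsD(2)[OF s(2)] by (auto simp: norm_closure_def)
qed

lemma norm_closure_base: "S \<subseteq> carrier V \<Longrightarrow> S \<subseteq> norm_closure V nV S"
  by (auto simp: norm_closure_conv intro!: exI[of _ "\<lambda>_. _"] conv_const)

lemma norm_closure_subset: "norm_closure V nV S \<subseteq> carrier V"
  by (auto simp: norm_closure_def)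

lemma norm_closure_closed:
  assumes "S \<subseteq> carrier V" "\<And>n. s n \<in> norm_closure V nV S" "conv s x"
  shows "x \<in> norm_closure V nV S"
  unfolding norm_closure_def
proof (intro CollectI conjI allI impI)
  show "x \<in> carrier V" using assms(3) by (rule tendsD)
  fix e :: real assume "e > 0"
  then have e: "e / 2 > 0" by simp
  then have "\<forall>\<^sub>F n in sequentially. nV (s n \<ominus> x) < e / 2"
    using order_tendstoD(2)[OF tendsD(3)[OF assms(3)]] by blast
  then obtain n where n: "nV (s n \<ominus> x) < e / 2" by (meson eventually_sequentially order_refl)
  obtain y where y: "y \<in> S" "nV (s n \<ominus> y) < e / 2"
    using assms(2)[of n] e unfolding norm_closure_def by blast
  have "nV (x \<ominus> y) < e"
    using norm_triangle3[of x "s n" y] n y assms(1) tendsD[OF assms(3)] norm_diff_commute[of x "s n"]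
    by fastforce
  with y show "\<exists>y\<in>S. nV (x \<ominus> y) < e" by blast
qed

lemma norm_closure_least:
  assumes "S \<subseteq> T" "T \<subseteq> carrier V" "\<And>s x. (\<And>n. s n \<in> T) \<Longrightarrow> conv s x \<Longrightarrow> x \<in> T"
  shows "norm_closure V nV S \<subseteq> T"
proof
  fix x assume "x \<in> norm_closure V nV S"
  then obtain s where "\<And>n. s n \<in> S" "conv s x"
    using norm_closure_conv[of S x] assms(1,2) by blast
  with assms show "x \<in> T" by blast
qed

lemma subspace_norm_closure:
  assumes S: "subspace_of V S"
  shows "subspace_of V (norm_closure V nV S)"
proof -
  have sub: "S \<subseteq> carrier V" using S by (simp add: subspace_of_def)
  have "x \<oplus> y \<in> norm_closure V nV S" if xy: "x \<in> norm_closure V nV S" "y \<in> norm_closure V nV S" for x y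
  proof -
    obtain s t where "\<And>n. s n \<in> S" "\<And>n. t n \<in> S" "conv s x" "conv t y"
      using xy norm_closure_conv[OF sub] by metis
    then show ?thesis
      unfolding norm_closure_conv[OF sub, of "x \<oplus> y"] using conv_add[of s x t y] S
      by (intro exI[of _ "\<lambda>n. s n \<oplus> t n"]) (simp add: subspace_of_def)
  qed
  moreover have "c \<odot> x \<in> norm_closure V nV S" if x: "x \<in> norm_closure V nV S" for c x
  proof -
    obtain s where "\<And>n. s n \<in> S" "conv s x"
      using x norm_closure_conv[OF sub] by metis
    then show ?thesis
      unfolding norm_closure_conv[OF sub, of "c \<odot> x"] using conv_scale[of s x c] S
      by (intro exI[of _ "\<lambda>n. c \<odot> s n"]) (simp add: subspace_of_def)
  qed
  ultimately show ?thesis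
    using norm_closure_base[OF sub] norm_closure_subset[of S] S by (auto simp: subspace_of_def)
qed

end

locale normed_space = seminormed +
  assumes norm_eq_zero: "x \<in> carrier V \<Longrightarrow> nV x = 0 \<Longrightarrow> x = \<zero>"
begin

lemma conv_unique: "conv s x \<Longrightarrow> conv s y \<Longrightarrow> x = y"
  using conv_unique_seminorm[of s x y] norm_eq_zero[of "x \<ominus> y"] diff_eq_zero[of x y] tendsD(2)
  by (metis diff_closed)

end

lemma conv_bounded_map:
  assumes "seminormed V nV" "seminormed W nW" "linear_map V W T"
    and bd: "\<And>x. x \<in> carrier V \<Longrightarrow> nW (T x) \<le> K * nV x"
    and s: "tends V nV s x"
  shows "tends W nW (\<lambda>n. T (s n)) (T x)"
proof -
  interpret V: seminormed V nV by fact
  interpret W: seminormed W nW by fact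
  note [simp] = tendsD(1,2)[OF s] linear_mapD(1)[OF assms(3)]
  show ?thesis
  proof (rule W.convI)
    show "nW (T (s n) \<ominus>\<^bsub>W\<^esub> T x) \<le> K * nV (s n \<ominus>\<^bsub>V\<^esub> x)" for n
      using linear_map_diff[OF V.cvec_axioms W.cvec_axioms assms(3), of "s n" x] bd[of "s n \<ominus>\<^bsub>V\<^esub> x"] by simp
    show "(\<lambda>n. K * nV (s n \<ominus>\<^bsub>V\<^esub> x)) \<longlonglongrightarrow> 0"
      using tendsto_mult_right_zero[OF tendsD(3)[OF s]] .
  qed simp_all
qed

lemma cauchy_bounded_map:
  assumes "seminormed V nV" "seminormed W nW" "linear_map V W T"
    and bd: "\<And>x. x \<in> carrier V \<Longrightarrow> nW (T x) \<le> K * nV x"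
    and s: "s \<in> cauchy_seqs V nV"
  shows "(\<lambda>n. T (s n)) \<in> cauchy_seqs W nW"
proof -
  interpret V: seminormed V nV by fact
  interpret W: seminormed W nW by fact
  note [simp] = V.cauchyD[OF s] linear_mapD(1)[OF assms(3)]
  show ?thesis
  proof (rule W.cauchy_dominated[OF s, of _ "max K 0"])
    show "nW (T (s m) \<ominus>\<^bsub>W\<^esub> T (s n)) \<le> max K 0 * nV (s m \<ominus>\<^bsub>V\<^esub> s n)" for m n
      using linear_map_diff[OF V.cvec_axioms W.cvec_axioms assms(3), of "s m" "s n"]
        bd[of "s m \<ominus>\<^bsub>V\<^esub> s n"] mult_right_mono[of K "max K 0" "nV (s m \<ominus>\<^bsub>V\<^esub> s n)"] by simp
  qed simp_all
qed


section \<open>Order in \<open>C\<^sup>*\<close>-algebras\<close>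

sublocale cstar_algebra \<subseteq> cvec A
  by unfold_locales

sublocale cstar_algebra \<subseteq> normed_space A "cnorm A"
  by unfold_locales (auto simp: cnorm_nonneg cnorm_triangle cnorm_smult cnorm_eq_0)

context cstar_algebra
begin

lemmas [simp] = mult_closed invol_closed invol_invol

lemma mult_zero_left [simp]: "a \<in> carrier A \<Longrightarrow> \<zero> \<otimes> a = \<zero>"
  using mult_smult_l[of \<zero> a 0] by simp

lemma mult_zero_right [simp]: "a \<in> carrier A \<Longrightarrow> a \<otimes> \<zero> = \<zero>"
  using mult_smult_r[of a \<zero> 0] by simp

lemma mult_diff_left:
  "a \<in> carrier A \<Longrightarrow> b \<in> carrier A \<Longrightarrow> c \<in> carrier A \<Longrightarrow> (a \<ominus> b) \<otimes> c = a \<otimes> c \<ominus> b \<otimes> c"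
  by (simp add: diff_eq_scale mult_l_distr mult_smult_l)

lemma mult_diff_right:
  "a \<in> carrier A \<Longrightarrow> b \<in> carrier A \<Longrightarrow> c \<in> carrier A \<Longrightarrow> a \<otimes> (b \<ominus> c) = a \<otimes> b \<ominus> a \<otimes> c"
  by (simp add: diff_eq_scale mult_r_distr mult_smult_r)

lemma mult_uminus_left: "a \<in> carrier A \<Longrightarrow> b \<in> carrier A \<Longrightarrow> (\<ominus> a) \<otimes> b = \<ominus> (a \<otimes> b)"
  by (simp add: uminus_eq_scale mult_smult_l)

lemma mult_uminus_right: "a \<in> carrier A \<Longrightarrow> b \<in> carrier A \<Longrightarrow> a \<otimes> (\<ominus> b) = \<ominus> (a \<otimes> b)"
  by (simp add: uminus_eq_scale mult_smult_r)

lemmas expand = mult_l_distr mult_r_distr mult_diff_left mult_diff_right mult_smult_l mult_smult_r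
  mult_uminus_left mult_uminus_right

lemma invol_diff: "a \<in> carrier A \<Longrightarrow> b \<in> carrier A \<Longrightarrow> invol A (a \<ominus> b) = invol A a \<ominus> invol A b"
  by (simp add: diff_eq_scale invol_add invol_smult)

lemma invol_zero [simp]: "invol A \<zero> = \<zero>"
  using invol_smult[of \<zero> 0] by simp

lemma cnorm_invol: "a \<in> carrier A \<Longrightarrow> cnorm A (invol A a) = cnorm A a"
proof -
  have le: "cnorm A a \<le> cnorm A (invol A a)" if a: "a \<in> carrier A" for a
  proof (cases "cnorm A a = 0")
    case False
    have "cnorm A a * cnorm A a \<le> cnorm A (invol A a) * cnorm A a"
      using cstar_identity[OF a] cnorm_mult[of "invol A a" a] a by (simp add: power2_eq_square)
    then show ?thesis using False cnorm_nonneg[OF a] by simp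
  qed (use a in simp)
  assume "a \<in> carrier A"
  then show ?thesis using le[of a] le[of "invol A a"] by simp
qed

definition sa :: "'a \<Rightarrow> bool" where "sa a \<longleftrightarrow> a \<in> carrier A \<and> invol A a = a"

lemma sa_closed [simp]: "sa a \<Longrightarrow> a \<in> carrier A" and sa_invol: "sa a \<Longrightarrow> invol A a = a"
  by (simp_all add: sa_def)

lemma sa_add: "sa a \<Longrightarrow> sa b \<Longrightarrow> sa (a \<oplus> b)"
  and sa_diff: "sa a \<Longrightarrow> sa b \<Longrightarrow> sa (a \<ominus> b)"
  and sa_scale: "sa a \<Longrightarrow> sa (complex_of_real t \<odot> a)"
  and sa_zero: "sa \<zero>"
  by (simp_all add: sa_def invol_add invol_diff invol_smult)

lemma sa_mult: "sa a \<Longrightarrow> sa b \<Longrightarrow> a \<otimes> b = b \<otimes> a \<Longrightarrow> sa (a \<otimes> b)"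
  by (simp add: sa_def invol_mult)

lemma sa_invol_mult: "c \<in> carrier A \<Longrightarrow> sa (invol A c \<otimes> c)"
  by (simp add: sa_def invol_mult)

lemma sa_norm_square: "sa a \<Longrightarrow> cnorm A (a \<otimes> a) = (cnorm A a)\<^sup>2"
  using cstar_identity[of a] by (simp add: sa_def)

lemma conv_mult:
  assumes "conv s x" "conv t y"
  shows "conv (\<lambda>n. s n \<otimes> t n) (x \<otimes> y)"
proof -
  note [simp] = tendsD(1,2)[OF assms(1)] tendsD(1,2)[OF assms(2)]
  obtain K where K: "\<And>n. cnorm A (t n) \<le> K" "K \<ge> 0"
    using cauchy_bounded[OF conv_imp_cauchy[OF assms(2)]] by metis
  show ?thesis
  proof (rule convI)
    show "cnorm A (s n \<otimes> t n \<ominus> x \<otimes> y) \<le> cnorm A (s n \<ominus> x) * K + cnorm A x * cnorm A (t n \<ominus> y)" for n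
    proof -
      have "s n \<otimes> t n \<ominus> x \<otimes> y = (s n \<ominus> x) \<otimes> t n \<oplus> x \<otimes> (t n \<ominus> y)"
        by (simp only: expand tendsD(1,2)[OF assms(1)] tendsD(1,2)[OF assms(2)])
          (rule lin_eqI, (rule lin | simp add: lookup_add algebra_simps)+)
      then have "cnorm A (s n \<otimes> t n \<ominus> x \<otimes> y)
          \<le> cnorm A (s n \<ominus> x) * cnorm A (t n) + cnorm A x * cnorm A (t n \<ominus> y)"
        using norm_triangle[of "(s n \<ominus> x) \<otimes> t n" "x \<otimes> (t n \<ominus> y)"]
          cnorm_mult[of "s n \<ominus> x" "t n"] cnorm_mult[of x "t n \<ominus> y"] by simp
      also have "\<dots> \<le> cnorm A (s n \<ominus> x) * K + cnorm A x * cnorm A (t n \<ominus> y)"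
        using K(1)[of n] by (simp add: mult_left_mono cnorm_nonneg)
      finally show ?thesis .
    qed
    show "(\<lambda>n. cnorm A (s n \<ominus> x) * K + cnorm A x * cnorm A (t n \<ominus> y)) \<longlonglongrightarrow> 0"
      using tendsto_add[OF tendsto_mult_left_zero[OF tendsD(3)[OF assms(1)], of K]
          tendsto_mult_right_zero[OF tendsD(3)[OF assms(2)], of "cnorm A x"]] by simp
  qed simp_all
qed

lemma conv_invol: "conv s x \<Longrightarrow> conv (\<lambda>n. invol A (s n)) (invol A x)"
  by (auto simp: tends_def cnorm_invol simp flip: invol_diff)

lemma sa_limit: "conv s x \<Longrightarrow> (\<And>n. sa (s n)) \<Longrightarrow> sa x"
  using conv_invol[of s x] conv_unique[of s x "invol A x"] tendsD(2)[of A "cnorm A" s x]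
  by (simp add: sa_def)

lemma cauchy_convergent:
  assumes "s \<in> cauchy_seqs A (cnorm A)"
  obtains x where "conv s x"
  using complete assms cauchyD[OF assms] unfolding norm_complete_def tends_def by blast

text \<open>
  The fixed point \<open>y = (x + y\<^sup>2) / 2\<close> satisfies \<open>(1 - y)\<^sup>2 = 1 - x\<close>, so \<open>1 - y\<close> is a square root
  of \<open>1 - x\<close>, obtained without a unit and without functional calculus.  The iteration starting at
  \<open>0\<close> is dominated by the same iteration on the real line for \<open>x = 1\<close>, which increases to \<open>1\<close>.
\<close>

lemma sqrt_of_one_minus:
  assumes x: "sa x" "cnorm A x \<le> 1"
  obtains y where "sa y" "cnorm A y \<le> 1" "2 \<odot> y = x \<oplus> y \<otimes> y"
    "\<And>z. z \<in> carrier A \<Longrightarrow> z \<otimes> x = x \<otimes> z \<Longrightarrow> z \<otimes> y = y \<otimes> z"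
proof -
  define Y where "Y = rec_nat \<zero> (\<lambda>_ w. (1/2) \<odot> (x \<oplus> w \<otimes> w))"
  define r where "r = rec_nat (0::real) (\<lambda>_ w. (1 + w\<^sup>2) / 2)"
  have Y0: "Y 0 = \<zero>" and YS: "Y (Suc n) = (1/2) \<odot> (x \<oplus> Y n \<otimes> Y n)" for n
    by (simp_all add: Y_def)
  have r0: "r 0 = 0" and rS: "r (Suc n) = (1 + (r n)\<^sup>2) / 2" for n
    by (simp_all add: r_def)
  have r_range: "0 \<le> r n \<and> r n \<le> 1" for n
    by (induction n) (auto simp: r0 rS power_le_one)
  have r_mono: "r n \<le> r (Suc n)" for n
    using sum_power2_ge_zero[of "r n - 1" 0] by (simp add: rS power2_eq_square algebra_simps)
  have r_conv: "convergent r"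
    by (rule Bseq_monoseq_convergent)
      (use r_range r_mono in \<open>auto intro!: BseqI'[of _ 1] mono_SucI1\<close>)
  have [simp]: "x \<in> carrier A" using x by simp
  have saY: "sa (Y n)" for n
  proof (induction n)
    case (Suc n)
    then show ?case
      using sa_scale[OF sa_add[OF x(1) sa_mult[OF Suc Suc refl]], of "1/2"] by (simp add: YS)
  qed (simp add: Y0 sa_zero)
  note [simp] = sa_closed[OF saY]
  have comm: "z \<otimes> Y n = Y n \<otimes> z" if z: "z \<in> carrier A" "z \<otimes> x = x \<otimes> z" for z n
  proof (induction n)
    case (Suc n)
    have "z \<otimes> (Y n \<otimes> Y n) = (Y n \<otimes> Y n) \<otimes> z"
      using z Suc mult_assoc[of z "Y n" "Y n"] mult_assoc[of "Y n" z "Y n"] mult_assoc[of "Y n" "Y n" z]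
      by simp
    then show ?case using z by (simp add: YS expand)
  qed (simp add: Y0 z)
  have commY: "Y m \<otimes> Y n = Y n \<otimes> Y m" for m n
    by (rule comm) (simp_all add: comm[symmetric])
  have normY: "cnorm A (Y n) \<le> r n" for n
  proof (induction n)
    case (Suc n)
    have "cnorm A (Y n \<otimes> Y n) \<le> (r n)\<^sup>2"
      using Suc saY[of n] by (simp add: sa_norm_square power_mono cnorm_nonneg)
    then show ?case
      using norm_triangle[of x "Y n \<otimes> Y n"] x by (simp add: YS rS norm_scale)
  qed (simp add: Y0 r0)
  have step: "cnorm A (Y (Suc n) \<ominus> Y n) \<le> r (Suc n) - r n" for n
  proof (induction n)
    case 0
    then show ?case using x by (simp add: YS Y0 rS r0 norm_scale diff_eq_scale)
  next
    case (Suc n)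
    have "Y (Suc (Suc n)) \<ominus> Y (Suc n) = (1/2) \<odot> ((Y (Suc n) \<ominus> Y n) \<otimes> (Y (Suc n) \<oplus> Y n))"
    proof -
      have "(Y (Suc n) \<ominus> Y n) \<otimes> (Y (Suc n) \<oplus> Y n) = Y (Suc n) \<otimes> Y (Suc n) \<ominus> Y n \<otimes> Y n"
        unfolding commY[of "Suc n" n]
        by (simp only: expand sa_closed[OF saY] M.a_closed commY[of "Suc n" n])
          (rule lin_eqI, (rule lin | simp add: lookup_add algebra_simps)+)
      then have "(1/2) \<odot> ((Y (Suc n) \<ominus> Y n) \<otimes> (Y (Suc n) \<oplus> Y n))
          = (1/2) \<odot> (x \<oplus> Y (Suc n) \<otimes> Y (Suc n)) \<ominus> (1/2) \<odot> (x \<oplus> Y n \<otimes> Y n)"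
        by (simp only:) (rule lin_eqI, (rule lin | simp add: lookup_add algebra_simps)+)
      then show ?thesis by (simp only: YS[symmetric])
    qed
    then have "cnorm A (Y (Suc (Suc n)) \<ominus> Y (Suc n))
        \<le> 1/2 * (cnorm A (Y (Suc n) \<ominus> Y n) * cnorm A (Y (Suc n) \<oplus> Y n))"
      using cnorm_mult[of "Y (Suc n) \<ominus> Y n" "Y (Suc n) \<oplus> Y n"] by (simp add: norm_scale)
    also have "\<dots> \<le> 1/2 * ((r (Suc n) - r n) * (r (Suc n) + r n))"
      using Suc norm_triangle[of "Y (Suc n)" "Y n"] normY[of n] normY[of "Suc n"] r_mono[of n]
      by (intro mult_left_mono mult_mono) auto
    also have "\<dots> = r (Suc (Suc n)) - r (Suc n)"
      using rS[of n] rS[of "Suc n"] by (simp add: power2_eq_square algebra_simps)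
    finally show ?case .
  qed
  obtain y where y: "conv Y y"
    using cauchy_convergent[OF cauchy_by_steps[OF _ step r_conv]] by auto
  have [simp]: "y \<in> carrier A" using tendsD(2)[OF y] .
  have "conv (\<lambda>n. Y (Suc n)) y"
    using y LIMSEQ_Suc[OF tendsD(3)[OF y]] by (simp add: tends_def)
  moreover have "conv (\<lambda>n. Y (Suc n)) ((1/2) \<odot> (x \<oplus> y \<otimes> y))"
    unfolding YS by (intro conv_scale conv_add conv_const conv_mult y) simp
  ultimately have "y = (1/2) \<odot> (x \<oplus> y \<otimes> y)" by (rule conv_unique)
  then have "2 \<odot> y = 2 \<odot> ((1/2) \<odot> (x \<oplus> y \<otimes> y))" by (rule arg_cong)
  then have "2 \<odot> y = x \<oplus> y \<otimes> y" by (simp add: scale_scale)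
  moreover have "sa y" using sa_limit[OF y saY] .
  moreover have "cnorm A y \<le> 1"
    using conv_norm_le[OF y, of 1] normY r_range by (meson order_trans)
  moreover have "z \<otimes> y = y \<otimes> z" if z: "z \<in> carrier A" "z \<otimes> x = x \<otimes> z" for z
  proof -
    have "conv (\<lambda>n. z \<otimes> Y n) (z \<otimes> y)" "conv (\<lambda>n. Y n \<otimes> z) (y \<otimes> z)"
      by (intro conv_mult conv_const y z)+
    then show ?thesis using conv_unique comm[OF z] by simp
  qed
  ultimately show thesis by (intro that)
qed

end

subsection \<open>Unital algebras\<close>

locale unital_cstar = cstar_algebra +
  assumes one_closed [simp]: "\<one> \<in> carrier A"
    and one_left [simp]: "a \<in> carrier A \<Longrightarrow> \<one> \<otimes> a = a"
    and one_right [simp]: "a \<in> carrier A \<Longrightarrow> a \<otimes> \<one> = a"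

sublocale unital_cstar \<subseteq> mon: monoid A
  by unfold_locales (simp_all add: mult_assoc)

context unital_cstar
begin

abbreviation sc :: "real \<Rightarrow> 'a" where "sc t \<equiv> complex_of_real t \<odot> \<one>"

lemma sa_one: "sa \<one>"
proof -
  have "invol A \<one> = invol A \<one> \<otimes> \<one>" by simp
  then have "\<one> = invol A (invol A \<one> \<otimes> \<one>)" by simp
  also have "\<dots> = invol A \<one>" by (subst invol_mult) simp_all
  finally show ?thesis by (simp add: sa_def)
qed

lemma norm_one_le: "cnorm A \<one> \<le> 1"
  using sa_norm_square[OF sa_one] cnorm_nonneg[of \<one>] by (auto simp: power2_eq_square)

lemma norm_sc_le: "cnorm A (sc t) \<le> \<bar>t\<bar>"
  using norm_one_le mult_left_mono[of "cnorm A \<one>" 1 "\<bar>t\<bar>"] by (simp add: norm_scale)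

lemma sa_sc: "sa (sc t)"
  by (intro sa_scale sa_one)

text \<open>\<open>h + ik\<close> is a multiple of a unitary, and \<open>h\<close> is its real part.\<close>

lemma norm_real_part_le:
  assumes h: "sa h" and k: "sa k" and comm: "h \<otimes> k = k \<otimes> h" and sum: "h \<otimes> h \<oplus> k \<otimes> k = sc t"
  shows "(cnorm A h)\<^sup>2 \<le> \<bar>t\<bar>"
proof -
  note [simp] = sa_closed[OF h] sa_closed[OF k]
  define u where "u = h \<oplus> \<i> \<odot> k"
  have [simp]: "u \<in> carrier A" by (simp add: u_def)
  have u': "invol A u = h \<oplus> (- \<i>) \<odot> k"
    using h k by (simp add: u_def invol_add invol_smult sa_invol)
  have "invol A u \<otimes> u = h \<otimes> h \<oplus> k \<otimes> k"
    unfolding u' unfolding u_def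
    by (simp only: expand sa_closed[OF h] sa_closed[OF k] scale_closed M.a_closed comm mult_closed)
      (rule lin_eqI, (rule lin | simp add: lookup_add algebra_simps)+)
  then have "(cnorm A u)\<^sup>2 \<le> \<bar>t\<bar>"
    using cstar_identity[of u] sum norm_sc_le[of t] by simp
  moreover have "h = (1/2) \<odot> (u \<oplus> invol A u)"
    unfolding u' unfolding u_def by (rule lin_eqI, (rule lin | simp add: lookup_add algebra_simps)+)
  then have "cnorm A h = 1/2 * cnorm A (u \<oplus> invol A u)"
    by (metis \<open>u \<in> carrier A\<close> invol_closed M.a_closed norm_scale norm_divide norm_numeral norm_one)
  then have "cnorm A h \<le> cnorm A u"
    using norm_triangle[of u "invol A u"] cnorm_invol[of u] by simp
  then have "(cnorm A h)\<^sup>2 \<le> (cnorm A u)\<^sup>2" by (simp add: power_mono cnorm_nonneg)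
  ultimately show ?thesis by linarith
qed

text \<open>
  The square root of \<open>t - h\<^sup>2\<close> and \<open>h\<close> are real and imaginary part of a multiple of a unitary.
\<close>

lemma norm_sc_minus_square:
  assumes h: "sa h" and t: "(cnorm A h)\<^sup>2 \<le> t"
  shows "cnorm A (sc t \<ominus> h \<otimes> h) \<le> t"
proof (cases "t = 0")
  case True
  with t have "cnorm A h = 0" by simp
  then have "h = \<zero>" using norm_eq_zero h by simp
  with True show ?thesis by simp
next
  case False
  have "0 \<le> t" using t by (rule order_trans[rotated]) simp
  with False have t0: "t > 0" by simp
  note [simp] = sa_closed[OF h]
  define x where "x = complex_of_real (1/t) \<odot> (h \<otimes> h)"
  have "sa x" unfolding x_def by (intro sa_scale sa_mult h refl)
  moreover have "cnorm A x \<le> 1"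
    using t t0 by (simp add: x_def norm_scale sa_norm_square[OF h] norm_divide field_simps)
  ultimately obtain y where y: "sa y" "2 \<odot> y = x \<oplus> y \<otimes> y"
    and comm: "\<And>z. z \<in> carrier A \<Longrightarrow> z \<otimes> x = x \<otimes> z \<Longrightarrow> z \<otimes> y = y \<otimes> z"
    using sqrt_of_one_minus by metis
  note [simp] = sa_closed[OF y(1)]
  have hy: "h \<otimes> y = y \<otimes> h"
    by (rule comm) (simp_all add: x_def expand mult_assoc)
  define s where "s = complex_of_real (sqrt t) \<odot> (\<one> \<ominus> y)"
  have s: "sa s" unfolding s_def by (intro sa_scale sa_diff sa_one y)
  have "s \<otimes> s = complex_of_real t \<odot> (\<one> \<ominus> (2 \<odot> y \<ominus> y \<otimes> y))"
  proof -
    have "s \<otimes> s = (complex_of_real (sqrt t) * complex_of_real (sqrt t)) \<odot> ((\<one> \<ominus> y) \<otimes> (\<one> \<ominus> y))"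
      unfolding s_def by (simp add: mult_smult_l mult_smult_r scale_scale)
    moreover have "(\<one> \<ominus> y) \<otimes> (\<one> \<ominus> y) = \<one> \<ominus> (2 \<odot> y \<ominus> y \<otimes> y)"
      by (simp add: expand) (rule lin_eqI, (rule lin | simp add: lookup_add algebra_simps)+)
    moreover have "complex_of_real (sqrt t) * complex_of_real (sqrt t) = complex_of_real t"
      using t0 by (metis of_real_mult real_sqrt_mult_self abs_of_pos)
    ultimately show ?thesis by simp
  qed
  also have "2 \<odot> y \<ominus> y \<otimes> y = x"
    unfolding y(2) using \<open>sa x\<close> by - (rule lin_eqI, (rule lin | simp add: lookup_add algebra_simps)+)
  also have "complex_of_real t \<odot> (\<one> \<ominus> x) = sc t \<ominus> h \<otimes> h"
    using t0 by (simp add: scale_diff_right x_def scale_scale flip: of_real_mult)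
  finally have ss: "s \<otimes> s = sc t \<ominus> h \<otimes> h" .
  have "s \<otimes> h = h \<otimes> s"
    by (simp add: s_def expand hy)
  moreover have "s \<otimes> s \<oplus> h \<otimes> h = sc t"
    unfolding ss by (rule lin_eqI, (rule lin | simp add: lookup_add algebra_simps)+)
  ultimately have "(cnorm A s)\<^sup>2 \<le> \<bar>t\<bar>" using norm_real_part_le[OF s h] by blast
  then show ?thesis using sa_norm_square[OF s] ss t0 by simp
qed

text \<open>
  Positivity expressed by the norm, as for real numbers \<open>a \<ge> 0\<close> iff \<open>\<bar>t - a\<bar> \<le> t\<close> for some \<open>t\<close>.  In this
  form, sums and limits of positive elements are
  positive by the triangle inequality.
\<close>

definition npos :: "'a \<Rightarrow> bool" where
  "npos a \<longleftrightarrow> sa a \<and> (\<exists>t\<ge>0. cnorm A (sc t \<ominus> a) \<le> t)"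

lemma npos_sa: "npos a \<Longrightarrow> sa a"
  by (simp add: npos_def)

lemma npos_closed [simp]: "npos a \<Longrightarrow> a \<in> carrier A"
  by (simp add: npos_def)

lemma npos_square: "sa h \<Longrightarrow> npos (h \<otimes> h)"
  unfolding npos_def using norm_sc_minus_square[of h "(cnorm A h)\<^sup>2"] sa_mult[of h h]
  by (intro conjI exI[of _ "(cnorm A h)\<^sup>2"]) simp_all

text \<open>
  Up to the factor \<open>t\<close>, the element \<open>a\<close> is \<open>1 - x\<close> with \<open>\<parallel>x\<parallel> \<le> 1\<close>, and the iteration for its square
  root stays in the algebra generated by \<open>x\<close>.
\<close>

lemma npos_sqrt:
  assumes a: "npos a"
  obtains h where "npos h" "h \<otimes> h = a"
    "\<And>z. z \<in> carrier A \<Longrightarrow> z \<otimes> a = a \<otimes> z \<Longrightarrow> z \<otimes> h = h \<otimes> z"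
proof -
  obtain t where t: "t \<ge> 0" "cnorm A (sc t \<ominus> a) \<le> t" and sa: "sa a"
    using a by (auto simp: npos_def)
  note [simp] = sa_closed[OF sa]
  show thesis
  proof (cases "t = 0")
    case True
    have "sc t \<ominus> a = \<zero>" using norm_eq_zero[of "sc t \<ominus> a"] cnorm_nonneg[of "sc t \<ominus> a"] t True
      by (intro norm_eq_zero antisym) simp_all
    then have "a = \<zero>" using diff_eq_zero[of "sc t" a] True by simp
    with a show thesis by (intro that[of \<zero>]) simp_all
  next
    case False
    with t have t0: "t > 0" by simp
    define x where "x = complex_of_real (1/t) \<odot> (sc t \<ominus> a)"
    have "sa x" unfolding x_def by (intro sa_scale sa_diff sa_sc sa)
    moreover have "cnorm A x \<le> 1"
      using t t0 by (simp add: x_def norm_scale norm_divide field_simps)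
    ultimately obtain y where y: "sa y" "cnorm A y \<le> 1" "2 \<odot> y = x \<oplus> y \<otimes> y"
      and comm: "\<And>z. z \<in> carrier A \<Longrightarrow> z \<otimes> x = x \<otimes> z \<Longrightarrow> z \<otimes> y = y \<otimes> z"
      using sqrt_of_one_minus by metis
    note [simp] = sa_closed[OF y(1)]
    define h where "h = complex_of_real (sqrt t) \<odot> (\<one> \<ominus> y)"
    have tt: "complex_of_real (sqrt t) * complex_of_real (sqrt t) = complex_of_real t"
      using t0 by (metis of_real_mult real_sqrt_mult_self abs_of_pos)
    show thesis
    proof (rule that)
      show "npos h"
        unfolding npos_def
      proof (intro conjI exI)
        show "sa h" unfolding h_def by (intro sa_scale sa_diff sa_one y)
        have "sc (sqrt t) \<ominus> h = complex_of_real (sqrt t) \<odot> y" unfolding h_def by (rule lin_eqI, (rule lin | simp add: lookup_add algebra_simps)+)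
        then show "cnorm A (sc (sqrt t) \<ominus> h) \<le> sqrt t"
          using y(2) t0 by (simp add: norm_scale)
      qed (use t0 in simp)
      have "h \<otimes> h = complex_of_real t \<odot> ((\<one> \<ominus> y) \<otimes> (\<one> \<ominus> y))"
        unfolding h_def by (simp add: mult_smult_l mult_smult_r scale_scale tt)
      also have "(\<one> \<ominus> y) \<otimes> (\<one> \<ominus> y) = \<one> \<ominus> (2 \<odot> y \<ominus> y \<otimes> y)"
        by (simp add: expand) (rule lin_eqI, (rule lin | simp add: lookup_add algebra_simps)+)
      also have "2 \<odot> y \<ominus> y \<otimes> y = x"
        unfolding y(3) using \<open>sa x\<close> by - (rule lin_eqI, (rule lin | simp add: lookup_add algebra_simps)+)
      also have "complex_of_real t \<odot> (\<one> \<ominus> x) = a"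
      proof -
        have "complex_of_real t \<odot> x = sc t \<ominus> a"
          using t0 by (simp add: x_def scale_scale flip: of_real_mult)
        then have "complex_of_real t \<odot> (\<one> \<ominus> x) = sc t \<ominus> (sc t \<ominus> a)"
          using \<open>sa x\<close> by (simp add: scale_diff_right)
        also have "\<dots> = a" by (rule lin_eqI, (rule lin | simp add: lookup_add algebra_simps)+)
        finally show ?thesis .
      qed
      finally show "h \<otimes> h = a" .
      show "z \<otimes> h = h \<otimes> z" if z: "z \<in> carrier A" "z \<otimes> a = a \<otimes> z" for z
      proof -
        have "z \<otimes> x = x \<otimes> z" using z by (simp add: x_def expand)
        from comm[OF z(1) this] show ?thesis using z by (simp add: h_def expand)
      qed
    qed
  qed
qed

lemma npos_bound:
  assumes a: "npos a" "cnorm A a \<le> t"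
  shows "cnorm A (sc t \<ominus> a) \<le> t"
proof -
  obtain h where h: "npos h" "h \<otimes> h = a" using npos_sqrt[OF a(1)] by metis
  then show ?thesis
    using norm_sc_minus_square[OF npos_sa[OF h(1)]] sa_norm_square[OF npos_sa[OF h(1)]] a(2) by simp
qed

lemma npos_add:
  assumes "npos a" "npos b"
  shows "npos (a \<oplus> b)"
proof -
  obtain s t where st: "s \<ge> 0" "t \<ge> 0" "cnorm A (sc s \<ominus> a) \<le> s" "cnorm A (sc t \<ominus> b) \<le> t"
    using assms by (auto simp: npos_def)
  note [simp] = npos_closed[OF assms(1)] npos_closed[OF assms(2)]
  have "sc (s + t) \<ominus> (a \<oplus> b) = (sc s \<ominus> a) \<oplus> (sc t \<ominus> b)"
    by (rule lin_eqI, (rule lin | simp add: lookup_add algebra_simps)+)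
  then have "cnorm A (sc (s + t) \<ominus> (a \<oplus> b)) \<le> s + t"
    using norm_triangle[of "sc s \<ominus> a" "sc t \<ominus> b"] st by simp
  then show ?thesis
    using st sa_add[OF npos_sa[OF assms(1)] npos_sa[OF assms(2)]] unfolding npos_def
    by (metis add_nonneg_nonneg)
qed

lemma npos_scale:
  assumes "npos a" "c \<ge> 0"
  shows "npos (complex_of_real c \<odot> a)"
proof -
  obtain t where t: "t \<ge> 0" "cnorm A (sc t \<ominus> a) \<le> t"
    using assms by (auto simp: npos_def)
  note [simp] = npos_closed[OF assms(1)]
  have "sc (c * t) \<ominus> complex_of_real c \<odot> a = complex_of_real c \<odot> (sc t \<ominus> a)"
    by (rule lin_eqI, (rule lin | simp add: lookup_add algebra_simps)+)
  then have "cnorm A (sc (c * t) \<ominus> complex_of_real c \<odot> a) \<le> c * t"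
    using t assms(2) by (simp add: norm_scale mult_left_mono)
  then show ?thesis
    using t assms(2) sa_scale[OF npos_sa[OF assms(1)]] unfolding npos_def
    by (metis mult_nonneg_nonneg)
qed

lemma npos_zero: "npos \<zero>"
  using npos_square[OF sa_zero] by simp

lemma npos_complement:
  assumes "sa a" "cnorm A a \<le> t"
  shows "npos (sc t \<ominus> a)"
proof -
  note [simp] = sa_closed[OF assms(1)]
  have "sc t \<ominus> (sc t \<ominus> a) = a" by (rule lin_eqI, (rule lin | simp add: lookup_add algebra_simps)+)
  moreover have "t \<ge> 0" using assms(2) cnorm_nonneg[of a] by (rule order_trans[rotated]) simp
  ultimately show ?thesis
    using assms sa_diff[OF sa_sc assms(1), of t] by (auto simp: npos_def)
qed

lemma npos_limit:
  assumes s: "conv s x" "\<And>n. npos (s n)"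
  shows "npos x"
proof -
  obtain K where K: "K \<ge> 0" "\<And>n. cnorm A (s n) \<le> K"
    using cauchy_bounded[OF conv_imp_cauchy[OF s(1)]] by metis
  have "conv (\<lambda>n. sc K \<ominus> s n) (sc K \<ominus> x)"
    by (intro conv_diff conv_const s) simp
  then have "cnorm A (sc K \<ominus> x) \<le> K"
    by (rule conv_norm_le) (use K s npos_bound in auto)
  then show ?thesis
    using K sa_limit[OF s(1)] s(2) by (auto simp: npos_def)
qed

lemma npos_mult:
  assumes a: "npos a" and b: "npos b" and comm: "a \<otimes> b = b \<otimes> a"
  shows "npos (a \<otimes> b)"
proof -
  note [simp] = npos_closed[OF a] npos_closed[OF b]
  obtain h where h: "npos h" "h \<otimes> h = a" "b \<otimes> h = h \<otimes> b" using npos_sqrt[OF a] comm by (metis npos_closed b)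
  obtain k where k: "npos k" "k \<otimes> k = b" "h \<otimes> k = k \<otimes> h" using npos_sqrt[OF b] h by (metis npos_closed)
  note [simp] = npos_closed[OF h(1)] npos_closed[OF k(1)]
  have "(h \<otimes> k) \<otimes> (h \<otimes> k) = h \<otimes> ((k \<otimes> h) \<otimes> k)" by (simp add: mult_assoc)
  also have "\<dots> = (h \<otimes> h) \<otimes> (k \<otimes> k)" by (simp add: mult_assoc flip: k(3))
  finally have "(h \<otimes> k) \<otimes> (h \<otimes> k) = a \<otimes> b" using h k by simp
  then show ?thesis using npos_square[OF sa_mult[OF npos_sa[OF h(1)] npos_sa[OF k(1)] k(3)]] by simp
qed

text \<open>
  For \<open>t = \<parallel>x + y\<parallel>\<close> also \<open>t - x\<close> is positive.  The square roots \<open>h\<close> of \<open>x\<close> and \<open>k\<close> of \<open>t - x\<close> commute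
  and satisfy \<open>h\<^sup>2 + k\<^sup>2 = t\<close>, so \<open>\<parallel>x\<parallel> = \<parallel>h\<parallel>\<^sup>2 \<le> t\<close>.
\<close>

lemma norm_mono:
  assumes x: "npos x" and y: "npos y"
  shows "cnorm A x \<le> cnorm A (x \<oplus> y)"
proof -
  note [simp] = npos_closed[OF x] npos_closed[OF y]
  define t where "t = cnorm A (x \<oplus> y)"
  have "npos ((sc t \<ominus> (x \<oplus> y)) \<oplus> y)"
    by (intro npos_add npos_complement y sa_add npos_sa x) (simp add: t_def)
  moreover have "(sc t \<ominus> (x \<oplus> y)) \<oplus> y = sc t \<ominus> x" by (rule lin_eqI, (rule lin | simp add: lookup_add algebra_simps)+)
  ultimately have z: "npos (sc t \<ominus> x)" by simp
  obtain h where h: "npos h" "h \<otimes> h = x" using npos_sqrt[OF x] by metis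
  note [simp] = npos_closed[OF h(1)]
  have "h \<otimes> (sc t \<ominus> x) = (sc t \<ominus> x) \<otimes> h"
    by (simp add: expand flip: h(2)) (simp add: mult_assoc)
  then obtain k where k: "npos k" "k \<otimes> k = sc t \<ominus> x" "h \<otimes> k = k \<otimes> h"
    using npos_sqrt[OF z] by (metis npos_closed h(1))
  have "h \<otimes> h \<oplus> k \<otimes> k = sc t"
    unfolding h k by (rule lin_eqI, (rule lin | simp add: lookup_add algebra_simps)+)
  then have "(cnorm A h)\<^sup>2 \<le> \<bar>t\<bar>"
    using norm_real_part_le[OF npos_sa[OF h(1)] npos_sa[OF k(1)] k(3)] by blast
  then show ?thesis
    using sa_norm_square[OF npos_sa[OF h(1)]] h(2) cnorm_nonneg[of "x \<oplus> y"] by (simp add: t_def)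
qed

text \<open>
  If \<open>d\<^sup>*d\<close> is negative, then \<open>d d\<^sup>*\<close> is positive, because \<open>d\<^sup>*d + d d\<^sup>*\<close> is a sum of squares of
  self-adjoint elements.  With \<open>s = -d\<^sup>*d\<close>, \<open>r = d d\<^sup>*\<close> and \<open>t = \<parallel>d\<parallel>\<^sup>2\<close> the element
  \<open>(t - r) d = d (t + s)\<close> is then too small on the left and too large on the right, unless \<open>d = 0\<close>.
  This replaces the usual comparison of the spectra of \<open>d\<^sup>*d\<close> and \<open>d d\<^sup>*\<close>.
\<close>

lemma negative_invol_mult_imp_zero:
  assumes d: "d \<in> carrier A" and s: "npos s" and ds: "invol A d \<otimes> d = \<ominus> s"
  shows "d = \<zero>"
proof -
  note [simp] = d npos_closed[OF s]
  define \<alpha> where "\<alpha> = (1/2) \<odot> (d \<oplus> invol A d)"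
  define \<beta> where "\<beta> = (- \<i> / 2) \<odot> (d \<ominus> invol A d)"
  define r where "r = d \<otimes> invol A d"
  define t where "t = (cnorm A d)\<^sup>2"
  have \<alpha>: "sa \<alpha>"
    unfolding sa_def \<alpha>_def by (simp add: invol_smult invol_add M.a_comm)
  have \<beta>: "sa \<beta>"
  proof -
    have "invol A \<beta> = (\<i> / 2) \<odot> (invol A d \<ominus> d)"
      by (simp add: \<beta>_def invol_smult invol_diff)
    also have "\<dots> = \<beta>" unfolding \<beta>_def by (rule lin_eqI, (rule lin | simp add: lookup_add algebra_simps)+)
    finally show ?thesis by (simp add: sa_def \<beta>_def)
  qed
  have [simp]: "r \<in> carrier A" by (simp add: r_def)
  have "npos (complex_of_real 2 \<odot> (\<alpha> \<otimes> \<alpha> \<oplus> \<beta> \<otimes> \<beta>) \<oplus> s)"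
    by (intro npos_add npos_scale npos_square \<alpha> \<beta> s) simp
  moreover have "complex_of_real 2 \<odot> (\<alpha> \<otimes> \<alpha> \<oplus> \<beta> \<otimes> \<beta>) \<oplus> s = r"
  proof -
    have "complex_of_real 2 \<odot> (\<alpha> \<otimes> \<alpha> \<oplus> \<beta> \<otimes> \<beta>) = invol A d \<otimes> d \<oplus> r"
      unfolding \<alpha>_def \<beta>_def r_def
      by (simp only: expand d invol_closed scale_closed M.a_closed diff_closed mult_closed)
        (rule lin_eqI, (rule lin | simp add: lookup_add algebra_simps)+)
    then show ?thesis unfolding ds by (simp only:) (rule lin_eqI, (rule lin | simp add: lookup_add algebra_simps)+)
  qed
  ultimately have r: "npos r" by simp
  have norm_s: "cnorm A s = t"
    using cstar_identity[OF d] ds by (simp add: t_def)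
  have norm_r: "cnorm A r = t"
    using cstar_identity[of "invol A d"] by (simp add: t_def r_def cnorm_invol)
  have t0: "t \<ge> 0" by (simp add: t_def)
  define e where "e = d \<otimes> (sc t \<oplus> s)"
  have "r \<otimes> d = d \<otimes> (\<ominus> s)"
    unfolding r_def ds[symmetric] by (simp add: mult_assoc)
  then have "e = (sc t \<ominus> r) \<otimes> d"
    unfolding e_def by (simp add: expand) (rule lin_eqI, (rule lin | simp add: lookup_add algebra_simps)+)
  then have "cnorm A e \<le> t * cnorm A d"
    using cnorm_mult[of "sc t \<ominus> r" d] npos_bound[OF r, of t] norm_r cnorm_nonneg[of d]
    by (smt (verit, ccfv_SIG) d diff_closed mult_right_mono npos_closed one_closed r scale_closed)
  then have "(cnorm A e)\<^sup>2 \<le> (t * cnorm A d)\<^sup>2"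
    by (intro power_mono) (simp_all add: e_def cnorm_nonneg)
  also have "\<dots> = t * t * t" by (simp add: t_def power_mult_distrib power2_eq_square)
  finally have upper: "(cnorm A e)\<^sup>2 \<le> t * t * t" .
  have "invol A e = (sc t \<oplus> s) \<otimes> invol A d"
    using s by (simp add: e_def invol_mult invol_add sa_invol[OF sa_sc] sa_invol[OF npos_sa])
  then have "invol A e \<otimes> e = (sc t \<oplus> s) \<otimes> ((invol A d \<otimes> d) \<otimes> (sc t \<oplus> s))"
    by (simp add: e_def mult_assoc)
  also have "\<dots> = \<ominus> (complex_of_real (2 * t) \<odot> (s \<otimes> s)
      \<oplus> (complex_of_real (t * t) \<odot> s \<oplus> s \<otimes> (s \<otimes> s)))"
    unfolding ds by (simp add: expand) (rule lin_eqI, (rule lin | simp add: lookup_add algebra_simps)+)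
  finally have ee: "invol A e \<otimes> e = \<dots>" .
  have "2 * t * t\<^sup>2 = cnorm A (complex_of_real (2 * t) \<odot> (s \<otimes> s))"
    using t0 norm_s sa_norm_square[OF npos_sa[OF s]] by (simp add: norm_scale norm_mult)
  also have "\<dots> \<le> cnorm A (complex_of_real (2 * t) \<odot> (s \<otimes> s)
      \<oplus> (complex_of_real (t * t) \<odot> s \<oplus> s \<otimes> (s \<otimes> s)))"
    using t0
    by (intro norm_mono npos_add npos_scale npos_mult s) (simp_all add: mult_assoc)
  also have "\<dots> = (cnorm A e)\<^sup>2"
  proof -
    have "e \<in> carrier A" by (simp add: e_def)
    from cstar_identity[OF this] show ?thesis unfolding ee by simp
  qed
  finally have "2 * t * t\<^sup>2 \<le> t * t * t" using upper by linarith
  then have "t * t * t \<le> 0" by (simp add: power2_eq_square)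
  then have "t = 0" using t0 by (smt (verit) mult_pos_pos)
  then show ?thesis using norm_eq_zero[OF d] by (simp add: t_def)
qed

text \<open>
  For \<open>b = c\<^sup>*c\<close> let \<open>p\<close> be the positive square root of \<open>b\<^sup>2\<close> and \<open>m = p - b\<close>, twice the negative
  part of \<open>b\<close>.  Then \<open>b m = - p m\<close>, so \<open>(c m)\<^sup>*(c m) = m b m\<close> is negative and \<open>c m = 0\<close>.
  Hence \<open>m p m = 0\<close>, and \<open>m\<^sup>2 = 2 p m\<close> gives \<open>m\<^sup>3 = 0\<close>, so that \<open>m = 0\<close> and \<open>b = p\<close>.
\<close>

lemma npos_invol_mult:
  assumes c [simp]: "c \<in> carrier A"
  shows "npos (invol A c \<otimes> c)"
proof -
  define b where "b = invol A c \<otimes> c"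
  have b: "sa b" unfolding b_def by (rule sa_invol_mult) simp
  note [simp] = sa_closed[OF b]
  obtain p where p: "npos p" "p \<otimes> p = b \<otimes> b" "b \<otimes> p = p \<otimes> b"
    using npos_sqrt[OF npos_square[OF b]] by (metis mult_assoc sa_closed b)
  note [simp] = npos_closed[OF p(1)]
  define m where "m = p \<ominus> b"
  have m: "sa m" unfolding m_def by (intro sa_diff npos_sa p b)
  note [simp] = sa_closed[OF m]
  obtain h where h: "npos h" "h \<otimes> h = p" and hcomm: "\<And>z. z \<in> carrier A \<Longrightarrow> z \<otimes> p = p \<otimes> z \<Longrightarrow> z \<otimes> h = h \<otimes> z"
    using npos_sqrt[OF p(1)] by metis
  note [simp] = npos_closed[OF h(1)]
  have pm: "p \<otimes> m = m \<otimes> p" by (simp add: m_def expand p(3))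
  have hm: "m \<otimes> h = h \<otimes> m" by (rule hcomm) (simp_all add: pm)
  define s where "s = m \<otimes> (p \<otimes> m)"
  have [simp]: "s \<in> carrier A" by (simp add: s_def)
  have "(m \<otimes> h) \<otimes> (m \<otimes> h) = (m \<otimes> h) \<otimes> (h \<otimes> m)" by (rule arg_cong[OF hm])
  then have "(m \<otimes> h) \<otimes> (m \<otimes> h) = m \<otimes> ((h \<otimes> h) \<otimes> m)" by (simp add: mult_assoc)
  then have s: "npos s"
    using npos_square[OF sa_mult[OF m npos_sa[OF h(1)] hm]] by (simp add: s_def h(2))
  have "b \<otimes> m \<oplus> p \<otimes> m = \<zero>"
    by (simp add: m_def expand p(2,3)) (rule lin_eqI, (rule lin | simp add: lookup_add algebra_simps)+)
  then have bm: "b \<otimes> m = \<ominus> (p \<otimes> m)" by (simp add: M.minus_equality)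
  have "invol A (c \<otimes> m) \<otimes> (c \<otimes> m) = m \<otimes> (b \<otimes> m)"
    by (simp add: invol_mult sa_invol[OF m] b_def mult_assoc)
  also have "\<dots> = \<ominus> s" by (simp add: bm s_def mult_uminus_right)
  finally have "invol A (c \<otimes> m) \<otimes> (c \<otimes> m) = \<ominus> s" .
  moreover from this have "c \<otimes> m = \<zero>"
    using negative_invol_mult_imp_zero[OF _ s, of "c \<otimes> m"] by simp
  ultimately have "\<ominus> s = \<zero>" by simp
  then have s0: "s = \<zero>" using M.minus_minus[of s] by simp
  have "m \<otimes> m = 2 \<odot> (p \<otimes> m)"
  proof -
    have "m \<otimes> m = p \<otimes> m \<ominus> b \<otimes> m" by (subst (1) m_def) (simp add: expand)
    also have "\<dots> = 2 \<odot> (p \<otimes> m)" unfolding bm by (rule lin_eqI, (rule lin | simp add: lookup_add algebra_simps)+)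
    finally show ?thesis .
  qed
  then have "m \<otimes> (m \<otimes> m) = \<zero>" using s0 by (simp add: mult_smult_r s_def)
  then have "(m \<otimes> m) \<otimes> (m \<otimes> m) = \<zero>" by (simp add: mult_assoc)
  then have "cnorm A m = 0"
    using sa_norm_square[OF sa_mult[OF m m refl]] sa_norm_square[OF m] by simp
  then have "m = \<zero>" using norm_eq_zero by simp
  then have "p = b" using diff_eq_zero[of p b] by (simp add: m_def)
  then show ?thesis using p(1) by (simp add: b_def)
qed

lemma cstar_pos_iff_npos: "cstar_pos A a \<longleftrightarrow> npos a"
proof
  assume "npos a"
  then obtain h where "npos h" "h \<otimes> h = a" using npos_sqrt by metis
  then show "cstar_pos A a"
    unfolding cstar_pos_def by (intro bexI[of _ h]) (simp_all add: sa_invol npos_sa)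
qed (auto simp: cstar_pos_def npos_invol_mult)

lemma npos_conj:
  assumes "npos p" "c \<in> carrier A"
  shows "npos (invol A c \<otimes> (p \<otimes> c))"
proof -
  obtain h where h: "npos h" "h \<otimes> h = p" using npos_sqrt[OF assms(1)] by metis
  have "invol A (h \<otimes> c) \<otimes> (h \<otimes> c) = invol A c \<otimes> (p \<otimes> c)"
    using h assms by (simp add: invol_mult sa_invol npos_sa mult_assoc flip: h(2))
  then show ?thesis using npos_invol_mult[of "h \<otimes> c"] h assms by simp
qed

text \<open>
  For \<open>0 \<le> b \<le> 1\<close> the elements \<open>b (1 - b)\<^sup>n\<close> decrease, and the first \<open>n\<close> of them add up to \<open>1 - (1 - b)\<^sup>n\<close>,
  whose norm is at most \<open>2\<close>.  So the norm of the \<open>n\<close>-th one is at most \<open>2 / n\<close>.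
\<close>

lemma tail_tendsto_zero:
  assumes b: "npos b" "cnorm A b \<le> 1"
  shows "(\<lambda>n. cnorm A (b \<otimes> (\<one> \<ominus> b) [^] (n::nat))) \<longlonglongrightarrow> 0"
proof -
  note [simp] = npos_closed[OF b(1)]
  define c where "c = \<one> \<ominus> b"
  have c: "npos c" "cnorm A c \<le> 1"
    using npos_complement[of b 1] npos_bound[of b 1] npos_sa b by (simp_all add: c_def)
  note [simp] = npos_closed[OF c(1)]
  define \<beta> where "\<beta> n = b \<otimes> c [^] n" for n :: nat
  have [simp]: "c [^] n \<in> carrier A" for n :: nat by (rule mon.nat_pow_closed) simp
  have [simp]: "\<beta> n \<in> carrier A" for n by (simp add: \<beta>_def)
  have cb: "b \<otimes> c = c \<otimes> b" by (simp add: c_def expand)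
  have cbn: "b \<otimes> c [^] n = c [^] n \<otimes> b" for n :: nat
  proof (induction n)
    case (Suc n)
    have "b \<otimes> c [^] Suc n = (b \<otimes> c [^] n) \<otimes> c" by (simp add: mult_assoc)
    also have "\<dots> = c [^] n \<otimes> (b \<otimes> c)" using Suc by (simp add: mult_assoc)
    also have "\<dots> = c [^] Suc n \<otimes> b" by (simp add: cb mult_assoc)
    finally show ?case .
  qed simp
  have npow: "npos (c [^] n)" "cnorm A (c [^] n) \<le> 1" for n :: nat
  proof (induction n)
    case 0
    show "npos (c [^] (0::nat))" "cnorm A (c [^] (0::nat)) \<le> 1"
      using npos_square[OF sa_one] norm_one_le by simp_all
  next
    case (Suc n)
    show "npos (c [^] Suc n)"
      using npos_mult[OF Suc(1) c(1)] mon.nat_pow_comm[of c n 1] by simp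
    show "cnorm A (c [^] Suc n) \<le> 1"
      using cnorm_mult[of "c [^] n" c] Suc(2) c(2) mult_mono[of "cnorm A (c [^] n)" 1 "cnorm A c" 1]
      by (simp add: cnorm_nonneg)
  qed
  have bpos: "npos (\<beta> n)" for n
    unfolding \<beta>_def by (intro npos_mult b npow cbn)
  have step: "\<beta> n \<ominus> \<beta> (Suc n) = b \<otimes> \<beta> n" for n
  proof -
    have "\<beta> (Suc n) = c \<otimes> \<beta> n"
    proof -
      have "\<beta> (Suc n) = b \<otimes> (c \<otimes> c [^] n)"
        unfolding \<beta>_def by (rule arg_cong[OF mon.nat_pow_Suc2]) simp
      also have "\<dots> = (c \<otimes> b) \<otimes> c [^] n" by (simp add: cb[symmetric] mult_assoc)
      finally show ?thesis by (simp add: \<beta>_def mult_assoc)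
    qed
    also have "\<dots> = \<beta> n \<ominus> b \<otimes> \<beta> n" by (simp add: c_def expand)
    finally show ?thesis by (simp only:) (rule lin_eqI, (rule lin | simp add: lookup_add algebra_simps)+)
  qed
  have mono: "npos (\<beta> n \<ominus> \<beta> (Suc n))" for n
    unfolding step by (intro npos_mult b bpos) (simp add: \<beta>_def cbn mult_assoc, simp add: cbn flip: mult_assoc)
  have "npos ((\<one> \<ominus> c [^] n) \<ominus> complex_of_real (real n) \<odot> \<beta> n)" for n
  proof (induction n)
    case (Suc n)
    have "c [^] n \<ominus> c [^] Suc n = \<beta> n"
      unfolding \<beta>_def cbn by (simp add: c_def expand) (rule lin_eqI, (rule lin | simp add: lookup_add algebra_simps)+)
    then have "(\<one> \<ominus> c [^] Suc n) = (\<one> \<ominus> c [^] n) \<oplus> \<beta> n"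
      by (simp del: mon.nat_pow_Suc flip: \<open>c [^] n \<ominus> c [^] Suc n = \<beta> n\<close>) (rule lin_eqI, (rule lin | simp add: lookup_add algebra_simps)+)
    then have "(\<one> \<ominus> c [^] Suc n) \<ominus> complex_of_real (real (Suc n)) \<odot> \<beta> (Suc n)
        = ((\<one> \<ominus> c [^] n) \<ominus> complex_of_real (real n) \<odot> \<beta> n)
          \<oplus> complex_of_real (real (Suc n)) \<odot> (\<beta> n \<ominus> \<beta> (Suc n))"
      by (simp only:) (rule lin_eqI, (rule lin | simp add: lookup_add algebra_simps)+)
    then show ?case
      using npos_add[OF Suc npos_scale[OF mono[of n], of "real (Suc n)"]] by simp
  qed (simp add: npos_zero)
  then have "cnorm A (complex_of_real (real n) \<odot> \<beta> n) \<le> cnorm A (complex_of_real (real n) \<odot> \<beta> n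
      \<oplus> ((\<one> \<ominus> c [^] n) \<ominus> complex_of_real (real n) \<odot> \<beta> n))" for n
    by (intro norm_mono npos_scale bpos) simp_all
  moreover have "complex_of_real (real n) \<odot> \<beta> n
      \<oplus> ((\<one> \<ominus> c [^] n) \<ominus> complex_of_real (real n) \<odot> \<beta> n) = \<one> \<ominus> c [^] n" for n
    by (rule lin_eqI, (rule lin | simp add: lookup_add algebra_simps)+)
  moreover have "cnorm A (\<one> \<ominus> c [^] n) \<le> 2" for n :: nat
    using norm_diff_triangle[of \<one> "c [^] n"] npow(2)[of n] norm_one_le by simp
  ultimately have "real n * cnorm A (\<beta> n) \<le> 2" for n
    by (metis (no_types, lifting) norm_scale norm_of_real abs_of_nat \<open>\<And>n. \<beta> n \<in> carrier A\<close> order_trans)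
  then have bound: "cnorm A (\<beta> (Suc n)) \<le> 2 * inverse (real (Suc n))" for n
  proof -
    have "real (Suc n) * cnorm A (\<beta> (Suc n)) \<le> 2" by fact
    then show ?thesis by (simp add: field_simps del: of_nat_Suc)
  qed
  have "(\<lambda>n. cnorm A (\<beta> (Suc n))) \<longlonglongrightarrow> 0"
    by (rule tendsto_sandwich[of "\<lambda>_. 0" _ _ "\<lambda>n. 2 * inverse (real (Suc n))"])
      (use bound tendsto_mult_right_zero[OF LIMSEQ_inverse_real_of_nat, of 2] in \<open>auto simp: cnorm_nonneg\<close>)
  then show ?thesis unfolding \<beta>_def c_def by (rule LIMSEQ_imp_Suc)
qed

lemma one_minus_power:
  assumes b: "npos b" "cnorm A b \<le> 1"
  shows "(\<one> \<ominus> b) [^] (n::nat) \<in> carrier A" "sa ((\<one> \<ominus> b) [^] n)" "cnorm A ((\<one> \<ominus> b) [^] n) \<le> 1"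
    "b \<otimes> (\<one> \<ominus> b) [^] n = (\<one> \<ominus> b) [^] n \<otimes> b"
proof -
  note [simp] = npos_closed[OF b(1)]
  define c where "c n = (\<one> \<ominus> b) [^] (n::nat)" for n
  have cl [simp]: "c n \<in> carrier A" for n by (simp add: c_def)
  have c1: "cnorm A (\<one> \<ominus> b) \<le> 1" "sa (\<one> \<ominus> b)"
    using npos_complement[of b 1] npos_bound[of b 1] npos_sa b by simp_all
  have c: "sa (c n) \<and> cnorm A (c n) \<le> 1 \<and> b \<otimes> c n = c n \<otimes> b" for n
  proof (induction n)
    case (Suc n)
    have comm: "c n \<otimes> (\<one> \<ominus> b) = (\<one> \<ominus> b) \<otimes> c n" using Suc by (simp add: expand)
    have "sa (c (Suc n))" using Suc c1(2) sa_mult[OF _ _ comm] by (simp add: c_def)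
    moreover have "cnorm A (c (Suc n)) \<le> 1"
      using cnorm_mult[of "c n" "\<one> \<ominus> b"] Suc c1(1)
        mult_mono[of "cnorm A (c n)" 1 "cnorm A (\<one> \<ominus> b)" 1] by (simp add: c_def cnorm_nonneg)
    moreover have "b \<otimes> c (Suc n) = c (Suc n) \<otimes> b"
    proof -
      have S: "c (Suc n) = c n \<otimes> (\<one> \<ominus> b)" by (simp add: c_def)
      have "b \<otimes> c n = c n \<otimes> b" using Suc by simp
      have "b \<otimes> (c n \<otimes> b) = (b \<otimes> c n) \<otimes> b" by (simp add: mult_assoc)
      then have "b \<otimes> (c n \<otimes> b) = c n \<otimes> (b \<otimes> b)" using \<open>b \<otimes> c n = c n \<otimes> b\<close> by (simp add: mult_assoc)
      then show ?thesis unfolding S using \<open>b \<otimes> c n = c n \<otimes> b\<close> by (simp add: expand mult_assoc)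
    qed
    ultimately show ?case by simp
  qed (simp_all add: c_def sa_one norm_one_le)
  show "(\<one> \<ominus> b) [^] (n::nat) \<in> carrier A" "sa ((\<one> \<ominus> b) [^] n)" "cnorm A ((\<one> \<ominus> b) [^] n) \<le> 1"
    "b \<otimes> (\<one> \<ominus> b) [^] n = (\<one> \<ominus> b) [^] n \<otimes> b"
    using c[of n] cl[of n] by (simp_all add: c_def)
qed

text \<open>
  Since \<open>x\<^sup>*x \<le> b\<close>, the square of the norm is at most that of \<open>(1 - b)\<^sup>n b (1 - b)\<^sup>n\<close>.
\<close>

lemma mult_tail_tendsto_zero:
  assumes b: "npos b" "cnorm A b \<le> 1" and x: "x \<in> carrier A" and le: "npos (b \<ominus> invol A x \<otimes> x)"
  shows "(\<lambda>n. cnorm A (x \<otimes> (\<one> \<ominus> b) [^] (n::nat))) \<longlonglongrightarrow> 0"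
proof -
  note [simp] = npos_closed[OF b(1)] x
  define c where "c n = (\<one> \<ominus> b) [^] (n::nat)" for n
  have [simp]: "c n \<in> carrier A" for n by (simp add: c_def)
  have c: "sa (c n) \<and> cnorm A (c n) \<le> 1 \<and> b \<otimes> c n = c n \<otimes> b" for n
    using one_minus_power[OF b] by (simp add: c_def)
  have "(cnorm A (x \<otimes> c n))\<^sup>2 \<le> cnorm A (b \<otimes> c n)" for n
  proof -
    have "invol A (x \<otimes> c n) \<otimes> (x \<otimes> c n) = c n \<otimes> ((invol A x \<otimes> x) \<otimes> c n)"
      using c[of n] by (simp add: invol_mult sa_invol mult_assoc)
    then have "(cnorm A (x \<otimes> c n))\<^sup>2 = cnorm A (c n \<otimes> ((invol A x \<otimes> x) \<otimes> c n))"
      using cstar_identity[of "x \<otimes> c n"] by simp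
    also have "\<dots> \<le> cnorm A (c n \<otimes> ((invol A x \<otimes> x) \<otimes> c n) \<oplus> c n \<otimes> ((b \<ominus> invol A x \<otimes> x) \<otimes> c n))"
      using norm_mono[OF npos_conj[OF npos_invol_mult[of x], of "c n"] npos_conj[OF le, of "c n"]] c[of n]
      by (simp add: sa_invol)
    also have "c n \<otimes> ((invol A x \<otimes> x) \<otimes> c n) \<oplus> c n \<otimes> ((b \<ominus> invol A x \<otimes> x) \<otimes> c n) = c n \<otimes> (b \<otimes> c n)"
      by (simp add: expand mult_assoc) (rule lin_eqI, (rule lin | simp add: lookup_add algebra_simps)+)
    also have "cnorm A \<dots> \<le> cnorm A (c n) * cnorm A (b \<otimes> c n)" by (intro cnorm_mult) simp_all
    also have "\<dots> \<le> 1 * cnorm A (b \<otimes> c n)" using c[of n] by (intro mult_right_mono) (simp_all add: cnorm_nonneg)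
    finally show ?thesis by simp
  qed
  then have "cnorm A (x \<otimes> c n) \<le> sqrt (cnorm A (b \<otimes> c n))" for n
    by (rule real_le_rsqrt)
  moreover have "(\<lambda>n. sqrt (cnorm A (b \<otimes> c n))) \<longlonglongrightarrow> 0"
    using tendsto_real_sqrt[OF tail_tendsto_zero[OF b]] by (simp add: c_def)
  ultimately have "(\<lambda>n. cnorm A (x \<otimes> c n)) \<longlonglongrightarrow> 0"
    using tendsto_sandwich[of "\<lambda>_. 0" "\<lambda>n. cnorm A (x \<otimes> c n)" sequentially "\<lambda>n. sqrt (cnorm A (b \<otimes> c n))" 0]
    by (simp add: cnorm_nonneg)
  then show ?thesis by (simp add: c_def)
qed

end

section \<open>Semi-Hilbert modules\<close>

text \<open>
  In the free vector spaces from which tensor products are built, the module laws of the right action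
  hold only up to vectors of length zero.  Therefore, the right action is described here by its effect
  on the inner product.
\<close>

locale semi_hilbert = B: cstar_algebra B + E: cvec E
  for B :: "('b, 'm) cstar_scheme" and E :: "('b, 'e, 'n) hmodule_scheme" +
  assumes ract_closed [simp]: "\<lbrakk>x \<in> carrier E; b \<in> carrier B\<rbrakk> \<Longrightarrow> ract E x b \<in> carrier E"
    and ip_closed [simp]: "\<lbrakk>x \<in> carrier E; y \<in> carrier E\<rbrakk> \<Longrightarrow> ip E x y \<in> carrier B"
    and ip_add: "\<lbrakk>x \<in> carrier E; y \<in> carrier E; y' \<in> carrier E\<rbrakk> \<Longrightarrow>
          ip E x (y \<oplus>\<^bsub>E\<^esub> y') = ip E x y \<oplus>\<^bsub>B\<^esub> ip E x y'"
    and ip_smult: "\<lbrakk>x \<in> carrier E; y \<in> carrier E\<rbrakk> \<Longrightarrow>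
          ip E x (z \<odot>\<^bsub>E\<^esub> y) = z \<odot>\<^bsub>B\<^esub> ip E x y"
    and ip_ract: "\<lbrakk>x \<in> carrier E; y \<in> carrier E; b \<in> carrier B\<rbrakk> \<Longrightarrow>
          ip E x (ract E y b) = ip E x y \<otimes>\<^bsub>B\<^esub> b"
    and ip_invol: "\<lbrakk>x \<in> carrier E; y \<in> carrier E\<rbrakk> \<Longrightarrow> invol B (ip E x y) = ip E y x"
    and ip_pos: "x \<in> carrier E \<Longrightarrow> cstar_pos B (ip E x x)"
begin

lemma ip_add_left: "\<lbrakk>x \<in> carrier E; x' \<in> carrier E; y \<in> carrier E\<rbrakk> \<Longrightarrow>
    ip E (x \<oplus>\<^bsub>E\<^esub> x') y = ip E x y \<oplus>\<^bsub>B\<^esub> ip E x' y"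
  using ip_invol[of y "x \<oplus>\<^bsub>E\<^esub> x'"] by (simp add: ip_add B.invol_add ip_invol)

lemma ip_smult_left: "\<lbrakk>x \<in> carrier E; y \<in> carrier E\<rbrakk> \<Longrightarrow>
    ip E (z \<odot>\<^bsub>E\<^esub> x) y = cnj z \<odot>\<^bsub>B\<^esub> ip E x y"
  using ip_invol[of y "z \<odot>\<^bsub>E\<^esub> x"] by (simp add: ip_smult B.invol_smult ip_invol)

lemma ip_ract_left: "\<lbrakk>x \<in> carrier E; y \<in> carrier E; b \<in> carrier B\<rbrakk> \<Longrightarrow>
    ip E (ract E x b) y = invol B b \<otimes>\<^bsub>B\<^esub> ip E x y"
  using ip_invol[of y "ract E x b"] by (simp add: ip_ract B.invol_mult ip_invol)

lemma ip_diff: "\<lbrakk>x \<in> carrier E; y \<in> carrier E; y' \<in> carrier E\<rbrakk> \<Longrightarrow>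
    ip E x (y \<ominus>\<^bsub>E\<^esub> y') = ip E x y \<ominus>\<^bsub>B\<^esub> ip E x y'"
  by (simp add: E.diff_eq_scale B.diff_eq_scale ip_add ip_smult)

lemma ip_diff_left: "\<lbrakk>x \<in> carrier E; x' \<in> carrier E; y \<in> carrier E\<rbrakk> \<Longrightarrow>
    ip E (x \<ominus>\<^bsub>E\<^esub> x') y = ip E x y \<ominus>\<^bsub>B\<^esub> ip E x' y"
  by (simp add: E.diff_eq_scale B.diff_eq_scale ip_add_left ip_smult_left)

lemmas ip_expand = ip_add ip_add_left ip_smult ip_smult_left ip_ract ip_ract_left ip_diff ip_diff_left

lemma ip_zero [simp]: "x \<in> carrier E \<Longrightarrow> ip E x \<zero>\<^bsub>E\<^esub> = \<zero>\<^bsub>B\<^esub>"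
  and ip_zero_left [simp]: "x \<in> carrier E \<Longrightarrow> ip E \<zero>\<^bsub>E\<^esub> x = \<zero>\<^bsub>B\<^esub>"
  using ip_smult[of x "\<zero>\<^bsub>E\<^esub>" 0] ip_smult_left[of "\<zero>\<^bsub>E\<^esub>" x 0] by simp_all

lemma hnorm_square: "x \<in> carrier E \<Longrightarrow> (hnorm B E x)\<^sup>2 = cnorm B (ip E x x)"
  by (simp add: hnorm_def B.cnorm_nonneg)

lemma hnorm_nonneg [simp]: "x \<in> carrier E \<Longrightarrow> 0 \<le> hnorm B E x"
  by (simp add: hnorm_def B.cnorm_nonneg)

lemma hnorm_ract: "x \<in> carrier E \<Longrightarrow> b \<in> carrier B \<Longrightarrow> hnorm B E (ract E x b) \<le> hnorm B E x * cnorm B b"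
proof (rule power2_le_imp_le)
  assume x: "x \<in> carrier E" and b: "b \<in> carrier B"
  have "(hnorm B E (ract E x b))\<^sup>2 = cnorm B (invol B b \<otimes>\<^bsub>B\<^esub> (ip E x x \<otimes>\<^bsub>B\<^esub> b))"
    using x b by (simp add: hnorm_square ip_expand B.mult_assoc)
  also have "\<dots> \<le> cnorm B (invol B b) * cnorm B (ip E x x \<otimes>\<^bsub>B\<^esub> b)"
    using x b by (intro B.cnorm_mult) simp_all
  also have "\<dots> \<le> cnorm B b * (cnorm B (ip E x x) * cnorm B b)"
    using x b by (simp add: B.cnorm_invol B.cnorm_mult mult_left_mono B.cnorm_nonneg)
  also have "\<dots> = (hnorm B E x * cnorm B b)\<^sup>2"
    using hnorm_square[OF x] by (simp add: power_mult_distrib power2_eq_square)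
  finally show "(hnorm B E (ract E x b))\<^sup>2 \<le> (hnorm B E x * cnorm B b)\<^sup>2" .
  show "0 \<le> hnorm B E x * cnorm B b" using x b by (simp add: B.cnorm_nonneg)
qed

lemma hnorm_isometry:
  assumes "ip E x x = ip F y y"
  shows "hnorm B E x = hnorm B F y"
  using assms by (simp add: hnorm_def)

end

text \<open>
  The Cauchy-Schwarz inequality is a hypothesis of this locale because its proof for a general
  module needs the order of the coefficient algebra, which is studied in the multiplier algebra,
  an instance of this locale.
\<close>

locale semi_hilbert_cs = semi_hilbert +
  assumes cauchy_schwarz:
    "x \<in> carrier E \<Longrightarrow> y \<in> carrier E \<Longrightarrow> cnorm B (ip E x y) \<le> hnorm B E x * hnorm B E y"

lemma (in semi_hilbert_cs) hnorm_triangle: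
  assumes [simp]: "x \<in> carrier E" "y \<in> carrier E"
  shows "hnorm B E (x \<oplus>\<^bsub>E\<^esub> y) \<le> hnorm B E x + hnorm B E y"
proof (rule power2_le_imp_le)
  have "ip E (x \<oplus>\<^bsub>E\<^esub> y) (x \<oplus>\<^bsub>E\<^esub> y) = (ip E x x \<oplus>\<^bsub>B\<^esub> ip E x y) \<oplus>\<^bsub>B\<^esub> (ip E y x \<oplus>\<^bsub>B\<^esub> ip E y y)"
    by (simp add: ip_expand) (rule B.lin_eqI, (rule B.lin | simp add: lookup_add algebra_simps)+)
  then have "(hnorm B E (x \<oplus>\<^bsub>E\<^esub> y))\<^sup>2
      \<le> (cnorm B (ip E x x) + cnorm B (ip E x y)) + (cnorm B (ip E y x) + cnorm B (ip E y y))"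
    using B.norm_triangle[of "ip E x x \<oplus>\<^bsub>B\<^esub> ip E x y" "ip E y x \<oplus>\<^bsub>B\<^esub> ip E y y"]
      B.norm_triangle[of "ip E x x" "ip E x y"] B.norm_triangle[of "ip E y x" "ip E y y"]
    by (simp add: hnorm_square)
  also have "\<dots> \<le> (hnorm B E x + hnorm B E y)\<^sup>2"
    using cauchy_schwarz[of x y] cauchy_schwarz[of y x]
    by (simp add: hnorm_square[symmetric] power2_eq_square algebra_simps)
  finally show "(hnorm B E (x \<oplus>\<^bsub>E\<^esub> y))\<^sup>2 \<le> (hnorm B E x + hnorm B E y)\<^sup>2" .
qed simp

sublocale semi_hilbert_cs \<subseteq> E: seminormed E "hnorm B E"
proof unfold_locales
  fix x c assume [simp]: "x \<in> carrier E"
  have "ip E (c \<odot>\<^bsub>E\<^esub> x) (c \<odot>\<^bsub>E\<^esub> x) = (c * cnj c) \<odot>\<^bsub>B\<^esub> ip E x x"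
    by (simp add: ip_expand B.scale_scale)
  then have "hnorm B E (c \<odot>\<^bsub>E\<^esub> x) = sqrt (cmod (c * cnj c) * cnorm B (ip E x x))"
    by (simp only: hnorm_def B.norm_scale ip_closed \<open>x \<in> carrier E\<close>)
  then show "hnorm B E (c \<odot>\<^bsub>E\<^esub> x) = cmod c * hnorm B E x"
    by (simp add: norm_mult hnorm_def real_sqrt_mult)
qed (use hnorm_triangle in auto)

context semi_hilbert_cs
begin

lemma cauchy_ip:
  assumes s: "s \<in> cauchy_seqs E (hnorm B E)" and t: "t \<in> cauchy_seqs E (hnorm B E)"
  shows "(\<lambda>n. ip E (s n) (t n)) \<in> cauchy_seqs B (cnorm B)"
proof (rule B.cauchyI)
  note [simp] = E.cauchyD[OF s] E.cauchyD[OF t]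
  show "ip E (s n) (t n) \<in> carrier B" for n by simp
  obtain K L where K: "K \<ge> 0" "\<And>n. hnorm B E (s n) \<le> K" and L: "L \<ge> 0" "\<And>n. hnorm B E (t n) \<le> L"
    using E.cauchy_bounded[OF s] E.cauchy_bounded[OF t] by metis
  fix e :: real assume e: "e > 0"
  define d where "d = e / (2 * (K + L + 1))"
  have d: "d > 0" using e K L by (simp add: d_def)
  obtain M N where M: "\<And>m n. m \<ge> M \<Longrightarrow> n \<ge> M \<Longrightarrow> hnorm B E (s m \<ominus>\<^bsub>E\<^esub> s n) < d"
    and N: "\<And>m n. m \<ge> N \<Longrightarrow> n \<ge> N \<Longrightarrow> hnorm B E (t m \<ominus>\<^bsub>E\<^esub> t n) < d"
    using E.cauchyE[OF s d] E.cauchyE[OF t d] by metis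
  have "cnorm B (ip E (s m) (t m) \<ominus>\<^bsub>B\<^esub> ip E (s n) (t n)) < e" if "m \<ge> max M N" "n \<ge> max M N" for m n
  proof -
    have "ip E (s m) (t m) \<ominus>\<^bsub>B\<^esub> ip E (s n) (t n)
        = ip E (s m \<ominus>\<^bsub>E\<^esub> s n) (t m) \<oplus>\<^bsub>B\<^esub> ip E (s n) (t m \<ominus>\<^bsub>E\<^esub> t n)"
      by (simp add: ip_expand) (rule B.lin_eqI, (rule B.lin | simp add: lookup_add algebra_simps)+)
    then have "cnorm B (ip E (s m) (t m) \<ominus>\<^bsub>B\<^esub> ip E (s n) (t n))
        \<le> hnorm B E (s m \<ominus>\<^bsub>E\<^esub> s n) * hnorm B E (t m) + hnorm B E (s n) * hnorm B E (t m \<ominus>\<^bsub>E\<^esub> t n)"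
      using B.norm_triangle[of "ip E (s m \<ominus>\<^bsub>E\<^esub> s n) (t m)" "ip E (s n) (t m \<ominus>\<^bsub>E\<^esub> t n)"]
        cauchy_schwarz[of "s m \<ominus>\<^bsub>E\<^esub> s n" "t m"] cauchy_schwarz[of "s n" "t m \<ominus>\<^bsub>E\<^esub> t n"] by simp
    also have "\<dots> \<le> d * L + K * d"
      using M[of m n] N[of m n] that K L d by (intro add_mono mult_mono) (auto intro: less_imp_le)
    also have "\<dots> < e"
    proof -
      have "d * L + K * d = d * (K + L)" by (simp add: algebra_simps)
      also have "\<dots> = e * ((K + L) / (2 * (K + L + 1)))" by (simp add: d_def)
      also have "\<dots> < e * 1" using K L e by (intro mult_strict_left_mono) (auto simp: field_simps)
      finally show ?thesis by simp
    qed
    finally show ?thesis .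
  qed
  then show "\<exists>M. \<forall>m\<ge>M. \<forall>n\<ge>M. cnorm B (ip E (s m) (t m) \<ominus>\<^bsub>B\<^esub> ip E (s n) (t n)) < e" by blast
qed

lemma conv_ip:
  assumes s: "E.conv s x" and t: "E.conv t y"
  shows "B.conv (\<lambda>n. ip E (s n) (t n)) (ip E x y)"
proof -
  note [simp] = tendsD(1,2)[OF s] tendsD(1,2)[OF t]
  obtain L where L: "L \<ge> 0" "\<And>n. hnorm B E (t n) \<le> L"
    using E.cauchy_bounded[OF E.conv_imp_cauchy[OF t]] by metis
  show ?thesis
  proof (rule B.convI)
    show "cnorm B (ip E (s n) (t n) \<ominus>\<^bsub>B\<^esub> ip E x y)
        \<le> hnorm B E (s n \<ominus>\<^bsub>E\<^esub> x) * L + hnorm B E x * hnorm B E (t n \<ominus>\<^bsub>E\<^esub> y)" for n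
    proof -
      have "ip E (s n) (t n) \<ominus>\<^bsub>B\<^esub> ip E x y
          = ip E (s n \<ominus>\<^bsub>E\<^esub> x) (t n) \<oplus>\<^bsub>B\<^esub> ip E x (t n \<ominus>\<^bsub>E\<^esub> y)"
        by (simp add: ip_expand) (rule B.lin_eqI, (rule B.lin | simp add: lookup_add algebra_simps)+)
      then have "cnorm B (ip E (s n) (t n) \<ominus>\<^bsub>B\<^esub> ip E x y)
          \<le> hnorm B E (s n \<ominus>\<^bsub>E\<^esub> x) * hnorm B E (t n) + hnorm B E x * hnorm B E (t n \<ominus>\<^bsub>E\<^esub> y)"
        using B.norm_triangle[of "ip E (s n \<ominus>\<^bsub>E\<^esub> x) (t n)" "ip E x (t n \<ominus>\<^bsub>E\<^esub> y)"]
          cauchy_schwarz[of "s n \<ominus>\<^bsub>E\<^esub> x" "t n"] cauchy_schwarz[of x "t n \<ominus>\<^bsub>E\<^esub> y"] by simp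
      also have "\<dots> \<le> hnorm B E (s n \<ominus>\<^bsub>E\<^esub> x) * L + hnorm B E x * hnorm B E (t n \<ominus>\<^bsub>E\<^esub> y)"
        using L(2)[of n] by (simp add: mult_left_mono)
      finally show ?thesis .
    qed
    show "(\<lambda>n. hnorm B E (s n \<ominus>\<^bsub>E\<^esub> x) * L + hnorm B E x * hnorm B E (t n \<ominus>\<^bsub>E\<^esub> y)) \<longlonglongrightarrow> 0"
      using tendsto_add[OF tendsto_mult_left_zero[OF tendsD(3)[OF s], of L]
          tendsto_mult_right_zero[OF tendsD(3)[OF t], of "hnorm B E x"]] by simp
  qed simp_all
qed

end

locale hilbert_cs = semi_hilbert_cs +
  assumes ip_definite: "x \<in> carrier E \<Longrightarrow> ip E x x = \<zero>\<^bsub>B\<^esub> \<Longrightarrow> x = \<zero>\<^bsub>E\<^esub>"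
    and norm_complete: "norm_complete E (hnorm B E)"

sublocale hilbert_cs \<subseteq> E: normed_space E "hnorm B E"
proof unfold_locales
  fix x assume "x \<in> carrier E" "hnorm B E x = 0"
  then show "x = \<zero>\<^bsub>E\<^esub>"
    using ip_definite[of x] B.norm_eq_zero[of "ip E x x"] hnorm_square[of x] by simp
qed

context hilbert_cs
begin

lemma ip_eqI:
  assumes "x \<in> carrier E" "y \<in> carrier E" "\<And>z. z \<in> carrier E \<Longrightarrow> ip E z x = ip E z y"
  shows "x = y"
proof -
  have "ip E (x \<ominus>\<^bsub>E\<^esub> y) (x \<ominus>\<^bsub>E\<^esub> y) = \<zero>\<^bsub>B\<^esub>"
    using assms by (simp add: ip_diff[of "x \<ominus>\<^bsub>E\<^esub> y" x y])
  then show ?thesis using ip_definite[of "x \<ominus>\<^bsub>E\<^esub> y"] assms E.diff_eq_zero[of x y] by simp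
qed

lemma E_convergent:
  assumes "s \<in> cauchy_seqs E (hnorm B E)"
  obtains x where "E.conv s x"
  using norm_complete assms E.cauchyD[OF assms] unfolding norm_complete_def tends_def by blast

end

section \<open>Adjointable operators\<close>

locale hilbert_pair = hilbert_cs B E + F: hilbert_cs B F
  for B :: "('b, 'm) cstar_scheme" and E :: "('b, 'e, 'n) hmodule_scheme"
    and F :: "('b, 'f, 'p) hmodule_scheme"
begin

lemma adjointable_extensional: "a \<in> adjointable E F \<Longrightarrow> a \<in> extensional (carrier E)"
  unfolding adjointable_def PiE_def by blast

lemma adjointable_closed: "a \<in> adjointable E F \<Longrightarrow> x \<in> carrier E \<Longrightarrow> a x \<in> carrier F"
  by (auto simp: adjointable_def)

lemma hm_adjoint_eq:
  assumes "y \<in> carrier F" "x' \<in> carrier E" "\<And>x. x \<in> carrier E \<Longrightarrow> ip F (a x) y = ip E x x'"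
  shows "hm_adjoint E F a y = x'"
  unfolding hm_adjoint_def restrict_apply'[OF assms(1)]
  by (rule the_equality) (use assms in \<open>auto intro!: ip_eqI\<close>)

lemma adjoint_ip:
  assumes "a \<in> adjointable E F" "y \<in> carrier F"
  shows "hm_adjoint E F a y \<in> carrier E"
    and "x \<in> carrier E \<Longrightarrow> ip F (a x) y = ip E x (hm_adjoint E F a y)"
proof -
  obtain a' where a': "a' \<in> carrier F \<rightarrow> carrier E"
      "\<And>x y. x \<in> carrier E \<Longrightarrow> y \<in> carrier F \<Longrightarrow> ip F (a x) y = ip E x (a' y)"
    using assms(1) by (auto simp: adjointable_def)
  then have "hm_adjoint E F a y = a' y"
    using assms(2) by (intro hm_adjoint_eq) auto
  with a' assms(2) show "hm_adjoint E F a y \<in> carrier E"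
    "x \<in> carrier E \<Longrightarrow> ip F (a x) y = ip E x (hm_adjoint E F a y)" by auto
qed

lemma adjoint_ip_left:
  assumes "a \<in> adjointable E F" "y \<in> carrier F" "x \<in> carrier E"
  shows "ip E (hm_adjoint E F a y) x = ip F y (a x)"
  using adjoint_ip[OF assms(1,2)] ip_invol[of x "hm_adjoint E F a y"] F.ip_invol[of "a x" y]
    adjointable_closed[OF assms(1,3)] assms by simp

lemma adjointableI:
  assumes "a \<in> extensional (carrier E)" "\<And>x. x \<in> carrier E \<Longrightarrow> a x \<in> carrier F"
    "\<And>y. y \<in> carrier F \<Longrightarrow> a' y \<in> carrier E"
    "\<And>x y. x \<in> carrier E \<Longrightarrow> y \<in> carrier F \<Longrightarrow> ip F (a x) y = ip E x (a' y)"
  shows "a \<in> adjointable E F" and "hm_adjoint E F a = restrict a' (carrier F)"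
proof -
  show "a \<in> adjointable E F" using assms by (auto simp: adjointable_def PiE_def)
  show "hm_adjoint E F a = restrict a' (carrier F)"
  proof
    fix y show "hm_adjoint E F a y = restrict a' (carrier F) y"
    proof (cases "y \<in> carrier F")
      case True
      then show ?thesis using assms by (simp add: hm_adjoint_eq)
    qed (simp add: hm_adjoint_def)
  qed
qed

lemma adjointable_linear:
  assumes a: "a \<in> adjointable E F"
  shows "linear_map E F a"
proof -
  note [simp] = adjointable_closed[OF a]
  have "a (x \<oplus>\<^bsub>E\<^esub> y) = a x \<oplus>\<^bsub>F\<^esub> a y" if "x \<in> carrier E" "y \<in> carrier E" for x y
    by (rule F.ip_eqI) (use that in \<open>simp_all add: F.ip_expand ip_expand adjoint_ip_left[OF a, symmetric] adjoint_ip(1)[OF a]\<close>)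
  moreover have "a (c \<odot>\<^bsub>E\<^esub> x) = c \<odot>\<^bsub>F\<^esub> a x" if "x \<in> carrier E" for c x
    by (rule F.ip_eqI) (use that in \<open>simp_all add: F.ip_expand ip_expand adjoint_ip_left[OF a, symmetric] adjoint_ip(1)[OF a]\<close>)
  ultimately show ?thesis by (auto simp: linear_map_def)
qed

lemma adjointable_eqI:
  assumes "a \<in> adjointable E F" "b \<in> adjointable E F" "\<And>x. x \<in> carrier E \<Longrightarrow> a x = b x"
  shows "a = b"
  using assms by (auto simp: adjointable_def intro: PiE_ext)

text \<open>
  The theorem of Hellinger and Toeplitz by a gliding hump: from vectors \<open>x n\<close> of the unit ball with
  \<open>\<parallel>a (x n)\<parallel> > 4\<^sup>n\<close> one builds a vector \<open>z\<close> by steps of length at most \<open>3\<^sup>-\<^sup>n\<close> such that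
  \<open>\<langle>a (x n), z\<rangle> = \<langle>x n, a\<^sup>* z\<rangle>\<close> is unbounded in \<open>n\<close>.
\<close>

lemma adjointable_bounded:
  assumes a: "a \<in> adjointable E F"
  shows "\<exists>K\<ge>0. \<forall>x\<in>carrier E. hnorm B F (a x) \<le> K * hnorm B E x"
proof -
  note lin = adjointable_linear[OF a]
  note [simp] = adjointable_closed[OF a]
  have "\<exists>M. \<forall>x\<in>carrier E. hnorm B E x \<le> 1 \<longrightarrow> hnorm B F (a x) \<le> M"
  proof (rule ccontr)
    assume "\<not> ?thesis"
    then have "\<exists>x\<in>carrier E. hnorm B E x \<le> 1 \<and> (4::real) ^ n < hnorm B F (a x)" for n
      by (meson not_le)
    then obtain x where x: "\<And>n. x n \<in> carrier E" "\<And>n. hnorm B E (x n) \<le> 1"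
        "\<And>n. (4::real) ^ n < hnorm B F (a (x n))"
      by metis
    note [simp] = x(1)
    define N where "N n = hnorm B F (a (x n))" for n
    have N: "N n > 0" for n using x(3)[of n] by (simp add: N_def) (meson less_trans zero_less_numeral zero_less_power)
    \<comment> \<open>One of \<open>y + e\<close> and \<open>y - e\<close> works, because half their difference does.\<close>
    have step: "\<exists>y'. y' \<in> carrier F \<and> hnorm B F (y' \<ominus>\<^bsub>F\<^esub> y) \<le> (1/3) ^ Suc n
        \<and> cnorm B (ip F (a (x n)) y') \<ge> (1/3) ^ Suc n * N n" if y: "y \<in> carrier F" for y n
    proof -
      define e where "e = complex_of_real ((1/3) ^ Suc n / N n) \<odot>\<^bsub>F\<^esub> a (x n)"
      have [simp]: "e \<in> carrier F" by (simp add: e_def)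
      have norm_e: "hnorm B F e = (1/3) ^ Suc n"
        using N[of n] by (simp add: e_def F.E.norm_scale N_def[symmetric] norm_divide norm_power)
      have "cnorm B (ip F (a (x n)) e) = (1/3) ^ Suc n * N n"
      proof -
        have "cnorm B (ip F (a (x n)) (a (x n))) = N n * N n"
          using F.hnorm_square[of "a (x n)"] by (simp add: N_def power2_eq_square)
        then show ?thesis
          using N[of n] by (simp add: e_def F.ip_smult B.norm_scale norm_divide norm_power)
      qed
      moreover have "ip F (a (x n)) e
          = (1/2) \<odot>\<^bsub>B\<^esub> (ip F (a (x n)) (y \<oplus>\<^bsub>F\<^esub> e) \<ominus>\<^bsub>B\<^esub> ip F (a (x n)) (y \<ominus>\<^bsub>F\<^esub> e))"
        using y by (simp add: F.ip_expand) (rule B.lin_eqI, (rule B.lin | simp add: lookup_add algebra_simps)+)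
      then have "cnorm B (ip F (a (x n)) e) \<le> 1/2 * (cnorm B (ip F (a (x n)) (y \<oplus>\<^bsub>F\<^esub> e))
          + cnorm B (ip F (a (x n)) (y \<ominus>\<^bsub>F\<^esub> e)))"
        using B.norm_diff_triangle[of "ip F (a (x n)) (y \<oplus>\<^bsub>F\<^esub> e)" "ip F (a (x n)) (y \<ominus>\<^bsub>F\<^esub> e)"] y
        by (simp add: B.norm_scale)
      ultimately consider "cnorm B (ip F (a (x n)) (y \<oplus>\<^bsub>F\<^esub> e)) \<ge> (1/3) ^ Suc n * N n"
        | "cnorm B (ip F (a (x n)) (y \<ominus>\<^bsub>F\<^esub> e)) \<ge> (1/3) ^ Suc n * N n"
        by fastforce
      then show ?thesis
      proof cases
        case 1
        have "(y \<oplus>\<^bsub>F\<^esub> e) \<ominus>\<^bsub>F\<^esub> y = e"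
          using y by - (rule F.E.lin_eqI, (rule F.E.lin | simp add: lookup_add algebra_simps)+)
        then show ?thesis using 1 y norm_e by (intro exI[of _ "y \<oplus>\<^bsub>F\<^esub> e"]) simp
      next
        case 2
        have "(y \<ominus>\<^bsub>F\<^esub> e) \<ominus>\<^bsub>F\<^esub> y = (-1) \<odot>\<^bsub>F\<^esub> e"
          using y by - (rule F.E.lin_eqI, (rule F.E.lin | simp add: lookup_add algebra_simps)+)
        then have "hnorm B F ((y \<ominus>\<^bsub>F\<^esub> e) \<ominus>\<^bsub>F\<^esub> y) = (1/3) ^ Suc n"
          using norm_e F.E.norm_scale[of e "-1"] by simp
        then show ?thesis using 2 y by (intro exI[of _ "y \<ominus>\<^bsub>F\<^esub> e"]) simp
      qed
    qed
    have "\<exists>y. \<forall>n. y n \<in> carrier F \<and> (hnorm B F (y (Suc n) \<ominus>\<^bsub>F\<^esub> y n) \<le> (1/3) ^ Suc n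
        \<and> cnorm B (ip F (a (x n)) (y (Suc n))) \<ge> (1/3) ^ Suc n * N n)"
      by (rule dependent_nat_choice[where P = "\<lambda>_ y. y \<in> carrier F"]) (use step in auto)
    then obtain y where y: "\<And>n. y n \<in> carrier F" "\<And>n. hnorm B F (y (Suc n) \<ominus>\<^bsub>F\<^esub> y n) \<le> (1/3) ^ Suc n"
        "\<And>n. cnorm B (ip F (a (x n)) (y (Suc n))) \<ge> (1/3) ^ Suc n * N n"
      by blast
    \<comment> \<open>The negative tails of the geometric series of the steps.\<close>
    define r where "r n = - ((1/3) ^ n / 2 :: real)" for n
    have steps: "hnorm B F (y (Suc n) \<ominus>\<^bsub>F\<^esub> y n) \<le> r (Suc n) - r n" for n
      using y(2)[of n] by (simp add: r_def field_simps)
    have "r \<longlonglongrightarrow> - (0 / 2)" unfolding r_def by (intro tendsto_intros) simp_all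
    then have "y \<in> cauchy_seqs F (hnorm B F)"
      using F.E.cauchy_by_steps[of y r, OF y(1) steps] by (auto simp: convergent_def)
    then obtain z where z: "F.E.conv y z" using F.E_convergent by metis
    note [simp] = y(1) tendsD(2)[OF z]
    have dist: "hnorm B F (z \<ominus>\<^bsub>F\<^esub> y n) \<le> (1/3) ^ n / 2" for n
    proof (rule F.E.conv_norm_le)
      have "F.E.conv (\<lambda>k. y (k + n)) z"
        using z LIMSEQ_ignore_initial_segment[OF tendsD(3)[OF z], of n] by (simp add: tends_def)
      then show "F.E.conv (\<lambda>k. y (k + n) \<ominus>\<^bsub>F\<^esub> y n) (z \<ominus>\<^bsub>F\<^esub> y n)"
        by (intro F.E.conv_diff F.E.conv_const) simp_all
      show "hnorm B F (y (k + n) \<ominus>\<^bsub>F\<^esub> y n) \<le> (1/3) ^ n / 2" for k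
      proof -
        have "0 \<le> (1/3::real) ^ (n + k)" by simp
        then show ?thesis
          using F.E.norm_by_steps[of y r n k, OF y(1) steps] unfolding r_def add.commute[of k n] by linarith
      qed
    qed
    define az where "az = hm_adjoint E F a z"
    have [simp]: "az \<in> carrier E" using adjoint_ip(1)[OF a] by (simp add: az_def)
    have "(4/3) ^ n \<le> 6 * hnorm B E az" for n
    proof -
      have "ip F (a (x n)) (y (Suc n)) = ip F (a (x n)) z \<ominus>\<^bsub>B\<^esub> ip F (a (x n)) (z \<ominus>\<^bsub>F\<^esub> y (Suc n))"
        by (simp add: F.ip_expand) (rule B.lin_eqI, (rule B.lin | simp add: lookup_add algebra_simps)+)
      then have "cnorm B (ip F (a (x n)) (y (Suc n)))
          \<le> cnorm B (ip F (a (x n)) z) + cnorm B (ip F (a (x n)) (z \<ominus>\<^bsub>F\<^esub> y (Suc n)))"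
        by (simp add: B.norm_diff_triangle)
      also have "cnorm B (ip F (a (x n)) z) \<le> 1 * hnorm B E az"
        using cauchy_schwarz[of "x n" az] adjoint_ip(2)[OF a, of z "x n"] x(2)[of n]
          mult_right_mono[of "hnorm B E (x n)" 1 "hnorm B E az"] by (simp add: az_def[symmetric])
      also have "cnorm B (ip F (a (x n)) (z \<ominus>\<^bsub>F\<^esub> y (Suc n))) \<le> N n * ((1/3) ^ Suc n / 2)"
      proof -
        have "cnorm B (ip F (a (x n)) (z \<ominus>\<^bsub>F\<^esub> y (Suc n))) \<le> N n * hnorm B F (z \<ominus>\<^bsub>F\<^esub> y (Suc n))"
          unfolding N_def by (rule F.cauchy_schwarz) simp_all
        also have "\<dots> \<le> N n * ((1/3) ^ Suc n / 2)"
          using dist[of "Suc n"] N[of n] by (intro mult_left_mono) simp_all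
        finally show ?thesis .
      qed
      finally have "(1/3) ^ Suc n * N n \<le> hnorm B E az + N n * ((1/3) ^ Suc n / 2)"
        using y(3)[of n] by simp
      then have "(1/3) ^ n * N n \<le> 6 * hnorm B E az" by (simp add: field_simps)
      moreover have "(4/3::real) ^ n \<le> (1/3) ^ n * N n"
        using x(3)[of n] by (simp add: N_def power_divide field_simps)
      ultimately show ?thesis by linarith
    qed
    moreover obtain n where "6 * hnorm B E az < (4/3::real) ^ n"
      using real_arch_pow[of "4/3" "6 * hnorm B E az"] by auto
    ultimately show False by (meson not_le)
  qed
  then obtain M where M: "\<And>x. x \<in> carrier E \<Longrightarrow> hnorm B E x \<le> 1 \<Longrightarrow> hnorm B F (a x) \<le> M" by blast
  have "hnorm B F (a x) \<le> \<bar>M\<bar> * hnorm B E x" if x: "x \<in> carrier E" for x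
  proof (cases "hnorm B E x = 0")
    case True
    then have "x = \<zero>\<^bsub>E\<^esub>" using E.norm_eq_zero x by simp
    then show ?thesis
      using linear_map_zero[OF E.cvec_axioms F.E.cvec_axioms lin] by simp
  next
    case False
    then have pos: "hnorm B E x > 0" using x by (metis hnorm_nonneg less_eq_real_def)
    define c where "c = complex_of_real (1 / hnorm B E x)"
    have c: "cmod c = 1 / hnorm B E x" using pos by (simp add: c_def norm_divide)
    have "hnorm B F (a (c \<odot>\<^bsub>E\<^esub> x)) \<le> M" using x pos by (intro M) (simp_all add: E.norm_scale c)
    then have "hnorm B F (a x) \<le> M * hnorm B E x"
      using linear_mapD(3)[OF lin x, of c] x pos by (simp add: F.E.norm_scale c field_simps)
    also have "\<dots> \<le> \<bar>M\<bar> * hnorm B E x" using pos by (intro mult_right_mono) simp_all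
    finally show ?thesis .
  qed
  then show ?thesis by (intro exI[of _ "\<bar>M\<bar>"]) simp
qed

end

section \<open>The \<open>C\<^sup>*\<close>-algebra of adjointable operators\<close>

lemma Ba_simps [simp]:
  "carrier (Ba B E) = adjointable E E"
  "mult (Ba B E) = (\<lambda>a a'. compose (carrier E) a a')"
  "\<one>\<^bsub>Ba B E\<^esub> = (\<lambda>x\<in>carrier E. x)"
  "\<zero>\<^bsub>Ba B E\<^esub> = (\<lambda>x\<in>carrier E. \<zero>\<^bsub>E\<^esub>)"
  "add (Ba B E) = (\<lambda>a a'. \<lambda>x\<in>carrier E. a x \<oplus>\<^bsub>E\<^esub> a' x)"
  "smult (Ba B E) = (\<lambda>c a. \<lambda>x\<in>carrier E. c \<odot>\<^bsub>E\<^esub> a x)"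
  "invol (Ba B E) = hm_adjoint E E"
  by (simp_all add: Ba_def)

lemma compose_apply [simp]: "x \<in> A \<Longrightarrow> compose A f g x = f (g x)"
  by (simp add: compose_def)

lemma cnorm_Ba: "cnorm (Ba B E) a = Sup {hnorm B E (a x) | x. x \<in> carrier E \<and> hnorm B E x \<le> 1}"
  by (simp add: Ba_def)

context hilbert_cs
begin

interpretation self: hilbert_pair B E E
  by unfold_locales

lemmas Ba_closed [simp] = self.adjointable_closed
lemmas Ba_adjoint_closed [simp] = self.adjoint_ip(1)

lemma Ba_adjoint_ip: "a \<in> adjointable E E \<Longrightarrow> x \<in> carrier E \<Longrightarrow> y \<in> carrier E \<Longrightarrow>
    ip E (hm_adjoint E E a y) x = ip E y (a x)"
  by (rule self.adjoint_ip_left)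

lemma Ba_linear:
  assumes "a \<in> adjointable E E"
  shows "x \<in> carrier E \<Longrightarrow> y \<in> carrier E \<Longrightarrow> a (x \<oplus>\<^bsub>E\<^esub> y) = a x \<oplus>\<^bsub>E\<^esub> a y"
    and "x \<in> carrier E \<Longrightarrow> a (c \<odot>\<^bsub>E\<^esub> x) = c \<odot>\<^bsub>E\<^esub> a x"
    and "x \<in> carrier E \<Longrightarrow> y \<in> carrier E \<Longrightarrow> a (x \<ominus>\<^bsub>E\<^esub> y) = a x \<ominus>\<^bsub>E\<^esub> a y"
    and "a \<zero>\<^bsub>E\<^esub> = \<zero>\<^bsub>E\<^esub>"
  using self.adjointable_linear[OF assms] linear_map_diff[OF E.cvec_axioms E.cvec_axioms]
    linear_map_zero[OF E.cvec_axioms E.cvec_axioms]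
  by (auto simp: linear_map_def)

lemma Ba_ract:
  assumes "a \<in> adjointable E E" "x \<in> carrier E" "b \<in> carrier B"
  shows "a (ract E x b) = ract E (a x) b"
  by (rule ip_eqI) (use assms in \<open>simp_all add: ip_ract Ba_adjoint_ip[symmetric]\<close>)

lemmas Ba_eqI = self.adjointable_eqI

lemma Ba_adjoint:
  assumes "a \<in> adjointable E E"
  shows "hm_adjoint E E a \<in> adjointable E E" "hm_adjoint E E (hm_adjoint E E a) = a"
proof -
  have *: "hm_adjoint E E a \<in> extensional (carrier E)"
    by (simp add: hm_adjoint_def)
  show "hm_adjoint E E a \<in> adjointable E E"
    by (rule self.adjointableI(1)[OF *, where a' = a]) (use assms in \<open>simp_all add: Ba_adjoint_ip\<close>)
  have "hm_adjoint E E (hm_adjoint E E a) = restrict a (carrier E)"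
    by (rule self.adjointableI(2)[OF *]) (use assms in \<open>simp_all add: Ba_adjoint_ip\<close>)
  then show "hm_adjoint E E (hm_adjoint E E a) = a"
    using self.adjointable_extensional[OF assms] by (simp only: extensional_restrict)
qed

lemma Ba_adjoint_ip': "a \<in> adjointable E E \<Longrightarrow> x \<in> carrier E \<Longrightarrow> y \<in> carrier E \<Longrightarrow>
    ip E y (hm_adjoint E E a x) = ip E (a y) x"
  using self.adjoint_ip(2) by simp

lemma Ba_adjointI:
  assumes "\<And>x. x \<in> carrier E \<Longrightarrow> f x \<in> carrier E" "\<And>x. x \<in> carrier E \<Longrightarrow> g x \<in> carrier E"
    "\<And>x y. x \<in> carrier E \<Longrightarrow> y \<in> carrier E \<Longrightarrow> ip E (f x) y = ip E x (g y)"
  shows "(\<lambda>x\<in>carrier E. f x) \<in> adjointable E E"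
    and "hm_adjoint E E (\<lambda>x\<in>carrier E. f x) = (\<lambda>x\<in>carrier E. g x)"
  by (rule self.adjointableI, use assms in simp_all)+

lemma Ba_add:
  assumes "a \<in> adjointable E E" "b \<in> adjointable E E"
  shows "(\<lambda>x\<in>carrier E. a x \<oplus>\<^bsub>E\<^esub> b x) \<in> adjointable E E"
    and "hm_adjoint E E (\<lambda>x\<in>carrier E. a x \<oplus>\<^bsub>E\<^esub> b x)
      = (\<lambda>x\<in>carrier E. hm_adjoint E E a x \<oplus>\<^bsub>E\<^esub> hm_adjoint E E b x)"
  by (rule Ba_adjointI[where g = "\<lambda>x. hm_adjoint E E a x \<oplus>\<^bsub>E\<^esub> hm_adjoint E E b x"],
      use assms in \<open>simp_all add: ip_expand Ba_adjoint_ip'\<close>)+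

lemma Ba_scale:
  assumes "a \<in> adjointable E E"
  shows "(\<lambda>x\<in>carrier E. c \<odot>\<^bsub>E\<^esub> a x) \<in> adjointable E E"
    and "hm_adjoint E E (\<lambda>x\<in>carrier E. c \<odot>\<^bsub>E\<^esub> a x)
      = (\<lambda>x\<in>carrier E. cnj c \<odot>\<^bsub>E\<^esub> hm_adjoint E E a x)"
  by (rule Ba_adjointI[where g = "\<lambda>x. cnj c \<odot>\<^bsub>E\<^esub> hm_adjoint E E a x"], use assms in \<open>simp_all add: ip_expand Ba_adjoint_ip'\<close>)+

lemma Ba_compose:
  assumes "a \<in> adjointable E E" "b \<in> adjointable E E"
  shows "compose (carrier E) a b \<in> adjointable E E"
    and "hm_adjoint E E (compose (carrier E) a b) = compose (carrier E) (hm_adjoint E E b) (hm_adjoint E E a)"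
  unfolding compose_def
  by (rule Ba_adjointI[where g = "\<lambda>x. hm_adjoint E E b (hm_adjoint E E a x)"], use assms in \<open>simp_all add: Ba_adjoint_ip'\<close>)+

lemma Ba_one: "(\<lambda>x\<in>carrier E. x) \<in> adjointable E E"
  and Ba_zero: "(\<lambda>x\<in>carrier E. \<zero>\<^bsub>E\<^esub>) \<in> adjointable E E"
  by (rule Ba_adjointI[where g = "\<lambda>x. x"], simp_all) (rule Ba_adjointI[where g = "\<lambda>_. \<zero>\<^bsub>E\<^esub>"], simp_all)

lemma Ba_cvec: "cvec (Ba B E)"
  unfolding cvec_def
proof (rule moduleI[OF cring_complex_field])
  show "abelian_group (Ba B E)"
  proof (rule abelian_groupI)
    fix x assume x: "x \<in> carrier (Ba B E)"
    show "\<exists>y\<in>carrier (Ba B E). y \<oplus>\<^bsub>Ba B E\<^esub> x = \<zero>\<^bsub>Ba B E\<^esub>"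
    proof (rule bexI)
      show "(\<lambda>z\<in>carrier E. (-1) \<odot>\<^bsub>E\<^esub> x z) \<oplus>\<^bsub>Ba B E\<^esub> x = \<zero>\<^bsub>Ba B E\<^esub>"
        using x by (auto simp: fun_eq_iff E.M.l_neg simp flip: E.uminus_eq_scale)
    qed (use x Ba_scale in simp)
  next
    fix x assume "x \<in> carrier (Ba B E)"
    then show "\<zero>\<^bsub>Ba B E\<^esub> \<oplus>\<^bsub>Ba B E\<^esub> x = x"
      using Ba_add(1)[OF Ba_zero, of x] by (intro Ba_eqI) simp_all
  qed (auto simp: Ba_add Ba_zero E.M.a_ac fun_eq_iff)
next
  fix x assume "x \<in> carrier (Ba B E)"
  then show "\<one>\<^bsub>complex_field\<^esub> \<odot>\<^bsub>Ba B E\<^esub> x = x"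
    using Ba_scale(1)[of x 1] by (intro Ba_eqI) simp_all
qed (auto simp: Ba_add Ba_scale E.scale_add_left E.scale_add_right E.scale_scale fun_eq_iff)

interpretation Ba: cvec "Ba B E"
  by (rule Ba_cvec)

lemma Ba_diff: "a \<in> adjointable E E \<Longrightarrow> b \<in> adjointable E E \<Longrightarrow>
    a \<ominus>\<^bsub>Ba B E\<^esub> b = (\<lambda>x\<in>carrier E. a x \<ominus>\<^bsub>E\<^esub> b x)"
  by (auto simp: Ba.diff_eq_scale E.diff_eq_scale fun_eq_iff)

abbreviation opn :: "('c \<Rightarrow> 'c) \<Rightarrow> real" where "opn \<equiv> cnorm (Ba B E)"

lemma opn_bdd:
  assumes "a \<in> adjointable E E"
  shows "bdd_above {hnorm B E (a x) | x. x \<in> carrier E \<and> hnorm B E x \<le> 1}"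
proof -
  obtain K where K: "K \<ge> 0" "\<And>x. x \<in> carrier E \<Longrightarrow> hnorm B E (a x) \<le> K * hnorm B E x"
    using self.adjointable_bounded[OF assms] by blast
  have "hnorm B E (a x) \<le> K" if "x \<in> carrier E" "hnorm B E x \<le> 1" for x
    using K(2)[OF that(1)] mult_left_mono[OF that(2) K(1)] by simp
  then show ?thesis by (auto simp: bdd_above_def)
qed

lemma opn_le:
  assumes "K \<ge> 0" "\<And>x. x \<in> carrier E \<Longrightarrow> hnorm B E (a x) \<le> K * hnorm B E x"
  shows "opn a \<le> K"
  unfolding cnorm_Ba
proof (rule cSup_least)
  show "{hnorm B E (a x) | x. x \<in> carrier E \<and> hnorm B E x \<le> 1} \<noteq> {}"
    by (auto intro!: exI[of _ "\<zero>\<^bsub>E\<^esub>"])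
  fix r assume "r \<in> {hnorm B E (a x) | x. x \<in> carrier E \<and> hnorm B E x \<le> 1}"
  then obtain x where x: "r = hnorm B E (a x)" "x \<in> carrier E" "hnorm B E x \<le> 1" by blast
  then show "r \<le> K" using assms(2)[of x] mult_left_mono[OF x(3) assms(1)] by simp
qed

lemma opn_bound_unit:
  assumes "a \<in> adjointable E E" "x \<in> carrier E" "hnorm B E x \<le> 1"
  shows "hnorm B E (a x) \<le> opn a"
  unfolding cnorm_Ba by (rule cSup_upper[OF _ opn_bdd]) (use assms in auto)

lemma opn_nonneg: "a \<in> adjointable E E \<Longrightarrow> 0 \<le> opn a"
  using order_trans[OF hnorm_nonneg[of "a \<zero>\<^bsub>E\<^esub>"] opn_bound_unit[of a "\<zero>\<^bsub>E\<^esub>"]] by simp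

lemma opn_bound:
  assumes a: "a \<in> adjointable E E" and x: "x \<in> carrier E"
  shows "hnorm B E (a x) \<le> opn a * hnorm B E x"
proof (cases "hnorm B E x = 0")
  case True
  then have "x = \<zero>\<^bsub>E\<^esub>" using E.norm_eq_zero x by simp
  then show ?thesis by (simp add: Ba_linear[OF a])
next
  case False
  then have pos: "hnorm B E x > 0" using x by (metis hnorm_nonneg less_eq_real_def)
  define c where "c = complex_of_real (1 / hnorm B E x)"
  have c: "cmod c = 1 / hnorm B E x" using pos by (simp add: c_def norm_divide)
  have "hnorm B E (a (c \<odot>\<^bsub>E\<^esub> x)) \<le> opn a"
    using x pos by (intro opn_bound_unit a) (simp_all add: E.norm_scale c)
  then show ?thesis using x a pos by (simp add: Ba_linear E.norm_scale c field_simps)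
qed

lemma opn_complete: "norm_complete (Ba B E) opn"
  unfolding norm_complete_def
proof
  fix s assume s: "s \<in> cauchy_seqs (Ba B E) opn"
  then have [simp]: "s n \<in> adjointable E E" for n by (simp add: cauchy_seqs_def)
  note [simp] = Ba_adjoint
  have cauchy: "\<exists>N. \<forall>m\<ge>N. \<forall>n\<ge>N. opn (s m \<ominus>\<^bsub>Ba B E\<^esub> s n) < e" if "e > 0" for e
    using s that by (simp add: cauchy_seqs_def)
  have diff: "s m \<ominus>\<^bsub>Ba B E\<^esub> s n \<in> adjointable E E" for m n
    using Ba.diff_closed[of "s m" "s n"] by simp
  have ptwise: "(\<lambda>n. s n x) \<in> cauchy_seqs E (hnorm B E)" if x [simp]: "x \<in> carrier E" for x
  proof (rule E.cauchy_dominated[OF s, where K = "hnorm B E x"])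
    show "hnorm B E (s m x \<ominus>\<^bsub>E\<^esub> s n x) \<le> hnorm B E x * opn (s m \<ominus>\<^bsub>Ba B E\<^esub> s n)" for m n
      using opn_bound[OF diff x, of m n] by (simp add: Ba_diff mult.commute)
  qed simp_all
  have ptwise': "(\<lambda>n. hm_adjoint E E (s n) x) \<in> cauchy_seqs E (hnorm B E)" if x [simp]: "x \<in> carrier E" for x
  proof (rule E.cauchy_dominated[OF s, where K = "hnorm B E x"])
    fix m n
    let ?d = "hm_adjoint E E (s m) x \<ominus>\<^bsub>E\<^esub> hm_adjoint E E (s n) x"
    have "ip E ?d ?d = ip E x ((s m \<ominus>\<^bsub>Ba B E\<^esub> s n) ?d)"
      by (simp add: Ba_diff Ba_adjoint_ip ip_diff_left) (simp add: Ba_adjoint_ip ip_diff)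
    then have "(hnorm B E ?d)\<^sup>2 \<le> hnorm B E x * hnorm B E ((s m \<ominus>\<^bsub>Ba B E\<^esub> s n) ?d)"
      using cauchy_schwarz[of x "(s m \<ominus>\<^bsub>Ba B E\<^esub> s n) ?d"] diff by (simp add: hnorm_square)
    also have "\<dots> \<le> hnorm B E x * (opn (s m \<ominus>\<^bsub>Ba B E\<^esub> s n) * hnorm B E ?d)"
      using opn_bound[OF diff, of ?d m n] by (intro mult_left_mono) simp_all
    finally have le: "hnorm B E ?d * hnorm B E ?d \<le> (hnorm B E x * opn (s m \<ominus>\<^bsub>Ba B E\<^esub> s n)) * hnorm B E ?d"
      by (simp add: power2_eq_square mult.assoc)
    show "hnorm B E ?d \<le> hnorm B E x * opn (s m \<ominus>\<^bsub>Ba B E\<^esub> s n)"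
    proof (cases "hnorm B E ?d = 0")
      case True
      then show ?thesis using opn_nonneg[OF diff] by (simp del: mult_nonneg_nonneg) (intro mult_nonneg_nonneg, simp_all)
    next
      case False
      then have "hnorm B E ?d > 0" by (simp add: less_le)
      with le show ?thesis by (rule mult_right_le_imp_le)
    qed
  qed simp_all
  define T where "T = (\<lambda>x\<in>carrier E. SOME y. E.conv (\<lambda>n. s n x) y)"
  define T' where "T' x = (SOME y. E.conv (\<lambda>n. hm_adjoint E E (s n) x) y)" for x
  have T: "E.conv (\<lambda>n. s n x) (T x)" if "x \<in> carrier E" for x
    unfolding T_def using someI_ex[of "\<lambda>y. E.conv (\<lambda>n. s n x) y"] E_convergent[OF ptwise[OF that]] that
    by auto
  have T': "E.conv (\<lambda>n. hm_adjoint E E (s n) x) (T' x)" if "x \<in> carrier E" for x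
    unfolding T'_def using someI_ex[of "\<lambda>y. E.conv (\<lambda>n. hm_adjoint E E (s n) x) y"] E_convergent[OF ptwise'[OF that]]
    by auto
  note [simp] = tendsD(2)[OF T] tendsD(2)[OF T']
  have "ip E (T x) y = ip E x (T' y)" if [simp]: "x \<in> carrier E" "y \<in> carrier E" for x y
  proof (rule B.conv_unique)
    show "B.conv (\<lambda>n. ip E (s n x) y) (ip E (T x) y)"
      by (intro conv_ip T E.conv_const) simp_all
    show "B.conv (\<lambda>n. ip E (s n x) y) (ip E x (T' y))"
      using conv_ip[OF E.conv_const[of x] T'[of y]] by (simp add: Ba_adjoint_ip')
  qed
  then have Tadj: "T \<in> adjointable E E"
    by (intro self.adjointableI(1)[where a' = T']) (simp_all, simp add: T_def)
  have "(\<lambda>n. opn (s n \<ominus>\<^bsub>Ba B E\<^esub> T)) \<longlonglongrightarrow> 0"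
  proof (rule LIMSEQ_I)
    fix e :: real assume e: "0 < e"
    then obtain N where N: "\<And>m n. m \<ge> N \<Longrightarrow> n \<ge> N \<Longrightarrow> opn (s m \<ominus>\<^bsub>Ba B E\<^esub> s n) < e / 2"
      using cauchy[of "e / 2"] by auto
    have "opn (s m \<ominus>\<^bsub>Ba B E\<^esub> T) \<le> e / 2" if m: "m \<ge> N" for m
    proof (rule opn_le)
      fix x assume x [simp]: "x \<in> carrier E"
      have "E.conv (\<lambda>n. s m x \<ominus>\<^bsub>E\<^esub> s (n + N) x) (s m x \<ominus>\<^bsub>E\<^esub> T x)"
        using T[OF x] LIMSEQ_ignore_initial_segment[OF tendsD(3)[OF T[OF x]], of N]
        by (intro E.conv_diff E.conv_const) (simp_all add: tends_def)
      then have "hnorm B E (s m x \<ominus>\<^bsub>E\<^esub> T x) \<le> e / 2 * hnorm B E x"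
      proof (rule E.conv_norm_le)
        fix n
        have "hnorm B E (s m x \<ominus>\<^bsub>E\<^esub> s (n + N) x) \<le> opn (s m \<ominus>\<^bsub>Ba B E\<^esub> s (n + N)) * hnorm B E x"
          using opn_bound[OF diff x] by (simp add: Ba_diff)
        also have "\<dots> \<le> e / 2 * hnorm B E x"
          using N[OF m, of "n + N"] by (intro mult_right_mono) simp_all
        finally show "hnorm B E (s m x \<ominus>\<^bsub>E\<^esub> s (n + N) x) \<le> e / 2 * hnorm B E x" .
      qed
      then show "hnorm B E ((s m \<ominus>\<^bsub>Ba B E\<^esub> T) x) \<le> e / 2 * hnorm B E x"
        using Tadj by (simp add: Ba_diff)
    qed (use e in simp)
    moreover have "opn (s m \<ominus>\<^bsub>Ba B E\<^esub> T) \<ge> 0" for m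
      using Ba.diff_closed[of "s m" T] Tadj by (intro opn_nonneg) simp
    ultimately show "\<exists>no. \<forall>n\<ge>no. norm (opn (s n \<ominus>\<^bsub>Ba B E\<^esub> T) - 0) < e"
      using e by (intro exI[of _ N]) (smt (verit) field_sum_of_halves real_norm_def)
  qed
  with Tadj show "\<exists>x\<in>carrier (Ba B E). (\<lambda>n. opn (s n \<ominus>\<^bsub>Ba B E\<^esub> x)) \<longlonglongrightarrow> 0"
    by auto
qed

lemma opn_scale:
  assumes a: "a \<in> adjointable E E"
  shows "opn (\<lambda>x\<in>carrier E. c \<odot>\<^bsub>E\<^esub> a x) = cmod c * opn a"
proof -
  have le: "opn (\<lambda>x\<in>carrier E. c \<odot>\<^bsub>E\<^esub> a x) \<le> cmod c * opn a" if "a \<in> adjointable E E" for a c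
    using that opn_nonneg[OF that]
    by (intro opn_le) (simp_all add: E.norm_scale mult.assoc mult_left_mono opn_bound)
  show ?thesis
  proof (cases "c = 0")
    case True
    then show ?thesis using le[OF a, of c] opn_nonneg[OF Ba_scale(1)[OF a, of c]] by simp
  next
    case False
    have "(\<lambda>x\<in>carrier E. inverse c \<odot>\<^bsub>E\<^esub> (\<lambda>x\<in>carrier E. c \<odot>\<^bsub>E\<^esub> a x) x) = a"
      using False by (intro Ba_eqI Ba_scale a) (simp_all add: E.scale_scale a)
    then have "opn a \<le> cmod (inverse c) * opn (\<lambda>x\<in>carrier E. c \<odot>\<^bsub>E\<^esub> a x)"
      using le[OF Ba_scale(1)[OF a, of c], of "inverse c"] by simp
    then have "cmod c * opn a \<le> opn (\<lambda>x\<in>carrier E. c \<odot>\<^bsub>E\<^esub> a x)"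
      using False by (simp add: norm_divide field_simps)
    then show ?thesis using le[OF a, of c] by simp
  qed
qed

lemma opn_triangle:
  assumes "a \<in> adjointable E E" "b \<in> adjointable E E"
  shows "opn (\<lambda>x\<in>carrier E. a x \<oplus>\<^bsub>E\<^esub> b x) \<le> opn a + opn b"
proof (rule opn_le)
  fix x assume "x \<in> carrier E"
  then show "hnorm B E ((\<lambda>x\<in>carrier E. a x \<oplus>\<^bsub>E\<^esub> b x) x) \<le> (opn a + opn b) * hnorm B E x"
    using hnorm_triangle[of "a x" "b x"] opn_bound[OF assms(1), of x] opn_bound[OF assms(2), of x] assms
    by (simp add: distrib_right)
qed (use assms opn_nonneg in simp)

lemma opn_mult:
  assumes "a \<in> adjointable E E" "b \<in> adjointable E E"
  shows "opn (compose (carrier E) a b) \<le> opn a * opn b"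
proof (rule opn_le)
  fix x assume "x \<in> carrier E"
  then show "hnorm B E (compose (carrier E) a b x) \<le> opn a * opn b * hnorm B E x"
    using opn_bound[OF assms(1), of "b x"]
      mult_left_mono[OF opn_bound[OF assms(2), of x] opn_nonneg[OF assms(1)]]
    by (simp add: assms mult.assoc)
qed (simp add: assms opn_nonneg)

lemma opn_adjoint_mult:
  assumes a: "a \<in> adjointable E E"
  shows "opn (compose (carrier E) (hm_adjoint E E a) a) = (opn a)\<^sup>2"
proof -
  note mult = opn_mult
  have lower: "(opn a)\<^sup>2 \<le> opn (compose (carrier E) (hm_adjoint E E a) a)" if a: "a \<in> adjointable E E" for a
  proof -
    let ?c = "compose (carrier E) (hm_adjoint E E a) a"
    have c: "?c \<in> adjointable E E" using a Ba_compose Ba_adjoint by blast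
    have "opn a \<le> sqrt (opn ?c)"
    proof (rule opn_le)
      fix x assume x [simp]: "x \<in> carrier E"
      have "(hnorm B E (a x))\<^sup>2 = cnorm B (ip E (?c x) x)"
        using a by (simp add: hnorm_square Ba_adjoint_ip)
      also have "\<dots> \<le> hnorm B E (?c x) * hnorm B E x"
        using a by (intro cauchy_schwarz) (simp_all add: Ba_adjoint)
      also have "\<dots> \<le> opn ?c * hnorm B E x * hnorm B E x"
        by (intro mult_right_mono opn_bound c) simp_all
      also have "\<dots> = (sqrt (opn ?c) * hnorm B E x)\<^sup>2"
        using opn_nonneg[OF c] by (simp add: power_mult_distrib power2_eq_square)
      finally show "hnorm B E (a x) \<le> sqrt (opn ?c) * hnorm B E x"
        by (rule power2_le_imp_le) (use opn_nonneg[OF c] in simp)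
    qed (use opn_nonneg[OF c] in simp)
    then have "(opn a)\<^sup>2 \<le> (sqrt (opn ?c))\<^sup>2" using opn_nonneg[OF a] by (intro power_mono)
    then show ?thesis using opn_nonneg[OF c] by simp
  qed
  have le: "opn a \<le> opn (hm_adjoint E E a)" if a: "a \<in> adjointable E E" for a
  proof (cases "opn a = 0")
    case True
    then show ?thesis using opn_nonneg[OF Ba_adjoint(1)[OF a]] by simp
  next
    case False
    then have "opn a > 0" using opn_nonneg[OF a] by simp
    moreover have "opn a * opn a \<le> opn (hm_adjoint E E a) * opn a"
      using lower[OF a] mult[OF Ba_adjoint(1)[OF a] a] by (simp add: power2_eq_square)
    ultimately show ?thesis by simp
  qed
  have "opn (hm_adjoint E E a) = opn a"
    using le[OF a] le[OF Ba_adjoint(1)[OF a]] Ba_adjoint(2)[OF a] by simp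
  then show ?thesis
    using lower[OF a] mult[OF Ba_adjoint(1)[OF a] a] by (simp add: power2_eq_square)
qed

lemma opn_eq_zero:
  assumes a: "a \<in> adjointable E E"
  shows "opn a = 0 \<longleftrightarrow> a = (\<lambda>x\<in>carrier E. \<zero>\<^bsub>E\<^esub>)"
proof
  assume "opn a = 0"
  then have "a x = \<zero>\<^bsub>E\<^esub>" if "x \<in> carrier E" for x
    using opn_bound[OF a, of x] a that by (intro E.norm_eq_zero antisym) simp_all
  then show "a = (\<lambda>x\<in>carrier E. \<zero>\<^bsub>E\<^esub>)"
    using a Ba_zero by (auto intro!: Ba_eqI)
next
  assume "a = (\<lambda>x\<in>carrier E. \<zero>\<^bsub>E\<^esub>)"
  then show "opn a = 0" using opn_le[of 0 a] opn_nonneg[OF a] by simp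
qed

theorem Ba_cstar: "cstar_algebra (Ba B E)"
proof (intro cstar_algebra.intro cstar_algebra_axioms.intro)
  show "Module.module complex_field (Ba B E)" using Ba_cvec by (simp add: cvec_def)
  show "norm_complete (Ba B E) opn" by (rule opn_complete)
  show "(opn a = 0) = (a = \<zero>\<^bsub>Ba B E\<^esub>)" if "a \<in> carrier (Ba B E)" for a
    using opn_eq_zero[of a] that by simp
qed (auto simp: Ba_add Ba_scale Ba_compose Ba_adjoint Ba_linear opn_nonneg opn_scale opn_triangle
    opn_mult[unfolded compose_def] opn_adjoint_mult[unfolded compose_def] Ba_compose[unfolded compose_def]
    fun_eq_iff compose_def)

theorem Ba_unital_cstar: "unital_cstar (Ba B E)"
  by (intro unital_cstar.intro Ba_cstar unital_cstar_axioms.intro)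
    (auto simp: Ba_one Ba_compose intro!: Ba_eqI)

end

declare Ba_simps [simp del]

section \<open>The multiplier algebra and the order of a nonunital algebra\<close>

text \<open>
  The adjointable operators on the algebra, taken as a Hilbert module over itself, form its multiplier
  algebra.  It contains the algebra isometrically by left multiplication as an ideal and has a unit.
\<close>

definition self_module :: "('a, 'm) cstar_scheme \<Rightarrow> ('a, 'a) hmodule" where
  "self_module A = \<lparr>carrier = carrier A, mult = mult A, one = one A, zero = zero A, add = add A,
     smult = smult A, ract = mult A, ip = (\<lambda>a b. invol A a \<otimes>\<^bsub>A\<^esub> b)\<rparr>"

lemma self_module_simps [simp]:
  "carrier (self_module A) = carrier A" "zero (self_module A) = zero A" "add (self_module A) = add A"
  "smult (self_module A) = smult A" "ract (self_module A) = mult A"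
  "ip (self_module A) = (\<lambda>a b. invol A a \<otimes>\<^bsub>A\<^esub> b)"
  by (simp_all add: self_module_def)

lemma self_module_minus [simp]: "x \<ominus>\<^bsub>self_module A\<^esub> y = x \<ominus>\<^bsub>A\<^esub> y"
  by (simp add: a_minus_def a_inv_def m_inv_def)

context cstar_algebra
begin

lemma self_norm: "a \<in> carrier A \<Longrightarrow> hnorm A (self_module A) a = cnorm A a"
  by (simp add: hnorm_def cstar_identity cnorm_nonneg)

lemma self_cvec: "cvec (self_module A)"
  unfolding cvec_def
proof (rule moduleI[OF cring_complex_field])
  show "abelian_group (self_module A)"
  proof (rule abelian_groupI)
    fix x assume "x \<in> carrier (self_module A)"
    then show "\<exists>y\<in>carrier (self_module A). y \<oplus>\<^bsub>self_module A\<^esub> x = \<zero>\<^bsub>self_module A\<^esub>"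
      by (intro bexI[of _ "\<ominus> x"]) (simp_all add: M.l_neg)
  qed (auto simp: M.a_ac)
qed (auto simp: scale_add_left scale_add_right scale_scale)

theorem self_hilbert: "hilbert_cs A (self_module A)"
proof (intro hilbert_cs.intro semi_hilbert_cs.intro semi_hilbert.intro semi_hilbert_axioms.intro
    semi_hilbert_cs_axioms.intro hilbert_cs_axioms.intro cstar_algebra_axioms self_cvec)
  show "cnorm A (ip (self_module A) x y) \<le> hnorm A (self_module A) x * hnorm A (self_module A) y"
    if "x \<in> carrier (self_module A)" "y \<in> carrier (self_module A)" for x y
    using that cnorm_mult[of "invol A x" y] by (simp add: self_norm cnorm_invol)
  show "x = \<zero>\<^bsub>self_module A\<^esub>"
    if "x \<in> carrier (self_module A)" "ip (self_module A) x x = \<zero>" for x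
    using that cstar_identity[of x] norm_eq_zero[of x] by simp
  show "norm_complete (self_module A) (hnorm A (self_module A))"
    unfolding norm_complete_def
  proof
    fix s assume s: "s \<in> cauchy_seqs (self_module A) (hnorm A (self_module A))"
    then have [simp]: "s n \<in> carrier A" for n by (simp add: cauchy_seqs_def)
    have "s \<in> cauchy_seqs A (cnorm A)"
      using s by (simp add: cauchy_seqs_def self_norm)
    then obtain x where "conv s x" by (rule cauchy_convergent)
    then show "\<exists>x\<in>carrier (self_module A). (\<lambda>n. hnorm A (self_module A) (s n \<ominus>\<^bsub>self_module A\<^esub> x)) \<longlonglongrightarrow> 0"
      by (intro bexI[of _ x]) (auto simp: tends_def self_norm)
  qed
qed (auto simp: mult_r_distr mult_smult_r mult_assoc invol_mult cstar_pos_def)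

abbreviation MA :: "('a \<Rightarrow> 'a) cstar" where "MA \<equiv> Ba A (self_module A)"

definition lmul :: "'a \<Rightarrow> 'a \<Rightarrow> 'a" where "lmul a = (\<lambda>x\<in>carrier A. a \<otimes> x)"

interpretation S: hilbert_cs A "self_module A"
  by (rule self_hilbert)

interpretation MA: unital_cstar MA
  by (rule S.Ba_unital_cstar)

lemma lmul_adj:
  assumes "a \<in> carrier A"
  shows "lmul a \<in> adjointable (self_module A) (self_module A)"
    and "hm_adjoint (self_module A) (self_module A) (lmul a) = lmul (invol A a)"
  unfolding lmul_def
  using S.Ba_adjointI[of "\<lambda>x. a \<otimes> x" "\<lambda>x. invol A a \<otimes> x"] assms
  by (simp_all add: invol_mult mult_assoc)

lemma lmul_closed [simp]: "a \<in> carrier A \<Longrightarrow> lmul a \<in> carrier MA"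
  using lmul_adj by (simp add: Ba_simps)

lemma lmul_hom:
  assumes "a \<in> carrier A" "b \<in> carrier A"
  shows "lmul (a \<otimes> b) = lmul a \<otimes>\<^bsub>MA\<^esub> lmul b"
    and "lmul (a \<oplus> b) = lmul a \<oplus>\<^bsub>MA\<^esub> lmul b"
proof -
  show "lmul (a \<otimes> b) = lmul a \<otimes>\<^bsub>MA\<^esub> lmul b"
    using assms by (auto simp: Ba_simps lmul_def fun_eq_iff mult_assoc compose_def)
  show "lmul (a \<oplus> b) = lmul a \<oplus>\<^bsub>MA\<^esub> lmul b"
    using assms by (auto simp: Ba_simps lmul_def fun_eq_iff mult_l_distr)
qed

lemma lmul_scale: "a \<in> carrier A \<Longrightarrow> lmul (c \<odot> a) = c \<odot>\<^bsub>MA\<^esub> lmul a"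
  by (auto simp: Ba_simps lmul_def fun_eq_iff mult_smult_l)

lemma lmul_invol: "a \<in> carrier A \<Longrightarrow> lmul (invol A a) = invol MA (lmul a)"
  by (simp add: Ba_simps lmul_adj)

lemma lmul_linear: "linear_map A MA lmul"
  by (simp add: linear_map_def lmul_hom lmul_scale)

lemma lmul_diff: "a \<in> carrier A \<Longrightarrow> b \<in> carrier A \<Longrightarrow> lmul (a \<ominus> b) = lmul a \<ominus>\<^bsub>MA\<^esub> lmul b"
  by (rule linear_map_diff[OF cvec_axioms MA.cvec_axioms lmul_linear])

lemma lmul_norm: "a \<in> carrier A \<Longrightarrow> cnorm MA (lmul a) = cnorm A a"
proof (rule antisym)
  assume a: "a \<in> carrier A"
  show "cnorm MA (lmul a) \<le> cnorm A a"
    by (rule S.opn_le) (use a in \<open>simp_all add: self_norm lmul_def cnorm_mult cnorm_nonneg\<close>)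
  show "cnorm A a \<le> cnorm MA (lmul a)"
  proof (cases "cnorm A a = 0")
    case True
    then show ?thesis using S.opn_nonneg[OF lmul_adj(1)[OF a]] by simp
  next
    case False
    then have "cnorm A a > 0" using cnorm_nonneg[OF a] by simp
    moreover have "cnorm A a * cnorm A a \<le> cnorm MA (lmul a) * cnorm A a"
      using S.opn_bound[OF lmul_adj(1)[OF a], of "invol A a"] a cstar_identity[of "invol A a"]
      by (simp add: self_norm lmul_def cnorm_invol power2_eq_square)
    ultimately show ?thesis by simp
  qed
qed

lemma lmul_inj: "a \<in> carrier A \<Longrightarrow> b \<in> carrier A \<Longrightarrow> lmul a = lmul b \<Longrightarrow> a = b"
  using lmul_norm[of "a \<ominus> b"] lmul_diff[of a b] norm_eq_zero[of "a \<ominus> b"] diff_eq_zero[of a b] by simp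

lemma lmul_ideal: "T \<in> carrier MA \<Longrightarrow> a \<in> carrier A \<Longrightarrow> T \<otimes>\<^bsub>MA\<^esub> lmul a = lmul (T a)"
  using S.Ba_ract[of T a] S.Ba_closed[of T] by (auto simp: Ba_simps lmul_def fun_eq_iff compose_def)

lemma lmul_conv: "conv s x \<Longrightarrow> MA.conv (\<lambda>n. lmul (s n)) (lmul x)"
  by (rule conv_bounded_map[OF seminormed_axioms MA.seminormed_axioms lmul_linear, of 1])
    (simp_all add: lmul_norm)

text \<open>
  The square root of \<open>a \<ge> 0\<close> taken in the multiplier algebra lies in the algebra itself:
  \<open>s (1 - s\<^sup>2)\<^sup>n\<close> tends to zero, and \<open>s - s (1 - s\<^sup>2)\<^sup>n\<close> lies in the closed ideal \<open>A\<close>.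
\<close>

lemma lmul_sqrt_range:
  assumes a: "a \<in> carrier A" "cnorm A a \<le> 1" and s: "MA.npos s" "s \<otimes>\<^bsub>MA\<^esub> s = lmul a"
  obtains c where "c \<in> carrier A" "lmul c = s"
proof -
  note [simp] = MA.npos_closed[OF s(1)] a(1)
  have la: "MA.npos (lmul a)"
    using MA.npos_square[OF MA.npos_sa[OF s(1)]] s(2) by simp
  define v where "v n = s \<otimes>\<^bsub>MA\<^esub> (\<one>\<^bsub>MA\<^esub> \<ominus>\<^bsub>MA\<^esub> lmul a) [^]\<^bsub>MA\<^esub> (n::nat)" for n
  have pow [simp]: "(\<one>\<^bsub>MA\<^esub> \<ominus>\<^bsub>MA\<^esub> lmul a) [^]\<^bsub>MA\<^esub> (n::nat) \<in> carrier MA" for n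
    by (rule MA.mon.nat_pow_closed) (rule MA.diff_closed[OF MA.one_closed lmul_closed[OF a(1)]])
  have [simp]: "v n \<in> carrier MA" for n
    unfolding v_def by (rule MA.mult_closed) (simp_all only: pow MA.npos_closed[OF s(1)])
  have "invol MA s = s" using MA.sa_invol[OF MA.npos_sa[OF s(1)]] .
  then have v0: "(\<lambda>n. cnorm MA (v n)) \<longlonglongrightarrow> 0"
    unfolding v_def
    by (intro MA.mult_tail_tendsto_zero la MA.npos_closed s(1))
      (simp_all only: lmul_norm a s(2) MA.diff_self lmul_closed MA.npos_zero)
  have "\<exists>c\<in>carrier A. s \<ominus>\<^bsub>MA\<^esub> v n = lmul c" for n
  proof (induction n)
    case 0
    have "s \<ominus>\<^bsub>MA\<^esub> v 0 = lmul \<zero>"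
      using MA.one_right[of s] MA.diff_self[of s] linear_map_zero[OF cvec_axioms MA.cvec_axioms lmul_linear]
      by (simp only: v_def monoid.nat_pow_0[OF MA.mon.monoid_axioms] MA.npos_closed[OF s(1)])
    then show ?case by auto
  next
    case (Suc n)
    then obtain c where c: "c \<in> carrier A" "s \<ominus>\<^bsub>MA\<^esub> v n = lmul c" by blast
    have "v (Suc n) = v n \<otimes>\<^bsub>MA\<^esub> (\<one>\<^bsub>MA\<^esub> \<ominus>\<^bsub>MA\<^esub> lmul a)"
      unfolding v_def MA.mon.nat_pow_Suc
      by (rule MA.mult_assoc[symmetric]) (rule MA.npos_closed[OF s(1)] pow MA.diff_closed MA.one_closed lmul_closed a)+
    also have "\<dots> = v n \<ominus>\<^bsub>MA\<^esub> lmul (v n a)"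
      using MA.mult_diff_right[of "v n" "\<one>\<^bsub>MA\<^esub>" "lmul a"] MA.one_right[of "v n"] lmul_ideal[of "v n" a] MA.one_closed
      by (simp only: \<open>\<And>n. v n \<in> carrier MA\<close> lmul_closed a(1))
    finally have v: "v (Suc n) = v n \<ominus>\<^bsub>MA\<^esub> lmul (v n a)" .
    have va: "v n a \<in> carrier A" using S.Ba_closed[of "v n" a] \<open>v n \<in> carrier MA\<close> by (simp add: Ba_simps)
    have "s \<ominus>\<^bsub>MA\<^esub> v (Suc n) = (s \<ominus>\<^bsub>MA\<^esub> v n) \<oplus>\<^bsub>MA\<^esub> lmul (v n a)"
      unfolding v using lmul_closed[OF va] MA.npos_closed[OF s(1)] \<open>v n \<in> carrier MA\<close>
      by - (rule MA.lin_eqI, (rule MA.lin | assumption | (simp add: lookup_add algebra_simps; fail))+)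
    also have "\<dots> = lmul (c \<oplus> v n a)" unfolding c(2) by (rule lmul_hom(2)[symmetric]) (rule c va)+
    finally show ?case using c va by blast
  qed
  then obtain c where c: "\<And>n. c n \<in> carrier A" "\<And>n. s \<ominus>\<^bsub>MA\<^esub> v n = lmul (c n)" by metis
  have conv: "MA.conv (\<lambda>n. lmul (c n)) s"
  proof (rule MA.convI[OF _ _ _ v0])
    fix n
    have "lmul (c n) \<ominus>\<^bsub>MA\<^esub> s = (-1) \<odot>\<^bsub>MA\<^esub> v n"
      unfolding c(2)[symmetric] using MA.npos_closed[OF s(1)] \<open>v n \<in> carrier MA\<close>
      by - (rule MA.lin_eqI, (rule MA.lin | assumption | (simp add: lookup_add algebra_simps; fail))+)
    then show "cnorm MA (lmul (c n) \<ominus>\<^bsub>MA\<^esub> s) \<le> cnorm MA (v n)"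
      using MA.norm_scale[of "v n" "-1"] \<open>v n \<in> carrier MA\<close> by simp
  qed (rule lmul_closed[OF c(1)], rule MA.npos_closed[OF s(1)])
  have "c \<in> cauchy_seqs A (cnorm A)"
    by (rule cauchy_dominated[OF MA.conv_imp_cauchy[OF conv], of _ 1])
      (simp_all add: c(1) lmul_norm flip: lmul_diff)
  then obtain x where x: "conv c x" by (rule cauchy_convergent)
  have "lmul x = s" by (rule MA.conv_unique[OF lmul_conv[OF x] conv])
  with tendsD(2)[OF x] show thesis by (rule that)
qed

text \<open>
  Positivity in the algebra is positivity in the multiplier algebra, where the norm criterion is at hand.
\<close>

lemma cstar_pos_iff: "a \<in> carrier A \<Longrightarrow> cstar_pos A a \<longleftrightarrow> MA.npos (lmul a)"
proof
  assume a: "a \<in> carrier A" and "MA.npos (lmul a)"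
  define r where "r = cnorm A a + 1"
  have r: "r > 0" using cnorm_nonneg[OF a] by (simp add: r_def)
  define b where "b = complex_of_real (1/r) \<odot> a"
  have b: "b \<in> carrier A" "cnorm A b \<le> 1"
    using a r cnorm_nonneg[OF a] by (simp_all add: b_def norm_scale norm_divide) (simp add: r_def)
  have "MA.npos (lmul b)"
    using MA.npos_scale[OF \<open>MA.npos (lmul a)\<close>, of "1/r"] r lmul_scale[OF a, of "complex_of_real (1/r)"]
    by (simp only: b_def) simp
  then obtain s where s: "MA.npos s" "s \<otimes>\<^bsub>MA\<^esub> s = lmul b" by (rule MA.npos_sqrt)
  obtain c where c: "c \<in> carrier A" "lmul c = s" using lmul_sqrt_range[OF b s] .
  have "lmul (invol A c \<otimes> c) = invol MA s \<otimes>\<^bsub>MA\<^esub> s"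
    unfolding c(2)[symmetric] using lmul_hom(1)[of "invol A c" c] lmul_invol[of c] c(1)
    by (simp only: invol_closed)
  also have "\<dots> = lmul b" unfolding MA.sa_invol[OF MA.npos_sa[OF s(1)]] s(2) ..
  finally have cb: "invol A c \<otimes> c = b" using lmul_inj b c by simp
  have "invol A (complex_of_real (sqrt r) \<odot> c) \<otimes> (complex_of_real (sqrt r) \<odot> c)
      = (complex_of_real (sqrt r) * complex_of_real (sqrt r)) \<odot> b"
    using c(1) cb b(1) by (simp add: invol_smult expand scale_scale)
  also have "complex_of_real (sqrt r) * complex_of_real (sqrt r) = complex_of_real r"
    using r by (metis of_real_mult real_sqrt_mult_self abs_of_pos)
  also have "complex_of_real r \<odot> b = a"
    using r a by (simp add: b_def scale_scale flip: of_real_mult)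
  finally show "cstar_pos A a"
    unfolding cstar_pos_def using c(1) by (intro bexI[of _ "complex_of_real (sqrt r) \<odot> c"]) simp_all
next
  assume a: "a \<in> carrier A" and "cstar_pos A a"
  then obtain c where c: "c \<in> carrier A" "a = invol A c \<otimes> c" by (auto simp: cstar_pos_def)
  have "lmul a = invol MA (lmul c) \<otimes>\<^bsub>MA\<^esub> lmul c"
    unfolding c(2) using lmul_hom(1)[of "invol A c" c] lmul_invol[of c] c(1)
    by (simp only: invol_closed)
  then show "MA.npos (lmul a)" using MA.npos_invol_mult[OF lmul_closed[OF c(1)]] by simp
qed

lemma cstar_pos_closed: "cstar_pos A a \<Longrightarrow> a \<in> carrier A"
  by (auto simp: cstar_pos_def)

lemma cstar_pos_add: "cstar_pos A a \<Longrightarrow> cstar_pos A b \<Longrightarrow> cstar_pos A (a \<oplus> b)"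
  using MA.npos_add[of "lmul a" "lmul b"] cstar_pos_closed[of a] cstar_pos_closed[of b]
    lmul_hom(2)[of a b] by (simp only: cstar_pos_iff M.a_closed)

lemma cstar_pos_zero: "cstar_pos A \<zero>"
  by (auto simp: cstar_pos_def intro!: bexI[of _ "\<zero>"])

lemma cstar_pos_invol_mult: "c \<in> carrier A \<Longrightarrow> cstar_pos A (invol A c \<otimes> c)"
  by (auto simp: cstar_pos_def)

lemma cstar_pos_finsum:
  assumes "finite K" "\<And>i. i \<in> K \<Longrightarrow> cstar_pos A (f i)"
  shows "cstar_pos A (\<Oplus>i\<in>K. f i)"
  using assms
proof (induction K rule: finite_induct)
  case (insert i K)
  then have "(\<Oplus>i\<in>insert i K. f i) = f i \<oplus> (\<Oplus>i\<in>K. f i)"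
    by (intro M.finsum_insert) (auto simp: cstar_pos_closed)
  with insert show ?case by (simp add: cstar_pos_add)
qed (simp add: cstar_pos_zero)

lemma cstar_pos_limit:
  assumes "conv s x" "\<And>n. cstar_pos A (s n)"
  shows "cstar_pos A x"
  using MA.npos_limit[OF lmul_conv[OF assms(1)]] tendsD(2)[OF assms(1)] assms(2)
    cstar_pos_iff cstar_pos_closed by blast

lemma cstar_pos_norm_mono:
  assumes "cstar_pos A a" "cstar_pos A b"
  shows "cnorm A a \<le> cnorm A (a \<oplus> b)"
proof -
  note [simp] = cstar_pos_closed[OF assms(1)] cstar_pos_closed[OF assms(2)]
  have "cnorm MA (lmul a) \<le> cnorm MA (lmul a \<oplus>\<^bsub>MA\<^esub> lmul b)"
    using assms cstar_pos_iff by (intro MA.norm_mono) (blast intro: cstar_pos_closed)+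
  also have "lmul a \<oplus>\<^bsub>MA\<^esub> lmul b = lmul (a \<oplus> b)"
    using lmul_hom(2)[of a b] cstar_pos_closed[OF assms(1)] cstar_pos_closed[OF assms(2)] by simp
  finally show ?thesis using lmul_norm[of a] lmul_norm[of "a \<oplus> b"] by simp
qed

lemma cstar_pos_sa: "cstar_pos A a \<Longrightarrow> sa a"
  by (auto simp: cstar_pos_def intro: sa_invol_mult)

end

section \<open>The Cauchy-Schwarz inequality\<close>

context semi_hilbert
begin

text \<open>
  For \<open>a = \<langle>x, y\<rangle>\<close> the difference \<open>\<langle>y, y\<rangle> - a\<^sup>*a\<close> is the sum of \<open>\<langle>xa - y, xa - y\<rangle>\<close> and
  \<open>a\<^sup>*(1 - \<langle>x, x\<rangle>)a\<close>, where \<open>1 - \<langle>x, x\<rangle> = (1 - w)\<^sup>2\<close>.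
\<close>

lemma cauchy_schwarz_unit:
  assumes [simp]: "x \<in> carrier E" "y \<in> carrier E" and x1: "hnorm B E x \<le> 1"
  shows "cnorm B (ip E x y) \<le> hnorm B E y"
proof -
  define a where "a = ip E x y"
  define p where "p = ip E x x"
  have [simp]: "a \<in> carrier B" "p \<in> carrier B" by (simp_all add: a_def p_def)
  have a': "ip E y x = invol B a" by (simp add: a_def ip_invol)
  have "B.sa p" by (simp add: B.sa_def p_def ip_invol)
  moreover have "cnorm B p \<le> 1"
    using x1 hnorm_square[of x] power_le_one[of "hnorm B E x" 2] by (simp add: p_def)
  ultimately obtain w where w: "B.sa w" "2 \<odot>\<^bsub>B\<^esub> w = p \<oplus>\<^bsub>B\<^esub> w \<otimes>\<^bsub>B\<^esub> w"
    using B.sqrt_of_one_minus by metis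
  have [simp]: "w \<in> carrier B" using w by simp
  have pw: "p = 2 \<odot>\<^bsub>B\<^esub> w \<ominus>\<^bsub>B\<^esub> w \<otimes>\<^bsub>B\<^esub> w"
    unfolding w(2) by (rule B.lin_eqI, (rule B.lin | simp add: lookup_add algebra_simps)+)
  define d where "d = a \<ominus>\<^bsub>B\<^esub> w \<otimes>\<^bsub>B\<^esub> a"
  define z where "z = ract E x a \<ominus>\<^bsub>E\<^esub> y"
  have [simp]: "z \<in> carrier E" "d \<in> carrier B" by (simp_all add: z_def d_def)
  have dd: "invol B d \<otimes>\<^bsub>B\<^esub> d = invol B a \<otimes>\<^bsub>B\<^esub> a \<ominus>\<^bsub>B\<^esub> invol B a \<otimes>\<^bsub>B\<^esub> (p \<otimes>\<^bsub>B\<^esub> a)"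
    unfolding d_def pw
    by (simp add: B.invol_diff B.invol_mult B.sa_invol[OF w(1)] B.expand B.mult_assoc)
      (rule B.lin_eqI, (rule B.lin | simp add: lookup_add algebra_simps)+)
  have zz: "ip E z z = ((invol B a \<otimes>\<^bsub>B\<^esub> (p \<otimes>\<^bsub>B\<^esub> a) \<ominus>\<^bsub>B\<^esub> invol B a \<otimes>\<^bsub>B\<^esub> a) \<ominus>\<^bsub>B\<^esub> invol B a \<otimes>\<^bsub>B\<^esub> a) \<oplus>\<^bsub>B\<^esub> ip E y y"
    by (simp add: z_def ip_expand a' B.expand B.mult_assoc flip: p_def a_def)
      (rule B.lin_eqI, (rule B.lin | simp add: lookup_add algebra_simps)+)
  have "ip E y y = invol B a \<otimes>\<^bsub>B\<^esub> a \<oplus>\<^bsub>B\<^esub> (ip E z z \<oplus>\<^bsub>B\<^esub> invol B d \<otimes>\<^bsub>B\<^esub> d)"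
    unfolding dd zz by (rule B.lin_eqI, (rule B.lin | simp add: lookup_add algebra_simps)+)
  then have "cnorm B (invol B a \<otimes>\<^bsub>B\<^esub> a) \<le> cnorm B (ip E y y)"
    using B.cstar_pos_norm_mono[of "invol B a \<otimes>\<^bsub>B\<^esub> a" "ip E z z \<oplus>\<^bsub>B\<^esub> invol B d \<otimes>\<^bsub>B\<^esub> d"]
    by (simp add: B.cstar_pos_add B.cstar_pos_invol_mult ip_pos)
  then have "(cnorm B a)\<^sup>2 \<le> (hnorm B E y)\<^sup>2"
    by (simp add: B.cstar_identity hnorm_square)
  then show ?thesis unfolding a_def by (rule power2_le_imp_le) simp
qed

lemma cauchy_schwarz_ineq:
  assumes [simp]: "x \<in> carrier E" "y \<in> carrier E"
  shows "cnorm B (ip E x y) \<le> hnorm B E x * hnorm B E y"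
proof -
  have le: "cnorm B (ip E x y) \<le> t * hnorm B E y" if t: "t > 0" "hnorm B E x \<le> t" for t
  proof -
    define z where "z = complex_of_real (1/t) \<odot>\<^bsub>E\<^esub> x"
    have [simp]: "z \<in> carrier E" by (simp add: z_def)
    have "ip E z z = complex_of_real (1/t * (1/t)) \<odot>\<^bsub>B\<^esub> ip E x x"
      by (simp add: z_def ip_expand B.scale_scale)
    then have "cnorm B (ip E z z) = 1/t * (1/t) * cnorm B (ip E x x)"
      using t by (simp only: B.norm_scale ip_closed assms norm_of_real) simp
    then have "(hnorm B E z)\<^sup>2 = (hnorm B E x / t)\<^sup>2"
      by (simp only: hnorm_square assms \<open>z \<in> carrier E\<close> power_divide) (simp add: power2_eq_square)
    then have "hnorm B E z = hnorm B E x / t"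
      by (rule power2_eq_imp_eq) (use t in simp_all)
    then have "cnorm B (ip E z y) \<le> hnorm B E y"
      using t by (intro cauchy_schwarz_unit) simp_all
    then show ?thesis
      using t by (simp add: z_def ip_smult_left B.norm_scale norm_divide field_simps)
  qed
  show ?thesis
  proof (rule field_le_epsilon)
    fix e :: real assume e: "e > 0"
    define t where "t = hnorm B E x + e / (hnorm B E y + 1)"
    have pos: "hnorm B E y + 1 > 0" using hnorm_nonneg[of y] by (simp add: add_nonneg_pos)
    then have "e / (hnorm B E y + 1) > 0" using e by simp
    then have "cnorm B (ip E x y) \<le> t * hnorm B E y"
      by (intro le) (simp_all add: t_def add_nonneg_pos)
    also have "\<dots> = hnorm B E x * hnorm B E y + e * (hnorm B E y / (hnorm B E y + 1))"
      by (simp add: t_def distrib_right)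
    also have "\<dots> \<le> hnorm B E x * hnorm B E y + e"
      using pos e by (simp add: field_simps)
    finally show "cnorm B (ip E x y) \<le> hnorm B E x * hnorm B E y + e" .
  qed
qed

end

sublocale semi_hilbert \<subseteq> semi_hilbert_cs
  by unfold_locales (rule cauchy_schwarz_ineq)

lemma hilbert_cs_if_hilbert_module:
  assumes "hilbert_module B E"
  shows "hilbert_cs B E"
proof -
  interpret hilbert_module B E by fact
  have "semi_hilbert B E"
    by (intro semi_hilbert.intro semi_hilbert_axioms.intro B.cstar_algebra_axioms)
      (simp_all add: cvec_def E.module_axioms ract_closed ip_closed ip_add ip_smult ip_ract ip_invol ip_pos)
  then interpret semi_hilbert B E .
  show ?thesis
    by unfold_locales (use ip_definite complete in auto)
qed

context hilbert_cs
begin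

lemma hilbert_module: "hilbert_module B E"
proof (intro hilbert_module.intro hilbert_module_axioms.intro B.cstar_algebra_axioms)
  show "Module.module complex_field E" using E.cvec_axioms by (simp add: cvec_def)
  show "norm_complete E (hnorm B E)" by (rule norm_complete)
  show "x = \<zero>\<^bsub>E\<^esub>" if "x \<in> carrier E" "ip E x x = \<zero>\<^bsub>B\<^esub>" for x
    using that by (rule ip_definite)
qed (auto simp: ip_expand B.expand ip_invol ip_pos B.mult_assoc intro!: ip_eqI)

text \<open>
  Applying \<open>z \<mapsto> z (1 - b)\<close> \<open>n\<close> times turns \<open>\<langle>z, z\<rangle>\<close> into \<open>(1 - b)\<^sup>n \<langle>z, z\<rangle> (1 - b)\<^sup>n\<close>, which is dominated by
  \<open>(1 - b)\<^sup>n b (1 - b)\<^sup>n\<close>.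
\<close>

lemma module_tail_tendsto_zero:
  assumes b: "cstar_pos B b" "cnorm B b \<le> 1" and z: "z \<in> carrier E"
    and le: "cstar_pos B (b \<ominus>\<^bsub>B\<^esub> ip E z z)"
  shows "(\<lambda>n. hnorm B E (((\<lambda>v. v \<ominus>\<^bsub>E\<^esub> ract E v b) ^^ n) z)) \<longlonglongrightarrow> 0"
proof -
  interpret M: unital_cstar B.MA
    by (rule hilbert_cs.Ba_unital_cstar[OF B.self_hilbert])
  have bB: "b \<in> carrier B" "B.sa b" using b B.cstar_pos_closed B.cstar_pos_sa by auto
  define D where "D = (\<lambda>v. v \<ominus>\<^bsub>E\<^esub> ract E v b)"
  define L where "L = B.lmul"
  have Dn: "(D ^^ n) z \<in> carrier E" for n
    by (induction n) (use z bB in \<open>simp_all add: D_def\<close>)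
  have L: "L a \<in> carrier B.MA" if "a \<in> carrier B" for a using that by (simp only: L_def B.lmul_closed)
  have pb: "M.npos (L b)" "M.npos (L b \<ominus>\<^bsub>B.MA\<^esub> L (ip E z z))" "M.npos (L (ip E z z))"
    using b(1) le ip_pos[OF z] bB z B.cstar_pos_iff B.lmul_diff[of b "ip E z z"]
    unfolding L_def by (metis B.diff_closed ip_closed)+
  obtain h where h: "M.npos h" "h \<otimes>\<^bsub>B.MA\<^esub> h = L (ip E z z)" using M.npos_sqrt[OF pb(3)] by metis
  define c where "c = \<one>\<^bsub>B.MA\<^esub> \<ominus>\<^bsub>B.MA\<^esub> L b"
  have c: "M.sa c"
    unfolding c_def by (rule M.sa_diff[OF M.sa_one M.npos_sa[OF pb(1)]])
  note cC = M.sa_closed[OF c] and hC = M.npos_closed[OF h(1)]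
  have pow: "c [^]\<^bsub>B.MA\<^esub> (n::nat) \<in> carrier B.MA" for n by (rule M.mon.nat_pow_closed[OF cC])
  have step: "L (ip E (D v) (D v)) = c \<otimes>\<^bsub>B.MA\<^esub> (L (ip E v v) \<otimes>\<^bsub>B.MA\<^esub> c)" if v: "v \<in> carrier E" for v
  proof -
    note ips = ip_closed[OF v v] bB(1)
    have "ip E (D v) (D v) = (ip E v v \<ominus>\<^bsub>B\<^esub> b \<otimes>\<^bsub>B\<^esub> ip E v v) \<ominus>\<^bsub>B\<^esub> (ip E v v \<otimes>\<^bsub>B\<^esub> b \<ominus>\<^bsub>B\<^esub> b \<otimes>\<^bsub>B\<^esub> (ip E v v \<otimes>\<^bsub>B\<^esub> b))"
      using v bB by (simp add: D_def ip_expand B.sa_invol B.expand B.mult_assoc)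
    then have "L (ip E (D v) (D v)) = (L (ip E v v) \<ominus>\<^bsub>B.MA\<^esub> L b \<otimes>\<^bsub>B.MA\<^esub> L (ip E v v)) \<ominus>\<^bsub>B.MA\<^esub>
        (L (ip E v v) \<otimes>\<^bsub>B.MA\<^esub> L b \<ominus>\<^bsub>B.MA\<^esub> L b \<otimes>\<^bsub>B.MA\<^esub> (L (ip E v v) \<otimes>\<^bsub>B.MA\<^esub> L b))"
      unfolding L_def by (simp only: B.lmul_diff B.lmul_hom(1) ips B.mult_closed B.diff_closed)
    also have "\<dots> = c \<otimes>\<^bsub>B.MA\<^esub> (L (ip E v v) \<otimes>\<^bsub>B.MA\<^esub> c)"
      unfolding c_def
      by (simp only: M.mult_diff_left M.mult_diff_right M.one_left M.one_right M.one_closed M.mult_closed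
          M.diff_closed L ips)
    finally show ?thesis .
  qed
  have main: "L (ip E ((D ^^ n) z) ((D ^^ n) z)) = invol B.MA (h \<otimes>\<^bsub>B.MA\<^esub> c [^]\<^bsub>B.MA\<^esub> n) \<otimes>\<^bsub>B.MA\<^esub> (h \<otimes>\<^bsub>B.MA\<^esub> c [^]\<^bsub>B.MA\<^esub> n)" for n
  proof (induction n)
    case 0
    show ?case
      using h(2) M.sa_invol[OF M.npos_sa[OF h(1)]] M.one_right[OF hC] by (simp only: funpow_0 M.mon.nat_pow_0)
  next
    case (Suc n)
    let ?u = "h \<otimes>\<^bsub>B.MA\<^esub> c [^]\<^bsub>B.MA\<^esub> n"
    have u: "?u \<in> carrier B.MA" by (rule M.mult_closed[OF hC pow])
    have "L (ip E ((D ^^ Suc n) z) ((D ^^ Suc n) z)) = c \<otimes>\<^bsub>B.MA\<^esub> ((invol B.MA ?u \<otimes>\<^bsub>B.MA\<^esub> ?u) \<otimes>\<^bsub>B.MA\<^esub> c)"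
      using step[OF Dn[of n]] Suc by (simp only: funpow.simps o_apply)
    also have "\<dots> = (c \<otimes>\<^bsub>B.MA\<^esub> invol B.MA ?u) \<otimes>\<^bsub>B.MA\<^esub> (?u \<otimes>\<^bsub>B.MA\<^esub> c)"
      by (simp only: M.mult_assoc M.mult_closed M.invol_closed u cC)
    also have "c \<otimes>\<^bsub>B.MA\<^esub> invol B.MA ?u = invol B.MA (?u \<otimes>\<^bsub>B.MA\<^esub> c)"
      by (simp only: M.invol_mult[OF u cC] M.sa_invol[OF c])
    also have "?u \<otimes>\<^bsub>B.MA\<^esub> c = h \<otimes>\<^bsub>B.MA\<^esub> c [^]\<^bsub>B.MA\<^esub> Suc n"
      by (simp only: M.mult_assoc[OF hC pow cC] M.mon.nat_pow_Suc)
    finally show ?case .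
  qed
  have "(\<lambda>n. cnorm B.MA (h \<otimes>\<^bsub>B.MA\<^esub> c [^]\<^bsub>B.MA\<^esub> (n::nat))) \<longlonglongrightarrow> 0"
    unfolding c_def
  proof (rule M.mult_tail_tendsto_zero[OF pb(1) _ hC])
    show "cnorm B.MA (L b) \<le> 1" using b(2) bB(1) by (simp only: L_def B.lmul_norm)
    show "M.npos (L b \<ominus>\<^bsub>B.MA\<^esub> invol B.MA h \<otimes>\<^bsub>B.MA\<^esub> h)"
      using pb(2) by (simp only: M.sa_invol[OF M.npos_sa[OF h(1)]] h(2))
  qed
  moreover have "cnorm B.MA (h \<otimes>\<^bsub>B.MA\<^esub> c [^]\<^bsub>B.MA\<^esub> n) = hnorm B E ((D ^^ n) z)" for n
  proof -
    have "(cnorm B.MA (h \<otimes>\<^bsub>B.MA\<^esub> c [^]\<^bsub>B.MA\<^esub> n))\<^sup>2 = (hnorm B E ((D ^^ n) z))\<^sup>2"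
      unfolding M.cstar_identity[OF M.mult_closed[OF hC pow], symmetric] main[symmetric]
        hnorm_square[OF Dn] L_def by (rule B.lmul_norm[OF ip_closed[OF Dn Dn]])
    then show ?thesis
      by (rule power2_eq_imp_eq) (rule M.cnorm_nonneg[OF M.mult_closed[OF hC pow]], rule hnorm_nonneg[OF Dn])
  qed
  ultimately show ?thesis by (simp add: D_def)
qed

end

section \<open>Compact operators and approximate units\<close>

lemma (in cstar_algebra) closed_subalgebra:
  assumes S: "subspace_of A S" and mult: "\<And>a b. a \<in> S \<Longrightarrow> b \<in> S \<Longrightarrow> a \<otimes> b \<in> S"
    and star: "\<And>a. a \<in> S \<Longrightarrow> invol A a \<in> S"
    and closed: "\<And>s x. (\<And>n. s n \<in> S) \<Longrightarrow> conv s x \<Longrightarrow> x \<in> S"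
  shows "cstar_algebra (A\<lparr>carrier := S\<rparr>)"
proof -
  have sub: "x \<in> carrier A" if "x \<in> S" for x using S that by (auto simp: subspace_of_def)
  have S0: "\<zero> \<in> S" and Sadd: "\<And>x y. x \<in> S \<Longrightarrow> y \<in> S \<Longrightarrow> x \<oplus> y \<in> S"
    and Sscale: "\<And>c x. x \<in> S \<Longrightarrow> c \<odot> x \<in> S"
    using S by (auto simp: subspace_of_def)
  have mod: "Module.module complex_field (A\<lparr>carrier := S\<rparr>)"
  proof (rule moduleI[OF cring_complex_field])
    show "abelian_group (A\<lparr>carrier := S\<rparr>)"
    proof (rule abelian_groupI)
      fix x assume "x \<in> carrier (A\<lparr>carrier := S\<rparr>)"
      then show "\<exists>y\<in>carrier (A\<lparr>carrier := S\<rparr>). y \<oplus>\<^bsub>A\<lparr>carrier := S\<rparr>\<^esub> x = \<zero>\<^bsub>A\<lparr>carrier := S\<rparr>\<^esub>"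
        using Sscale[of x "-1"] sub[of x]
        by (intro bexI[of _ "(-1) \<odot> x"]) (simp_all add: M.l_neg flip: uminus_eq_scale)
    qed (auto simp: S0 Sadd sub M.a_ac)
  qed (auto simp: Sscale sub scale_add_left scale_add_right scale_scale)
  then interpret S: cvec "A\<lparr>carrier := S\<rparr>" by (simp add: cvec_def)
  have minus: "x \<ominus>\<^bsub>A\<lparr>carrier := S\<rparr>\<^esub> y = x \<ominus> y" if "x \<in> S" "y \<in> S" for x y
    using S.diff_eq_scale[of x y] diff_eq_scale[of x y] that sub by simp
  show ?thesis
  proof (intro cstar_algebra.intro cstar_algebra_axioms.intro mod)
    show "norm_complete (A\<lparr>carrier := S\<rparr>) (cnorm (A\<lparr>carrier := S\<rparr>))"
      unfolding norm_complete_def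
    proof
      fix s assume s: "s \<in> cauchy_seqs (A\<lparr>carrier := S\<rparr>) (cnorm (A\<lparr>carrier := S\<rparr>))"
      then have sS: "s n \<in> S" for n by (simp add: cauchy_seqs_def)
      have "s \<in> cauchy_seqs A (cnorm A)"
        using s by (simp add: cauchy_seqs_def sS sub minus)
      then obtain x where x: "conv s x" by (rule cauchy_convergent)
      have "x \<in> S" using closed[OF sS x] .
      then show "\<exists>x\<in>carrier (A\<lparr>carrier := S\<rparr>).
          (\<lambda>n. cnorm (A\<lparr>carrier := S\<rparr>) (s n \<ominus>\<^bsub>A\<lparr>carrier := S\<rparr>\<^esub> x)) \<longlonglongrightarrow> 0"
        using tendsD(3)[OF x] by (intro bexI[of _ x]) (simp_all add: minus sS)
    qed
  qed (auto simp: mult star sub mult_assoc mult_l_distr mult_r_distr mult_smult_l mult_smult_r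
      invol_add invol_smult invol_mult cnorm_nonneg cnorm_triangle cnorm_smult cnorm_mult cstar_identity
      cnorm_eq_0)
qed

text \<open>
  The element is \<open>d = 1 - (1 - b)\<^sup>n\<close> for large \<open>n\<close>, where \<open>b \<le> 1\<close> is a multiple of \<open>\<Sum> (k\<^sup>*k + k k\<^sup>*)\<close>: up to
  this multiple, \<open>k\<^sup>*k \<le> b\<close> and \<open>k k\<^sup>* \<le> b\<close>, so both \<open>k (1 - b)\<^sup>n\<close> and \<open>(1 - b)\<^sup>n k\<close> tend to zero.  The bound
  \<open>2\<close> is the one for a difference of contractions.
\<close>

lemma (in unital_cstar) ideal_approximate_unit:
  assumes J: "subspace_of A J" "\<And>a k. a \<in> carrier A \<Longrightarrow> k \<in> J \<Longrightarrow> a \<otimes> k \<in> J"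
      "\<And>k. k \<in> J \<Longrightarrow> invol A k \<in> J"
    and K: "finite K" "K \<subseteq> J" and e: "e > (0::real)"
  shows "\<exists>d\<in>J. cnorm A d \<le> 2 \<and>
    (\<forall>k\<in>K. cnorm A ((\<one> \<ominus> d) \<otimes> k) < e \<and> cnorm A (k \<otimes> (\<one> \<ominus> d)) < e)"
proof -
  have Jc: "k \<in> carrier A" if "k \<in> J" for k using that J(1) by (auto simp: subspace_of_def)
  have KJ: "k \<in> J" "k \<in> carrier A" if "k \<in> K" for k using that K Jc by auto
  define q where "q k = invol A k \<otimes> k \<oplus> k \<otimes> invol A k" for k
  have qpos: "cstar_pos A (q k)" if "k \<in> K" for k
    using KJ[OF that] cstar_pos_invol_mult[of "invol A k"]
    unfolding q_def by (intro cstar_pos_add cstar_pos_invol_mult) simp_all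
  define Q where "Q = (\<Oplus>k\<in>K. q k)"
  have Q: "cstar_pos A Q" unfolding Q_def by (rule cstar_pos_finsum[OF K(1) qpos])
  have QJ: "Q \<in> J"
    unfolding Q_def
  proof (rule subspace_finsum[OF J(1) K(1)])
    fix k assume k: "k \<in> K"
    have "invol A k \<otimes> k \<in> J" "k \<otimes> invol A k \<in> J"
      using J(2)[OF _ KJ(1)[OF k]] J(2)[OF _ J(3)[OF KJ(1)[OF k]]] KJ(2)[OF k] by simp_all
    then show "q k \<in> J" using J(1) by (simp add: q_def subspace_of_def)
  qed
  note [simp] = cstar_pos_closed[OF Q]
  define r where "r = cnorm A Q + 1"
  have r: "r > 0" using cnorm_nonneg[OF cstar_pos_closed[OF Q]] unfolding r_def by linarith
  define b where "b = complex_of_real (1/r) \<odot> Q"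
  have b: "npos b" unfolding b_def using r Q by (intro npos_scale) (simp_all add: cstar_pos_iff_npos)
  have b1: "cnorm A b \<le> 1"
    using r cnorm_nonneg[of Q] by (simp add: b_def norm_scale norm_divide) (simp add: r_def)
  have bJ: "b \<in> J" using QJ J(1) by (simp add: b_def subspace_of_def)
  note [simp] = npos_closed[OF b]
  define c where "c n = (\<one> \<ominus> b) [^] (n::nat)" for n
  have c [simp]: "c n \<in> carrier A" and csa: "sa (c n)" and c1: "cnorm A (c n) \<le> 1" for n
    using one_minus_power[OF b b1] by (simp_all add: c_def)
  define s where "s = complex_of_real (1 / sqrt r)"
  have ss: "cnj s * s = complex_of_real (1/r)" "s \<noteq> 0"
    using r by (simp_all add: s_def flip: of_real_mult)
  have tail: "(\<lambda>n. cnorm A (y \<otimes> c n)) \<longlonglongrightarrow> 0"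
    if y [simp]: "y \<in> carrier A" and pos: "cstar_pos A p" and Qy: "Q = invol A y \<otimes> y \<oplus> p" for y p
  proof -
    note [simp] = cstar_pos_closed[OF pos]
    have "b \<ominus> invol A (s \<odot> y) \<otimes> (s \<odot> y) = complex_of_real (1/r) \<odot> p"
    proof -
      have "invol A (s \<odot> y) \<otimes> (s \<odot> y) = complex_of_real (1/r) \<odot> (invol A y \<otimes> y)"
        by (simp add: invol_smult expand scale_scale mult.commute[of s] ss(1))
      then show ?thesis unfolding b_def Qy by (simp only:) (rule lin_eqI, (rule lin | simp add: lookup_add algebra_simps)+)
    qed
    then have "npos (b \<ominus> invol A (s \<odot> y) \<otimes> (s \<odot> y))"
      using npos_scale[of p "1/r"] pos r by (simp add: cstar_pos_iff_npos)
    then have "(\<lambda>n. cnorm A ((s \<odot> y) \<otimes> c n)) \<longlonglongrightarrow> 0"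
      unfolding c_def by (intro mult_tail_tendsto_zero b b1) simp_all
    then have "(\<lambda>n. cmod s * cnorm A (y \<otimes> c n)) \<longlonglongrightarrow> 0"
      by (simp add: mult_smult_l norm_scale)
    then have "(\<lambda>n. inverse (cmod s) * (cmod s * cnorm A (y \<otimes> c n))) \<longlonglongrightarrow> 0"
      by (rule tendsto_mult_right_zero)
    then show ?thesis using ss(2) by (simp flip: mult.assoc)
  qed
  have "\<forall>\<^sub>F n in sequentially. \<forall>k\<in>K. cnorm A (k \<otimes> c n) < e \<and> cnorm A (invol A k \<otimes> c n) < e"
  proof (rule eventually_ball_finite[OF K(1)], rule ballI)
    fix k assume k: "k \<in> K"
    note [simp] = KJ(2)[OF k]
    define R where "R = (\<Oplus>k\<in>K - {k}. q k)"
    have R: "cstar_pos A R" unfolding R_def using K(1) qpos by (intro cstar_pos_finsum) auto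
    note [simp] = cstar_pos_closed[OF R]
    have "K = insert k (K - {k})" using k by auto
    then have "Q = (\<Oplus>k\<in>insert k (K - {k}). q k)" by (simp add: Q_def)
    also have "\<dots> = q k \<oplus> R"
      unfolding R_def using K(1) qpos cstar_pos_closed k by (intro M.finsum_insert) auto
    finally have Qk: "Q = q k \<oplus> R" .
    have "(\<lambda>n. cnorm A (k \<otimes> c n)) \<longlonglongrightarrow> 0"
    proof (rule tail)
      show "cstar_pos A (k \<otimes> invol A k \<oplus> R)"
        using cstar_pos_invol_mult[of "invol A k"] R by (intro cstar_pos_add) simp_all
      show "Q = invol A k \<otimes> k \<oplus> (k \<otimes> invol A k \<oplus> R)"
        unfolding Qk q_def by (rule lin_eqI, (rule lin | simp add: lookup_add algebra_simps)+)
    qed simp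
    moreover have "(\<lambda>n. cnorm A (invol A k \<otimes> c n)) \<longlonglongrightarrow> 0"
    proof (rule tail)
      show "cstar_pos A (invol A k \<otimes> k \<oplus> R)"
        by (intro cstar_pos_add cstar_pos_invol_mult R) simp_all
      show "Q = invol A (invol A k) \<otimes> invol A k \<oplus> (invol A k \<otimes> k \<oplus> R)"
        unfolding Qk q_def invol_invol[OF KJ(2)[OF k]] by (rule lin_eqI, (rule lin | simp add: lookup_add algebra_simps)+)
    qed simp
    ultimately show "\<forall>\<^sub>F n in sequentially. cnorm A (k \<otimes> c n) < e \<and> cnorm A (invol A k \<otimes> c n) < e"
      by (intro eventually_conj order_tendstoD(2)[OF _ e])
  qed
  from eventually_happens'[OF sequentially_bot this]
  obtain n where "\<forall>k\<in>K. cnorm A (k \<otimes> c n) < e \<and> cnorm A (invol A k \<otimes> c n) < e"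
    by (elim exE)
  then have n: "cnorm A (k \<otimes> c n) < e" "cnorm A (invol A k \<otimes> c n) < e" if "k \<in> K" for k
    using that by simp_all
  define d where "d = \<one> \<ominus> c n"
  have d: "\<one> \<ominus> d = c n" unfolding d_def by (rule lin_eqI, (rule lin | simp add: lookup_add algebra_simps)+)
  have "\<one> \<ominus> c m \<in> J" for m
  proof (induction m)
    case (Suc m)
    have "\<one> \<ominus> c (Suc m) = (\<one> \<ominus> c m) \<oplus> c m \<otimes> b"
      by (simp add: c_def expand) (rule lin_eqI, (rule lin | simp add: lookup_add algebra_simps)+)
    then show ?case using Suc J(2)[OF c bJ] J(1) by (simp add: subspace_of_def)
  qed (use J(1) in \<open>simp add: c_def subspace_of_def\<close>)
  then have "d \<in> J" by (simp add: d_def)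
  moreover have "cnorm A d \<le> 2"
    using norm_diff_triangle[of \<one> "c n"] norm_one_le c1[of n] by (simp add: d_def)
  moreover have "cnorm A ((\<one> \<ominus> d) \<otimes> k) < e" if "k \<in> K" for k
  proof -
    have "invol A (invol A k \<otimes> c n) = c n \<otimes> k"
      using KJ[OF that] csa[of n] by (simp add: invol_mult sa_invol)
    then have "cnorm A (c n \<otimes> k) = cnorm A (invol A k \<otimes> c n)"
      using cnorm_invol[of "invol A k \<otimes> c n"] KJ[OF that] by simp
    then show ?thesis using n[OF that] by (simp add: d)
  qed
  moreover have "cnorm A (k \<otimes> (\<one> \<ominus> d)) < e" if "k \<in> K" for k
    using n[OF that] by (simp add: d)
  ultimately show ?thesis by blast
qed

context hilbert_cs
begin

interpretation Ba: unital_cstar "Ba B E"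
  by (rule Ba_unital_cstar)

lemma rank_one_adj:
  assumes "x \<in> carrier E" "y \<in> carrier E"
  shows "rank_one E x y \<in> adjointable E E" "hm_adjoint E E (rank_one E x y) = rank_one E y x"
  unfolding rank_one_def
  using Ba_adjointI[of "\<lambda>z. ract E x (ip E y z)" "\<lambda>z. ract E y (ip E x z)"] assms
  by (simp_all add: ip_expand ip_invol)

lemma rank_one_closed [simp]:
  "x \<in> carrier E \<Longrightarrow> y \<in> carrier E \<Longrightarrow> rank_one E x y \<in> carrier (Ba B E)"
  by (simp add: Ba_simps rank_one_adj)

lemma rank_one_invol: "x \<in> carrier E \<Longrightarrow> y \<in> carrier E \<Longrightarrow> invol (Ba B E) (rank_one E x y) = rank_one E y x"
  by (simp add: Ba_simps rank_one_adj)

lemma Ba_mult_rank_one: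
  assumes "a \<in> carrier (Ba B E)" "x \<in> carrier E" "y \<in> carrier E"
  shows "a \<otimes>\<^bsub>Ba B E\<^esub> rank_one E x y = rank_one E (a x) y"
  using assms Ba_ract[of a x] by (auto simp: Ba_simps rank_one_def fun_eq_iff compose_def)

lemma ract_laws:
  "\<lbrakk>x \<in> carrier E; b \<in> carrier B; b' \<in> carrier B\<rbrakk> \<Longrightarrow> ract E x (b \<oplus>\<^bsub>B\<^esub> b') = ract E x b \<oplus>\<^bsub>E\<^esub> ract E x b'"
  "\<lbrakk>x \<in> carrier E; b \<in> carrier B; b' \<in> carrier B\<rbrakk> \<Longrightarrow> ract E x (b \<ominus>\<^bsub>B\<^esub> b') = ract E x b \<ominus>\<^bsub>E\<^esub> ract E x b'"
  "\<lbrakk>x \<in> carrier E; y \<in> carrier E; b \<in> carrier B\<rbrakk> \<Longrightarrow> ract E (x \<oplus>\<^bsub>E\<^esub> y) b = ract E x b \<oplus>\<^bsub>E\<^esub> ract E y b"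
  "\<lbrakk>x \<in> carrier E; y \<in> carrier E; b \<in> carrier B\<rbrakk> \<Longrightarrow> ract E (x \<ominus>\<^bsub>E\<^esub> y) b = ract E x b \<ominus>\<^bsub>E\<^esub> ract E y b"
  "\<lbrakk>x \<in> carrier E; b \<in> carrier B; b' \<in> carrier B\<rbrakk> \<Longrightarrow> ract E x (b \<otimes>\<^bsub>B\<^esub> b') = ract E (ract E x b) b'"
  "\<lbrakk>x \<in> carrier E; b \<in> carrier B\<rbrakk> \<Longrightarrow> ract E (z \<odot>\<^bsub>E\<^esub> x) b = z \<odot>\<^bsub>E\<^esub> ract E x b"
  "\<lbrakk>x \<in> carrier E; b \<in> carrier B\<rbrakk> \<Longrightarrow> ract E x (z \<odot>\<^bsub>B\<^esub> b) = z \<odot>\<^bsub>E\<^esub> ract E x b"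
  by (rule ip_eqI; simp add: ip_expand B.expand B.mult_assoc)+

lemma rank_one_linear:
  assumes "x \<in> carrier E" "x' \<in> carrier E" "y \<in> carrier E"
  shows "rank_one E (x \<oplus>\<^bsub>E\<^esub> x') y = rank_one E x y \<oplus>\<^bsub>Ba B E\<^esub> rank_one E x' y"
    and "rank_one E (x \<ominus>\<^bsub>E\<^esub> x') y = rank_one E x y \<ominus>\<^bsub>Ba B E\<^esub> rank_one E x' y"
    and "rank_one E y (x \<ominus>\<^bsub>E\<^esub> x') = rank_one E y x \<ominus>\<^bsub>Ba B E\<^esub> rank_one E y x'"
  using assms rank_one_adj Ba_diff
  by (auto simp: rank_one_def fun_eq_iff ract_laws ip_diff_left Ba_simps)

lemma rank_one_scale:
  "x \<in> carrier E \<Longrightarrow> y \<in> carrier E \<Longrightarrow> rank_one E (c \<odot>\<^bsub>E\<^esub> x) y = c \<odot>\<^bsub>Ba B E\<^esub> rank_one E x y"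
  by (auto simp: rank_one_def fun_eq_iff ract_laws Ba_simps)

lemma rank_one_ract:
  assumes "x \<in> carrier E" "y \<in> carrier E" "b \<in> carrier B"
  shows "rank_one E x (ract E y b) = rank_one E (ract E x (invol B b)) y"
  using assms by (auto simp: rank_one_def fun_eq_iff ip_ract_left ract_laws)

lemma opn_rank_one:
  assumes "x \<in> carrier E" "y \<in> carrier E"
  shows "opn (rank_one E x y) \<le> hnorm B E x * hnorm B E y"
proof (rule opn_le)
  fix z assume z: "z \<in> carrier E"
  have "hnorm B E (rank_one E x y z) \<le> hnorm B E x * cnorm B (ip E y z)"
    using assms z by (simp add: rank_one_def hnorm_ract)
  also have "\<dots> \<le> hnorm B E x * (hnorm B E y * hnorm B E z)"
    using assms z by (intro mult_left_mono cauchy_schwarz) simp_all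
  finally show "hnorm B E (rank_one E x y z) \<le> hnorm B E x * hnorm B E y * hnorm B E z"
    by (simp add: mult.assoc)
qed (use assms in simp)

lemma rank_one_set_closed: "{rank_one E x y | x y. x \<in> carrier E \<and> y \<in> carrier E} \<subseteq> carrier (Ba B E)"
  by auto

lemma subspace_finite_rank: "subspace_of (Ba B E) (finite_rank B E)"
  unfolding finite_rank_def by (rule Ba.subspace_lin_span[OF rank_one_set_closed])

lemma rank_one_finite_rank: "x \<in> carrier E \<Longrightarrow> y \<in> carrier E \<Longrightarrow> rank_one E x y \<in> finite_rank B E"
  unfolding finite_rank_def by (rule Ba.lin_span_base[OF rank_one_set_closed]) auto

lemma finite_rank_ideal:
  assumes f: "f \<in> finite_rank B E"
  shows "a \<in> carrier (Ba B E) \<Longrightarrow> a \<otimes>\<^bsub>Ba B E\<^esub> f \<in> finite_rank B E"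
    and "invol (Ba B E) f \<in> finite_rank B E"
proof -
  note S = subspace_finite_rank[unfolded subspace_of_def]
  show "a \<otimes>\<^bsub>Ba B E\<^esub> f \<in> finite_rank B E" if a: "a \<in> carrier (Ba B E)"
  proof -
    let ?W = "{f \<in> carrier (Ba B E). a \<otimes>\<^bsub>Ba B E\<^esub> f \<in> finite_rank B E}"
    have "finite_rank B E \<subseteq> ?W"
      unfolding finite_rank_def[of B E, THEN eq_reflection]
    proof (rule Ba.lin_span_subset)
      show "subspace_of (Ba B E) {f \<in> carrier (Ba B E). a \<otimes>\<^bsub>Ba B E\<^esub> f
          \<in> lin_span (Ba B E) {rank_one E x y |x y. x \<in> carrier E \<and> y \<in> carrier E}}"
        using S a by (auto simp: subspace_of_def Ba.expand finite_rank_def)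
      have "a x \<in> carrier E" if "x \<in> carrier E" for x using that a by (simp add: Ba_simps)
      then show "{rank_one E x y |x y. x \<in> carrier E \<and> y \<in> carrier E} \<subseteq> {f \<in> carrier (Ba B E).
          a \<otimes>\<^bsub>Ba B E\<^esub> f \<in> lin_span (Ba B E) {rank_one E x y |x y. x \<in> carrier E \<and> y \<in> carrier E}}"
        using a rank_one_finite_rank by (auto simp: Ba_mult_rank_one finite_rank_def)
    qed
    with f show ?thesis by auto
  qed
  let ?W = "{f \<in> carrier (Ba B E). invol (Ba B E) f \<in> finite_rank B E}"
  have "finite_rank B E \<subseteq> ?W"
    unfolding finite_rank_def[of B E, THEN eq_reflection]
  proof (rule Ba.lin_span_subset)
    show "subspace_of (Ba B E) {f \<in> carrier (Ba B E). invol (Ba B E) f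
        \<in> lin_span (Ba B E) {rank_one E x y |x y. x \<in> carrier E \<and> y \<in> carrier E}}"
      using S by (auto simp: subspace_of_def Ba.invol_add Ba.invol_smult finite_rank_def)
    show "{rank_one E x y |x y. x \<in> carrier E \<and> y \<in> carrier E} \<subseteq> {f \<in> carrier (Ba B E).
        invol (Ba B E) f \<in> lin_span (Ba B E) {rank_one E x y |x y. x \<in> carrier E \<and> y \<in> carrier E}}"
      using rank_one_finite_rank by (auto simp: rank_one_invol finite_rank_def)
  qed
  with f show "invol (Ba B E) f \<in> finite_rank B E" by auto
qed

lemma carrier_compacts: "carrier (compacts B E) = norm_closure (Ba B E) opn (finite_rank B E)"
  by (simp add: compacts_def)

lemma finite_rank_subset: "finite_rank B E \<subseteq> carrier (Ba B E)"
  using subspace_finite_rank by (simp add: subspace_of_def)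

lemma subspace_compacts: "subspace_of (Ba B E) (carrier (compacts B E))"
  unfolding carrier_compacts by (rule Ba.subspace_norm_closure[OF subspace_finite_rank])

lemma compacts_limit:
  "(\<And>n. s n \<in> carrier (compacts B E)) \<Longrightarrow> Ba.conv s x \<Longrightarrow> x \<in> carrier (compacts B E)"
  unfolding carrier_compacts by (rule Ba.norm_closure_closed[OF finite_rank_subset])

lemma rank_one_compact: "x \<in> carrier E \<Longrightarrow> y \<in> carrier E \<Longrightarrow> rank_one E x y \<in> carrier (compacts B E)"
  unfolding carrier_compacts using Ba.norm_closure_base[OF finite_rank_subset] rank_one_finite_rank by auto

lemma compacts_ideal:
  assumes f: "f \<in> carrier (compacts B E)"
  shows "a \<in> carrier (Ba B E) \<Longrightarrow> a \<otimes>\<^bsub>Ba B E\<^esub> f \<in> carrier (compacts B E)"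
    and "invol (Ba B E) f \<in> carrier (compacts B E)"
proof -
  obtain s where s: "\<And>n. s n \<in> finite_rank B E" "Ba.conv s f"
    using f Ba.norm_closure_conv[OF finite_rank_subset, of f] unfolding carrier_compacts by auto
  show "a \<otimes>\<^bsub>Ba B E\<^esub> f \<in> carrier (compacts B E)" if a: "a \<in> carrier (Ba B E)"
    unfolding carrier_compacts Ba.norm_closure_conv[OF finite_rank_subset]
    by (rule exI[of _ "\<lambda>n. a \<otimes>\<^bsub>Ba B E\<^esub> s n"])
      (use Ba.conv_mult[OF Ba.conv_const[OF a] s(2)] finite_rank_ideal(1)[OF s(1) a] in simp)
  show "invol (Ba B E) f \<in> carrier (compacts B E)"
    unfolding carrier_compacts Ba.norm_closure_conv[OF finite_rank_subset]
    by (rule exI[of _ "\<lambda>n. invol (Ba B E) (s n)"])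
      (use Ba.conv_invol[OF s(2)] finite_rank_ideal(2)[OF s(1)] in simp)
qed

lemma compacts_closed: "f \<in> carrier (compacts B E) \<Longrightarrow> f \<in> carrier (Ba B E)"
  using subspace_compacts by (auto simp: subspace_of_def)

theorem compacts_cstar: "cstar_algebra (compacts B E)"
proof -
  have "compacts B E = (Ba B E)\<lparr>carrier := carrier (compacts B E)\<rparr>"
    by (simp add: compacts_def)
  moreover have "cstar_algebra ((Ba B E)\<lparr>carrier := carrier (compacts B E)\<rparr>)"
    by (rule Ba.closed_subalgebra[OF subspace_compacts])
      (auto intro: compacts_ideal compacts_closed compacts_limit)
  ultimately show ?thesis by simp
qed

text \<open>
  With \<open>b\<close> a multiple of \<open>\<langle>y, y\<rangle>\<close>, the vectors \<open>y (1 - b)\<^sup>n\<close> tend to zero, and by induction they are of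
  the form \<open>y - y \<langle>y, z\<rangle>\<close>.
\<close>

lemma rank_one_approximation:
  assumes y [simp]: "y \<in> carrier E" and e: "e > 0"
  obtains z where "z \<in> carrier E" "hnorm B E (y \<ominus>\<^bsub>E\<^esub> rank_one E y y z) < e"
proof -
  define r where "r = cnorm B (ip E y y) + 1"
  have r: "r > 0" using B.cnorm_nonneg[OF ip_closed[OF y y]] unfolding r_def by linarith
  define b where "b = complex_of_real (1/r) \<odot>\<^bsub>B\<^esub> ip E y y"
  define s where "s = complex_of_real (1 / sqrt r)"
  have ss: "cnj s * s = complex_of_real (1/r)" "cmod s = 1 / sqrt r"
    using r by (simp_all add: s_def norm_divide flip: of_real_mult)
  have ipb: "ip E (s \<odot>\<^bsub>E\<^esub> y) (s \<odot>\<^bsub>E\<^esub> y) = b"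
    using ss by (simp add: b_def ip_expand B.scale_scale mult.commute)
  have [simp]: "b \<in> carrier B" by (simp add: b_def)
  have b: "cstar_pos B b" "cnorm B b \<le> 1"
    using ip_pos[of "s \<odot>\<^bsub>E\<^esub> y"] ipb r B.cnorm_nonneg[of "ip E y y"]
    by (simp_all add: b_def B.norm_scale norm_divide) (simp add: r_def)
  define D where "D = (\<lambda>v. v \<ominus>\<^bsub>E\<^esub> ract E v b)"
  have lim: "(\<lambda>n. hnorm B E ((D ^^ n) (s \<odot>\<^bsub>E\<^esub> y))) \<longlonglongrightarrow> 0"
    unfolding D_def using b by (intro module_tail_tendsto_zero) (simp_all add: ipb B.cstar_pos_zero)
  have range: "\<exists>z\<in>carrier E. (D ^^ n) (s \<odot>\<^bsub>E\<^esub> y) = s \<odot>\<^bsub>E\<^esub> y \<ominus>\<^bsub>E\<^esub> rank_one E y y z" for n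
  proof (induction n)
    case 0
    show ?case by (rule bexI[of _ "\<zero>\<^bsub>E\<^esub>"]) (auto simp: rank_one_def Ba_linear intro!: ip_eqI simp: ip_expand B.expand B.diff_eq_scale)
  next
    case (Suc n)
    then obtain z where z [simp]: "z \<in> carrier E" and Dz: "(D ^^ n) (s \<odot>\<^bsub>E\<^esub> y) = s \<odot>\<^bsub>E\<^esub> y \<ominus>\<^bsub>E\<^esub> rank_one E y y z"
      by blast
    define R where "R = rank_one E y y"
    have R: "R \<in> adjointable E E" by (simp add: R_def rank_one_adj)
    define w where "w = (s * complex_of_real (1/r)) \<odot>\<^bsub>E\<^esub> y"
    define z' where "z' = z \<oplus>\<^bsub>E\<^esub> (w \<ominus>\<^bsub>E\<^esub> ract E z b)"
    have [simp]: "w \<in> carrier E" "z' \<in> carrier E" by (simp_all add: w_def z'_def)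
    have "ract E (s \<odot>\<^bsub>E\<^esub> y) b = R w"
      by (simp add: b_def w_def R_def rank_one_def ract_laws ip_smult E.scale_scale)
    moreover have "ract E (R z) b = R (ract E z b)" by (rule Ba_ract[OF R, symmetric]) simp_all
    ultimately have "(D ^^ Suc n) (s \<odot>\<^bsub>E\<^esub> y) = (s \<odot>\<^bsub>E\<^esub> y \<ominus>\<^bsub>E\<^esub> R z) \<ominus>\<^bsub>E\<^esub> (R w \<ominus>\<^bsub>E\<^esub> R (ract E z b))"
      using Dz R by (simp add: R_def[symmetric]) (simp add: D_def ract_laws)
    also have "\<dots> = s \<odot>\<^bsub>E\<^esub> y \<ominus>\<^bsub>E\<^esub> (R z \<oplus>\<^bsub>E\<^esub> (R w \<ominus>\<^bsub>E\<^esub> R (ract E z b)))"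
      using R by - (rule E.lin_eqI, (rule E.lin | simp add: lookup_add algebra_simps)+)
    also have "R z \<oplus>\<^bsub>E\<^esub> (R w \<ominus>\<^bsub>E\<^esub> R (ract E z b)) = R z'"
      using R by (simp add: z'_def Ba_linear)
    finally have "(D ^^ Suc n) (s \<odot>\<^bsub>E\<^esub> y) = s \<odot>\<^bsub>E\<^esub> y \<ominus>\<^bsub>E\<^esub> rank_one E y y z'" by (simp only: R_def)
    then show ?case by (intro bexI[of _ z']) simp_all
  qed
  have "0 < e / sqrt r" using e r by simp
  then have "\<forall>\<^sub>F n in sequentially. hnorm B E ((D ^^ n) (s \<odot>\<^bsub>E\<^esub> y)) < e / sqrt r"
    by (rule order_tendstoD(2)[OF lim])
  then obtain n where n: "hnorm B E ((D ^^ n) (s \<odot>\<^bsub>E\<^esub> y)) < e / sqrt r"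
    by (meson eventually_sequentially order_refl)
  obtain z where z: "z \<in> carrier E" "hnorm B E (s \<odot>\<^bsub>E\<^esub> y \<ominus>\<^bsub>E\<^esub> rank_one E y y z) < e / sqrt r"
    using range[of n] n by auto
  have "s \<odot>\<^bsub>E\<^esub> (y \<ominus>\<^bsub>E\<^esub> rank_one E y y (complex_of_real (sqrt r) \<odot>\<^bsub>E\<^esub> z)) = s \<odot>\<^bsub>E\<^esub> y \<ominus>\<^bsub>E\<^esub> rank_one E y y z"
    using r z by (intro ip_eqI)
      (simp_all add: rank_one_def ip_expand B.expand B.scale_scale s_def B.scale_diff_right flip: of_real_mult)
  then have "1 / sqrt r * hnorm B E (y \<ominus>\<^bsub>E\<^esub> rank_one E y y (complex_of_real (sqrt r) \<odot>\<^bsub>E\<^esub> z)) < e / sqrt r"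
    using z ss(2) E.norm_scale[of "y \<ominus>\<^bsub>E\<^esub> rank_one E y y (complex_of_real (sqrt r) \<odot>\<^bsub>E\<^esub> z)" s]
    by (simp add: rank_one_def)
  then have "hnorm B E (y \<ominus>\<^bsub>E\<^esub> rank_one E y y (complex_of_real (sqrt r) \<odot>\<^bsub>E\<^esub> z)) < e"
    using r by (simp add: field_simps)
  then show thesis using z by (intro that[of "complex_of_real (sqrt r) \<odot>\<^bsub>E\<^esub> z"]) simp_all
qed

end

section \<open>Nondegeneracy of strict representations on the compact operators\<close>

text \<open>
  The strict topology is given by a subbasis of seminorm balls with arbitrary centres; by the triangle
  inequality, balls around \<open>1\<close> suffice for neighbourhoods of \<open>1\<close>.
\<close>

lemma strict_neighbourhood_of_one:
  assumes E: "hilbert_cs B E" and T: "openin (strict_topology B E) T" and one: "\<one>\<^bsub>Ba B E\<^esub> \<in> T"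
  shows "\<exists>K e. finite K \<and> K \<subseteq> carrier (compacts B E) \<and> e > (0::real) \<and>
    (\<forall>a\<in>carrier (Ba B E). (\<forall>k\<in>K. cnorm (Ba B E) ((\<one>\<^bsub>Ba B E\<^esub> \<ominus>\<^bsub>Ba B E\<^esub> a) \<otimes>\<^bsub>Ba B E\<^esub> k) < e \<and>
        cnorm (Ba B E) (k \<otimes>\<^bsub>Ba B E\<^esub> (\<one>\<^bsub>Ba B E\<^esub> \<ominus>\<^bsub>Ba B E\<^esub> a)) < e) \<longrightarrow> a \<in> T)"
proof -
  interpret hilbert_cs B E by fact
  interpret Ba: unital_cstar "Ba B E" by (rule Ba_unital_cstar)
  define good where "good T \<longleftrightarrow> (\<exists>K e. finite K \<and> K \<subseteq> carrier (compacts B E) \<and> e > (0::real) \<and>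
    (\<forall>a\<in>carrier (Ba B E). (\<forall>k\<in>K. cnorm (Ba B E) ((\<one>\<^bsub>Ba B E\<^esub> \<ominus>\<^bsub>Ba B E\<^esub> a) \<otimes>\<^bsub>Ba B E\<^esub> k) < e \<and>
        cnorm (Ba B E) (k \<otimes>\<^bsub>Ba B E\<^esub> (\<one>\<^bsub>Ba B E\<^esub> \<ominus>\<^bsub>Ba B E\<^esub> a)) < e) \<longrightarrow> a \<in> T))" for T
  have good_mono: "good T" if "good S" "S \<subseteq> T" for S T
    using that unfolding good_def by (meson subsetD)
  have good_Int: "good (S \<inter> T)" if S: "good S" and T: "good T" for S T
  proof -
    obtain K e where K: "finite K" "K \<subseteq> carrier (compacts B E)" "e > (0::real)"
      "\<forall>a\<in>carrier (Ba B E). (\<forall>k\<in>K. cnorm (Ba B E) ((\<one>\<^bsub>Ba B E\<^esub> \<ominus>\<^bsub>Ba B E\<^esub> a) \<otimes>\<^bsub>Ba B E\<^esub> k) < e \<and>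
        cnorm (Ba B E) (k \<otimes>\<^bsub>Ba B E\<^esub> (\<one>\<^bsub>Ba B E\<^esub> \<ominus>\<^bsub>Ba B E\<^esub> a)) < e) \<longrightarrow> a \<in> S"
      using S unfolding good_def by (elim exE conjE)
    obtain L f where L: "finite L" "L \<subseteq> carrier (compacts B E)" "f > (0::real)"
      "\<forall>a\<in>carrier (Ba B E). (\<forall>k\<in>L. cnorm (Ba B E) ((\<one>\<^bsub>Ba B E\<^esub> \<ominus>\<^bsub>Ba B E\<^esub> a) \<otimes>\<^bsub>Ba B E\<^esub> k) < f \<and>
        cnorm (Ba B E) (k \<otimes>\<^bsub>Ba B E\<^esub> (\<one>\<^bsub>Ba B E\<^esub> \<ominus>\<^bsub>Ba B E\<^esub> a)) < f) \<longrightarrow> a \<in> T"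
      using T unfolding good_def by (elim exE conjE)
    show ?thesis
      unfolding good_def
      by (rule exI[of _ "K \<union> L"], rule exI[of _ "min e f"]) (use K L in simp)
  qed
  define G where "G = {{a \<in> carrier (Ba B E). cnorm (Ba B E) ((a \<ominus>\<^bsub>Ba B E\<^esub> a\<^sub>0) \<otimes>\<^bsub>Ba B E\<^esub> k) < \<epsilon>} | a\<^sub>0 k \<epsilon>.
         a\<^sub>0 \<in> carrier (Ba B E) \<and> k \<in> carrier (compacts B E) \<and> 0 < \<epsilon>} \<union>
      {{a \<in> carrier (Ba B E). cnorm (Ba B E) (k \<otimes>\<^bsub>Ba B E\<^esub> (a \<ominus>\<^bsub>Ba B E\<^esub> a\<^sub>0)) < \<epsilon>} | a\<^sub>0 k \<epsilon>.
         a\<^sub>0 \<in> carrier (Ba B E) \<and> k \<in> carrier (compacts B E) \<and> 0 < \<epsilon>}"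
  have "generate_topology_on G T"
    using T openin_topology_generated_by unfolding strict_topology_def Let_def G_def by blast
  then have "\<one>\<^bsub>Ba B E\<^esub> \<in> T \<longrightarrow> good T"
  proof induction
    case (Int S T)
    then show ?case using good_Int by simp
  next
    case (UN \<T>)
    show ?case
    proof
      assume "\<one>\<^bsub>Ba B E\<^esub> \<in> \<Union>\<T>"
      then obtain S where S: "S \<in> \<T>" "\<one>\<^bsub>Ba B E\<^esub> \<in> S" by blast
      show "good (\<Union>\<T>)" by (rule good_mono[of S]) (use S UN.IH[OF S(1)] in auto)
    qed
  next
    case (Basis T)
    show ?case
    proof
      assume one: "\<one>\<^bsub>Ba B E\<^esub> \<in> T"
      from Basis consider (left) a\<^sub>0 k \<epsilon> where "a\<^sub>0 \<in> carrier (Ba B E)" "k \<in> carrier (compacts B E)"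
          "T = {a \<in> carrier (Ba B E). cnorm (Ba B E) ((a \<ominus>\<^bsub>Ba B E\<^esub> a\<^sub>0) \<otimes>\<^bsub>Ba B E\<^esub> k) < \<epsilon>}"
        | (right) a\<^sub>0 k \<epsilon> where "a\<^sub>0 \<in> carrier (Ba B E)" "k \<in> carrier (compacts B E)"
          "T = {a \<in> carrier (Ba B E). cnorm (Ba B E) (k \<otimes>\<^bsub>Ba B E\<^esub> (a \<ominus>\<^bsub>Ba B E\<^esub> a\<^sub>0)) < \<epsilon>}"
        unfolding G_def by blast
      then show "good T"
      proof cases
        case left
        note [simp] = left(1) compacts_closed[OF left(2)]
        let ?d = "\<epsilon> - cnorm (Ba B E) ((\<one>\<^bsub>Ba B E\<^esub> \<ominus>\<^bsub>Ba B E\<^esub> a\<^sub>0) \<otimes>\<^bsub>Ba B E\<^esub> k)"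
        have "a \<in> T" if a [simp]: "a \<in> carrier (Ba B E)"
          and small: "cnorm (Ba B E) ((\<one>\<^bsub>Ba B E\<^esub> \<ominus>\<^bsub>Ba B E\<^esub> a) \<otimes>\<^bsub>Ba B E\<^esub> k) < ?d" for a
        proof -
          have "(a \<ominus>\<^bsub>Ba B E\<^esub> a\<^sub>0) \<otimes>\<^bsub>Ba B E\<^esub> k = (\<one>\<^bsub>Ba B E\<^esub> \<ominus>\<^bsub>Ba B E\<^esub> a\<^sub>0) \<otimes>\<^bsub>Ba B E\<^esub> k
              \<ominus>\<^bsub>Ba B E\<^esub> (\<one>\<^bsub>Ba B E\<^esub> \<ominus>\<^bsub>Ba B E\<^esub> a) \<otimes>\<^bsub>Ba B E\<^esub> k"
            by (simp add: Ba.expand) (rule Ba.lin_eqI, (rule Ba.lin | simp add: lookup_add algebra_simps)+)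
          then show ?thesis
            using Ba.norm_diff_triangle[of "(\<one>\<^bsub>Ba B E\<^esub> \<ominus>\<^bsub>Ba B E\<^esub> a\<^sub>0) \<otimes>\<^bsub>Ba B E\<^esub> k" "(\<one>\<^bsub>Ba B E\<^esub> \<ominus>\<^bsub>Ba B E\<^esub> a) \<otimes>\<^bsub>Ba B E\<^esub> k"] small
            by (simp add: left(3))
        qed
        then show ?thesis
          unfolding good_def using left(2) one
          by (intro exI[of _ "{k}"] exI[of _ ?d] conjI) (simp_all add: left(3))
      next
        case right
        note [simp] = right(1) compacts_closed[OF right(2)]
        let ?d = "\<epsilon> - cnorm (Ba B E) (k \<otimes>\<^bsub>Ba B E\<^esub> (\<one>\<^bsub>Ba B E\<^esub> \<ominus>\<^bsub>Ba B E\<^esub> a\<^sub>0))"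
        have "a \<in> T" if a [simp]: "a \<in> carrier (Ba B E)"
          and small: "cnorm (Ba B E) (k \<otimes>\<^bsub>Ba B E\<^esub> (\<one>\<^bsub>Ba B E\<^esub> \<ominus>\<^bsub>Ba B E\<^esub> a)) < ?d" for a
        proof -
          have "k \<otimes>\<^bsub>Ba B E\<^esub> (a \<ominus>\<^bsub>Ba B E\<^esub> a\<^sub>0) = k \<otimes>\<^bsub>Ba B E\<^esub> (\<one>\<^bsub>Ba B E\<^esub> \<ominus>\<^bsub>Ba B E\<^esub> a\<^sub>0)
              \<ominus>\<^bsub>Ba B E\<^esub> k \<otimes>\<^bsub>Ba B E\<^esub> (\<one>\<^bsub>Ba B E\<^esub> \<ominus>\<^bsub>Ba B E\<^esub> a)"
            by (simp add: Ba.expand) (rule Ba.lin_eqI, (rule Ba.lin | simp add: lookup_add algebra_simps)+)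
          then show ?thesis
            using Ba.norm_diff_triangle[of "k \<otimes>\<^bsub>Ba B E\<^esub> (\<one>\<^bsub>Ba B E\<^esub> \<ominus>\<^bsub>Ba B E\<^esub> a\<^sub>0)" "k \<otimes>\<^bsub>Ba B E\<^esub> (\<one>\<^bsub>Ba B E\<^esub> \<ominus>\<^bsub>Ba B E\<^esub> a)"] small
            by (simp add: right(3))
        qed
        then show ?thesis
          unfolding good_def using right(2) one
          by (intro exI[of _ "{k}"] exI[of _ ?d] conjI) (simp_all add: right(3))
      qed
    qed
  qed simp
  with one have "good T" by simp
  then show ?thesis unfolding good_def .
qed

text \<open>
  Compact operators \<open>d\<close> of norm at most \<open>2\<close> come strictly close to \<open>1\<close>; the common bound matters since
  strict maps are continuous on bounded sets.  So a strict unital map makes \<open>(\<theta>(d) - 1) y y\<^sup>*\<close> small in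
  norm, and \<open>y\<close> is close to the range of \<open>y y\<^sup>*\<close>.
\<close>

lemma strict_compacts_approximate_identity:
  assumes E: "hilbert_cs B E" and F: "hilbert_cs C F" and strict: "strict_map B E C F \<theta>"
    and unital: "\<theta> \<one>\<^bsub>Ba B E\<^esub> = \<one>\<^bsub>Ba C F\<^esub>" and y: "y \<in> carrier F" and e: "e > 0"
  obtains d where "d \<in> carrier (compacts B E)" "hnorm C F (y \<ominus>\<^bsub>F\<^esub> \<theta> d y) < e"
proof -
  interpret E: hilbert_cs B E by fact
  interpret F: hilbert_cs C F by fact
  interpret BE: unital_cstar "Ba B E" by (rule E.Ba_unital_cstar)
  interpret BF: unital_cstar "Ba C F" by (rule F.Ba_unital_cstar)
  have closed: "\<theta> a \<in> carrier (Ba C F)" if "a \<in> carrier (Ba B E)" for a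
    using strict[unfolded strict_map_def, THEN conjunct1] that unfolding bounded_linear_map_def by blast
  obtain K where K: "\<And>a. a \<in> carrier (Ba B E) \<Longrightarrow> cnorm (Ba C F) (\<theta> a) \<le> K * cnorm (Ba B E) a"
    using strict[unfolded strict_map_def, THEN conjunct1] unfolding bounded_linear_map_def by blast
  define M where "M = \<bar>K\<bar> * 2 + 1"
  have M: "M > 0" by (simp add: M_def)
  obtain z where z: "z \<in> carrier F" "hnorm C F (y \<ominus>\<^bsub>F\<^esub> rank_one F y y z) < e / (2 * M)"
    using F.rank_one_approximation[OF y, of "e / (2 * M)"] e M by auto
  define R where "R = rank_one F y y"
  have R: "R \<in> carrier (Ba C F)" "R \<in> carrier (compacts C F)"
    using y by (simp_all add: R_def F.rank_one_compact)
  define \<delta> where "\<delta> = e / (2 * (hnorm C F z + 1))"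
  have zpos: "hnorm C F z + 1 > 0" using z by (simp add: add_nonneg_pos)
  then have \<delta>: "\<delta> > 0" using e by (simp add: \<delta>_def)
  define U where "U = {b \<in> carrier (Ba C F). cnorm (Ba C F) ((b \<ominus>\<^bsub>Ba C F\<^esub> \<one>\<^bsub>Ba C F\<^esub>) \<otimes>\<^bsub>Ba C F\<^esub> R) < \<delta>}"
  have U: "openin (strict_topology C F) U"
    unfolding strict_topology_def Let_def U_def
    by (rule topology_generated_by_Basis, rule UnI1) (use R(2) \<delta> BF.one_closed in blast)
  define S where "S = {a \<in> carrier (Ba B E). cnorm (Ba B E) a \<le> 2}"
  have "continuous_map (subtopology (strict_topology B E) S) (strict_topology C F) \<theta>"
  proof -
    have "S \<subseteq> carrier (Ba B E)" "\<exists>K. \<forall>a\<in>S. cnorm (Ba B E) a \<le> K" by (auto simp: S_def)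
    then show ?thesis using strict[unfolded strict_map_def, THEN conjunct2] by blast
  qed
  then have "openin (subtopology (strict_topology B E) S)
      {a \<in> topspace (subtopology (strict_topology B E) S). \<theta> a \<in> U}"
    using U by (rule openin_continuous_map_preimage)
  then obtain T where T: "openin (strict_topology B E) T"
      "{a \<in> topspace (subtopology (strict_topology B E) S). \<theta> a \<in> U} = T \<inter> S"
    unfolding openin_subtopology by blast
  have oneS: "\<one>\<^bsub>Ba B E\<^esub> \<in> S" using BE.norm_one_le by (simp add: S_def)
  have "\<one>\<^bsub>Ba B E\<^esub> \<in> topspace (strict_topology B E)"
  proof -
    let ?V = "{a \<in> carrier (Ba B E). cnorm (Ba B E) ((a \<ominus>\<^bsub>Ba B E\<^esub> \<one>\<^bsub>Ba B E\<^esub>) \<otimes>\<^bsub>Ba B E\<^esub> \<zero>\<^bsub>Ba B E\<^esub>) < 1}"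
    have "openin (strict_topology B E) ?V"
      unfolding strict_topology_def Let_def
    proof (rule topology_generated_by_Basis, rule UnI1)
      have "\<zero>\<^bsub>Ba B E\<^esub> \<in> carrier (compacts B E)" using E.subspace_compacts by (simp add: subspace_of_def)
      then show "?V \<in> {{a \<in> carrier (Ba B E). cnorm (Ba B E) ((a \<ominus>\<^bsub>Ba B E\<^esub> a\<^sub>0) \<otimes>\<^bsub>Ba B E\<^esub> k) < \<epsilon>} | a\<^sub>0 k \<epsilon>.
         a\<^sub>0 \<in> carrier (Ba B E) \<and> k \<in> carrier (compacts B E) \<and> 0 < \<epsilon>}"
        using BE.one_closed zero_less_one by blast
    qed
    moreover have "\<one>\<^bsub>Ba B E\<^esub> \<in> ?V" by simp
    ultimately show ?thesis using openin_subset by blast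
  qed
  then have "\<one>\<^bsub>Ba B E\<^esub> \<in> topspace (subtopology (strict_topology B E) S)"
    unfolding topspace_subtopology using oneS by (rule IntI)
  moreover have "\<theta> \<one>\<^bsub>Ba B E\<^esub> \<in> U" unfolding unital using \<delta> R by (simp add: U_def)
  ultimately have "\<one>\<^bsub>Ba B E\<^esub> \<in> T \<inter> S" unfolding T(2)[symmetric] by (intro CollectI conjI)
  then have "\<one>\<^bsub>Ba B E\<^esub> \<in> T" by (rule IntD1)
  note oneT = this
  obtain L f where L: "finite L" "L \<subseteq> carrier (compacts B E)" "f > 0"
    and LT: "\<forall>a\<in>carrier (Ba B E). (\<forall>k\<in>L.
        cnorm (Ba B E) ((\<one>\<^bsub>Ba B E\<^esub> \<ominus>\<^bsub>Ba B E\<^esub> a) \<otimes>\<^bsub>Ba B E\<^esub> k) < f \<and>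
        cnorm (Ba B E) (k \<otimes>\<^bsub>Ba B E\<^esub> (\<one>\<^bsub>Ba B E\<^esub> \<ominus>\<^bsub>Ba B E\<^esub> a)) < f) \<longrightarrow> a \<in> T"
    using strict_neighbourhood_of_one[OF E T(1) oneT] by (elim exE conjE)
  obtain d where d: "d \<in> carrier (compacts B E)" "cnorm (Ba B E) d \<le> 2"
    "\<forall>k\<in>L. cnorm (Ba B E) ((\<one>\<^bsub>Ba B E\<^esub> \<ominus>\<^bsub>Ba B E\<^esub> d) \<otimes>\<^bsub>Ba B E\<^esub> k) < f \<and>
      cnorm (Ba B E) (k \<otimes>\<^bsub>Ba B E\<^esub> (\<one>\<^bsub>Ba B E\<^esub> \<ominus>\<^bsub>Ba B E\<^esub> d)) < f"
  proof -
    have "\<exists>d\<in>carrier (compacts B E). cnorm (Ba B E) d \<le> 2 \<and>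
        (\<forall>k\<in>L. cnorm (Ba B E) ((\<one>\<^bsub>Ba B E\<^esub> \<ominus>\<^bsub>Ba B E\<^esub> d) \<otimes>\<^bsub>Ba B E\<^esub> k) < f \<and>
          cnorm (Ba B E) (k \<otimes>\<^bsub>Ba B E\<^esub> (\<one>\<^bsub>Ba B E\<^esub> \<ominus>\<^bsub>Ba B E\<^esub> d)) < f)"
      by (rule BE.ideal_approximate_unit[OF E.subspace_compacts _ _ L(1,2,3)])
        (rule E.compacts_ideal; assumption)+
    then show ?thesis using that by blast
  qed
  note dB = E.compacts_closed[OF d(1)]
  have "d \<in> T \<inter> S" using LT d dB by (auto simp: S_def)
  then have "\<theta> d \<in> U" using T(2) by blast
  define t where "t = \<theta> d \<ominus>\<^bsub>Ba C F\<^esub> \<one>\<^bsub>Ba C F\<^esub>"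
  have t: "t \<in> carrier (Ba C F)" using closed[OF dB] by (simp add: t_def)
  have t_apply: "t v = \<theta> d v \<ominus>\<^bsub>F\<^esub> v" if "v \<in> carrier F" for v
    using that closed[OF dB] BF.one_closed F.Ba_diff[of "\<theta> d" "\<one>\<^bsub>Ba C F\<^esub>"] by (simp add: t_def Ba_simps)
  have tR: "cnorm (Ba C F) (t \<otimes>\<^bsub>Ba C F\<^esub> R) < \<delta>" using \<open>\<theta> d \<in> U\<close> by (simp add: U_def t_def)
  have tM: "cnorm (Ba C F) t \<le> M"
  proof -
    have "cnorm (Ba C F) (\<theta> d) \<le> \<bar>K\<bar> * 2"
      using K[OF dB] mult_mono[OF abs_ge_self[of K] d(2) abs_ge_zero BE.cnorm_nonneg[OF dB]] by linarith
    then show ?thesis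
      using BF.norm_diff_triangle[OF closed[OF dB] BF.one_closed] BF.norm_one_le by (simp add: t_def M_def)
  qed
  have adj: "t \<in> adjointable F F" "R \<in> adjointable F F" "t \<otimes>\<^bsub>Ba C F\<^esub> R \<in> adjointable F F"
    using t R BF.mult_closed[OF t R(1)] by (simp_all add: Ba_simps)
  have [simp]: "R z \<in> carrier F" "t y \<in> carrier F" "\<theta> d y \<in> carrier F"
    using z y closed[OF dB] adj by (simp_all add: Ba_simps)
  define v where "v = y \<ominus>\<^bsub>F\<^esub> R z"
  have [simp]: "v \<in> carrier F" using y by (simp add: v_def)
  have "y = R z \<oplus>\<^bsub>F\<^esub> v"
    unfolding v_def using y by - (rule F.E.lin_eqI, (rule F.E.lin | simp add: lookup_add algebra_simps)+)
  then have "t y = t (R z) \<oplus>\<^bsub>F\<^esub> t v" using F.Ba_linear(1)[OF adj(1), of "R z" v] by simp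
  moreover have "t (R z) = (t \<otimes>\<^bsub>Ba C F\<^esub> R) z" using z by (simp add: Ba_simps)
  ultimately have "hnorm C F (t y) \<le> hnorm C F ((t \<otimes>\<^bsub>Ba C F\<^esub> R) z) + hnorm C F (t v)"
    using F.hnorm_triangle[of "t (R z)" "t v"] adj z by simp
  also have "\<dots> \<le> cnorm (Ba C F) (t \<otimes>\<^bsub>Ba C F\<^esub> R) * hnorm C F z + cnorm (Ba C F) t * hnorm C F v"
    using adj z by (intro add_mono F.opn_bound) simp_all
  also have "\<dots> < e"
  proof -
    have "cnorm (Ba C F) (t \<otimes>\<^bsub>Ba C F\<^esub> R) * hnorm C F z \<le> \<delta> * (hnorm C F z + 1)"
      using tR z \<delta> by (intro mult_mono) simp_all
    also have "\<dots> = e / 2"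
    proof -
      have "e / (2 * p) * p = e / 2" if "p > 0" for p using that by simp
      from this[OF zpos] show ?thesis by (simp only: \<delta>_def)
    qed
    finally have 1: "cnorm (Ba C F) (t \<otimes>\<^bsub>Ba C F\<^esub> R) * hnorm C F z \<le> e / 2" .
    have "cnorm (Ba C F) t * hnorm C F v \<le> M * hnorm C F v"
      using tM by (intro mult_right_mono) simp_all
    also have "\<dots> < M * (e / (2 * M))"
      using z(2) M by (intro mult_strict_left_mono) (simp_all add: v_def R_def)
    also have "\<dots> = e / 2" using M by simp
    finally show ?thesis using 1 by simp
  qed
  finally have "hnorm C F (y \<ominus>\<^bsub>F\<^esub> \<theta> d y) < e"
    using t_apply[OF y] F.E.norm_diff_commute[of y "\<theta> d y"] y by simp
  with d(1) show thesis by (rule that)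
qed


section \<open>Completion of a semi-Hilbert module\<close>

lemma (in cstar_algebra) cstar_lim_eq: "conv s x \<Longrightarrow> cstar_lim A s = x"
  unfolding cstar_lim_def
proof (rule the_equality)
  fix a assume s: "conv s x" and a: "a \<in> carrier A \<and> (\<lambda>n. cnorm A (s n \<ominus> a)) \<longlonglongrightarrow> 0"
  then have "conv s a" using tendsD(1)[OF s] by (simp add: tends_def)
  then show "a = x" using s by (rule conv_unique)
qed (simp add: tends_def)

context semi_hilbert
begin

abbreviation Cs :: "(nat \<Rightarrow> 'e) set" where "Cs \<equiv> cauchy_seqs E (hnorm B E)"
abbreviation cl :: "(nat \<Rightarrow> 'e) \<Rightarrow> (nat \<Rightarrow> 'e) set" where "cl \<equiv> cauchy_class B E"
abbreviation EC :: "('b, (nat \<Rightarrow> 'e) set) hmodule" where "EC \<equiv> completion B E"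
abbreviation emb :: "'e \<Rightarrow> (nat \<Rightarrow> 'e) set" where "emb x \<equiv> cl (\<lambda>_. x)"

definition equi :: "(nat \<Rightarrow> 'e) \<Rightarrow> (nat \<Rightarrow> 'e) \<Rightarrow> bool" where
  "equi s t \<longleftrightarrow> (\<lambda>n. hnorm B E (s n \<ominus>\<^bsub>E\<^esub> t n)) \<longlonglongrightarrow> 0"

lemma equiI:
  assumes "\<And>n. s n \<in> carrier E" "\<And>n. t n \<in> carrier E" "\<And>n. hnorm B E (s n \<ominus>\<^bsub>E\<^esub> t n) \<le> r n" "r \<longlonglongrightarrow> 0"
  shows "equi s t"
  unfolding equi_def by (rule tendsto_sandwich[of "\<lambda>_. 0" _ _ r]) (use assms in auto)

lemma equi_refl: "s \<in> Cs \<Longrightarrow> equi s s"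
  by (simp add: equi_def E.cauchyD)

lemma equi_sym: "s \<in> Cs \<Longrightarrow> t \<in> Cs \<Longrightarrow> equi s t \<Longrightarrow> equi t s"
  unfolding equi_def using E.norm_diff_commute E.cauchyD by simp

lemma equi_trans:
  assumes "s \<in> Cs" "t \<in> Cs" "u \<in> Cs" "equi s t" "equi t u"
  shows "equi s u"
  by (rule equiI[OF _ _ E.norm_triangle3])
    (use assms E.cauchyD tendsto_add[OF assms(4,5)[unfolded equi_def]] in auto)

lemma cl_eq_iff: "s \<in> Cs \<Longrightarrow> t \<in> Cs \<Longrightarrow> cl s = cl t \<longleftrightarrow> equi s t"
proof
  assume st: "s \<in> Cs" "t \<in> Cs"
  show "equi s t" if "cl s = cl t"
  proof -
    have "t \<in> cl t" using st equi_refl by (simp add: cauchy_class_def equi_def)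
    then show ?thesis using that by (auto simp: cauchy_class_def equi_def)
  qed
  assume "equi s t"
  then have "equi s u \<longleftrightarrow> equi t u" if "u \<in> Cs" for u
    using equi_trans[OF st(1) st(2) that] equi_trans[OF st(2) st(1) that] equi_sym[OF st] by metis
  then show "cl s = cl t"
    unfolding cauchy_class_def equi_def by (intro Collect_cong conj_cong refl)
qed

lemma class_rep_cl:
  assumes "s \<in> Cs"
  shows "class_rep (cl s) \<in> Cs" "equi s (class_rep (cl s))"
proof -
  have "s \<in> cl s" using assms equi_refl by (simp add: cauchy_class_def equi_def)
  then have "class_rep (cl s) \<in> cl s" unfolding class_rep_def by (rule someI[where P = "\<lambda>t. t \<in> cl s"])
  then show "class_rep (cl s) \<in> Cs" "equi s (class_rep (cl s))"
    by (auto simp: cauchy_class_def equi_def)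
qed

lemma EC_simps:
  "carrier EC = cl ` Cs" "\<zero>\<^bsub>EC\<^esub> = emb \<zero>\<^bsub>E\<^esub>"
  "\<xi> \<oplus>\<^bsub>EC\<^esub> \<eta> = cl (\<lambda>n. class_rep \<xi> n \<oplus>\<^bsub>E\<^esub> class_rep \<eta> n)"
  "z \<odot>\<^bsub>EC\<^esub> \<xi> = cl (\<lambda>n. z \<odot>\<^bsub>E\<^esub> class_rep \<xi> n)"
  "ract EC \<xi> b = cl (\<lambda>n. ract E (class_rep \<xi> n) b)"
  "ip EC \<xi> \<eta> = cstar_lim B (\<lambda>n. ip E (class_rep \<xi> n) (class_rep \<eta> n))"
  by (simp_all add: completion_def)

text \<open>
  A map given by operating on representatives can be computed on any representing sequence, if the
  operation is Lipschitz in the seminorm.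
\<close>

lemma cl_map:
  assumes T: "\<And>x. x \<in> carrier E \<Longrightarrow> T x \<in> carrier E"
    and lip: "\<And>x y. x \<in> carrier E \<Longrightarrow> y \<in> carrier E \<Longrightarrow>
      hnorm B E (T x \<ominus>\<^bsub>E\<^esub> T y) \<le> K * hnorm B E (x \<ominus>\<^bsub>E\<^esub> y)"
    and s: "s \<in> Cs"
  shows "(\<lambda>n. T (s n)) \<in> Cs" "cl (\<lambda>n. T (class_rep (cl s) n)) = cl (\<lambda>n. T (s n))"
proof -
  have C: "(\<lambda>n. T (s n)) \<in> Cs" if "s \<in> Cs" for s
    using that T lip[OF E.cauchyD[OF that] E.cauchyD[OF that]]
    by (intro E.cauchy_dominated[OF that, of _ "\<bar>K\<bar>"])
      (auto simp: E.cauchyD intro: order_trans[OF _ mult_right_mono[OF abs_ge_self]])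
  show "(\<lambda>n. T (s n)) \<in> Cs" by (rule C[OF s])
  have "equi (\<lambda>n. T (class_rep (cl s) n)) (\<lambda>n. T (s n))"
  proof (rule equiI)
    show "(\<lambda>n. K * hnorm B E (class_rep (cl s) n \<ominus>\<^bsub>E\<^esub> s n)) \<longlonglongrightarrow> 0"
      using equi_sym[OF s class_rep_cl[OF s]] unfolding equi_def by (rule tendsto_mult_right_zero)
  qed (use T lip E.cauchyD[OF s] E.cauchyD[OF class_rep_cl(1)[OF s]] in auto)
  then show "cl (\<lambda>n. T (class_rep (cl s) n)) = cl (\<lambda>n. T (s n))"
    using cl_eq_iff C[OF s] C[OF class_rep_cl(1)[OF s]] by simp
qed

lemma cl_scale:
  assumes s: "s \<in> Cs"
  shows "z \<odot>\<^bsub>EC\<^esub> cl s = cl (\<lambda>n. z \<odot>\<^bsub>E\<^esub> s n)"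
  unfolding EC_simps
  by (rule cl_map(2)[OF _ _ s, of _ "cmod z"]) (simp_all add: E.norm_scale flip: E.scale_diff_right)

lemma ract_diff_norm:
  assumes "x \<in> carrier E" "y \<in> carrier E" "b \<in> carrier B"
  shows "hnorm B E (ract E x b \<ominus>\<^bsub>E\<^esub> ract E y b) \<le> cnorm B b * hnorm B E (x \<ominus>\<^bsub>E\<^esub> y)"
proof -
  have "ip E (ract E x b \<ominus>\<^bsub>E\<^esub> ract E y b) (ract E x b \<ominus>\<^bsub>E\<^esub> ract E y b)
      = ip E (ract E (x \<ominus>\<^bsub>E\<^esub> y) b) (ract E (x \<ominus>\<^bsub>E\<^esub> y) b)"
    using assms by (simp add: ip_expand B.expand B.mult_assoc)
  then have "hnorm B E (ract E x b \<ominus>\<^bsub>E\<^esub> ract E y b) = hnorm B E (ract E (x \<ominus>\<^bsub>E\<^esub> y) b)"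
    by (rule hnorm_isometry)
  then show ?thesis using hnorm_ract[of "x \<ominus>\<^bsub>E\<^esub> y" b] assms by (simp add: mult.commute)
qed

lemma cl_ract:
  assumes s: "s \<in> Cs" and b: "b \<in> carrier B"
  shows "(\<lambda>n. ract E (s n) b) \<in> Cs" "ract EC (cl s) b = cl (\<lambda>n. ract E (s n) b)"
  unfolding EC_simps
  by (rule cl_map[where K = "cnorm B b"], use s b ract_diff_norm in simp_all)+

lemma cl_add:
  assumes s: "s \<in> Cs" and t: "t \<in> Cs"
  shows "cl s \<oplus>\<^bsub>EC\<^esub> cl t = cl (\<lambda>n. s n \<oplus>\<^bsub>E\<^esub> t n)"
proof -
  note [simp] = E.cauchyD[OF s] E.cauchyD[OF t] E.cauchyD[OF class_rep_cl(1)[OF s]] E.cauchyD[OF class_rep_cl(1)[OF t]]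
  have "equi (\<lambda>n. class_rep (cl s) n \<oplus>\<^bsub>E\<^esub> class_rep (cl t) n) (\<lambda>n. s n \<oplus>\<^bsub>E\<^esub> t n)"
  proof (rule equiI)
    show "hnorm B E ((class_rep (cl s) n \<oplus>\<^bsub>E\<^esub> class_rep (cl t) n) \<ominus>\<^bsub>E\<^esub> (s n \<oplus>\<^bsub>E\<^esub> t n))
      \<le> hnorm B E (class_rep (cl s) n \<ominus>\<^bsub>E\<^esub> s n) + hnorm B E (class_rep (cl t) n \<ominus>\<^bsub>E\<^esub> t n)" for n
    proof -
      have "(class_rep (cl s) n \<oplus>\<^bsub>E\<^esub> class_rep (cl t) n) \<ominus>\<^bsub>E\<^esub> (s n \<oplus>\<^bsub>E\<^esub> t n)
          = (class_rep (cl s) n \<ominus>\<^bsub>E\<^esub> s n) \<oplus>\<^bsub>E\<^esub> (class_rep (cl t) n \<ominus>\<^bsub>E\<^esub> t n)"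
        by (rule E.lin_eqI, (rule E.lin | simp add: lookup_add algebra_simps)+)
      then show ?thesis using hnorm_triangle[of "class_rep (cl s) n \<ominus>\<^bsub>E\<^esub> s n"] by simp
    qed
    show "(\<lambda>n. hnorm B E (class_rep (cl s) n \<ominus>\<^bsub>E\<^esub> s n) + hnorm B E (class_rep (cl t) n \<ominus>\<^bsub>E\<^esub> t n)) \<longlonglongrightarrow> 0"
      using tendsto_add[OF equi_sym[OF s class_rep_cl[OF s], unfolded equi_def]
          equi_sym[OF t class_rep_cl[OF t], unfolded equi_def]] by simp
  qed simp_all
  then show ?thesis
    unfolding EC_simps using cl_eq_iff E.cauchy_add s t class_rep_cl(1) by blast
qed

lemma conv_ip_cl:
  assumes s: "s \<in> Cs" and t: "t \<in> Cs"
  shows "B.conv (\<lambda>n. ip E (s n) (t n)) (ip EC (cl s) (cl t))"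
proof -
  let ?s = "class_rep (cl s)" and ?t = "class_rep (cl t)"
  note [simp] = E.cauchyD[OF s] E.cauchyD[OF t] E.cauchyD[OF class_rep_cl(1)[OF s]] E.cauchyD[OF class_rep_cl(1)[OF t]]
  obtain x where x: "B.conv (\<lambda>n. ip E (?s n) (?t n)) x"
    using B.cauchy_convergent[OF cauchy_ip[OF class_rep_cl(1)[OF s] class_rep_cl(1)[OF t]]] .
  then have "ip EC (cl s) (cl t) = x" unfolding EC_simps by (rule B.cstar_lim_eq)
  obtain K L where K: "\<And>n. hnorm B E (s n) \<le> K" and L: "\<And>n. hnorm B E (?t n) \<le> L"
    using E.cauchy_bounded[OF s] E.cauchy_bounded[OF class_rep_cl(1)[OF t]] by metis
  have "B.conv (\<lambda>n. ip E (s n) (t n) \<ominus>\<^bsub>B\<^esub> ip E (?s n) (?t n)) \<zero>\<^bsub>B\<^esub>"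
  proof (rule B.convI)
    fix n
    have "(ip E (s n) (t n) \<ominus>\<^bsub>B\<^esub> ip E (?s n) (?t n)) \<ominus>\<^bsub>B\<^esub> \<zero>\<^bsub>B\<^esub>
        = ip E (s n) (t n \<ominus>\<^bsub>E\<^esub> ?t n) \<oplus>\<^bsub>B\<^esub> ip E (s n \<ominus>\<^bsub>E\<^esub> ?s n) (?t n)"
      by (simp add: ip_expand) (rule B.lin_eqI, (rule B.lin | simp add: lookup_add algebra_simps)+)
    then have "cnorm B ((ip E (s n) (t n) \<ominus>\<^bsub>B\<^esub> ip E (?s n) (?t n)) \<ominus>\<^bsub>B\<^esub> \<zero>\<^bsub>B\<^esub>)
        \<le> hnorm B E (s n) * hnorm B E (t n \<ominus>\<^bsub>E\<^esub> ?t n) + hnorm B E (s n \<ominus>\<^bsub>E\<^esub> ?s n) * hnorm B E (?t n)"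
      using B.norm_triangle[of "ip E (s n) (t n \<ominus>\<^bsub>E\<^esub> ?t n)" "ip E (s n \<ominus>\<^bsub>E\<^esub> ?s n) (?t n)"]
        cauchy_schwarz[of "s n" "t n \<ominus>\<^bsub>E\<^esub> ?t n"] cauchy_schwarz[of "s n \<ominus>\<^bsub>E\<^esub> ?s n" "?t n"] by simp
    also have "\<dots> \<le> K * hnorm B E (t n \<ominus>\<^bsub>E\<^esub> ?t n) + hnorm B E (s n \<ominus>\<^bsub>E\<^esub> ?s n) * L"
      using K[of n] L[of n] by (intro add_mono mult_left_mono mult_right_mono) simp_all
    finally show "cnorm B ((ip E (s n) (t n) \<ominus>\<^bsub>B\<^esub> ip E (?s n) (?t n)) \<ominus>\<^bsub>B\<^esub> \<zero>\<^bsub>B\<^esub>)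
        \<le> K * hnorm B E (t n \<ominus>\<^bsub>E\<^esub> ?t n) + hnorm B E (s n \<ominus>\<^bsub>E\<^esub> ?s n) * L" .
  next
    show "(\<lambda>n. K * hnorm B E (t n \<ominus>\<^bsub>E\<^esub> ?t n) + hnorm B E (s n \<ominus>\<^bsub>E\<^esub> ?s n) * L) \<longlonglongrightarrow> 0"
      using tendsto_add[OF tendsto_mult_right_zero[OF class_rep_cl(2)[OF t, unfolded equi_def], of K]
          tendsto_mult_left_zero[OF class_rep_cl(2)[OF s, unfolded equi_def], of L]] by simp
  qed simp_all
  from B.conv_add[OF x this]
  have "B.conv (\<lambda>n. ip E (?s n) (?t n) \<oplus>\<^bsub>B\<^esub> (ip E (s n) (t n) \<ominus>\<^bsub>B\<^esub> ip E (?s n) (?t n))) x"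
    using tendsD(2)[OF x] by simp
  moreover have "ip E (?s n) (?t n) \<oplus>\<^bsub>B\<^esub> (ip E (s n) (t n) \<ominus>\<^bsub>B\<^esub> ip E (?s n) (?t n)) = ip E (s n) (t n)" for n
    by (rule B.lin_eqI, (rule B.lin | simp add: lookup_add algebra_simps)+)
  ultimately show ?thesis using \<open>ip EC (cl s) (cl t) = x\<close> by simp
qed

lemma EC_cvec: "cvec EC"
  unfolding cvec_def
proof (rule moduleI[OF cring_complex_field])
  note C = E.cauchy_add E.cauchy_scale E.cauchy_const
  have zero: "(\<lambda>_. \<zero>\<^bsub>E\<^esub>) \<in> Cs" by (rule E.cauchy_const) simp
  show "abelian_group EC"
  proof (rule abelian_groupI)
    fix \<xi> assume "\<xi> \<in> carrier EC"
    then obtain s where s: "s \<in> Cs" "\<xi> = cl s" by (auto simp: EC_simps(1))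
    have "(-1) \<odot>\<^bsub>E\<^esub> s n \<oplus>\<^bsub>E\<^esub> s n = \<zero>\<^bsub>E\<^esub>" for n
      using E.M.l_neg[of "s n"] E.uminus_eq_scale[of "s n"] E.cauchyD[OF s(1)] by simp
    then have "cl (\<lambda>n. (-1) \<odot>\<^bsub>E\<^esub> s n) \<oplus>\<^bsub>EC\<^esub> \<xi> = \<zero>\<^bsub>EC\<^esub>"
      by (simp add: s cl_add C EC_simps(2))
    then show "\<exists>\<eta>\<in>carrier EC. \<eta> \<oplus>\<^bsub>EC\<^esub> \<xi> = \<zero>\<^bsub>EC\<^esub>"
      using C s by (intro bexI[of _ "cl (\<lambda>n. (-1) \<odot>\<^bsub>E\<^esub> s n)"]) (auto simp: EC_simps(1))
  next
    fix \<xi> \<eta> \<zeta> assume "\<xi> \<in> carrier EC" "\<eta> \<in> carrier EC" "\<zeta> \<in> carrier EC"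
    then obtain s t u where "s \<in> Cs" "\<xi> = cl s" "t \<in> Cs" "\<eta> = cl t" "u \<in> Cs" "\<zeta> = cl u"
      by (auto simp: EC_simps(1))
    then show "\<xi> \<oplus>\<^bsub>EC\<^esub> \<eta> \<oplus>\<^bsub>EC\<^esub> \<zeta> = \<xi> \<oplus>\<^bsub>EC\<^esub> (\<eta> \<oplus>\<^bsub>EC\<^esub> \<zeta>)"
      using E.cauchyD by (simp add: cl_add C E.M.a_assoc)
  next
    fix \<xi> \<eta> assume "\<xi> \<in> carrier EC" "\<eta> \<in> carrier EC"
    then obtain s t where st: "s \<in> Cs" "\<xi> = cl s" "t \<in> Cs" "\<eta> = cl t"
      by (auto simp: EC_simps(1))
    then show "\<xi> \<oplus>\<^bsub>EC\<^esub> \<eta> = \<eta> \<oplus>\<^bsub>EC\<^esub> \<xi>"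
      using E.cauchyD by (simp add: cl_add C E.M.a_comm)
    show "\<xi> \<oplus>\<^bsub>EC\<^esub> \<eta> \<in> carrier EC"
      using st by (simp add: cl_add C) (simp add: EC_simps(1) C)
  next
    show "\<zero>\<^bsub>EC\<^esub> \<in> carrier EC" using zero by (simp add: EC_simps(1,2))
    fix \<xi> assume "\<xi> \<in> carrier EC"
    then obtain s where "s \<in> Cs" "\<xi> = cl s" by (auto simp: EC_simps(1))
    then show "\<zero>\<^bsub>EC\<^esub> \<oplus>\<^bsub>EC\<^esub> \<xi> = \<xi>"
      using E.cauchyD by (simp add: cl_add zero EC_simps(2))
  qed
next
  fix a :: complex and \<xi> assume "\<xi> \<in> carrier EC"
  then obtain s where s: "s \<in> Cs" "\<xi> = cl s" by (auto simp: EC_simps(1))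
  then show "a \<odot>\<^bsub>EC\<^esub> \<xi> \<in> carrier EC"
    by (simp add: cl_scale) (simp add: EC_simps(1) E.cauchy_scale)
next
  fix a b :: complex and \<xi> assume "\<xi> \<in> carrier EC"
  then obtain s where s: "s \<in> Cs" "\<xi> = cl s" by (auto simp: EC_simps(1))
  then show "(a \<oplus>\<^bsub>complex_field\<^esub> b) \<odot>\<^bsub>EC\<^esub> \<xi> = a \<odot>\<^bsub>EC\<^esub> \<xi> \<oplus>\<^bsub>EC\<^esub> b \<odot>\<^bsub>EC\<^esub> \<xi>"
    "(a \<otimes>\<^bsub>complex_field\<^esub> b) \<odot>\<^bsub>EC\<^esub> \<xi> = a \<odot>\<^bsub>EC\<^esub> (b \<odot>\<^bsub>EC\<^esub> \<xi>)"
    using E.cauchyD[OF s(1)]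
    by (simp_all add: cl_scale cl_add E.cauchy_scale E.scale_add_left E.scale_scale)
next
  fix a :: complex and \<xi> \<eta> assume "\<xi> \<in> carrier EC" "\<eta> \<in> carrier EC"
  then obtain s t where "s \<in> Cs" "\<xi> = cl s" "t \<in> Cs" "\<eta> = cl t"
    by (auto simp: EC_simps(1))
  then show "a \<odot>\<^bsub>EC\<^esub> (\<xi> \<oplus>\<^bsub>EC\<^esub> \<eta>) = a \<odot>\<^bsub>EC\<^esub> \<xi> \<oplus>\<^bsub>EC\<^esub> a \<odot>\<^bsub>EC\<^esub> \<eta>"
    using E.cauchyD by (simp add: cl_scale cl_add E.cauchy_scale E.cauchy_add E.scale_add_right)
next
  fix \<xi> assume "\<xi> \<in> carrier EC"
  then obtain s where "s \<in> Cs" "\<xi> = cl s" by (auto simp: EC_simps(1))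
  then show "\<one>\<^bsub>complex_field\<^esub> \<odot>\<^bsub>EC\<^esub> \<xi> = \<xi>"
    using E.cauchyD by (simp add: cl_scale)
qed

lemma EC_semi_hilbert: "semi_hilbert B EC"
proof (intro semi_hilbert.intro semi_hilbert_axioms.intro B.cstar_algebra_axioms EC_cvec)
  fix \<xi> b assume "\<xi> \<in> carrier EC" "b \<in> carrier B"
  then obtain s where s: "s \<in> Cs" "\<xi> = cl s" by (auto simp: EC_simps(1))
  show "ract EC \<xi> b \<in> carrier EC"
    using cl_ract[OF s(1) \<open>b \<in> carrier B\<close>] s(2) by (simp add: EC_simps(1))
next
  fix \<xi> \<eta> assume "\<xi> \<in> carrier EC" "\<eta> \<in> carrier EC"
  then obtain s t where st: "s \<in> Cs" "\<xi> = cl s" "t \<in> Cs" "\<eta> = cl t"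
    by (auto simp: EC_simps(1))
  note [simp] = E.cauchyD[OF st(1)] E.cauchyD[OF st(3)]
  show "ip EC \<xi> \<eta> \<in> carrier B" using tendsD(2)[OF conv_ip_cl[OF st(1,3)]] st by simp
  show "ip EC \<xi> (z \<odot>\<^bsub>EC\<^esub> \<eta>) = z \<odot>\<^bsub>B\<^esub> ip EC \<xi> \<eta>" for z
    using B.conv_unique[OF conv_ip_cl[OF st(1) E.cauchy_scale[OF st(3), of z]]] B.conv_scale[OF conv_ip_cl[OF st(1,3)], of z]
    by (simp add: st cl_scale ip_smult)
  show "ip EC \<xi> (ract EC \<eta> b) = ip EC \<xi> \<eta> \<otimes>\<^bsub>B\<^esub> b" if "b \<in> carrier B" for b
    using B.conv_unique[OF conv_ip_cl[OF st(1) cl_ract(1)[OF st(3) that]]] that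
      B.conv_mult[OF conv_ip_cl[OF st(1,3)] B.conv_const[OF that]]
    by (simp add: st cl_ract ip_ract)
  show "invol B (ip EC \<xi> \<eta>) = ip EC \<eta> \<xi>"
    using B.conv_unique[OF conv_ip_cl[OF st(3,1)]] B.conv_invol[OF conv_ip_cl[OF st(1,3)]]
    by (simp add: st ip_invol)
  show "cstar_pos B (ip EC \<xi> \<xi>)"
    using B.cstar_pos_limit[OF conv_ip_cl[OF st(1,1)]] ip_pos by (simp add: st)
  fix \<eta>' assume "\<eta>' \<in> carrier EC"
  then obtain u where u: "u \<in> Cs" "\<eta>' = cl u" by (auto simp: EC_simps(1))
  note [simp] = E.cauchyD[OF u(1)]
  show "ip EC \<xi> (\<eta> \<oplus>\<^bsub>EC\<^esub> \<eta>') = ip EC \<xi> \<eta> \<oplus>\<^bsub>B\<^esub> ip EC \<xi> \<eta>'"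
    using B.conv_unique[OF conv_ip_cl[OF st(1) E.cauchy_add[OF st(3) u(1)]]]
      B.conv_add[OF conv_ip_cl[OF st(1,3)] conv_ip_cl[OF st(1) u(1)]]
    by (simp add: st u cl_add ip_add)
qed

interpretation EC: semi_hilbert B EC
  by (rule EC_semi_hilbert)

lemma cl_closed: "s \<in> Cs \<Longrightarrow> cl s \<in> carrier EC"
  by (simp add: EC_simps(1))

lemma emb_closed [simp]: "x \<in> carrier E \<Longrightarrow> emb x \<in> carrier EC"
  by (intro cl_closed E.cauchy_const)

lemma emb_linear: "linear_map E EC emb"
  by (auto simp: linear_map_def cl_add cl_scale E.cauchy_const)

lemma emb_diff: "x \<in> carrier E \<Longrightarrow> y \<in> carrier E \<Longrightarrow> emb (x \<ominus>\<^bsub>E\<^esub> y) = emb x \<ominus>\<^bsub>EC\<^esub> emb y"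
  by (rule linear_map_diff[OF E.cvec_axioms EC_cvec emb_linear])

lemma emb_ip: "x \<in> carrier E \<Longrightarrow> y \<in> carrier E \<Longrightarrow> ip EC (emb x) (emb y) = ip E x y"
  using B.conv_unique[OF conv_ip_cl[OF E.cauchy_const E.cauchy_const] B.conv_const] by simp

lemma emb_norm: "x \<in> carrier E \<Longrightarrow> hnorm B EC (emb x) = hnorm B E x"
  by (rule EC.hnorm_isometry) (rule emb_ip)

lemma norm_cl:
  assumes s: "s \<in> Cs"
  shows "(\<lambda>n. hnorm B E (s n)) \<longlonglongrightarrow> hnorm B EC (cl s)"
  using tendsto_real_sqrt[OF B.conv_norm[OF conv_ip_cl[OF s s]]] by (simp add: hnorm_def)

lemma cl_diff_emb:
  assumes s: "s \<in> Cs" and x: "x \<in> carrier E"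
  shows "cl s \<ominus>\<^bsub>EC\<^esub> emb x = cl (\<lambda>n. s n \<ominus>\<^bsub>E\<^esub> x)" "(\<lambda>n. s n \<ominus>\<^bsub>E\<^esub> x) \<in> Cs"
proof -
  note [simp] = E.cauchyD[OF s] x
  have xc: "(\<lambda>n. (-1) \<odot>\<^bsub>E\<^esub> x) \<in> Cs" by (rule E.cauchy_const) simp
  have "cl s \<ominus>\<^bsub>EC\<^esub> emb x = cl s \<oplus>\<^bsub>EC\<^esub> cl (\<lambda>n. (-1) \<odot>\<^bsub>E\<^esub> x)"
    using EC.E.diff_eq_scale[OF cl_closed[OF s] emb_closed[OF x]] cl_scale[OF E.cauchy_const[OF x], of "-1"] by simp
  also have "\<dots> = cl (\<lambda>n. s n \<oplus>\<^bsub>E\<^esub> (-1) \<odot>\<^bsub>E\<^esub> x)" by (rule cl_add[OF s xc])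
  finally show "cl s \<ominus>\<^bsub>EC\<^esub> emb x = cl (\<lambda>n. s n \<ominus>\<^bsub>E\<^esub> x)" by (simp add: E.diff_eq_scale)
  show "(\<lambda>n. s n \<ominus>\<^bsub>E\<^esub> x) \<in> Cs" using E.cauchy_add[OF s xc] by (simp add: E.diff_eq_scale)
qed

lemma cl_emb_dist:
  assumes s: "s \<in> Cs" and N: "\<And>m. m \<ge> N \<Longrightarrow> hnorm B E (s m \<ominus>\<^bsub>E\<^esub> s N) \<le> e"
  shows "hnorm B EC (cl s \<ominus>\<^bsub>EC\<^esub> emb (s N)) \<le> e"
proof -
  have "(\<lambda>n. hnorm B E (s n \<ominus>\<^bsub>E\<^esub> s N)) \<longlonglongrightarrow> hnorm B EC (cl s \<ominus>\<^bsub>EC\<^esub> emb (s N))"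
    using norm_cl[OF cl_diff_emb(2)[OF s]] cl_diff_emb(1)[OF s] E.cauchyD[OF s] by simp
  then show ?thesis by (rule LIMSEQ_le_const2) (use N in blast)
qed

lemma emb_conv:
  assumes s: "s \<in> Cs"
  shows "EC.E.conv (\<lambda>n. emb (s n)) (cl s)"
  unfolding tends_def
proof (intro conjI allI)
  note [simp] = E.cauchyD[OF s] cl_closed[OF s]
  show "emb (s n) \<in> carrier EC" "cl s \<in> carrier EC" for n by simp_all
  show "(\<lambda>n. hnorm B EC (emb (s n) \<ominus>\<^bsub>EC\<^esub> cl s)) \<longlonglongrightarrow> 0"
  proof (rule LIMSEQ_I)
    fix e :: real assume "e > 0"
    then have "e / 2 > 0" by simp
    then obtain N where N: "\<And>m n. m \<ge> N \<Longrightarrow> n \<ge> N \<Longrightarrow> hnorm B E (s m \<ominus>\<^bsub>E\<^esub> s n) < e / 2"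
      using E.cauchyE[OF s] by metis
    have "hnorm B EC (emb (s n) \<ominus>\<^bsub>EC\<^esub> cl s) < e" if "n \<ge> N" for n
    proof -
      have "hnorm B EC (cl s \<ominus>\<^bsub>EC\<^esub> emb (s n)) \<le> e / 2"
        by (rule cl_emb_dist[OF s]) (use N that in \<open>auto intro: less_imp_le\<close>)
      then show ?thesis
        using EC.E.norm_diff_commute[of "cl s" "emb (s n)"] \<open>e > 0\<close> by simp
    qed
    then show "\<exists>N. \<forall>n\<ge>N. norm (hnorm B EC (emb (s n) \<ominus>\<^bsub>EC\<^esub> cl s) - 0) < e"
      by (intro exI[of _ N]) simp
  qed
qed

lemma EC_dense:
  assumes \<xi>: "\<xi> \<in> carrier EC"
  obtains s where "s \<in> Cs" "\<xi> = cl s" "EC.E.conv (\<lambda>n. emb (s n)) \<xi>"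
proof -
  obtain s where "s \<in> Cs" "\<xi> = cl s" using \<xi> by (auto simp: EC_simps(1))
  then show thesis using that emb_conv by blast
qed

text \<open>
  Each member of a Cauchy sequence of classes is approximated by the class of a constant sequence.  The
  constants form a Cauchy sequence, and its class is the limit.
\<close>

theorem completion_hilbert: "hilbert_cs B EC"
proof (intro hilbert_cs.intro hilbert_cs_axioms.intro EC.semi_hilbert_cs_axioms)
  fix \<xi> assume "\<xi> \<in> carrier EC" and null: "ip EC \<xi> \<xi> = \<zero>\<^bsub>B\<^esub>"
  then obtain s where s: "s \<in> Cs" "\<xi> = cl s" by (auto simp: EC_simps(1))
  have "(\<lambda>n. hnorm B E (s n)) \<longlonglongrightarrow> 0"
    using norm_cl[OF s(1)] null s(2) by (simp add: hnorm_def)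
  then have "equi s (\<lambda>_. \<zero>\<^bsub>E\<^esub>)"
    using E.cauchyD[OF s(1)] by (simp add: equi_def E.diff_eq_scale)
  then show "\<xi> = \<zero>\<^bsub>EC\<^esub>"
    using cl_eq_iff[OF s(1) E.cauchy_const] s(2) by (simp add: EC_simps(2))
next
  show "norm_complete EC (hnorm B EC)"
    unfolding norm_complete_def
  proof
    fix X assume X: "X \<in> cauchy_seqs EC (hnorm B EC)"
    have "\<exists>x\<in>carrier E. hnorm B EC (X n \<ominus>\<^bsub>EC\<^esub> emb x) \<le> inverse (Suc n)" for n
    proof -
      obtain s where s: "s \<in> Cs" "X n = cl s" using EC.E.cauchyD[OF X, of n] by (auto simp: EC_simps(1))
      have "inverse (real (Suc n)) > 0" by simp
      then obtain N where "\<And>m k. m \<ge> N \<Longrightarrow> k \<ge> N \<Longrightarrow> hnorm B E (s m \<ominus>\<^bsub>E\<^esub> s k) < inverse (Suc n)"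
        using E.cauchyE[OF s(1)] by metis
      then have "hnorm B EC (cl s \<ominus>\<^bsub>EC\<^esub> emb (s N)) \<le> inverse (Suc n)"
        by (intro cl_emb_dist s less_imp_le) simp
      then show ?thesis using s E.cauchyD[OF s(1)] by auto
    qed
    then obtain x where x: "\<And>n. x n \<in> carrier E" "\<And>n. hnorm B EC (X n \<ominus>\<^bsub>EC\<^esub> emb (x n)) \<le> inverse (Suc n)"
      by metis
    note [simp] = x(1) EC.E.cauchyD[OF X]
    have "x \<in> Cs"
    proof (rule E.cauchyI)
      fix e :: real assume e: "e > 0"
      then have e3: "e / 3 > 0" by simp
      obtain N where N: "\<And>m n. m \<ge> N \<Longrightarrow> n \<ge> N \<Longrightarrow> hnorm B EC (X m \<ominus>\<^bsub>EC\<^esub> X n) < e / 3"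
        using EC.E.cauchyE[OF X e3] by metis
      obtain M where M: "inverse (real (Suc M)) < e / 3" using reals_Archimedean[OF e3] by blast
      have small: "hnorm B EC (X n \<ominus>\<^bsub>EC\<^esub> emb (x n)) < e / 3" if "n \<ge> M" for n
      proof -
        have "inverse (real (Suc n)) \<le> inverse (real (Suc M))" using that by (simp add: field_simps)
        then show ?thesis using x(2)[of n] M by linarith
      qed
      have "hnorm B E (x m \<ominus>\<^bsub>E\<^esub> x n) < e" if "m \<ge> max M N" "n \<ge> max M N" for m n
      proof -
        have "hnorm B E (x m \<ominus>\<^bsub>E\<^esub> x n) = hnorm B EC (emb (x m) \<ominus>\<^bsub>EC\<^esub> emb (x n))"
          using emb_norm[of "x m \<ominus>\<^bsub>E\<^esub> x n"] emb_diff[of "x m" "x n"] by simp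
        also have "\<dots> \<le> hnorm B EC (emb (x m) \<ominus>\<^bsub>EC\<^esub> X m) + hnorm B EC (X m \<ominus>\<^bsub>EC\<^esub> emb (x n))"
          by (rule EC.E.norm_triangle3) simp_all
        also have "hnorm B EC (X m \<ominus>\<^bsub>EC\<^esub> emb (x n)) \<le> hnorm B EC (X m \<ominus>\<^bsub>EC\<^esub> X n) + hnorm B EC (X n \<ominus>\<^bsub>EC\<^esub> emb (x n))"
          by (rule EC.E.norm_triangle3) simp_all
        finally show ?thesis
          using small[of m] small[of n] N[of m n] that EC.E.norm_diff_commute[of "emb (x m)" "X m"] by simp
      qed
      then show "\<exists>N. \<forall>m\<ge>N. \<forall>n\<ge>N. hnorm B E (x m \<ominus>\<^bsub>E\<^esub> x n) < e" by blast
    qed simp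
    then have lim: "EC.E.conv (\<lambda>n. emb (x n)) (cl x)" by (rule emb_conv)
    have "EC.E.conv (\<lambda>n. X n \<ominus>\<^bsub>EC\<^esub> emb (x n)) \<zero>\<^bsub>EC\<^esub>"
      by (rule EC.E.convI[OF _ _ _ LIMSEQ_inverse_real_of_nat])
        (use x(2) in \<open>simp_all add: EC.E.diff_eq_scale del: of_nat_Suc\<close>)
    from EC.E.conv_add[OF this lim]
    have "EC.E.conv (\<lambda>n. (X n \<ominus>\<^bsub>EC\<^esub> emb (x n)) \<oplus>\<^bsub>EC\<^esub> emb (x n)) (cl x)"
      using tendsD(2)[OF lim] by simp
    moreover have "(X n \<ominus>\<^bsub>EC\<^esub> emb (x n)) \<oplus>\<^bsub>EC\<^esub> emb (x n) = X n" for n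
      by (rule EC.E.lin_eqI, (rule EC.E.lin | simp add: lookup_add algebra_simps)+)
    ultimately have "EC.E.conv X (cl x)" by simp
    then show "\<exists>\<xi>\<in>carrier EC. (\<lambda>n. hnorm B EC (X n \<ominus>\<^bsub>EC\<^esub> \<xi>)) \<longlonglongrightarrow> 0"
      by (auto simp: tends_def)
  qed
qed

lemma bounded_extension:
  assumes W: "hilbert_cs D W" and T: "linear_map E W T"
    and bd: "\<And>x. x \<in> carrier E \<Longrightarrow> hnorm D W (T x) \<le> K * hnorm B E x"
  obtains U where "linear_map EC W U" "U \<in> extensional (carrier EC)"
    "\<And>\<xi>. \<xi> \<in> carrier EC \<Longrightarrow> hnorm D W (U \<xi>) \<le> K * hnorm B EC \<xi>"
    "\<And>s. s \<in> Cs \<Longrightarrow> tends W (hnorm D W) (\<lambda>n. T (s n)) (U (cl s))"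
    "\<And>x. x \<in> carrier E \<Longrightarrow> U (emb x) = T x"
proof -
  interpret W: hilbert_cs D W by fact
  have TC: "(\<lambda>n. T (s n)) \<in> cauchy_seqs W (hnorm D W)" if "s \<in> Cs" for s
    using cauchy_bounded_map[OF E.seminormed_axioms W.E.seminormed_axioms T bd that] .
  define U where "U = (\<lambda>\<xi>\<in>carrier EC. SOME w. W.E.conv (\<lambda>n. T (class_rep \<xi> n)) w)"
  have U_rep: "W.E.conv (\<lambda>n. T (class_rep \<xi> n)) (U \<xi>)" if \<xi>: "\<xi> \<in> carrier EC" for \<xi>
  proof -
    have "class_rep \<xi> \<in> Cs" using \<xi> class_rep_cl by (auto simp: EC_simps(1))
    then obtain w where "W.E.conv (\<lambda>n. T (class_rep \<xi> n)) w" using W.E_convergent[OF TC] by metis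
    then show ?thesis using \<xi> by (simp add: U_def someI)
  qed
  have lim: "W.E.conv (\<lambda>n. T (s n)) (U (cl s))" if s: "s \<in> Cs" for s
  proof -
    let ?s = "class_rep (cl s)"
    note [simp] = E.cauchyD[OF s] E.cauchyD[OF class_rep_cl(1)[OF s]] linear_mapD(1)[OF T]
    have "W.E.conv (\<lambda>n. T (s n) \<ominus>\<^bsub>W\<^esub> T (?s n)) \<zero>\<^bsub>W\<^esub>"
    proof (rule W.E.convI)
      show "hnorm D W ((T (s n) \<ominus>\<^bsub>W\<^esub> T (?s n)) \<ominus>\<^bsub>W\<^esub> \<zero>\<^bsub>W\<^esub>) \<le> K * hnorm B E (s n \<ominus>\<^bsub>E\<^esub> ?s n)" for n
      proof -
        have "(T (s n) \<ominus>\<^bsub>W\<^esub> T (?s n)) \<ominus>\<^bsub>W\<^esub> \<zero>\<^bsub>W\<^esub> = T (s n \<ominus>\<^bsub>E\<^esub> ?s n)"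
          using linear_map_diff[OF E.cvec_axioms W.E.cvec_axioms T, of "s n" "?s n"]
          by (simp add: W.E.diff_eq_scale)
        then show ?thesis using bd[of "s n \<ominus>\<^bsub>E\<^esub> ?s n"] by simp
      qed
      show "(\<lambda>n. K * hnorm B E (s n \<ominus>\<^bsub>E\<^esub> ?s n)) \<longlonglongrightarrow> 0"
        using class_rep_cl(2)[OF s] unfolding equi_def by (rule tendsto_mult_right_zero)
    qed simp_all
    from W.E.conv_add[OF U_rep[OF cl_closed[OF s]] this]
    have "W.E.conv (\<lambda>n. T (?s n) \<oplus>\<^bsub>W\<^esub> (T (s n) \<ominus>\<^bsub>W\<^esub> T (?s n))) (U (cl s))"
      using tendsD(2)[OF U_rep[OF cl_closed[OF s]]] by simp
    moreover have "T (?s n) \<oplus>\<^bsub>W\<^esub> (T (s n) \<ominus>\<^bsub>W\<^esub> T (?s n)) = T (s n)" for n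
      by (rule W.E.lin_eqI, (rule W.E.lin | simp add: lookup_add algebra_simps)+)
    ultimately show ?thesis by simp
  qed
  have U_emb: "U (emb x) = T x" if x: "x \<in> carrier E" for x
    using W.E.conv_unique[OF lim[OF E.cauchy_const[OF x]] W.E.conv_const] linear_mapD(1)[OF T x] by simp
  have U_lin: "linear_map EC W U"
    unfolding linear_map_def
  proof (intro conjI ballI allI Pi_I)
    fix \<xi> \<eta> c assume "\<xi> \<in> carrier EC" "\<eta> \<in> carrier EC"
    then obtain s t where st: "s \<in> Cs" "\<xi> = cl s" "t \<in> Cs" "\<eta> = cl t" by (auto simp: EC_simps(1))
    show "U (\<xi> \<oplus>\<^bsub>EC\<^esub> \<eta>) = U \<xi> \<oplus>\<^bsub>W\<^esub> U \<eta>"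
      using W.E.conv_unique[OF lim[OF E.cauchy_add[OF st(1,3)]]] W.E.conv_add[OF lim[OF st(1)] lim[OF st(3)]]
        E.cauchyD[OF st(1)] E.cauchyD[OF st(3)]
      by (simp add: st cl_add linear_mapD(2)[OF T])
  next
    fix \<xi> assume "\<xi> \<in> carrier EC"
    then obtain s where s: "s \<in> Cs" "\<xi> = cl s" by (auto simp: EC_simps(1))
    show "U \<xi> \<in> carrier W" using tendsD(2)[OF lim[OF s(1)]] s(2) by simp
    show "U (c \<odot>\<^bsub>EC\<^esub> \<xi>) = c \<odot>\<^bsub>W\<^esub> U \<xi>" for c
      using W.E.conv_unique[OF lim[OF E.cauchy_scale[OF s(1)]]] W.E.conv_scale[OF lim[OF s(1)], of c]
        E.cauchyD[OF s(1)]
      by (simp add: s cl_scale linear_mapD(3)[OF T])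
  qed
  have U_bd: "hnorm D W (U \<xi>) \<le> K * hnorm B EC \<xi>" if \<xi>: "\<xi> \<in> carrier EC" for \<xi>
  proof -
    obtain s where s: "s \<in> Cs" "\<xi> = cl s" using \<xi> by (auto simp: EC_simps(1))
    show ?thesis
      using LIMSEQ_le[OF W.E.conv_norm[OF lim[OF s(1)]] tendsto_mult_left[OF norm_cl[OF s(1)], of K]]
        bd E.cauchyD[OF s(1)] s(2) by simp
  qed
  show thesis
  proof (rule that[OF U_lin _ U_bd lim U_emb])
    show "U \<in> extensional (carrier EC)" unfolding U_def by (rule restrict_extensional)
  qed
qed

end

section \<open>Sesquilinear forms on free vector spaces\<close>

text \<open>The sesquilinear extension of a kernel from generators to the free vector spaces.\<close>

definition form ::
  "('c, 'm) cstar_scheme \<Rightarrow> ('i \<Rightarrow> 'j \<Rightarrow> 'c) \<Rightarrow> ('i \<Rightarrow>\<^sub>0 complex) \<Rightarrow> ('j \<Rightarrow>\<^sub>0 complex) \<Rightarrow> 'c" where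
  "form C k s t = (\<Oplus>\<^bsub>C\<^esub>p\<in>Poly_Mapping.keys s. \<Oplus>\<^bsub>C\<^esub>q\<in>Poly_Mapping.keys t.
     (cnj (Poly_Mapping.lookup s p) * Poly_Mapping.lookup t q) \<odot>\<^bsub>C\<^esub> k p q)"

lemma keys_free_map: "Poly_Mapping.keys (free_map g t) \<subseteq> g ` Poly_Mapping.keys t"
  unfolding free_map_def by (rule keys_sum_single)

lemma free_map_add: "free_map g (s + t) = free_map g s + free_map g t"
  unfolding free_map_def
  by (rule setsum_keys_plus_distrib[where f = "\<lambda>p c. Poly_Mapping.single (g p) c"])
    (simp_all add: single_add)

lemma free_map_scale: "free_map g (free_scale z t) = free_scale z (free_map g t)"
proof -
  have "free_map g (free_scale z t)
      = (\<Sum>p\<in>Poly_Mapping.keys t. Poly_Mapping.single (g p) (z * Poly_Mapping.lookup t p))"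
    unfolding free_map_def lookup_free_scale
    by (rule sum.mono_neutral_left) (use keys_free_scale[of z t] in \<open>auto simp: in_keys_iff\<close>)
  also have "\<dots> = free_scale z (free_map g t)"
    by (rule poly_mapping_eqI)
      (simp add: free_map_def lookup_sum sum_distrib_left lookup_single when_def if_distrib cong: if_cong)
  finally show ?thesis .
qed

lemma free_map_single: "free_map g (Poly_Mapping.single p c) = Poly_Mapping.single (g p) c"
  by (simp add: free_map_def)

lemma (in cvec) lin_ext_free_map:
  assumes "\<And>p. p \<in> Poly_Mapping.keys t \<Longrightarrow> h (g p) \<in> carrier V"
  shows "lin_ext V h (free_map g t) = lin_ext V (\<lambda>p. h (g p)) t"
  unfolding free_map_def lin_ext_def[of V "\<lambda>p. h (g p)"]
  using lin_ext_sum[of "Poly_Mapping.keys t" h g "Poly_Mapping.lookup t"] assms by simp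

lemma (in cvec) finsum_swap:
  assumes "finite P" "finite Q" "\<And>p q. p \<in> P \<Longrightarrow> q \<in> Q \<Longrightarrow> f p q \<in> carrier V"
  shows "(\<Oplus>p\<in>P. \<Oplus>q\<in>Q. f p q) = (\<Oplus>q\<in>Q. \<Oplus>p\<in>P. f p q)"
  using assms(1,3)
proof (induction P rule: finite_induct)
  case (insert x P)
  have "(\<Oplus>p\<in>insert x P. \<Oplus>q\<in>Q. f p q) = (\<Oplus>q\<in>Q. f x q) \<oplus> (\<Oplus>p\<in>P. \<Oplus>q\<in>Q. f p q)"
    using insert by (intro M.finsum_insert) (auto intro!: M.finsum_closed)
  also have "\<dots> = (\<Oplus>q\<in>Q. f x q) \<oplus> (\<Oplus>q\<in>Q. \<Oplus>p\<in>P. f p q)"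
    using insert by simp
  also have "\<dots> = (\<Oplus>q\<in>Q. f x q \<oplus> (\<Oplus>p\<in>P. f p q))"
    using insert by (intro M.finsum_addf[symmetric]) (auto intro!: M.finsum_closed)
  also have "\<dots> = (\<Oplus>q\<in>Q. \<Oplus>p\<in>insert x P. f p q)"
  proof (rule M.finsum_cong')
    show "(\<lambda>q. \<Oplus>p\<in>insert x P. f p q) \<in> Q \<rightarrow> carrier V"
      using insert by (auto intro!: M.finsum_closed)
    fix q assume "q \<in> Q"
    then show "f x q \<oplus> (\<Oplus>p\<in>P. f p q) = (\<Oplus>p\<in>insert x P. f p q)"
      using insert by (intro M.finsum_insert[symmetric]) auto
  qed simp
  finally show ?case .
qed (simp add: M.add.finprod_one_eqI)

lemma (in seminormed) conv_finsum:
  assumes "finite K" "\<And>i. i \<in> K \<Longrightarrow> conv (s i) (x i)"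
  shows "conv (\<lambda>n. \<Oplus>i\<in>K. s i n) (\<Oplus>i\<in>K. x i)"
  using assms
proof (induction K rule: finite_induct)
  case (insert i K)
  have c: "s j n \<in> carrier V" "x j \<in> carrier V" if "j \<in> insert i K" for j n
    using tendsD(1,2)[OF insert.prems[OF that]] by simp_all
  have "(\<Oplus>i\<in>insert i K. s i n) = s i n \<oplus> (\<Oplus>i\<in>K. s i n)" for n
    using insert.hyps c by (intro M.finsum_insert) simp_all
  moreover have "(\<Oplus>i\<in>insert i K. x i) = x i \<oplus> (\<Oplus>i\<in>K. x i)"
    using insert.hyps c by (intro M.finsum_insert) simp_all
  ultimately show ?case using insert by (simp add: conv_add)
qed (simp add: conv_const)

context cstar_algebra
begin

lemma cstar_pos_scale:
  assumes "cstar_pos A a" "c \<ge> 0"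
  shows "cstar_pos A (complex_of_real c \<odot> a)"
proof -
  obtain d where d: "d \<in> carrier A" "a = invol A d \<otimes> d" using assms(1) by (auto simp: cstar_pos_def)
  have "complex_of_real (sqrt c) * complex_of_real (sqrt c) = complex_of_real c"
    using assms(2) by (metis of_real_mult real_sqrt_mult_self abs_of_nonneg)
  then have "complex_of_real c \<odot> a = invol A (complex_of_real (sqrt c) \<odot> d) \<otimes> (complex_of_real (sqrt c) \<odot> d)"
    using d by (simp add: invol_smult mult_smult_l mult_smult_r scale_scale)
  then show ?thesis using d(1) cstar_pos_invol_mult[of "complex_of_real (sqrt c) \<odot> d"] by simp
qed

lemma invol_finsum:
  assumes "finite K" "\<And>i. i \<in> K \<Longrightarrow> f i \<in> carrier A"
  shows "invol A (\<Oplus>i\<in>K. f i) = (\<Oplus>i\<in>K. invol A (f i))"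
  using assms
proof (induction K rule: finite_induct)
  case (insert i K)
  have "(\<Oplus>i\<in>insert i K. f i) = f i \<oplus> (\<Oplus>i\<in>K. f i)"
    "(\<Oplus>i\<in>insert i K. invol A (f i)) = invol A (f i) \<oplus> (\<Oplus>i\<in>K. invol A (f i))"
    using insert by (intro M.finsum_insert; auto)+
  moreover have "(\<Oplus>i\<in>K. f i) \<in> carrier A" using insert by (intro M.finsum_closed) auto
  ultimately show ?case using insert by (simp add: invol_add)
qed simp

definition kernel_on :: "('i \<Rightarrow> 'j \<Rightarrow> 'a) \<Rightarrow> ('i \<Rightarrow>\<^sub>0 complex) \<Rightarrow> ('j \<Rightarrow>\<^sub>0 complex) \<Rightarrow> bool" where
  "kernel_on k s t \<longleftrightarrow> (\<forall>p\<in>Poly_Mapping.keys s. \<forall>q\<in>Poly_Mapping.keys t. k p q \<in> carrier A)"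

lemma form_closed: "kernel_on k s t \<Longrightarrow> form A k s t \<in> carrier A"
  unfolding form_def kernel_on_def by (intro M.finsum_closed Pi_I) simp

lemma form_inner_closed: "kernel_on k s t \<Longrightarrow> p \<in> Poly_Mapping.keys s \<Longrightarrow>
    (\<Oplus>q\<in>Poly_Mapping.keys t. (cnj (Poly_Mapping.lookup s p) * Poly_Mapping.lookup t q) \<odot> k p q) \<in> carrier A"
  unfolding kernel_on_def by (intro M.finsum_closed Pi_I) simp

lemma form_cong:
  assumes "\<And>p q. p \<in> Poly_Mapping.keys s \<Longrightarrow> q \<in> Poly_Mapping.keys t \<Longrightarrow> k p q = l p q"
    and "kernel_on l s t"
  shows "form A k s t = form A l s t"
  unfolding form_def
  by (intro M.finsum_cong' refl Pi_I) (use assms in \<open>auto intro!: form_inner_closed M.finsum_cong' simp: kernel_on_def\<close>)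

lemma form_alt:
  assumes "kernel_on k s t"
  shows "form A k s t = (\<Oplus>p\<in>Poly_Mapping.keys s. cnj (Poly_Mapping.lookup s p) \<odot> lin_ext A (k p) t)"
  unfolding form_def
proof (intro M.finsum_cong' refl Pi_I)
  fix p assume p: "p \<in> Poly_Mapping.keys s"
  then show "cnj (Poly_Mapping.lookup s p) \<odot> lin_ext A (k p) t \<in> carrier A"
    using assms by (intro scale_closed lin_ext_closed) (simp add: kernel_on_def)
  have "(\<Oplus>q\<in>Poly_Mapping.keys t. (cnj (Poly_Mapping.lookup s p) * Poly_Mapping.lookup t q) \<odot> k p q)
      = (\<Oplus>q\<in>Poly_Mapping.keys t. cnj (Poly_Mapping.lookup s p) \<odot> (Poly_Mapping.lookup t q \<odot> k p q))"
    using assms p by (intro M.finsum_cong' refl) (auto simp: kernel_on_def scale_scale)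
  also have "\<dots> = cnj (Poly_Mapping.lookup s p) \<odot> lin_ext A (k p) t"
    unfolding lin_ext_def using assms p
    by (intro finsum_smult_ldistr[symmetric]) (auto simp: kernel_on_def)
  finally show "(\<Oplus>q\<in>Poly_Mapping.keys t. (cnj (Poly_Mapping.lookup s p) * Poly_Mapping.lookup t q) \<odot> k p q)
      = cnj (Poly_Mapping.lookup s p) \<odot> lin_ext A (k p) t" .
qed

lemma form_invol:
  assumes "kernel_on k s t"
  shows "invol A (form A k s t) = form A (\<lambda>q p. invol A (k p q)) t s"
proof -
  have "invol A (form A k s t) = (\<Oplus>p\<in>Poly_Mapping.keys s. \<Oplus>q\<in>Poly_Mapping.keys t.
      (cnj (Poly_Mapping.lookup t q) * Poly_Mapping.lookup s p) \<odot> invol A (k p q))"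
    unfolding form_def using assms form_inner_closed[OF assms]
    by (subst invol_finsum)
      (auto simp: kernel_on_def invol_finsum invol_smult mult.commute intro!: M.finsum_cong' M.finsum_closed)
  also have "\<dots> = form A (\<lambda>q p. invol A (k p q)) t s"
    unfolding form_def using assms by (intro finsum_swap) (auto simp: kernel_on_def)
  finally show ?thesis .
qed

lemma form_add_right:
  assumes "kernel_on k s t" "kernel_on k s u"
  shows "form A k s (t + u) = form A k s t \<oplus> form A k s u"
proof -
  have ktu: "kernel_on k s (t + u)"
    using assms Poly_Mapping.keys_add[of t u] by (auto simp: kernel_on_def)
  have "form A k s (t + u) = (\<Oplus>p\<in>Poly_Mapping.keys s. cnj (Poly_Mapping.lookup s p) \<odot> lin_ext A (k p) t
      \<oplus> cnj (Poly_Mapping.lookup s p) \<odot> lin_ext A (k p) u)"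
    unfolding form_alt[OF ktu]
  proof (intro M.finsum_cong' refl Pi_I)
    fix p assume "p \<in> Poly_Mapping.keys s"
    then have k: "\<And>q. q \<in> Poly_Mapping.keys t \<Longrightarrow> k p q \<in> carrier A" "\<And>q. q \<in> Poly_Mapping.keys u \<Longrightarrow> k p q \<in> carrier A"
      using assms by (auto simp: kernel_on_def)
    show "cnj (Poly_Mapping.lookup s p) \<odot> lin_ext A (k p) t \<oplus> cnj (Poly_Mapping.lookup s p) \<odot> lin_ext A (k p) u \<in> carrier A"
      by (intro M.a_closed scale_closed lin_ext_closed k)
    have "lin_ext A (k p) (t + u) = lin_ext A (k p) t \<oplus> lin_ext A (k p) u"
      by (rule lin_ext_add) (use k in blast)
    then show "cnj (Poly_Mapping.lookup s p) \<odot> lin_ext A (k p) (t + u)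
        = cnj (Poly_Mapping.lookup s p) \<odot> lin_ext A (k p) t \<oplus> cnj (Poly_Mapping.lookup s p) \<odot> lin_ext A (k p) u"
      using lin_ext_closed[of t "k p"] lin_ext_closed[of u "k p"] k by (simp add: scale_add_right)
  qed
  also have "\<dots> = form A k s t \<oplus> form A k s u"
    unfolding form_alt[OF assms(1)] form_alt[OF assms(2)]
    using assms by (intro M.finsum_addf) (auto simp: kernel_on_def)
  finally show ?thesis .
qed

lemma form_scale_right:
  assumes k: "kernel_on k s t"
  shows "form A k s (free_scale z t) = z \<odot> form A k s t"
proof -
  have kz: "kernel_on k s (free_scale z t)"
    using k keys_free_scale[of z t] by (auto simp: kernel_on_def)
  have "form A k s (free_scale z t) = (\<Oplus>p\<in>Poly_Mapping.keys s. z \<odot> (cnj (Poly_Mapping.lookup s p) \<odot> lin_ext A (k p) t))"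
    unfolding form_alt[OF kz]
    using k by (intro M.finsum_cong' refl Pi_I) (auto simp: kernel_on_def lin_ext_scale scale_scale mult.commute)
  also have "\<dots> = z \<odot> form A k s t"
    unfolding form_alt[OF k] using k by (intro finsum_smult_ldistr[symmetric]) (auto simp: kernel_on_def)
  finally show ?thesis .
qed

lemma form_free_map_right:
  assumes "kernel_on k s (free_map g t)" "kernel_on (\<lambda>p q. k p (g q)) s t"
  shows "form A k s (free_map g t) = form A (\<lambda>p q. k p (g q)) s t"
  unfolding form_alt[OF assms(1)] form_alt[OF assms(2)]
  using assms(2) by (intro M.finsum_cong' refl Pi_I) (auto simp: kernel_on_def lin_ext_free_map)

lemma form_free_map_left:
  assumes "kernel_on k (free_map g s) t" "kernel_on (\<lambda>p q. k (g p) q) s t"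
  shows "form A k (free_map g s) t = form A (\<lambda>p q. k (g p) q) s t"
proof -
  have "form A (\<lambda>q p. invol A (k p q)) t (free_map g s) = form A (\<lambda>q p. invol A (k (g p) q)) t s"
    by (rule form_free_map_right) (use assms in \<open>auto simp: kernel_on_def\<close>)
  then have "invol A (form A k (free_map g s) t) = invol A (form A (\<lambda>p q. k (g p) q) s t)"
    using form_invol[OF assms(1)] form_invol[OF assms(2)] by simp
  then have "invol A (invol A (form A k (free_map g s) t)) = invol A (invol A (form A (\<lambda>p q. k (g p) q) s t))"
    by simp
  then show ?thesis using form_closed[OF assms(1)] form_closed[OF assms(2)] by simp
qed

lemma form_linear_map:
  assumes "linear_map A A T" "kernel_on k s t"
  shows "T (form A k s t) = form A (\<lambda>p q. T (k p q)) s t"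
proof -
  have "T (form A k s t) = (\<Oplus>p\<in>Poly_Mapping.keys s. T (\<Oplus>q\<in>Poly_Mapping.keys t.
      (cnj (Poly_Mapping.lookup s p) * Poly_Mapping.lookup t q) \<odot> k p q))"
    unfolding form_def
    by (rule linear_map_finsum[OF cvec_axioms cvec_axioms assms(1)]) (use form_inner_closed[OF assms(2)] in simp_all)
  also have "\<dots> = form A (\<lambda>p q. T (k p q)) s t"
    unfolding form_def
  proof (intro M.finsum_cong' refl Pi_I)
    fix p assume p: "p \<in> Poly_Mapping.keys s"
    have "T (\<Oplus>q\<in>Poly_Mapping.keys t. (cnj (Poly_Mapping.lookup s p) * Poly_Mapping.lookup t q) \<odot> k p q)
        = (\<Oplus>q\<in>Poly_Mapping.keys t. T ((cnj (Poly_Mapping.lookup s p) * Poly_Mapping.lookup t q) \<odot> k p q))"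
      using assms(2) p by (intro linear_map_finsum[OF cvec_axioms cvec_axioms assms(1)]) (auto simp: kernel_on_def)
    also have "\<dots> = (\<Oplus>q\<in>Poly_Mapping.keys t. (cnj (Poly_Mapping.lookup s p) * Poly_Mapping.lookup t q) \<odot> T (k p q))"
      using assms(2) p linear_mapD(1,3)[OF assms(1)] by (intro M.finsum_cong' refl Pi_I) (auto simp: kernel_on_def)
    finally show "T (\<Oplus>q\<in>Poly_Mapping.keys t. (cnj (Poly_Mapping.lookup s p) * Poly_Mapping.lookup t q) \<odot> k p q)
      = (\<Oplus>q\<in>Poly_Mapping.keys t. (cnj (Poly_Mapping.lookup s p) * Poly_Mapping.lookup t q) \<odot> T (k p q))" .
    show "(\<Oplus>q\<in>Poly_Mapping.keys t. (cnj (Poly_Mapping.lookup s p) * Poly_Mapping.lookup t q) \<odot> T (k p q)) \<in> carrier A"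
      using assms(2) p linear_mapD(1)[OF assms(1)] by (intro M.finsum_closed Pi_I) (auto simp: kernel_on_def)
  qed
  finally show ?thesis .
qed

lemma form_kernel_add:
  assumes "kernel_on k s t" "kernel_on l s t"
  shows "form A (\<lambda>p q. k p q \<oplus> l p q) s t = form A k s t \<oplus> form A l s t"
proof -
  have "form A (\<lambda>p q. k p q \<oplus> l p q) s t = (\<Oplus>p\<in>Poly_Mapping.keys s.
      (\<Oplus>q\<in>Poly_Mapping.keys t. (cnj (Poly_Mapping.lookup s p) * Poly_Mapping.lookup t q) \<odot> k p q) \<oplus>
      (\<Oplus>q\<in>Poly_Mapping.keys t. (cnj (Poly_Mapping.lookup s p) * Poly_Mapping.lookup t q) \<odot> l p q))"
    unfolding form_def
  proof (intro M.finsum_cong' refl Pi_I)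
    fix p assume p: "p \<in> Poly_Mapping.keys s"
    show "(\<Oplus>q\<in>Poly_Mapping.keys t. (cnj (Poly_Mapping.lookup s p) * Poly_Mapping.lookup t q) \<odot> k p q) \<oplus>
      (\<Oplus>q\<in>Poly_Mapping.keys t. (cnj (Poly_Mapping.lookup s p) * Poly_Mapping.lookup t q) \<odot> l p q) \<in> carrier A"
      by (intro M.a_closed form_inner_closed assms p)
    have "(\<Oplus>q\<in>Poly_Mapping.keys t. (cnj (Poly_Mapping.lookup s p) * Poly_Mapping.lookup t q) \<odot> (k p q \<oplus> l p q))
      = (\<Oplus>q\<in>Poly_Mapping.keys t. (cnj (Poly_Mapping.lookup s p) * Poly_Mapping.lookup t q) \<odot> k p q \<oplus>
        (cnj (Poly_Mapping.lookup s p) * Poly_Mapping.lookup t q) \<odot> l p q)"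
      using assms p by (intro M.finsum_cong' refl Pi_I) (auto simp: kernel_on_def scale_add_right)
    also have "\<dots> = (\<Oplus>q\<in>Poly_Mapping.keys t. (cnj (Poly_Mapping.lookup s p) * Poly_Mapping.lookup t q) \<odot> k p q) \<oplus>
      (\<Oplus>q\<in>Poly_Mapping.keys t. (cnj (Poly_Mapping.lookup s p) * Poly_Mapping.lookup t q) \<odot> l p q)"
      using assms p by (intro M.finsum_addf) (auto simp: kernel_on_def)
    finally show "(\<Oplus>q\<in>Poly_Mapping.keys t. (cnj (Poly_Mapping.lookup s p) * Poly_Mapping.lookup t q) \<odot> (k p q \<oplus> l p q))
      = (\<Oplus>q\<in>Poly_Mapping.keys t. (cnj (Poly_Mapping.lookup s p) * Poly_Mapping.lookup t q) \<odot> k p q) \<oplus>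
      (\<Oplus>q\<in>Poly_Mapping.keys t. (cnj (Poly_Mapping.lookup s p) * Poly_Mapping.lookup t q) \<odot> l p q)" .
  qed
  also have "\<dots> = form A k s t \<oplus> form A l s t"
    unfolding form_def using form_inner_closed[OF assms(1)] form_inner_closed[OF assms(2)]
    by (intro M.finsum_addf) auto
  finally show ?thesis .
qed

lemma form_kernel_scale:
  assumes "kernel_on k s t"
  shows "form A (\<lambda>p q. z \<odot> k p q) s t = z \<odot> form A k s t"
proof -
  have "linear_map A A (\<lambda>x. z \<odot> x)"
    by (auto simp: linear_map_def scale_add_right scale_scale mult.commute)
  from form_linear_map[OF this assms] show ?thesis by simp
qed

lemma form_kernel_diff:
  assumes "kernel_on k s t" "kernel_on l s t"
  shows "form A (\<lambda>p q. k p q \<ominus> l p q) s t = form A k s t \<ominus> form A l s t"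
proof -
  have l: "kernel_on (\<lambda>p q. (-1) \<odot> l p q) s t" using assms(2) by (auto simp: kernel_on_def)
  have "form A (\<lambda>p q. k p q \<ominus> l p q) s t = form A (\<lambda>p q. k p q \<oplus> (-1) \<odot> l p q) s t"
    using assms l by (intro form_cong) (auto simp: kernel_on_def diff_eq_scale)
  then show ?thesis
    using form_kernel_add[OF assms(1) l] form_kernel_scale[OF assms(2), of "-1"]
      form_closed[OF assms(1)] form_closed[OF assms(2)] by (simp add: diff_eq_scale)
qed

lemma form_kernel_zero: "form A (\<lambda>p q. \<zero>) s t = \<zero>"
  unfolding form_def by (simp add: M.add.finprod_one_eqI)

lemma form_kernel_finsum:
  assumes "finite Z" "\<And>z. z \<in> Z \<Longrightarrow> kernel_on (k z) s t"
  shows "form A (\<lambda>p q. \<Oplus>z\<in>Z. k z p q) s t = (\<Oplus>z\<in>Z. form A (k z) s t)"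
  using assms
proof (induction Z rule: finite_induct)
  case (insert z Z)
  have kz: "kernel_on (\<lambda>p q. \<Oplus>z\<in>Z. k z p q) s t"
    using insert by (auto simp: kernel_on_def intro!: M.finsum_closed)
  have "form A (\<lambda>p q. \<Oplus>z\<in>insert z Z. k z p q) s t = form A (\<lambda>p q. k z p q \<oplus> (\<Oplus>z\<in>Z. k z p q)) s t"
  proof (rule form_cong)
    show "kernel_on (\<lambda>p q. k z p q \<oplus> (\<Oplus>z\<in>Z. k z p q)) s t"
      using insert kz by (auto simp: kernel_on_def)
    fix p q assume "p \<in> Poly_Mapping.keys s" "q \<in> Poly_Mapping.keys t"
    then show "(\<Oplus>z\<in>insert z Z. k z p q) = k z p q \<oplus> (\<Oplus>z\<in>Z. k z p q)"
      using insert by (intro M.finsum_insert) (auto simp: kernel_on_def)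
  qed
  also have "\<dots> = form A (k z) s t \<oplus> (\<Oplus>z\<in>Z. form A (k z) s t)"
    using form_kernel_add[OF insert.prems[of z] kz] insert by simp
  also have "\<dots> = (\<Oplus>z\<in>insert z Z. form A (k z) s t)"
    using insert by (intro M.finsum_insert[symmetric]) (auto intro!: form_closed)
  finally show ?case .
qed (simp add: form_kernel_zero)

lemma form_conv:
  assumes "\<And>p q. p \<in> Poly_Mapping.keys s \<Longrightarrow> q \<in> Poly_Mapping.keys t \<Longrightarrow> conv (\<lambda>n. k n p q) (l p q)"
  shows "conv (\<lambda>n. form A (k n) s t) (form A l s t)"
  unfolding form_def by (intro conv_finsum finite_keys conv_scale assms)

end

context semi_hilbert
begin

lemma ip_linear: "x \<in> carrier E \<Longrightarrow> linear_map E B (ip E x)"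
  by (auto simp: linear_map_def ip_add ip_smult)

lemma ip_lin_ext:
  assumes f: "\<And>p. p \<in> Poly_Mapping.keys s \<Longrightarrow> f p \<in> carrier E"
    and g: "\<And>q. q \<in> Poly_Mapping.keys t \<Longrightarrow> g q \<in> carrier E"
  shows "ip E (lin_ext E f s) (lin_ext E g t) = form B (\<lambda>p q. ip E (f p) (g q)) s t"
proof -
  have k: "B.kernel_on (\<lambda>p q. ip E (f p) (g q)) s t" using f g by (auto simp: B.kernel_on_def)
  define y where "y = lin_ext E g t"
  have [simp]: "y \<in> carrier E" using g by (simp add: y_def)
  have y: "ip E (f p) y = lin_ext B (\<lambda>q. ip E (f p) (g q)) t" if "p \<in> Poly_Mapping.keys s" for p
    unfolding y_def
    by (rule linear_map_lin_ext[OF E.cvec_axioms B.cvec_axioms ip_linear]) (use f g that in auto)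
  have "ip E (lin_ext E f s) y = invol B (ip E y (lin_ext E f s))"
    using f by (simp add: ip_invol)
  also have "ip E y (lin_ext E f s) = lin_ext B (\<lambda>p. ip E y (f p)) s"
    by (rule linear_map_lin_ext[OF E.cvec_axioms B.cvec_axioms ip_linear]) (use f in auto)
  also have "invol B \<dots> = (\<Oplus>\<^bsub>B\<^esub>p\<in>Poly_Mapping.keys s. invol B (Poly_Mapping.lookup s p \<odot>\<^bsub>B\<^esub> ip E y (f p)))"
    unfolding lin_ext_def by (rule B.invol_finsum) (use f in auto)
  also have "\<dots> = form B (\<lambda>p q. ip E (f p) (g q)) s t"
    unfolding B.form_alt[OF k]
    using f by (intro B.M.finsum_cong' refl Pi_I) (auto simp: B.invol_smult ip_invol y simp flip: y)
  finally show ?thesis by (simp add: y_def)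
qed

end

section \<open>Tensor products\<close>

lemma pre_tensor_simps:
  "carrier (pre_tensor C E F \<phi>) = {t. Poly_Mapping.keys t \<subseteq> carrier E \<times> carrier F}"
  "\<zero>\<^bsub>pre_tensor C E F \<phi>\<^esub> = 0" "add (pre_tensor C E F \<phi>) = (+)" "smult (pre_tensor C E F \<phi>) = free_scale"
  "ract (pre_tensor C E F \<phi>) = (\<lambda>t c. free_map (\<lambda>(x, y). (x, ract F y c)) t)"
  "ip (pre_tensor C E F \<phi>) = form C (\<lambda>p q. ip F (snd p) (\<phi> (ip E (fst p) (fst q)) (snd q)))"
  by (simp_all add: pre_tensor_def free_scale_def form_def fun_eq_iff)

lemma pre_tensor_cvec: "cvec (pre_tensor C E F \<phi>)"
  unfolding cvec_def
proof (rule moduleI[OF cring_complex_field])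
  show "abelian_group (pre_tensor C E F \<phi>)"
  proof (rule abelian_groupI)
    fix s t assume "s \<in> carrier (pre_tensor C E F \<phi>)" "t \<in> carrier (pre_tensor C E F \<phi>)"
    then show "s \<oplus>\<^bsub>pre_tensor C E F \<phi>\<^esub> t \<in> carrier (pre_tensor C E F \<phi>)"
      using Poly_Mapping.keys_add[of s t] by (auto simp: pre_tensor_simps)
  next
    fix t assume t: "t \<in> carrier (pre_tensor C E F \<phi>)"
    have "free_scale (-1) t + t = 0" by (rule poly_mapping_eqI) (simp add: lookup_add)
    then show "\<exists>s\<in>carrier (pre_tensor C E F \<phi>). s \<oplus>\<^bsub>pre_tensor C E F \<phi>\<^esub> t = \<zero>\<^bsub>pre_tensor C E F \<phi>\<^esub>"
      using t keys_free_scale[of "-1" t]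
      by (intro bexI[of _ "free_scale (-1) t"]) (auto simp: pre_tensor_simps)
  qed (auto simp: pre_tensor_simps add.assoc add.commute)
  fix t z assume "t \<in> carrier (pre_tensor C E F \<phi>)"
  then show "z \<odot>\<^bsub>pre_tensor C E F \<phi>\<^esub> t \<in> carrier (pre_tensor C E F \<phi>)"
    using keys_free_scale[of z t] by (auto simp: pre_tensor_simps)
qed (auto simp: pre_tensor_simps lookup_add algebra_simps intro!: poly_mapping_eqI)

lemma lin_ext_pre_tensor_linear:
  assumes "cvec W" and g: "\<And>p. p \<in> carrier E \<times> carrier F \<Longrightarrow> g p \<in> carrier W"
  shows "linear_map (pre_tensor C E F \<phi>) W (lin_ext W g)"
proof -
  interpret W: cvec W by fact
  have keys: "g p \<in> carrier W" if "Poly_Mapping.keys t \<subseteq> carrier E \<times> carrier F" "p \<in> Poly_Mapping.keys t" for t p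
    using g that by blast
  show ?thesis
    unfolding linear_map_def pre_tensor_simps(3,4)
  proof (intro conjI ballI allI Pi_I)
    fix t assume "t \<in> carrier (pre_tensor C E F \<phi>)"
    then have t: "Poly_Mapping.keys t \<subseteq> carrier E \<times> carrier F" by (simp add: pre_tensor_simps(1))
    show "lin_ext W g t \<in> carrier W" using keys[OF t] by (rule W.lin_ext_closed)
    show "lin_ext W g (free_scale c t) = c \<odot>\<^bsub>W\<^esub> lin_ext W g t" for c
      using keys[OF t] by (rule W.lin_ext_scale)
    fix s assume "s \<in> carrier (pre_tensor C E F \<phi>)"
    then have s: "Poly_Mapping.keys s \<subseteq> carrier E \<times> carrier F" by (simp add: pre_tensor_simps(1))
    show "lin_ext W g (t + s) = lin_ext W g t \<oplus>\<^bsub>W\<^esub> lin_ext W g s"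
      by (rule W.lin_ext_add) (use keys[OF s] keys[OF t] in blast)
  qed
qed

lemma pre_tensor_generators:
  assumes t: "t \<in> carrier (pre_tensor C E F \<phi>)"
  shows "t = lin_ext (pre_tensor C E F \<phi>) (\<lambda>p. Poly_Mapping.single p 1) t"
proof -
  let ?P = "pre_tensor C E F \<phi>"
  interpret P: cvec ?P by (rule pre_tensor_cvec)
  have "(\<Oplus>\<^bsub>?P\<^esub>p\<in>K. c p \<odot>\<^bsub>?P\<^esub> Poly_Mapping.single p 1) = (\<Sum>p\<in>K. Poly_Mapping.single p (c p))"
    if "finite K" "K \<subseteq> carrier E \<times> carrier F" for K and c :: "'a \<times> 'b \<Rightarrow> complex"
    using that
  proof (induction K rule: finite_induct)
    case (insert p K)
    have single: "Poly_Mapping.single q 1 \<in> carrier ?P" if "q \<in> insert p K" for q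
      using insert.prems that by (auto simp: pre_tensor_simps)
    have "(\<Oplus>\<^bsub>?P\<^esub>p\<in>insert p K. c p \<odot>\<^bsub>?P\<^esub> Poly_Mapping.single p 1)
        = c p \<odot>\<^bsub>?P\<^esub> Poly_Mapping.single p 1 \<oplus>\<^bsub>?P\<^esub> (\<Oplus>\<^bsub>?P\<^esub>p\<in>K. c p \<odot>\<^bsub>?P\<^esub> Poly_Mapping.single p 1)"
      by (rule P.M.finsum_insert) (use insert.hyps P.scale_closed[OF single] in auto)
    moreover have "free_scale (c p) (Poly_Mapping.single p 1) = Poly_Mapping.single p (c p)"
      by (rule poly_mapping_eqI) (simp add: lookup_single when_def)
    ultimately show ?case using insert by (simp add: pre_tensor_simps)
  qed (simp add: pre_tensor_simps)
  then have "lin_ext ?P (\<lambda>p. Poly_Mapping.single p 1) t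
      = (\<Sum>p\<in>Poly_Mapping.keys t. Poly_Mapping.single p (Poly_Mapping.lookup t p))"
    using t unfolding lin_ext_def by (simp add: pre_tensor_simps(1))
  also have "\<dots> = t"
    by (rule poly_mapping_eqI) (simp add: lookup_sum lookup_single when_def in_keys_iff)
  finally show ?thesis ..
qed

text \<open>
  Positivity of the semi-inner product usually comes from the positivity of the matrices
  \<open>(\<langle>x\<^sub>i, x\<^sub>j\<rangle>)\<^sub>i\<^sub>j\<close> over the coefficient algebra.  Here it is a hypothesis, since both tensor products below
  have a direct reason for it.
\<close>

lemma pre_tensor_semi_hilbert:
  assumes F: "hilbert_cs C F"
    and \<phi>: "\<And>x x' y. x \<in> carrier E \<Longrightarrow> x' \<in> carrier E \<Longrightarrow> y \<in> carrier F \<Longrightarrow> \<phi> (ip E x x') y \<in> carrier F"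
    and adj: "\<And>x x' y y'. x \<in> carrier E \<Longrightarrow> x' \<in> carrier E \<Longrightarrow> y \<in> carrier F \<Longrightarrow> y' \<in> carrier F \<Longrightarrow>
      ip F (\<phi> (ip E x x') y) y' = ip F y (\<phi> (ip E x' x) y')"
    and right: "\<And>x x' y c. x \<in> carrier E \<Longrightarrow> x' \<in> carrier E \<Longrightarrow> y \<in> carrier F \<Longrightarrow> c \<in> carrier C \<Longrightarrow>
      \<phi> (ip E x x') (ract F y c) = ract F (\<phi> (ip E x x') y) c"
    and pos: "\<And>t. t \<in> carrier (pre_tensor C E F \<phi>) \<Longrightarrow> cstar_pos C (ip (pre_tensor C E F \<phi>) t t)"
  shows "semi_hilbert C (pre_tensor C E F \<phi>)"
proof -
  interpret F: hilbert_cs C F by fact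
  let ?P = "pre_tensor C E F \<phi>"
  let ?k = "\<lambda>p q. ip F (snd p) (\<phi> (ip E (fst p) (fst q)) (snd q))"
  have keys: "fst p \<in> carrier E" "snd p \<in> carrier F" if "t \<in> carrier ?P" "p \<in> Poly_Mapping.keys t" for t p
    using that by (auto simp: pre_tensor_simps)
  have k: "F.B.kernel_on ?k s t" if "s \<in> carrier ?P" "t \<in> carrier ?P" for s t
    using keys that \<phi> by (auto simp: F.B.kernel_on_def)
  show ?thesis
  proof (intro semi_hilbert.intro semi_hilbert_axioms.intro F.B.cstar_algebra_axioms pre_tensor_cvec pos)
    fix t c assume t: "t \<in> carrier ?P" and c: "c \<in> carrier C"
    show tc: "ract ?P t c \<in> carrier ?P"
      using t c keys_free_map[of "\<lambda>(x, y). (x, ract F y c)" t]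
      by (fastforce simp: pre_tensor_simps)
    fix s assume s: "s \<in> carrier ?P"
    have "linear_map C C (\<lambda>x. x \<otimes>\<^bsub>C\<^esub> c)"
      using c by (auto simp: linear_map_def F.B.mult_l_distr F.B.mult_smult_l)
    then have "ip ?P s t \<otimes>\<^bsub>C\<^esub> c = form C (\<lambda>p q. ?k p q \<otimes>\<^bsub>C\<^esub> c) s t"
      using F.B.form_linear_map[OF _ k[OF s t]] by (simp add: pre_tensor_simps)
    also have "\<dots> = form C (\<lambda>p q. ?k p ((\<lambda>(x, y). (x, ract F y c)) q)) s t"
      using keys[OF s] keys[OF t] c \<phi>
      by (intro F.B.form_cong) (auto simp: F.B.kernel_on_def right F.ip_ract split: prod.splits)
    also have "\<dots> = ip ?P s (ract ?P t c)"
      unfolding pre_tensor_simps(5,6)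
      using k[OF s tc] keys[OF s] keys[OF t] c \<phi>
      by (intro F.B.form_free_map_right[symmetric]) (auto simp: F.B.kernel_on_def pre_tensor_simps(5) split: prod.splits)
    finally show "ip ?P s (ract ?P t c) = ip ?P s t \<otimes>\<^bsub>C\<^esub> c" ..
  next
    fix s t assume st: "s \<in> carrier ?P" "t \<in> carrier ?P"
    show "ip ?P s t \<in> carrier C" using F.B.form_closed[OF k[OF st]] by (simp add: pre_tensor_simps)
    show "ip ?P s (z \<odot>\<^bsub>?P\<^esub> t) = z \<odot>\<^bsub>C\<^esub> ip ?P s t" for z
      using F.B.form_scale_right[OF k[OF st]] by (simp add: pre_tensor_simps)
    have "invol C (form C ?k s t) = form C (\<lambda>q p. invol C (?k p q)) t s"
      by (rule F.B.form_invol[OF k[OF st]])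
    also have "\<dots> = form C ?k t s"
      using keys[OF st(1)] keys[OF st(2)] k[OF st(2,1)] \<phi> by (intro F.B.form_cong) (simp_all add: F.ip_invol adj)
    finally show "invol C (ip ?P s t) = ip ?P t s" by (simp add: pre_tensor_simps)
    fix u assume u: "u \<in> carrier ?P"
    show "ip ?P s (t \<oplus>\<^bsub>?P\<^esub> u) = ip ?P s t \<oplus>\<^bsub>C\<^esub> ip ?P s u"
      using F.B.form_add_right[OF k[OF st] k[OF st(1) u]] by (simp add: pre_tensor_simps)
  qed
qed

lemma (in semi_hilbert) extension_unique:
  assumes W: "hilbert_cs D W" and T: "linear_map EC W T" "linear_map EC W U"
    and bd: "\<And>\<xi>. \<xi> \<in> carrier EC \<Longrightarrow> hnorm D W (T \<xi>) \<le> K * hnorm B EC \<xi>"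
      "\<And>\<xi>. \<xi> \<in> carrier EC \<Longrightarrow> hnorm D W (U \<xi>) \<le> L * hnorm B EC \<xi>"
    and eq: "\<And>x. x \<in> carrier E \<Longrightarrow> T (emb x) = U (emb x)" and \<xi>: "\<xi> \<in> carrier EC"
  shows "T \<xi> = U \<xi>"
proof -
  interpret W: hilbert_cs D W by fact
  interpret EC: hilbert_cs B EC by (rule completion_hilbert)
  obtain s where s: "s \<in> Cs" "EC.E.conv (\<lambda>n. emb (s n)) \<xi>" using EC_dense[OF \<xi>] by metis
  have "W.E.conv (\<lambda>n. T (emb (s n))) (T \<xi>)"
    by (rule conv_bounded_map[OF EC.E.seminormed_axioms W.E.seminormed_axioms T(1) bd(1) s(2)])
  moreover have "W.E.conv (\<lambda>n. U (emb (s n))) (U \<xi>)"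
    by (rule conv_bounded_map[OF EC.E.seminormed_axioms W.E.seminormed_axioms T(2) bd(2) s(2)])
  ultimately show ?thesis using eq E.cauchyD[OF s(1)] W.E.conv_unique by simp
qed

lemma tensor_map_unique:
  assumes P: "semi_hilbert C (pre_tensor C E F \<phi>)" and W: "hilbert_cs D W"
    and T: "linear_map (tensor C E F \<phi>) W T" "linear_map (tensor C E F \<phi>) W U"
    and bd: "\<And>\<xi>. \<xi> \<in> carrier (tensor C E F \<phi>) \<Longrightarrow> hnorm D W (T \<xi>) \<le> K * hnorm C (tensor C E F \<phi>) \<xi>"
      "\<And>\<xi>. \<xi> \<in> carrier (tensor C E F \<phi>) \<Longrightarrow> hnorm D W (U \<xi>) \<le> L * hnorm C (tensor C E F \<phi>) \<xi>"
    and eq: "\<And>x y. x \<in> carrier E \<Longrightarrow> y \<in> carrier F \<Longrightarrow>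
      T (elem_tensor C E F \<phi> x y) = U (elem_tensor C E F \<phi> x y)"
    and \<xi>: "\<xi> \<in> carrier (tensor C E F \<phi>)"
  shows "T \<xi> = U \<xi>"
proof -
  let ?P = "pre_tensor C E F \<phi>"
  interpret P: semi_hilbert C ?P by fact
  interpret W: hilbert_cs D W by fact
  interpret PC: hilbert_cs C P.EC by (rule P.completion_hilbert)
  have "T (P.emb t) = U (P.emb t)" if t: "t \<in> carrier ?P" for t
  proof -
    have single: "Poly_Mapping.single p 1 \<in> carrier ?P" if "p \<in> Poly_Mapping.keys t" for p
      using that t by (auto simp: pre_tensor_simps)
    have "P.emb t = P.emb (lin_ext ?P (\<lambda>p. Poly_Mapping.single p 1) t)"
      using pre_tensor_generators[OF t] by simp
    also have "\<dots> = lin_ext P.EC (\<lambda>p. P.emb (Poly_Mapping.single p 1)) t"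
      by (rule linear_map_lin_ext[OF P.E.cvec_axioms P.EC_cvec P.emb_linear]) (rule single)
    finally have emb: "P.emb t = lin_ext P.EC (\<lambda>p. P.emb (Poly_Mapping.single p 1)) t" .
    have V: "V (P.emb t) = lin_ext W (\<lambda>p. V (P.emb (Poly_Mapping.single p 1))) t"
      if "linear_map P.EC W V" for V
      unfolding emb by (rule linear_map_lin_ext[OF P.EC_cvec W.E.cvec_axioms that]) (rule P.emb_closed[OF single])
    have "lin_ext W (\<lambda>p. T (P.emb (Poly_Mapping.single p 1))) t = lin_ext W (\<lambda>p. U (P.emb (Poly_Mapping.single p 1))) t"
    proof (rule W.E.lin_ext_cong)
      fix p assume p: "p \<in> Poly_Mapping.keys t"
      then show "T (P.emb (Poly_Mapping.single p 1)) = U (P.emb (Poly_Mapping.single p 1))"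
        using eq[of "fst p" "snd p"] t by (auto simp: elem_tensor_def pre_tensor_simps(1))
      show "U (P.emb (Poly_Mapping.single p 1)) \<in> carrier W"
        using linear_mapD(1)[OF T(2)] P.emb_closed[OF single[OF p]] by (simp add: tensor_def)
    qed
    then show ?thesis using V T by (simp add: tensor_def)
  qed
  then show ?thesis
    using P.extension_unique[OF W T[unfolded tensor_def] bd[unfolded tensor_def]] \<xi> by (simp add: tensor_def)
qed


section \<open>The correspondence of a strict unital representation\<close>

lemma (in seminormed) norm_closure_eq_carrier:
  assumes "S \<subseteq> carrier V" "\<And>x e. x \<in> carrier V \<Longrightarrow> e > 0 \<Longrightarrow> \<exists>s\<in>S. nV (x \<ominus> s) < e"
  shows "norm_closure V nV S = carrier V"
  using assms by (auto simp: norm_closure_def)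

lemma dual_module_simps [simp]:
  "carrier (dual_module E) = Star ` carrier E"
  "ip (dual_module E) \<xi> \<eta> = rank_one E (unstar \<xi>) (unstar \<eta>)"
  by (simp_all add: dual_module_def)

locale strict_rep = E: hilbert_cs B E + F: hilbert_cs C F
  for B :: "'b cstar" and E :: "('b, 'e) hmodule" and C :: "'c cstar" and F :: "('c, 'f) hmodule" +
  fixes \<theta> :: "('e \<Rightarrow> 'e) \<Rightarrow> 'f \<Rightarrow> 'f"
  assumes hom: "star_hom (Ba B E) (Ba C F) \<theta>"
    and unital: "\<theta> \<one>\<^bsub>Ba B E\<^esub> = \<one>\<^bsub>Ba C F\<^esub>"
    and strict: "strict_map B E C F \<theta>"

sublocale strict_rep \<subseteq> BE: unital_cstar "Ba B E"
  by (rule E.Ba_unital_cstar)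

sublocale strict_rep \<subseteq> BF: unital_cstar "Ba C F"
  by (rule F.Ba_unital_cstar)

context strict_rep
begin

abbreviation R :: "'e \<Rightarrow> 'e \<Rightarrow> 'e \<Rightarrow> 'e" where "R \<equiv> rank_one E"

lemma rep_closed [simp]: "a \<in> carrier (Ba B E) \<Longrightarrow> \<theta> a \<in> carrier (Ba C F)"
  using hom by (auto simp: star_hom_def)

lemma rep_linear: "linear_map (Ba B E) (Ba C F) \<theta>"
  using hom by (simp add: star_hom_def linear_map_def)

lemma rep_adj: "a \<in> carrier (Ba B E) \<Longrightarrow> \<theta> a \<in> adjointable F F"
  using rep_closed by (simp add: Ba_simps)

lemma rep_apply_closed [simp]: "a \<in> carrier (Ba B E) \<Longrightarrow> y \<in> carrier F \<Longrightarrow> \<theta> a y \<in> carrier F"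
  using F.Ba_closed[OF rep_adj] .

lemma rep_one: "y \<in> carrier F \<Longrightarrow> \<theta> \<one>\<^bsub>Ba B E\<^esub> y = y"
  unfolding unital by (simp add: Ba_simps)

lemma rep_mult: "a \<in> carrier (Ba B E) \<Longrightarrow> b \<in> carrier (Ba B E) \<Longrightarrow> y \<in> carrier F \<Longrightarrow>
    \<theta> (a \<otimes>\<^bsub>Ba B E\<^esub> b) y = \<theta> a (\<theta> b y)"
proof -
  assume ab: "a \<in> carrier (Ba B E)" "b \<in> carrier (Ba B E)" and y: "y \<in> carrier F"
  have "\<theta> (a \<otimes>\<^bsub>Ba B E\<^esub> b) = \<theta> a \<otimes>\<^bsub>Ba C F\<^esub> \<theta> b" using hom ab unfolding star_hom_def by blast
  then show ?thesis using y by (simp add: Ba_simps)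
qed

lemma rep_add: "a \<in> carrier (Ba B E) \<Longrightarrow> b \<in> carrier (Ba B E) \<Longrightarrow> y \<in> carrier F \<Longrightarrow>
    \<theta> (a \<oplus>\<^bsub>Ba B E\<^esub> b) y = \<theta> a y \<oplus>\<^bsub>F\<^esub> \<theta> b y"
  using linear_mapD(2)[OF rep_linear, of a b] by (simp add: Ba_simps(5)[of C F])

lemma rep_scale: "a \<in> carrier (Ba B E) \<Longrightarrow> y \<in> carrier F \<Longrightarrow> \<theta> (c \<odot>\<^bsub>Ba B E\<^esub> a) y = c \<odot>\<^bsub>F\<^esub> \<theta> a y"
  using linear_mapD(3)[OF rep_linear, of a c] by (simp add: Ba_simps(6)[of C F])

lemma rep_diff: "a \<in> carrier (Ba B E) \<Longrightarrow> b \<in> carrier (Ba B E) \<Longrightarrow> y \<in> carrier F \<Longrightarrow>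
    \<theta> (a \<ominus>\<^bsub>Ba B E\<^esub> b) y = \<theta> a y \<ominus>\<^bsub>F\<^esub> \<theta> b y"
  using linear_map_diff[OF BE.cvec_axioms BF.cvec_axioms rep_linear, of a b] F.Ba_diff[OF rep_adj rep_adj, of a b]
  by simp

lemma rep_ip: "a \<in> carrier (Ba B E) \<Longrightarrow> y \<in> carrier F \<Longrightarrow> y' \<in> carrier F \<Longrightarrow>
    ip F (\<theta> a y) y' = ip F y (\<theta> (invol (Ba B E) a) y')"
proof -
  assume a: "a \<in> carrier (Ba B E)" and y: "y \<in> carrier F" "y' \<in> carrier F"
  have "\<theta> (invol (Ba B E) a) = hm_adjoint F F (\<theta> a)"
    using hom a unfolding star_hom_def by (simp add: Ba_simps(7)[of C F])
  then show ?thesis using F.Ba_adjoint_ip'[OF rep_adj[OF a] y(2,1)] by simp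
qed

lemma rep_vector: 
  assumes "a \<in> carrier (Ba B E)" "y \<in> carrier F"
  shows "y' \<in> carrier F \<Longrightarrow> \<theta> a (y \<oplus>\<^bsub>F\<^esub> y') = \<theta> a y \<oplus>\<^bsub>F\<^esub> \<theta> a y'"
    and "\<theta> a (c \<odot>\<^bsub>F\<^esub> y) = c \<odot>\<^bsub>F\<^esub> \<theta> a y"
    and "d \<in> carrier C \<Longrightarrow> \<theta> a (ract F y d) = ract F (\<theta> a y) d"
  using F.Ba_linear[OF rep_adj[OF assms(1)]] F.Ba_ract[OF rep_adj[OF assms(1)]] assms(2) by simp_all

definition bnd :: real where
  "bnd = (SOME K. K \<ge> 0 \<and> (\<forall>a\<in>carrier (Ba B E). cnorm (Ba C F) (\<theta> a) \<le> K * cnorm (Ba B E) a))"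

lemma bnd: "bnd \<ge> 0" "a \<in> carrier (Ba B E) \<Longrightarrow> y \<in> carrier F \<Longrightarrow>
    hnorm C F (\<theta> a y) \<le> bnd * cnorm (Ba B E) a * hnorm C F y"
proof -
  obtain K where K: "\<forall>a\<in>carrier (Ba B E). cnorm (Ba C F) (\<theta> a) \<le> K * cnorm (Ba B E) a"
    using strict[unfolded strict_map_def, THEN conjunct1] unfolding bounded_linear_map_def by blast
  have "cnorm (Ba C F) (\<theta> a) \<le> \<bar>K\<bar> * cnorm (Ba B E) a" if "a \<in> carrier (Ba B E)" for a
    using K that mult_right_mono[OF abs_ge_self[of K] BE.cnorm_nonneg[OF that]] by force
  then have "\<exists>K\<ge>0. \<forall>a\<in>carrier (Ba B E). cnorm (Ba C F) (\<theta> a) \<le> K * cnorm (Ba B E) a"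
    by (intro exI[of _ "\<bar>K\<bar>"]) simp
  then have b: "bnd \<ge> 0 \<and> (\<forall>a\<in>carrier (Ba B E). cnorm (Ba C F) (\<theta> a) \<le> bnd * cnorm (Ba B E) a)"
    unfolding bnd_def by (rule someI_ex)
  then show "bnd \<ge> 0" by simp
  assume a: "a \<in> carrier (Ba B E)" and y: "y \<in> carrier F"
  have "hnorm C F (\<theta> a y) \<le> cnorm (Ba C F) (\<theta> a) * hnorm C F y" by (rule F.opn_bound[OF rep_adj[OF a] y])
  also have "\<dots> \<le> bnd * cnorm (Ba B E) a * hnorm C F y" using b a y by (intro mult_right_mono) simp_all
  finally show "hnorm C F (\<theta> a y) \<le> bnd * cnorm (Ba B E) a * hnorm C F y" .
qed

lemma rep_rank_one_norm:
  assumes "x \<in> carrier E" "x' \<in> carrier E" "y \<in> carrier F" "y' \<in> carrier F"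
  shows "cnorm C (ip F y (\<theta> (R x x') y')) \<le> hnorm B E x * hnorm B E x' * (hnorm C F y * bnd * hnorm C F y')"
proof -
  have "cnorm C (ip F y (\<theta> (R x x') y')) \<le> hnorm C F y * hnorm C F (\<theta> (R x x') y')"
    using assms by (intro F.cauchy_schwarz) simp_all
  also have "\<dots> \<le> hnorm C F y * (bnd * (hnorm B E x * hnorm B E x') * hnorm C F y')"
  proof (intro mult_left_mono)
    have "hnorm C F (\<theta> (R x x') y') \<le> bnd * cnorm (Ba B E) (R x x') * hnorm C F y'"
      using assms by (intro bnd) simp_all
    also have "\<dots> \<le> bnd * (hnorm B E x * hnorm B E x') * hnorm C F y'"
      using assms bnd(1) by (intro mult_right_mono mult_left_mono E.opn_rank_one) simp_all
    finally show "hnorm C F (\<theta> (R x x') y') \<le> bnd * (hnorm B E x * hnorm B E x') * hnorm C F y'" .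
  qed (use assms in simp)
  finally show ?thesis by (simp add: mult_ac)
qed

lemma rank_one_sandwich:
  assumes "x \<in> carrier E" "x' \<in> carrier E" "z \<in> carrier E" "z' \<in> carrier E"
  shows "R (ract E x (ip E z z')) x' = invol (Ba B E) (R z x) \<otimes>\<^bsub>Ba B E\<^esub> R z' x'"
proof -
  have "invol (Ba B E) (R z x) \<otimes>\<^bsub>Ba B E\<^esub> R z' x' = R (R x z z') x'"
    using assms by (simp add: E.rank_one_invol E.Ba_mult_rank_one)
  then show ?thesis using assms by (simp add: rank_one_def[of E x z])
qed

abbreviation X :: "'e dual \<times> 'f \<Rightarrow> 'e" where "X p \<equiv> unstar (fst p)"
abbreviation P1 :: "('c, ('e dual \<times> 'f) \<Rightarrow>\<^sub>0 complex) hmodule" where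
  "P1 \<equiv> pre_tensor C (dual_module E) F \<theta>"

lemma P1_keys:
  assumes "t \<in> carrier P1" "p \<in> Poly_Mapping.keys t"
  shows "X p \<in> carrier E" "snd p \<in> carrier F"
  using assms by (auto simp: pre_tensor_simps)

text \<open>The form \<open>\<langle>s, t\<rangle>\<close> with \<open>h\<close> applied to the left vectors of \<open>E\<close>.\<close>

definition gform :: "('e \<Rightarrow> 'e) \<Rightarrow> (('e dual \<times> 'f) \<Rightarrow>\<^sub>0 complex) \<Rightarrow> (('e dual \<times> 'f) \<Rightarrow>\<^sub>0 complex) \<Rightarrow> 'c" where
  "gform h s t = form C (\<lambda>p q. ip F (snd p) (\<theta> (R (h (X p)) (X q)) (snd q))) s t"

lemma ip_P1: "ip P1 s t = gform (\<lambda>x. x) s t"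
  by (simp add: gform_def pre_tensor_simps)

lemma gform_kernel:
  assumes "s \<in> carrier P1" "t \<in> carrier P1" "\<And>x. x \<in> carrier E \<Longrightarrow> h x \<in> carrier E"
  shows "F.B.kernel_on (\<lambda>p q. ip F (snd p) (\<theta> (R (h (X p)) (X q)) (snd q))) s t"
  using P1_keys[OF assms(1)] P1_keys[OF assms(2)] assms(3) by (auto simp: F.B.kernel_on_def)

lemma gform_cong:
  assumes "s \<in> carrier P1" "t \<in> carrier P1" "\<And>x. x \<in> carrier E \<Longrightarrow> h x = h' x"
    "\<And>x. x \<in> carrier E \<Longrightarrow> h' x \<in> carrier E"
  shows "gform h s t = gform h' s t"
  unfolding gform_def
  by (rule F.B.form_cong[OF _ gform_kernel[OF assms(1,2,4)]])
    (use P1_keys[OF assms(1)] P1_keys[OF assms(2)] assms(3) in auto)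

lemma gform_closed:
  assumes "s \<in> carrier P1" "t \<in> carrier P1" "\<And>x. x \<in> carrier E \<Longrightarrow> h x \<in> carrier E"
  shows "gform h s t \<in> carrier C"
  unfolding gform_def by (rule F.B.form_closed[OF gform_kernel[OF assms]])

lemma gform_linear:
  assumes s: "s \<in> carrier P1" and t: "t \<in> carrier P1"
    and h: "\<And>x. x \<in> carrier E \<Longrightarrow> h x \<in> carrier E" and h': "\<And>x. x \<in> carrier E \<Longrightarrow> h' x \<in> carrier E"
  shows "gform (\<lambda>x. h x \<oplus>\<^bsub>E\<^esub> h' x) s t = gform h s t \<oplus>\<^bsub>C\<^esub> gform h' s t"
    and "gform (\<lambda>x. h x \<ominus>\<^bsub>E\<^esub> h' x) s t = gform h s t \<ominus>\<^bsub>C\<^esub> gform h' s t"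
    and "gform (\<lambda>x. c \<odot>\<^bsub>E\<^esub> h x) s t = c \<odot>\<^bsub>C\<^esub> gform h s t"
proof -
  note k = gform_kernel[OF s t h] gform_kernel[OF s t h']
  note keys = P1_keys[OF s] P1_keys[OF t]
  show "gform (\<lambda>x. h x \<oplus>\<^bsub>E\<^esub> h' x) s t = gform h s t \<oplus>\<^bsub>C\<^esub> gform h' s t"
    unfolding gform_def
    by (rule trans[OF F.B.form_cong F.B.form_kernel_add[OF k]]) (use keys h h' in \<open>auto simp: F.B.kernel_on_def E.rank_one_linear rep_add F.ip_add\<close>)
  show "gform (\<lambda>x. h x \<ominus>\<^bsub>E\<^esub> h' x) s t = gform h s t \<ominus>\<^bsub>C\<^esub> gform h' s t"
    unfolding gform_def
    by (rule trans[OF F.B.form_cong F.B.form_kernel_diff[OF k]]) (use keys h h' in \<open>auto simp: F.B.kernel_on_def E.rank_one_linear rep_diff F.ip_diff\<close>)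
  show "gform (\<lambda>x. c \<odot>\<^bsub>E\<^esub> h x) s t = c \<odot>\<^bsub>C\<^esub> gform h s t"
    unfolding gform_def
    by (rule trans[OF F.B.form_cong F.B.form_kernel_scale[OF k(1)]]) (use keys h in \<open>auto simp: F.B.kernel_on_def E.rank_one_scale rep_scale F.ip_smult\<close>)
qed

text \<open>\<open>V z\<close> is the map \<open>x\<^sup>* \<odot> y \<mapsto> \<theta>(z x\<^sup>*) y\<close>, that is, \<open>\<xi> \<mapsto> u(z \<odot> \<xi>)\<close> for the unitary to be found.\<close>

definition V :: "'e \<Rightarrow> (('e dual \<times> 'f) \<Rightarrow>\<^sub>0 complex) \<Rightarrow> 'f" where
  "V z t = lin_ext F (\<lambda>p. \<theta> (R z (X p)) (snd p)) t"

lemma V_linear: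
  assumes "z \<in> carrier E"
  shows "linear_map P1 F (V z)"
  unfolding V_def[abs_def]
  by (rule lin_ext_pre_tensor_linear[OF F.E.cvec_axioms]) (use assms in auto)

lemma V_ip:
  assumes "z \<in> carrier E" "z' \<in> carrier E" "s \<in> carrier P1" "t \<in> carrier P1"
  shows "ip F (V z s) (V z' t) = gform (\<lambda>x. ract E x (ip E z z')) s t"
proof -
  note keys = P1_keys[OF assms(3)] P1_keys[OF assms(4)]
  have "ip F (V z s) (V z' t) = form C (\<lambda>p q. ip F (\<theta> (R z (X p)) (snd p)) (\<theta> (R z' (X q)) (snd q))) s t"
    unfolding V_def using keys assms by (intro F.ip_lin_ext) auto
  also have "\<dots> = gform (\<lambda>x. ract E x (ip E z z')) s t"
    unfolding gform_def
  proof (rule F.B.form_cong)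
    show "F.B.kernel_on (\<lambda>p q. ip F (snd p) (\<theta> (R (ract E (X p) (ip E z z')) (X q)) (snd q))) s t"
      using assms by (intro gform_kernel) simp_all
    fix p q assume pq: "p \<in> Poly_Mapping.keys s" "q \<in> Poly_Mapping.keys t"
    show "ip F (\<theta> (R z (X p)) (snd p)) (\<theta> (R z' (X q)) (snd q))
        = ip F (snd p) (\<theta> (R (ract E (X p) (ip E z z')) (X q)) (snd q))"
      using keys(1,2)[OF pq(1)] keys(3,4)[OF pq(2)] assms(1,2)
      by (simp add: rep_ip rank_one_sandwich rep_mult)
  qed
  finally show ?thesis .
qed

text \<open>
  Positivity of the semi-inner product of \<open>E\<^sup>* \<odot> F\<close>: let \<open>x\<^sub>1, \<dots>, x\<^sub>n\<close> be the vectors of \<open>E\<close>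
  that occur in \<open>t\<close>, scaled such that \<open>b = \<Sum> \<langle>x\<^sub>k, x\<^sub>k\<rangle>\<close> has norm at most \<open>1\<close>, and let
  \<open>(1 - w)\<^sup>2 = 1 - b\<close>.  Replacing each \<open>x\<close> by \<open>x - x w\<close> lowers \<open>\<langle>t, t\<rangle>\<close> by \<open>\<Sum> \<langle>V x\<^sub>k t, V x\<^sub>k t\<rangle>\<close>,
  and iterating this replacement makes \<open>t\<close> tend to zero.
\<close>

lemma P1_pos:
  assumes t: "t \<in> carrier P1"
  shows "cstar_pos C (ip P1 t t)"
proof -
  note keys = P1_keys[OF t]
  define Z where "Z = X ` Poly_Mapping.keys t"
  have Z: "finite Z" "\<And>x. x \<in> Z \<Longrightarrow> x \<in> carrier E" using keys by (auto simp: Z_def)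
  define c where "c = (\<Oplus>\<^bsub>B\<^esub>x\<in>Z. ip E x x)"
  have [simp]: "c \<in> carrier B" unfolding c_def using Z by (intro E.B.M.finsum_closed) auto
  define r where "r = cnorm B c + 1"
  have r: "r > 0" using E.B.cnorm_nonneg[OF \<open>c \<in> carrier B\<close>] unfolding r_def by linarith
  define s where "s = complex_of_real (1 / sqrt r)"
  have ss: "cnj s * s = complex_of_real (1/r)" "s \<noteq> 0"
    using r by (simp_all add: s_def flip: of_real_mult)
  define b where "b = (\<Oplus>\<^bsub>B\<^esub>x\<in>Z. ip E (s \<odot>\<^bsub>E\<^esub> x) (s \<odot>\<^bsub>E\<^esub> x))"
  have bc: "b = complex_of_real (1/r) \<odot>\<^bsub>B\<^esub> c"
  proof -
    have "b = (\<Oplus>\<^bsub>B\<^esub>x\<in>Z. complex_of_real (1/r) \<odot>\<^bsub>B\<^esub> ip E x x)"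
      unfolding b_def using Z ss
      by (intro E.B.M.finsum_cong' refl) (auto simp: E.ip_expand E.B.scale_scale mult.commute)
    also have "\<dots> = complex_of_real (1/r) \<odot>\<^bsub>B\<^esub> c"
      unfolding c_def using Z by (intro E.B.finsum_smult_ldistr[symmetric]) auto
    finally show ?thesis .
  qed
  have b: "cstar_pos B b" unfolding b_def using Z by (intro E.B.cstar_pos_finsum E.ip_pos) auto
  have b1: "cnorm B b \<le> 1"
    using r E.B.cnorm_nonneg[of c] by (simp add: bc E.B.norm_scale norm_divide) (simp add: r_def)
  note [simp] = E.B.cstar_pos_closed[OF b]
  obtain w where w: "E.B.sa w" "2 \<odot>\<^bsub>B\<^esub> w = b \<oplus>\<^bsub>B\<^esub> w \<otimes>\<^bsub>B\<^esub> w"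
    using E.B.sqrt_of_one_minus[OF E.B.cstar_pos_sa[OF b] b1] by metis
  note [simp] = E.B.sa_closed[OF w(1)]
  have bw: "b = (w \<oplus>\<^bsub>B\<^esub> w) \<ominus>\<^bsub>B\<^esub> w \<otimes>\<^bsub>B\<^esub> w"
  proof -
    have "w \<oplus>\<^bsub>B\<^esub> w = 2 \<odot>\<^bsub>B\<^esub> w"
      by (rule E.B.lin_eqI, (rule E.B.lin | simp add: lookup_add algebra_simps)+)
    then show ?thesis unfolding w(2)
      by (simp only:) (rule E.B.lin_eqI, (rule E.B.lin | simp add: lookup_add algebra_simps)+)
  qed
  define D where "D = (\<lambda>v. v \<ominus>\<^bsub>E\<^esub> ract E v w)"
  define D' where "D' = (\<lambda>v. v \<ominus>\<^bsub>E\<^esub> ract E v b)"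
  have [simp]: "D v \<in> carrier E" "D' v \<in> carrier E" if "v \<in> carrier E" for v
    using that by (simp_all add: D_def D'_def)
  have DD: "D (D v) = D' v" if [simp]: "v \<in> carrier E" for v
  proof -
    have "D (D v) = (v \<ominus>\<^bsub>E\<^esub> ract E v w) \<ominus>\<^bsub>E\<^esub> (ract E v w \<ominus>\<^bsub>E\<^esub> ract E v (w \<otimes>\<^bsub>B\<^esub> w))"
      by (simp add: D_def E.ract_laws)
    also have "\<dots> = v \<ominus>\<^bsub>E\<^esub> ((ract E v w \<oplus>\<^bsub>E\<^esub> ract E v w) \<ominus>\<^bsub>E\<^esub> ract E v (w \<otimes>\<^bsub>B\<^esub> w))"
      by (rule E.E.lin_eqI, (rule E.E.lin | simp add: lookup_add algebra_simps)+)
    also have "\<dots> = D' v" unfolding D'_def bw by (simp add: E.ract_laws)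
    finally show ?thesis .
  qed
  have Dn [simp]: "(D ^^ n) v \<in> carrier E" if "v \<in> carrier E" for n v
    by (induction n) (use that in simp_all)
  have Dn' [simp]: "(D' ^^ n) v \<in> carrier E" if "v \<in> carrier E" for n v
    by (induction n) (use that in simp_all)
  have D2n: "(D ^^ (2 * n)) v = (D' ^^ n) v" if v: "v \<in> carrier E" for n v
    by (induction n) (use v in \<open>simp_all add: DD flip: funpow_mult\<close>)
  have D'_scale: "(D' ^^ n) (a \<odot>\<^bsub>E\<^esub> v) = a \<odot>\<^bsub>E\<^esub> (D' ^^ n) v" if v: "v \<in> carrier E" for n a v
  proof (induction n)
    case (Suc n)
    have "D' (a \<odot>\<^bsub>E\<^esub> u) = a \<odot>\<^bsub>E\<^esub> D' u" if "u \<in> carrier E" for u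
      using that by (simp add: D'_def E.ract_laws E.E.scale_diff_right)
    from this[OF Dn'[OF v]] have "D' (a \<odot>\<^bsub>E\<^esub> (D' ^^ n) v) = a \<odot>\<^bsub>E\<^esub> D' ((D' ^^ n) v)" .
    then show ?case using Suc by simp
  qed simp
  have tail: "(\<lambda>n. hnorm B E ((D ^^ (2 * n)) x)) \<longlonglongrightarrow> 0" if x: "x \<in> Z" for x
  proof -
    note [simp] = Z(2)[OF x]
    define rest where "rest = (\<Oplus>\<^bsub>B\<^esub>x\<in>Z - {x}. ip E (s \<odot>\<^bsub>E\<^esub> x) (s \<odot>\<^bsub>E\<^esub> x))"
    have rest: "cstar_pos B rest" unfolding rest_def using Z by (intro E.B.cstar_pos_finsum E.ip_pos) auto
    note [simp] = E.B.cstar_pos_closed[OF rest]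
    have "Z = insert x (Z - {x})" using x by auto
    then have "b = (\<Oplus>\<^bsub>B\<^esub>x\<in>insert x (Z - {x}). ip E (s \<odot>\<^bsub>E\<^esub> x) (s \<odot>\<^bsub>E\<^esub> x))" by (simp add: b_def)
    also have "\<dots> = ip E (s \<odot>\<^bsub>E\<^esub> x) (s \<odot>\<^bsub>E\<^esub> x) \<oplus>\<^bsub>B\<^esub> rest"
      unfolding rest_def using Z by (intro E.B.M.finsum_insert) auto
    finally have "b \<ominus>\<^bsub>B\<^esub> ip E (s \<odot>\<^bsub>E\<^esub> x) (s \<odot>\<^bsub>E\<^esub> x) = rest"
      by (simp only:) (rule E.B.lin_eqI, (rule E.B.lin | simp add: lookup_add algebra_simps)+)
    then have "(\<lambda>n. hnorm B E ((D' ^^ n) (s \<odot>\<^bsub>E\<^esub> x))) \<longlonglongrightarrow> 0"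
      unfolding D'_def using b b1 rest by (intro E.module_tail_tendsto_zero) simp_all
    then have "(\<lambda>n. cmod s * hnorm B E ((D' ^^ n) x)) \<longlonglongrightarrow> 0"
      by (simp add: D'_scale E.E.norm_scale)
    then have "(\<lambda>n. inverse (cmod s) * (cmod s * hnorm B E ((D' ^^ n) x))) \<longlonglongrightarrow> 0"
      by (rule tendsto_mult_right_zero)
    then show ?thesis using ss(2) by (simp add: D2n flip: mult.assoc)
  qed
  define k where "k n p q = ip F (snd p) (\<theta> (R ((D ^^ n) (X p)) ((D ^^ n) (X q))) (snd q))" for n p q
  define l where "l n z p q = ip F (\<theta> (R (s \<odot>\<^bsub>E\<^esub> z) ((D ^^ n) (X p))) (snd p))
      (\<theta> (R (s \<odot>\<^bsub>E\<^esub> z) ((D ^^ n) (X q))) (snd q))" for n z p q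
  have k_on: "F.B.kernel_on (k n) t t" for n
    using keys by (auto simp: F.B.kernel_on_def k_def)
  have l_on: "F.B.kernel_on (l n z) t t" if "z \<in> Z" for n z
    using keys Z(2)[OF that] by (auto simp: F.B.kernel_on_def l_def)
  have step: "k n p q = k (Suc n) p q \<oplus>\<^bsub>C\<^esub> (\<Oplus>\<^bsub>C\<^esub>z\<in>Z. l n z p q)"
    if p: "p \<in> Poly_Mapping.keys t" and q: "q \<in> Poly_Mapping.keys t" for n p q
  proof -
    define x where "x = (D ^^ n) (X p)"
    define x' where "x' = (D ^^ n) (X q)"
    have [simp]: "x \<in> carrier E" "x' \<in> carrier E" "snd p \<in> carrier F" "snd q \<in> carrier F"
      using keys p q by (simp_all add: x_def x'_def)
    define \<beta> where "\<beta> a = ip F (snd p) (\<theta> (R (ract E x a) x') (snd q))" for a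
    have \<beta>_lin: "linear_map B C \<beta>"
      by (auto simp: linear_map_def \<beta>_def E.ract_laws E.rank_one_linear E.rank_one_scale rep_add rep_scale F.ip_expand)
    have "R (D x) (D x') = R (x \<ominus>\<^bsub>E\<^esub> ract E x b) x'"
    proof -
      have "R (D x) (D x') = R (D x) x' \<ominus>\<^bsub>Ba B E\<^esub> R (ract E (D x) (invol B w)) x'"
        by (simp add: D_def[of] E.rank_one_linear(3) E.rank_one_ract)
      also have "\<dots> = R (D x \<ominus>\<^bsub>E\<^esub> ract E (D x) w) x'"
        by (simp add: E.B.sa_invol[OF w(1)] E.rank_one_linear(2))
      also have "D x \<ominus>\<^bsub>E\<^esub> ract E (D x) w = D' x" using DD[of x] by (simp add: D_def)
      finally show ?thesis by (simp add: D'_def)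
    qed
    then have "k (Suc n) p q = k n p q \<ominus>\<^bsub>C\<^esub> \<beta> b"
      by (simp add: k_def \<beta>_def E.rank_one_linear(2) rep_diff F.ip_diff flip: x_def x'_def)
    moreover have "\<beta> b = (\<Oplus>\<^bsub>C\<^esub>z\<in>Z. l n z p q)"
    proof -
      have "\<beta> b = (\<Oplus>\<^bsub>C\<^esub>z\<in>Z. \<beta> (ip E (s \<odot>\<^bsub>E\<^esub> z) (s \<odot>\<^bsub>E\<^esub> z)))"
        unfolding b_def
        by (rule linear_map_finsum[OF E.B.cvec_axioms F.B.cvec_axioms \<beta>_lin Z(1)]) (use Z in simp)
      also have "\<dots> = (\<Oplus>\<^bsub>C\<^esub>z\<in>Z. l n z p q)"
      proof (intro F.B.M.finsum_cong' refl Pi_I)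
        fix z assume "z \<in> Z"
        note [simp] = Z(2)[OF this]
        show "l n z p q \<in> carrier C" by (simp add: l_def flip: x_def x'_def)
        show "\<beta> (ip E (s \<odot>\<^bsub>E\<^esub> z) (s \<odot>\<^bsub>E\<^esub> z)) = l n z p q"
          by (simp add: l_def \<beta>_def rank_one_sandwich rep_mult rep_ip flip: x_def x'_def)
      qed
      finally show ?thesis .
    qed
    moreover have "k n p q \<in> carrier C" "\<beta> b \<in> carrier C"
      by (simp_all add: k_def \<beta>_def flip: x_def x'_def)
    moreover have "u = (u \<ominus>\<^bsub>C\<^esub> v) \<oplus>\<^bsub>C\<^esub> v" if "u \<in> carrier C" "v \<in> carrier C" for u v
      using that by - (rule F.B.lin_eqI, (rule F.B.lin | simp add: lookup_add algebra_simps)+)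
    ultimately show ?thesis by metis
  qed
  have l_pos: "cstar_pos C (\<Oplus>\<^bsub>C\<^esub>z\<in>Z. form C (l n z) t t)" for n
  proof (rule F.B.cstar_pos_finsum[OF Z(1)])
    fix z assume "z \<in> Z"
    note [simp] = Z(2)[OF this]
    define v where "v = lin_ext F (\<lambda>p. \<theta> (R (s \<odot>\<^bsub>E\<^esub> z) ((D ^^ n) (X p))) (snd p)) t"
    have "ip F v v = form C (l n z) t t"
      unfolding v_def l_def using keys by (intro F.ip_lin_ext) auto
    moreover have "v \<in> carrier F" unfolding v_def using keys by (intro F.E.lin_ext_closed) auto
    ultimately show "cstar_pos C (form C (l n z) t t)" using F.ip_pos[of v] by simp
  qed
  have form_step: "form C (k n) t t = form C (k (Suc n)) t t \<oplus>\<^bsub>C\<^esub> (\<Oplus>\<^bsub>C\<^esub>z\<in>Z. form C (l n z) t t)" for n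
  proof -
    have L: "F.B.kernel_on (\<lambda>p q. \<Oplus>\<^bsub>C\<^esub>z\<in>Z. l n z p q) t t"
      using l_on by (auto simp: F.B.kernel_on_def intro!: F.B.M.finsum_closed)
    have "form C (k n) t t = form C (\<lambda>p q. k (Suc n) p q \<oplus>\<^bsub>C\<^esub> (\<Oplus>\<^bsub>C\<^esub>z\<in>Z. l n z p q)) t t"
      using k_on[of "Suc n"] L by (intro F.B.form_cong step) (auto simp: F.B.kernel_on_def)
    also have "\<dots> = form C (k (Suc n)) t t \<oplus>\<^bsub>C\<^esub> form C (\<lambda>p q. \<Oplus>\<^bsub>C\<^esub>z\<in>Z. l n z p q) t t"
      by (rule F.B.form_kernel_add[OF k_on L])
    also have "form C (\<lambda>p q. \<Oplus>\<^bsub>C\<^esub>z\<in>Z. l n z p q) t t = (\<Oplus>\<^bsub>C\<^esub>z\<in>Z. form C (l n z) t t)"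
      by (rule F.B.form_kernel_finsum[OF Z(1) l_on])
    finally show ?thesis .
  qed
  have pos: "cstar_pos C (form C (k 0) t t \<ominus>\<^bsub>C\<^esub> form C (k n) t t)" for n
  proof (induction n)
    case 0
    show ?case using F.B.form_closed[OF k_on] by (simp add: F.B.cstar_pos_zero)
  next
    case (Suc n)
    note [simp] = F.B.form_closed[OF k_on] F.B.cstar_pos_closed[OF l_pos]
    have "form C (k 0) t t \<ominus>\<^bsub>C\<^esub> form C (k (Suc n)) t t
        = (form C (k 0) t t \<ominus>\<^bsub>C\<^esub> form C (k n) t t) \<oplus>\<^bsub>C\<^esub> (\<Oplus>\<^bsub>C\<^esub>z\<in>Z. form C (l n z) t t)"
      unfolding form_step[of n] by (rule F.B.lin_eqI, (rule F.B.lin | simp add: lookup_add algebra_simps)+)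
    then show ?case using F.B.cstar_pos_add[OF Suc l_pos[of n]] by simp
  qed
  have "F.B.conv (\<lambda>n. form C (k (2 * n)) t t) (form C (\<lambda>p q. \<zero>\<^bsub>C\<^esub>) t t)"
  proof (rule F.B.form_conv)
    fix p q assume p: "p \<in> Poly_Mapping.keys t" and q: "q \<in> Poly_Mapping.keys t"
    note [simp] = keys[OF p] keys[OF q]
    show "F.B.conv (\<lambda>n. k (2 * n) p q) \<zero>\<^bsub>C\<^esub>"
    proof (rule F.B.convI)
      show "k (2 * n) p q \<in> carrier C" for n by (simp add: k_def)
      then have "k (2 * n) p q \<ominus>\<^bsub>C\<^esub> \<zero>\<^bsub>C\<^esub> = k (2 * n) p q" for n by (simp add: F.B.diff_eq_scale)
      then show "cnorm C (k (2 * n) p q \<ominus>\<^bsub>C\<^esub> \<zero>\<^bsub>C\<^esub>)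
          \<le> hnorm B E ((D ^^ (2 * n)) (X p)) * hnorm B E ((D ^^ (2 * n)) (X q)) * (hnorm C F (snd p) * bnd * hnorm C F (snd q))" for n
        by (simp only:) (simp add: k_def rep_rank_one_norm)
      have "X p \<in> Z" "X q \<in> Z" using p q by (simp_all add: Z_def)
      from tendsto_mult_left_zero[OF tendsto_mult_zero[OF tail[OF this(1)] tail[OF this(2)]]]
      show "(\<lambda>n. hnorm B E ((D ^^ (2 * n)) (X p)) * hnorm B E ((D ^^ (2 * n)) (X q)) * (hnorm C F (snd p) * bnd * hnorm C F (snd q))) \<longlonglongrightarrow> 0" .
    qed simp
  qed
  from F.B.conv_diff[OF F.B.conv_const[OF F.B.form_closed[OF k_on[of 0]]] this]
  have "F.B.conv (\<lambda>n. form C (k 0) t t \<ominus>\<^bsub>C\<^esub> form C (k (2 * n)) t t) (form C (k 0) t t)"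
    using F.B.form_closed[OF k_on[of 0]] by (simp add: F.B.form_kernel_zero F.B.diff_eq_scale)
  then have "cstar_pos C (form C (k 0) t t)" by (rule F.B.cstar_pos_limit) (rule pos)
  moreover have "k 0 = (\<lambda>p q. ip F (snd p) (\<theta> (R (X p) (X q)) (snd q)))"
    by (intro ext) (simp add: k_def)
  then have "form C (k 0) t t = ip P1 t t" by (simp add: pre_tensor_simps)
  ultimately show ?thesis by simp
qed

end

context strict_rep
begin

lemma P1_semi_hilbert: "semi_hilbert C P1"
  by (rule pre_tensor_semi_hilbert[OF F.hilbert_cs_axioms])
    (auto simp: rep_ip E.rank_one_invol rep_vector intro: P1_pos)

end

sublocale strict_rep \<subseteq> P1: semi_hilbert C P1
  by (rule P1_semi_hilbert)

context strict_rep
begin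

abbreviation FT :: "('c, (nat \<Rightarrow> ('e dual \<times> 'f) \<Rightarrow>\<^sub>0 complex) set) hmodule" where
  "FT \<equiv> F_theta C E F \<theta>"

lemma FT_eq: "FT = P1.EC"
  by (simp add: F_theta_def tensor_def)

lemma FT_hilbert: "hilbert_cs C FT"
  unfolding FT_eq by (rule P1.completion_hilbert)

end

sublocale strict_rep \<subseteq> FT: hilbert_cs C FT
  by (rule FT_hilbert)

sublocale strict_rep \<subseteq> BFT: unital_cstar "Ba C FT"
  by (rule FT.Ba_unital_cstar)

context strict_rep
begin

subsection \<open>The left action of the coefficient algebra\<close>

definition bact :: "'b \<Rightarrow> (('e dual \<times> 'f) \<Rightarrow>\<^sub>0 complex) \<Rightarrow> (('e dual \<times> 'f) \<Rightarrow>\<^sub>0 complex)" where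
  "bact b = free_map (\<lambda>(\<xi>, y). (dual_lact B E b \<xi>, y))"

lemma bact_closed [simp]: "b \<in> carrier B \<Longrightarrow> t \<in> carrier P1 \<Longrightarrow> bact b t \<in> carrier P1"
proof -
  assume b: "b \<in> carrier B" and t: "t \<in> carrier P1"
  let ?g = "\<lambda>(\<xi>, y). (dual_lact B E b \<xi>, y)"
  have "?g p \<in> carrier (dual_module E) \<times> carrier F" if "p \<in> Poly_Mapping.keys t" for p
    using P1_keys[OF t that] b by (auto simp: dual_lact_def split: prod.splits)
  then have "?g ` Poly_Mapping.keys t \<subseteq> carrier (dual_module E) \<times> carrier F" by blast
  then show ?thesis
    using keys_free_map[of ?g t] unfolding bact_def pre_tensor_simps(1) by blast
qed

lemma bact_linear: "b \<in> carrier B \<Longrightarrow> linear_map P1 P1 (bact b)"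
  by (auto simp: linear_map_def bact_def[of b] pre_tensor_simps(3,4) free_map_add free_map_scale
      bact_closed[unfolded bact_def])

lemma ip_bact:
  assumes b: "b \<in> carrier B" and s: "s \<in> carrier P1" and t: "t \<in> carrier P1"
  shows "ip P1 s (bact b t) = gform (\<lambda>x. ract E x b) s t"
    and "ip P1 (bact b s) t = gform (\<lambda>x. ract E x (invol B b)) s t"
    and "a \<in> carrier B \<Longrightarrow> ip P1 (bact a s) (bact b t) = gform (\<lambda>x. ract E x (invol B a \<otimes>\<^bsub>B\<^esub> b)) s t"
proof -
  let ?k = "\<lambda>p q. ip F (snd p) (\<theta> (R (X p) (X q)) (snd q))"
  let ?g = "\<lambda>b (\<xi>, y). (dual_lact B E b \<xi>, y)"
  note keys = P1_keys[OF s] P1_keys[OF t]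
  have g: "X (?g a p) = ract E (X p) (invol B a)" "snd (?g a p) = snd p" for a and p :: "'e dual \<times> 'f"
    by (auto simp: dual_lact_def split: prod.splits)
  have k_on: "F.B.kernel_on ?k s t" if "s \<in> carrier P1" "t \<in> carrier P1" for s t
    using gform_kernel[OF that, of "\<lambda>x. x"] by simp
  have right: "ip P1 s (bact b t) = gform (\<lambda>x. ract E x b) s t" if s: "s \<in> carrier P1" for s
  proof -
    note keys = P1_keys[OF s] P1_keys[OF t]
    have "ip P1 s (bact b t) = form C ?k s (free_map (?g b) t)" by (simp add: pre_tensor_simps bact_def)
    also have "\<dots> = form C (\<lambda>p q. ?k p (?g b q)) s t"
    proof (rule F.B.form_free_map_right)
      show "F.B.kernel_on ?k s (free_map (?g b) t)"
        using k_on[OF s bact_closed[OF b t]] by (simp add: bact_def)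
      show "F.B.kernel_on (\<lambda>p q. ?k p (?g b q)) s t"
        using keys b by (auto simp: F.B.kernel_on_def g split: prod.splits)
    qed
    also have "\<dots> = gform (\<lambda>x. ract E x b) s t"
      unfolding gform_def
      by (rule F.B.form_cong[OF _ gform_kernel[OF s t]])
        (use keys b in \<open>simp_all only: g\<close>, simp_all add: E.rank_one_ract)
    finally show ?thesis .
  qed
  show "ip P1 s (bact b t) = gform (\<lambda>x. ract E x b) s t" by (rule right[OF s])
  have left: "gform h (bact a s) t = gform (\<lambda>x. h (ract E x (invol B a))) s t"
    if a: "a \<in> carrier B" and h: "\<And>x. x \<in> carrier E \<Longrightarrow> h x \<in> carrier E" for a h
  proof -
    have "gform h (bact a s) t = form C (\<lambda>p q. ip F (snd p) (\<theta> (R (h (X p)) (X q)) (snd q))) (free_map (?g a) s) t"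
      by (simp add: gform_def bact_def)
    also have "\<dots> = form C (\<lambda>p q. ip F (snd (?g a p)) (\<theta> (R (h (X (?g a p))) (X q)) (snd q))) s t"
    proof (rule F.B.form_free_map_left)
      show "F.B.kernel_on (\<lambda>p q. ip F (snd p) (\<theta> (R (h (X p)) (X q)) (snd q))) (free_map (?g a) s) t"
        using gform_kernel[OF bact_closed[OF a s] t h] by (simp add: bact_def)
      show "F.B.kernel_on (\<lambda>p q. ip F (snd (?g a p)) (\<theta> (R (h (X (?g a p))) (X q)) (snd q))) s t"
        unfolding g using gform_kernel[OF s t, of "\<lambda>x. h (ract E x (invol B a))"] a h by simp
    qed
    also have "\<dots> = gform (\<lambda>x. h (ract E x (invol B a))) s t" unfolding g gform_def ..
    finally show ?thesis .
  qed
  show "ip P1 (bact b s) t = gform (\<lambda>x. ract E x (invol B b)) s t"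
    unfolding ip_P1 by (rule left[OF b])
  show "ip P1 (bact a s) (bact b t) = gform (\<lambda>x. ract E x (invol B a \<otimes>\<^bsub>B\<^esub> b)) s t" if a: "a \<in> carrier B"
    unfolding right[OF bact_closed[OF a s]]
    by (subst left[OF a]) (use a b s t in \<open>auto intro!: gform_cong simp: E.ract_laws\<close>)
qed

text \<open>
  With \<open>a = b\<^sup>*b / r\<close> of norm at most \<open>1\<close> and \<open>(1 - w)\<^sup>2 = 1 - a\<close> one has
  \<open>\<langle>t, t\<rangle> = \<langle>b t, b t\<rangle> / r + \<langle>t - w t, t - w t\<rangle>\<close>.
\<close>

lemma bact_bounded:
  assumes b: "b \<in> carrier B"
  shows "\<exists>K\<ge>0. \<forall>t\<in>carrier P1. hnorm C P1 (bact b t) \<le> K * hnorm C P1 t"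
proof -
  define r where "r = (cnorm B b)\<^sup>2 + 1"
  have r: "r > 0" unfolding r_def by (rule add_nonneg_pos) simp_all
  have bb: "invol B b \<otimes>\<^bsub>B\<^esub> b \<in> carrier B" using b by simp
  define a where "a = complex_of_real (1/r) \<odot>\<^bsub>B\<^esub> (invol B b \<otimes>\<^bsub>B\<^esub> b)"
  have a: "a \<in> carrier B" using bb by (simp add: a_def)
  have sa: "E.B.sa a" unfolding a_def by (intro E.B.sa_scale E.B.sa_invol_mult b)
  have a1: "cnorm B a \<le> 1"
    using r b E.B.cstar_identity[OF b] by (simp add: a_def E.B.norm_scale norm_divide) (simp add: r_def)
  obtain w where w: "E.B.sa w" "2 \<odot>\<^bsub>B\<^esub> w = a \<oplus>\<^bsub>B\<^esub> w \<otimes>\<^bsub>B\<^esub> w"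
    using E.B.sqrt_of_one_minus[OF sa a1] by metis
  note [simp] = E.B.sa_closed[OF w(1)] a
  have aw: "a = 2 \<odot>\<^bsub>B\<^esub> w \<ominus>\<^bsub>B\<^esub> w \<otimes>\<^bsub>B\<^esub> w"
    unfolding w(2) by (rule E.B.lin_eqI, (rule E.B.lin | simp add: lookup_add algebra_simps)+)
  have main: "cnorm C (ip P1 (bact b t) (bact b t)) \<le> r * cnorm C (ip P1 t t)" if t: "t \<in> carrier P1" for t
  proof -
    define u where "u = t \<ominus>\<^bsub>P1\<^esub> bact w t"
    have u: "u \<in> carrier P1" unfolding u_def using t by (intro P1.E.diff_closed) simp_all
    define g where "g h = gform h t t" for h
    have gC [simp]: "g (\<lambda>x. x) \<in> carrier C" "g (\<lambda>x. ract E x w) \<in> carrier C" "g (\<lambda>x. ract E x (w \<otimes>\<^bsub>B\<^esub> w)) \<in> carrier C"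
      "g (\<lambda>x. ract E x (invol B b \<otimes>\<^bsub>B\<^esub> b)) \<in> carrier C"
      unfolding g_def using t bb by (auto intro!: gform_closed)
    have uu: "ip P1 u u = (g (\<lambda>x. x) \<ominus>\<^bsub>C\<^esub> g (\<lambda>x. ract E x w)) \<ominus>\<^bsub>C\<^esub> (g (\<lambda>x. ract E x w) \<ominus>\<^bsub>C\<^esub> g (\<lambda>x. ract E x (w \<otimes>\<^bsub>B\<^esub> w)))"
    proof -
      have "ip P1 u u = (ip P1 t t \<ominus>\<^bsub>C\<^esub> ip P1 (bact w t) t) \<ominus>\<^bsub>C\<^esub> (ip P1 t (bact w t) \<ominus>\<^bsub>C\<^esub> ip P1 (bact w t) (bact w t))"
        unfolding u_def using t by (simp add: P1.ip_diff P1.ip_diff_left)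
      also have "ip P1 t t = g (\<lambda>x. x)" by (simp add: ip_P1 g_def)
      also have "ip P1 (bact w t) (bact w t) = g (\<lambda>x. ract E x (w \<otimes>\<^bsub>B\<^esub> w))"
        using ip_bact(3)[of w t t w] t by (simp add: E.B.sa_invol[OF w(1)] g_def)
      also have "ip P1 (bact w t) t = g (\<lambda>x. ract E x w)"
        using ip_bact(2)[of w t t] t by (simp add: E.B.sa_invol[OF w(1)] g_def)
      also have "ip P1 t (bact w t) = g (\<lambda>x. ract E x w)"
        using ip_bact(1)[of w t t] t by (simp add: g_def)
      finally show ?thesis .
    qed
    have "g (\<lambda>x. ract E x a) = 2 \<odot>\<^bsub>C\<^esub> g (\<lambda>x. ract E x w) \<ominus>\<^bsub>C\<^esub> g (\<lambda>x. ract E x (w \<otimes>\<^bsub>B\<^esub> w))"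
    proof -
      have "g (\<lambda>x. ract E x a) = gform (\<lambda>x. (2 \<odot>\<^bsub>E\<^esub> ract E x w) \<ominus>\<^bsub>E\<^esub> ract E x (w \<otimes>\<^bsub>B\<^esub> w)) t t"
        unfolding g_def aw by (rule gform_cong[OF t t]) (simp_all add: E.ract_laws)
      also have "\<dots> = gform (\<lambda>x. 2 \<odot>\<^bsub>E\<^esub> ract E x w) t t \<ominus>\<^bsub>C\<^esub> g (\<lambda>x. ract E x (w \<otimes>\<^bsub>B\<^esub> w))"
        unfolding g_def by (rule gform_linear(2)[OF t t]) simp_all
      also have "gform (\<lambda>x. 2 \<odot>\<^bsub>E\<^esub> ract E x w) t t = 2 \<odot>\<^bsub>C\<^esub> g (\<lambda>x. ract E x w)"
        unfolding g_def by (rule gform_linear(3)[OF t t, of _ "\<lambda>x. x"]) simp_all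
      finally show ?thesis .
    qed
    moreover have "g (\<lambda>x. ract E x a) = complex_of_real (1/r) \<odot>\<^bsub>C\<^esub> ip P1 (bact b t) (bact b t)"
    proof -
      have "g (\<lambda>x. ract E x a) = gform (\<lambda>x. complex_of_real (1/r) \<odot>\<^bsub>E\<^esub> ract E x (invol B b \<otimes>\<^bsub>B\<^esub> b)) t t"
        unfolding g_def a_def using bb by (intro gform_cong[OF t t]) (simp_all add: E.ract_laws)
      also have "\<dots> = complex_of_real (1/r) \<odot>\<^bsub>C\<^esub> gform (\<lambda>x. ract E x (invol B b \<otimes>\<^bsub>B\<^esub> b)) t t"
        using bb by (intro gform_linear(3)[OF t t, of _ "\<lambda>x. x"]) simp_all
      finally show ?thesis using ip_bact(3)[OF b t t b] by simp
    qed
    ultimately have decomp: "ip P1 t t = complex_of_real (1/r) \<odot>\<^bsub>C\<^esub> ip P1 (bact b t) (bact b t) \<oplus>\<^bsub>C\<^esub> ip P1 u u"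
      unfolding uu by (simp only: ip_P1[of t t] g_def[symmetric])
        (rule F.B.lin_eqI, (rule F.B.lin | simp add: lookup_add algebra_simps)+)
    have "cnorm C (complex_of_real (1/r) \<odot>\<^bsub>C\<^esub> ip P1 (bact b t) (bact b t)) \<le> cnorm C (ip P1 t t)"
      unfolding decomp using r t b u
      by (intro F.B.cstar_pos_norm_mono F.B.cstar_pos_scale P1.ip_pos) simp_all
    then show ?thesis using r t b by (simp add: F.B.norm_scale norm_divide field_simps)
  qed
  have "hnorm C P1 (bact b t) \<le> sqrt r * hnorm C P1 t" if t: "t \<in> carrier P1" for t
    using real_sqrt_le_mono[OF main[OF t]] by (simp add: hnorm_def real_sqrt_mult)
  then show ?thesis using r by (intro exI[of _ "sqrt r"]) simp
qed

abbreviation lact :: "'b \<Rightarrow> _" where "lact \<equiv> F_theta_lact B C E F \<theta>"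

lemma lact_def': "lact b = (\<lambda>\<xi>\<in>carrier FT. P1.cl (\<lambda>n. bact b (class_rep \<xi> n)))"
  by (simp add: F_theta_lact_def tensor_id_def F_theta_def bact_def)

lemma FT_cl: "\<xi> \<in> carrier FT \<longleftrightarrow> (\<exists>s\<in>P1.Cs. \<xi> = P1.cl s)"
  by (auto simp: FT_eq P1.EC_simps(1))

lemma lact_cl:
  assumes b: "b \<in> carrier B" and s: "s \<in> P1.Cs"
  shows "(\<lambda>n. bact b (s n)) \<in> P1.Cs" "lact b (P1.cl s) = P1.cl (\<lambda>n. bact b (s n))"
proof -
  obtain K where K: "\<And>t. t \<in> carrier P1 \<Longrightarrow> hnorm C P1 (bact b t) \<le> K * hnorm C P1 t"
    using bact_bounded[OF b] by blast
  have lip: "hnorm C P1 (bact b x \<ominus>\<^bsub>P1\<^esub> bact b y) \<le> K * hnorm C P1 (x \<ominus>\<^bsub>P1\<^esub> y)"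
    if "x \<in> carrier P1" "y \<in> carrier P1" for x y
    using linear_map_diff[OF P1.E.cvec_axioms P1.E.cvec_axioms bact_linear[OF b] that]
      K[of "x \<ominus>\<^bsub>P1\<^esub> y"] that by simp
  show "(\<lambda>n. bact b (s n)) \<in> P1.Cs"
    by (rule P1.cl_map(1)[OF bact_closed[OF b] lip s])
  have "P1.cl s \<in> carrier FT" using s FT_cl by blast
  then show "lact b (P1.cl s) = P1.cl (\<lambda>n. bact b (s n))"
    unfolding lact_def' using P1.cl_map(2)[OF bact_closed[OF b] lip s] by simp
qed

lemma lact_closed [simp]: "b \<in> carrier B \<Longrightarrow> \<xi> \<in> carrier FT \<Longrightarrow> lact b \<xi> \<in> carrier FT"
  using lact_cl FT_cl by metis

lemma lact_conv:
  assumes b: "b \<in> carrier B" and s: "s \<in> P1.Cs" and t: "t \<in> P1.Cs"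
  shows "F.B.conv (\<lambda>n. gform (\<lambda>x. ract E x b) (s n) (t n)) (ip FT (P1.cl s) (lact b (P1.cl t)))"
  using P1.conv_ip_cl[OF s lact_cl(1)[OF b t]] P1.E.cauchyD[OF s] P1.E.cauchyD[OF t]
  by (simp add: lact_cl(2)[OF b t] ip_bact(1)[OF b] FT_eq)

lemma lact_add:
  assumes "b \<in> carrier B" "b' \<in> carrier B" "\<xi> \<in> carrier FT" "\<eta> \<in> carrier FT"
  shows "ip FT \<eta> (lact (b \<oplus>\<^bsub>B\<^esub> b') \<xi>) = ip FT \<eta> (lact b \<xi>) \<oplus>\<^bsub>C\<^esub> ip FT \<eta> (lact b' \<xi>)"
proof -
  obtain s t where st: "s \<in> P1.Cs" "\<eta> = P1.cl s" "t \<in> P1.Cs" "\<xi> = P1.cl t"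
    using assms FT_cl by metis
  note st' = P1.E.cauchyD[OF st(1)] P1.E.cauchyD[OF st(3)]
  have "gform (\<lambda>x. ract E x (b \<oplus>\<^bsub>B\<^esub> b')) (s n) (t n)
      = gform (\<lambda>x. ract E x b) (s n) (t n) \<oplus>\<^bsub>C\<^esub> gform (\<lambda>x. ract E x b') (s n) (t n)" for n
  proof -
    have "gform (\<lambda>x. ract E x (b \<oplus>\<^bsub>B\<^esub> b')) (s n) (t n) = gform (\<lambda>x. ract E x b \<oplus>\<^bsub>E\<^esub> ract E x b') (s n) (t n)"
      by (rule gform_cong[OF st']) (simp_all add: E.ract_laws assms)
    also have "\<dots> = gform (\<lambda>x. ract E x b) (s n) (t n) \<oplus>\<^bsub>C\<^esub> gform (\<lambda>x. ract E x b') (s n) (t n)"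
      by (rule gform_linear(1)[OF st']) (simp_all add: assms)
    finally show ?thesis .
  qed
  then show ?thesis
    using F.B.conv_unique[OF lact_conv[OF E.B.M.a_closed[OF assms(1,2)] st(1,3)]]
      F.B.conv_add[OF lact_conv[OF assms(1) st(1,3)] lact_conv[OF assms(2) st(1,3)]] st by simp
qed

lemma lact_scale:
  assumes "b \<in> carrier B" "\<xi> \<in> carrier FT" "\<eta> \<in> carrier FT"
  shows "ip FT \<eta> (lact (c \<odot>\<^bsub>B\<^esub> b) \<xi>) = c \<odot>\<^bsub>C\<^esub> ip FT \<eta> (lact b \<xi>)"
proof -
  obtain s t where st: "s \<in> P1.Cs" "\<eta> = P1.cl s" "t \<in> P1.Cs" "\<xi> = P1.cl t"
    using assms FT_cl by metis
  note st' = P1.E.cauchyD[OF st(1)] P1.E.cauchyD[OF st(3)]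
  have "gform (\<lambda>x. ract E x (c \<odot>\<^bsub>B\<^esub> b)) (s n) (t n) = c \<odot>\<^bsub>C\<^esub> gform (\<lambda>x. ract E x b) (s n) (t n)" for n
  proof -
    have "gform (\<lambda>x. ract E x (c \<odot>\<^bsub>B\<^esub> b)) (s n) (t n) = gform (\<lambda>x. c \<odot>\<^bsub>E\<^esub> ract E x b) (s n) (t n)"
      by (rule gform_cong[OF st']) (simp_all add: E.ract_laws assms)
    also have "\<dots> = c \<odot>\<^bsub>C\<^esub> gform (\<lambda>x. ract E x b) (s n) (t n)"
      by (rule gform_linear(3)[OF st', of _ "\<lambda>x. x"]) (simp_all add: assms)
    finally show ?thesis .
  qed
  then show ?thesis
    using F.B.conv_unique[OF lact_conv[OF E.B.scale_closed[OF assms(1)] st(1,3)]]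
      F.B.conv_scale[OF lact_conv[OF assms(1) st(1,3)]] st by simp
qed

lemma lact_mult_ip:
  assumes "b \<in> carrier B" "b' \<in> carrier B" "\<xi> \<in> carrier FT" "\<eta> \<in> carrier FT"
  shows "ip FT (lact b \<eta>) (lact b' \<xi>) = ip FT \<eta> (lact (invol B b \<otimes>\<^bsub>B\<^esub> b') \<xi>)"
proof -
  obtain s t where st: "s \<in> P1.Cs" "\<eta> = P1.cl s" "t \<in> P1.Cs" "\<xi> = P1.cl t"
    using assms FT_cl by metis
  note st' = P1.E.cauchyD[OF st(1)] P1.E.cauchyD[OF st(3)]
  have "F.B.conv (\<lambda>n. gform (\<lambda>x. ract E x (invol B b \<otimes>\<^bsub>B\<^esub> b')) (s n) (t n)) (ip FT (lact b \<eta>) (lact b' \<xi>))"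
    using P1.conv_ip_cl[OF lact_cl(1)[OF assms(1) st(1)] lact_cl(1)[OF assms(2) st(3)]]
    by (simp add: st lact_cl(2) assms FT_eq ip_bact(3)[OF assms(2) st' assms(1)])
  then show ?thesis
    using F.B.conv_unique[OF _ lact_conv[OF _ st(1,3)]] assms st by simp
qed

lemma lact_ip:
  assumes "b \<in> carrier B" "\<xi> \<in> carrier FT" "\<eta> \<in> carrier FT"
  shows "ip FT (lact b \<eta>) \<xi> = ip FT \<eta> (lact (invol B b) \<xi>)"
proof -
  obtain s t where st: "s \<in> P1.Cs" "\<eta> = P1.cl s" "t \<in> P1.Cs" "\<xi> = P1.cl t"
    using assms FT_cl by metis
  note st' = P1.E.cauchyD[OF st(1)] P1.E.cauchyD[OF st(3)]
  have "F.B.conv (\<lambda>n. gform (\<lambda>x. ract E x (invol B b)) (s n) (t n)) (ip FT (lact b \<eta>) \<xi>)"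
    using P1.conv_ip_cl[OF lact_cl(1)[OF assms(1) st(1)] st(3)]
    by (simp add: st lact_cl(2) assms FT_eq ip_bact(2)[OF assms(1) st'])
  then show ?thesis
    using F.B.conv_unique[OF _ lact_conv[OF _ st(1,3)]] assms st by simp
qed

lemma lact_restrict: "lact b = (\<lambda>\<xi>\<in>carrier FT. lact b \<xi>)"
  unfolding lact_def' by (simp add: fun_eq_iff)

lemma lact_adj:
  assumes b: "b \<in> carrier B"
  shows "lact b \<in> carrier (Ba C FT)" "invol (Ba C FT) (lact b) = lact (invol B b)"
  using FT.Ba_adjointI[of "lact b" "lact (invol B b)"] b lact_ip
  by (simp_all add: Ba_simps flip: lact_restrict)

lemma lact_hom: "star_hom B (Ba C FT) lact"
  unfolding star_hom_def
proof (intro conjI ballI allI Pi_I)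
  fix b assume b: "b \<in> carrier B"
  show "lact b \<in> carrier (Ba C FT)" by (rule lact_adj(1)[OF b])
  show "lact (invol B b) = invol (Ba C FT) (lact b)" using lact_adj(2)[OF b] by simp
  show "lact (c \<odot>\<^bsub>B\<^esub> b) = c \<odot>\<^bsub>Ba C FT\<^esub> lact b" for c
  proof (rule FT.Ba_eqI)
    show "lact (c \<odot>\<^bsub>B\<^esub> b) \<in> adjointable FT FT" "c \<odot>\<^bsub>Ba C FT\<^esub> lact b \<in> adjointable FT FT"
      using lact_adj(1) BFT.scale_closed[OF lact_adj(1)[OF b]] b by (simp_all add: Ba_simps(1))
    fix \<xi> assume "\<xi> \<in> carrier FT"
    then show "lact (c \<odot>\<^bsub>B\<^esub> b) \<xi> = (c \<odot>\<^bsub>Ba C FT\<^esub> lact b) \<xi>"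
      using b by (intro FT.ip_eqI) (simp_all add: Ba_simps(6) lact_scale FT.ip_smult)
  qed
  fix b' assume b': "b' \<in> carrier B"
  show "lact (b \<oplus>\<^bsub>B\<^esub> b') = lact b \<oplus>\<^bsub>Ba C FT\<^esub> lact b'"
  proof (rule FT.Ba_eqI)
    show "lact (b \<oplus>\<^bsub>B\<^esub> b') \<in> adjointable FT FT" "lact b \<oplus>\<^bsub>Ba C FT\<^esub> lact b' \<in> adjointable FT FT"
      using lact_adj(1) BFT.M.a_closed[OF lact_adj(1)[OF b] lact_adj(1)[OF b']] b b' by (simp_all add: Ba_simps(1))
    fix \<xi> assume "\<xi> \<in> carrier FT"
    then show "lact (b \<oplus>\<^bsub>B\<^esub> b') \<xi> = (lact b \<oplus>\<^bsub>Ba C FT\<^esub> lact b') \<xi>"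
      using b b' by (intro FT.ip_eqI) (simp_all add: Ba_simps(5) lact_add FT.ip_add)
  qed
  show "lact (b \<otimes>\<^bsub>B\<^esub> b') = lact b \<otimes>\<^bsub>Ba C FT\<^esub> lact b'"
  proof (rule FT.Ba_eqI)
    show "lact (b \<otimes>\<^bsub>B\<^esub> b') \<in> adjointable FT FT" "lact b \<otimes>\<^bsub>Ba C FT\<^esub> lact b' \<in> adjointable FT FT"
      using lact_adj(1) BFT.mult_closed[OF lact_adj(1)[OF b] lact_adj(1)[OF b']] b b' by (simp_all add: Ba_simps(1))
    fix \<xi> assume \<xi>: "\<xi> \<in> carrier FT"
    show "lact (b \<otimes>\<^bsub>B\<^esub> b') \<xi> = (lact b \<otimes>\<^bsub>Ba C FT\<^esub> lact b') \<xi>"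
    proof (rule FT.ip_eqI)
      fix \<eta> assume \<eta>: "\<eta> \<in> carrier FT"
      have "ip FT \<eta> (lact b (lact b' \<xi>)) = ip FT (lact (invol B b) \<eta>) (lact b' \<xi>)"
        using lact_ip[of "invol B b" "lact b' \<xi>" \<eta>] b b' \<xi> \<eta> by simp
      also have "\<dots> = ip FT \<eta> (lact (b \<otimes>\<^bsub>B\<^esub> b') \<xi>)"
        using lact_mult_ip[of "invol B b" b' \<xi> \<eta>] b b' \<xi> \<eta> by simp
      finally show "ip FT \<eta> (lact (b \<otimes>\<^bsub>B\<^esub> b') \<xi>) = ip FT \<eta> ((lact b \<otimes>\<^bsub>Ba C FT\<^esub> lact b') \<xi>)"
        using \<xi> by (simp add: Ba_simps(2))
    qed (use b b' \<xi> in \<open>simp_all add: Ba_simps(2)\<close>)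
  qed
qed

lemma single_P1: "x \<in> carrier E \<Longrightarrow> y \<in> carrier F \<Longrightarrow> Poly_Mapping.single (Star x, y) 1 \<in> carrier P1"
  by (simp add: pre_tensor_simps)

lemma FT_elem: "F_theta_elem C E F \<theta> x y = P1.emb (Poly_Mapping.single (Star x, y) 1)"
  by (simp add: F_theta_elem_def elem_tensor_def)

lemma FT_elem_closed [simp]: "x \<in> carrier E \<Longrightarrow> y \<in> carrier F \<Longrightarrow> F_theta_elem C E F \<theta> x y \<in> carrier FT"
  unfolding FT_elem FT_eq by (rule P1.emb_closed[OF single_P1])

lemma FT_elem_ip:
  assumes "x \<in> carrier E" "y \<in> carrier F" "x' \<in> carrier E" "y' \<in> carrier F"
  shows "ip FT (F_theta_elem C E F \<theta> x y) (F_theta_elem C E F \<theta> x' y') = ip F y (\<theta> (R x x') y')"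
  using assms P1.emb_ip[OF single_P1[OF assms(1,2)] single_P1[OF assms(3,4)]]
  by (simp add: FT_elem FT_eq pre_tensor_simps form_def)

lemma lact_elem:
  assumes "x \<in> carrier E" "y \<in> carrier F" "b \<in> carrier B"
  shows "lact b (F_theta_elem C E F \<theta> x y) = F_theta_elem C E F \<theta> (ract E x (invol B b)) y"
  using lact_cl(2)[OF assms(3) P1.E.cauchy_const[OF single_P1[OF assms(1,2)]]]
  by (simp add: FT_elem bact_def free_map_single dual_lact_def)

text \<open>
  The vector \<open>x\<close> is the limit of vectors \<open>x c\<close> with \<open>c = \<langle>x, z\<rangle>\<close>, and \<open>(x c)\<^sup>* \<odot> y = c\<^sup>* (x\<^sup>* \<odot> y)\<close>.
\<close>

lemma lact_nondegenerate:
  "norm_closure FT (hnorm C FT) (lin_span FT {lact b \<xi> | b \<xi>. b \<in> carrier B \<and> \<xi> \<in> carrier FT}) = carrier FT"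
proof -
  let ?S = "{lact b \<xi> | b \<xi>. b \<in> carrier B \<and> \<xi> \<in> carrier FT}"
  have S: "?S \<subseteq> carrier FT" by auto
  let ?L = "lin_span FT ?S"
  have L: "subspace_of FT ?L" by (rule FT.E.subspace_lin_span[OF S])
  then have Lc: "?L \<subseteq> carrier FT" by (simp add: subspace_of_def)
  let ?N = "norm_closure FT (hnorm C FT) ?L"
  have N: "subspace_of FT ?N" by (rule FT.E.subspace_norm_closure[OF L])
  have elem: "F_theta_elem C E F \<theta> x y \<in> ?N" if x: "x \<in> carrier E" and y: "y \<in> carrier F" for x y
    unfolding norm_closure_def
  proof (intro CollectI conjI allI impI)
    show "F_theta_elem C E F \<theta> x y \<in> carrier FT" using x y by simp
    fix e :: real assume e: "e > 0"
    define M where "M = hnorm C F y * bnd * hnorm C F y + 1"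
    have M: "M > 0" unfolding M_def using y bnd(1) by (intro add_nonneg_pos mult_nonneg_nonneg) simp_all
    have "e / sqrt M > 0" using e M by simp
    then obtain z where z: "z \<in> carrier E" "hnorm B E (x \<ominus>\<^bsub>E\<^esub> R x x z) < e / sqrt M"
      using E.rank_one_approximation[OF x] by metis
    define c where "c = ip E x z"
    have c: "c \<in> carrier B" using x z by (simp add: c_def)
    define d where "d = x \<ominus>\<^bsub>E\<^esub> ract E x c"
    have d: "d \<in> carrier E" "hnorm B E d < e / sqrt M" using x z c by (simp_all add: d_def c_def rank_one_def)
    let ?x = "F_theta_elem C E F \<theta> x y" and ?xc = "F_theta_elem C E F \<theta> (ract E x c) y"
    have "lact (invol B c) ?x = ?xc" using lact_elem[OF x y, of "invol B c"] c by simp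
    then have "?xc \<in> ?S" using c x y by (auto intro!: exI[of _ "invol B c"] exI[of _ ?x])
    then have xc: "?xc \<in> ?L" by (rule FT.E.lin_span_base[OF S])
    have "ip FT (?x \<ominus>\<^bsub>FT\<^esub> ?xc) (?x \<ominus>\<^bsub>FT\<^esub> ?xc) = ip F y (\<theta> (R d d) y)"
    proof -
      have "ip FT (?x \<ominus>\<^bsub>FT\<^esub> ?xc) (?x \<ominus>\<^bsub>FT\<^esub> ?xc)
        = (ip F y (\<theta> (R x x) y) \<ominus>\<^bsub>C\<^esub> ip F y (\<theta> (R (ract E x c) x) y))
          \<ominus>\<^bsub>C\<^esub> (ip F y (\<theta> (R x (ract E x c)) y) \<ominus>\<^bsub>C\<^esub> ip F y (\<theta> (R (ract E x c) (ract E x c)) y))"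
        using x y c by (simp add: FT.ip_diff FT.ip_diff_left FT_elem_ip)
      also have "\<dots> = ip F y (\<theta> (R d d) y)"
      proof -
        define x' where "x' = ract E x c"
        have [simp]: "x' \<in> carrier E" "x \<in> carrier E" "y \<in> carrier F" using x y c by (simp_all add: x'_def)
        have "R d d = (R x x \<ominus>\<^bsub>Ba B E\<^esub> R x' x) \<ominus>\<^bsub>Ba B E\<^esub> (R x x' \<ominus>\<^bsub>Ba B E\<^esub> R x' x')"
          by (simp add: d_def E.rank_one_linear(2,3) flip: x'_def)
        then show ?thesis by (simp add: rep_diff F.ip_diff flip: x'_def)
      qed
      finally show ?thesis .
    qed
    then have "(hnorm C FT (?x \<ominus>\<^bsub>FT\<^esub> ?xc))\<^sup>2 = cnorm C (ip F y (\<theta> (R d d) y))"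
      using x y c by (simp add: FT.hnorm_square)
    also have "\<dots> \<le> hnorm B E d * hnorm B E d * (hnorm C F y * bnd * hnorm C F y)"
      using d y by (intro rep_rank_one_norm)
    also have "\<dots> \<le> (hnorm B E d)\<^sup>2 * M"
      using d by (simp add: power2_eq_square M_def mult_left_mono)
    also have "\<dots> = (hnorm B E d * sqrt M)\<^sup>2" using M by (simp add: power_mult_distrib)
    finally have "hnorm C FT (?x \<ominus>\<^bsub>FT\<^esub> ?xc) \<le> hnorm B E d * sqrt M"
      by (rule power2_le_imp_le) (use d M in simp)
    also have "\<dots> < e" using d(2) M by (simp add: pos_less_divide_eq)
    finally show "\<exists>s\<in>?L. hnorm C FT (?x \<ominus>\<^bsub>FT\<^esub> s) < e" using xc by blast
  qed
  have emb: "P1.emb t \<in> ?N" if t: "t \<in> carrier P1" for t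
  proof -
    have single: "Poly_Mapping.single p 1 \<in> carrier P1" if "p \<in> Poly_Mapping.keys t" for p
      using that t by (auto simp: pre_tensor_simps)
    have "P1.emb t = P1.emb (lin_ext P1 (\<lambda>p. Poly_Mapping.single p 1) t)"
      using pre_tensor_generators[OF t] by simp
    also have "\<dots> = lin_ext FT (\<lambda>p. P1.emb (Poly_Mapping.single p 1)) t"
      unfolding FT_eq by (rule linear_map_lin_ext[OF P1.E.cvec_axioms P1.EC_cvec P1.emb_linear]) (rule single)
    also have "\<dots> \<in> ?N"
    proof (rule FT.E.subspace_lin_ext[OF N])
      fix p assume "p \<in> Poly_Mapping.keys t"
      then obtain x y where "p = (Star x, y)" "x \<in> carrier E" "y \<in> carrier F"
        using t by (auto simp: pre_tensor_simps(1))
      then show "P1.emb (Poly_Mapping.single p 1) \<in> ?N" using elem by (simp add: FT_elem)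
    qed
    finally show ?thesis .
  qed
  show ?thesis
  proof
    show "?N \<subseteq> carrier FT" by (rule FT.E.norm_closure_subset)
    show "carrier FT \<subseteq> ?N"
    proof
      fix \<xi> assume "\<xi> \<in> carrier FT"
      then obtain s where s: "s \<in> P1.Cs" "tends FT (hnorm C FT) (\<lambda>n. P1.emb (s n)) \<xi>"
        unfolding FT_eq using P1.EC_dense by metis
      show "\<xi> \<in> ?N" by (rule FT.E.norm_closure_closed[OF Lc emb[OF P1.E.cauchyD[OF s(1)]] s(2)])
    qed
  qed
qed

theorem FT_correspondence: "correspondence B C FT lact"
  unfolding correspondence_def
  using E.B.cstar_algebra_axioms FT.hilbert_module lact_hom lact_nondegenerate by blast

theorem Ba_correspondence: "correspondence (Ba B E) C F \<theta>"
  unfolding correspondence_def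
proof (intro conjI)
  let ?S = "{\<theta> a y | a y. a \<in> carrier (Ba B E) \<and> y \<in> carrier F}"
  have S: "?S \<subseteq> carrier F" by auto
  show "norm_closure F (hnorm C F) (lin_span F ?S) = carrier F"
  proof (rule F.E.norm_closure_eq_carrier)
    show "lin_span F ?S \<subseteq> carrier F" using F.E.subspace_lin_span[OF S] by (simp add: subspace_of_def)
    fix y and e :: real assume y: "y \<in> carrier F" and "e > 0"
    have "y \<in> ?S" using rep_one[OF y] y BE.one_closed by (intro CollectI exI[of _ "\<one>\<^bsub>Ba B E\<^esub>"] exI[of _ y]) simp
    then show "\<exists>s\<in>lin_span F ?S. hnorm C F (y \<ominus>\<^bsub>F\<^esub> s) < e"
      using FT.E.norm_zero y \<open>e > 0\<close> by (intro bexI[of _ y] F.E.lin_span_base[OF S]) simp_all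
  qed
qed (use hom F.hilbert_module BE.cstar_algebra_axioms in auto)

lemma approximate_identity:
  assumes "y \<in> carrier F" "e > 0"
  obtains d where "d \<in> carrier (compacts B E)" "hnorm C F (y \<ominus>\<^bsub>F\<^esub> \<theta> d y) < e"
  using strict_compacts_approximate_identity[OF E.hilbert_cs_axioms F.hilbert_cs_axioms strict unital assms] by metis

theorem compacts_correspondence: "correspondence (compacts B E) C F \<theta>"
  unfolding correspondence_def
proof (intro conjI)
  let ?S = "{\<theta> a y | a y. a \<in> carrier (compacts B E) \<and> y \<in> carrier F}"
  have S: "?S \<subseteq> carrier F" using E.compacts_closed by auto
  show "norm_closure F (hnorm C F) (lin_span F ?S) = carrier F"
  proof (rule F.E.norm_closure_eq_carrier)
    show "lin_span F ?S \<subseteq> carrier F" using F.E.subspace_lin_span[OF S] by (simp add: subspace_of_def)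
    fix y and e :: real assume y: "y \<in> carrier F" and "e > 0"
    then obtain d where d: "d \<in> carrier (compacts B E)" "hnorm C F (y \<ominus>\<^bsub>F\<^esub> \<theta> d y) < e"
      by (rule approximate_identity)
    then show "\<exists>s\<in>lin_span F ?S. hnorm C F (y \<ominus>\<^bsub>F\<^esub> s) < e"
      using y by (intro bexI[of _ "\<theta> d y"] F.E.lin_span_base[OF S]) auto
  qed
  have ops: "add (compacts B E) = add (Ba B E)" "mult (compacts B E) = mult (Ba B E)"
    "smult (compacts B E) = smult (Ba B E)" "invol (compacts B E) = invol (Ba B E)"
    by (simp_all add: compacts_def)
  show "star_hom (compacts B E) (Ba C F) \<theta>"
    using hom E.compacts_closed unfolding star_hom_def ops by blast
qed (use E.compacts_cstar F.hilbert_module in auto)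

end

section \<open>The unitary\<close>

context strict_rep
begin

text \<open>
  The norm of \<open>V z\<close> is controlled by the action of \<open>\<langle>z, z\<rangle>\<close>, since \<open>\<langle>V z t, V z t\<rangle> = \<langle>t, \<langle>z, z\<rangle> t\<rangle>\<close>.
\<close>

lemma V_bounded:
  assumes z: "z \<in> carrier E"
  shows "\<exists>K. \<forall>t\<in>carrier P1. hnorm C F (V z t) \<le> K * hnorm C P1 t"
proof -
  have "ip E z z \<in> carrier B" using z by simp
  from bact_bounded[OF this] obtain K where K: "K \<ge> 0"
    "\<And>t. t \<in> carrier P1 \<Longrightarrow> hnorm C P1 (bact (ip E z z) t) \<le> K * hnorm C P1 t" by blast
  have "hnorm C F (V z t) \<le> sqrt K * hnorm C P1 t" if t: "t \<in> carrier P1" for t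
  proof (rule power2_le_imp_le)
    have Vc: "V z t \<in> carrier F" using linear_mapD(1)[OF V_linear[OF z] t] .
    have "(hnorm C F (V z t))\<^sup>2 = cnorm C (ip P1 t (bact (ip E z z) t))"
      using V_ip[OF z z t t] ip_bact(1)[of "ip E z z" t t] z t Vc by (simp add: F.hnorm_square)
    also have "\<dots> \<le> hnorm C P1 t * hnorm C P1 (bact (ip E z z) t)"
      using z t by (intro P1.cauchy_schwarz) simp_all
    also have "\<dots> \<le> hnorm C P1 t * (K * hnorm C P1 t)"
      using K(2)[OF t] t by (intro mult_left_mono) simp_all
    also have "\<dots> = (sqrt K * hnorm C P1 t)\<^sup>2" using K(1) by (simp add: power_mult_distrib power2_eq_square)
    finally show "(hnorm C F (V z t))\<^sup>2 \<le> (sqrt K * hnorm C P1 t)\<^sup>2" .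
  qed (use K t in simp)
  then show ?thesis by blast
qed

text \<open>
  The continuous extension of \<open>V z\<close> to \<open>F\<^sub>\<theta>\<close>.
\<close>

definition W :: "'e \<Rightarrow> (nat \<Rightarrow> ('e dual \<times> 'f) \<Rightarrow>\<^sub>0 complex) set \<Rightarrow> 'f" where
  "W z = (SOME T. linear_map FT F T \<and> (\<exists>K. \<forall>\<xi>\<in>carrier FT. hnorm C F (T \<xi>) \<le> K * hnorm C FT \<xi>) \<and>
     (\<forall>s\<in>P1.Cs. F.E.conv (\<lambda>n. V z (s n)) (T (P1.cl s))))"

lemma W:
  assumes z: "z \<in> carrier E"
  shows "linear_map FT F (W z)" "\<exists>K. \<forall>\<xi>\<in>carrier FT. hnorm C F (W z \<xi>) \<le> K * hnorm C FT \<xi>"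
    "s \<in> P1.Cs \<Longrightarrow> F.E.conv (\<lambda>n. V z (s n)) (W z (P1.cl s))"
proof -
  obtain K where K: "\<And>t. t \<in> carrier P1 \<Longrightarrow> hnorm C F (V z t) \<le> K * hnorm C P1 t"
    using V_bounded[OF z] by blast
  obtain T where "linear_map P1.EC F T" "\<And>\<xi>. \<xi> \<in> carrier P1.EC \<Longrightarrow> hnorm C F (T \<xi>) \<le> K * hnorm C P1.EC \<xi>"
    "\<And>s. s \<in> P1.Cs \<Longrightarrow> F.E.conv (\<lambda>n. V z (s n)) (T (P1.cl s))"
    using P1.bounded_extension[OF F.hilbert_cs_axioms V_linear[OF z] K] by metis
  then have "\<exists>T. linear_map FT F T \<and> (\<exists>K. \<forall>\<xi>\<in>carrier FT. hnorm C F (T \<xi>) \<le> K * hnorm C FT \<xi>) \<and>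
     (\<forall>s\<in>P1.Cs. F.E.conv (\<lambda>n. V z (s n)) (T (P1.cl s)))"
    unfolding FT_eq by blast
  then have *: "linear_map FT F (W z) \<and> (\<exists>K. \<forall>\<xi>\<in>carrier FT. hnorm C F (W z \<xi>) \<le> K * hnorm C FT \<xi>) \<and>
     (\<forall>s\<in>P1.Cs. F.E.conv (\<lambda>n. V z (s n)) (W z (P1.cl s)))"
    unfolding W_def by (rule someI_ex)
  show "linear_map FT F (W z)" "\<exists>K. \<forall>\<xi>\<in>carrier FT. hnorm C F (W z \<xi>) \<le> K * hnorm C FT \<xi>"
    "s \<in> P1.Cs \<Longrightarrow> F.E.conv (\<lambda>n. V z (s n)) (W z (P1.cl s))"
    using * by blast+
qed

lemma W_closed [simp]: "z \<in> carrier E \<Longrightarrow> \<xi> \<in> carrier FT \<Longrightarrow> W z \<xi> \<in> carrier F"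
  using linear_mapD(1)[OF W(1)] .

lemma W_elem:
  assumes "z \<in> carrier E" "x \<in> carrier E" "y \<in> carrier F"
  shows "W z (F_theta_elem C E F \<theta> x y) = \<theta> (R z x) y"
proof -
  have "V z (Poly_Mapping.single (Star x, y) 1) = \<theta> (R z x) y"
    using assms by (simp add: V_def)
  then show ?thesis
    using W(3)[OF assms(1) P1.E.cauchy_const[OF single_P1[OF assms(2,3)]]] assms
      F.E.conv_unique[OF _ F.E.conv_const[of "\<theta> (R z x) y"]] by (simp add: FT_elem)
qed

lemma W_ip:
  assumes z: "z \<in> carrier E" "z' \<in> carrier E" and \<xi>: "\<xi> \<in> carrier FT" and \<eta>: "\<eta> \<in> carrier FT"
  shows "ip F (W z \<xi>) (W z' \<eta>) = ip FT \<xi> (lact (ip E z z') \<eta>)"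
proof -
  obtain s t where st: "s \<in> P1.Cs" "\<xi> = P1.cl s" "t \<in> P1.Cs" "\<eta> = P1.cl t"
    using \<xi> \<eta> FT_cl by metis
  have "F.B.conv (\<lambda>n. ip F (V z (s n)) (V z' (t n))) (ip F (W z \<xi>) (W z' \<eta>))"
    unfolding st by (rule F.conv_ip[OF W(3)[OF z(1) st(1)] W(3)[OF z(2) st(3)]])
  then have "F.B.conv (\<lambda>n. gform (\<lambda>x. ract E x (ip E z z')) (s n) (t n)) (ip F (W z \<xi>) (W z' \<eta>))"
    using V_ip[OF z P1.E.cauchyD[OF st(1)] P1.E.cauchyD[OF st(3)]] by simp
  moreover have "F.B.conv (\<lambda>n. gform (\<lambda>x. ract E x (ip E z z')) (s n) (t n)) (ip FT \<xi> (lact (ip E z z') \<eta>))"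
    unfolding st by (rule lact_conv[OF _ st(1,3)]) (use z in simp)
  ultimately show ?thesis by (rule F.B.conv_unique)
qed

lemma rep_linear_map: "a \<in> carrier (Ba B E) \<Longrightarrow> linear_map F F (\<theta> a)"
  by (auto simp: linear_map_def rep_vector)

lemma Ba_apply_closed [simp]: "a \<in> carrier (Ba B E) \<Longrightarrow> x \<in> carrier E \<Longrightarrow> a x \<in> carrier E"
  by (simp add: Ba_simps(1))

lemma rep_conv: "a \<in> carrier (Ba B E) \<Longrightarrow> F.E.conv s y \<Longrightarrow> F.E.conv (\<lambda>n. \<theta> a (s n)) (\<theta> a y)"
  by (rule conv_bounded_map[OF F.E.seminormed_axioms F.E.seminormed_axioms rep_linear_map F.opn_bound[OF rep_adj]])

lemma W_Ba:
  assumes a: "a \<in> carrier (Ba B E)" and z: "z \<in> carrier E" and \<xi>: "\<xi> \<in> carrier FT"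
  shows "W (a z) \<xi> = \<theta> a (W z \<xi>)"
proof -
  obtain s where s: "s \<in> P1.Cs" "\<xi> = P1.cl s" using \<xi> FT_cl by metis
  have V: "V (a z) t = \<theta> a (V z t)" if t: "t \<in> carrier P1" for t
  proof -
    note keys = P1_keys[OF t]
    have "\<theta> a (V z t) = lin_ext F (\<lambda>p. \<theta> a (\<theta> (R z (X p)) (snd p))) t"
      unfolding V_def
      by (rule linear_map_lin_ext[OF F.E.cvec_axioms F.E.cvec_axioms rep_linear_map[OF a]]) (use keys z in simp)
    also have "\<dots> = lin_ext F (\<lambda>p. \<theta> (R (a z) (X p)) (snd p)) t"
      by (rule F.E.lin_ext_cong) (use keys a z in \<open>simp_all add: rep_mult[symmetric] E.Ba_mult_rank_one\<close>)
    finally show ?thesis by (simp add: V_def)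
  qed
  have "F.E.conv (\<lambda>n. \<theta> a (V z (s n))) (W (a z) \<xi>)"
    using W(3)[of "a z", OF _ s(1)] V[OF P1.E.cauchyD[OF s(1)]] a z s(2) by simp
  then show ?thesis
    using rep_conv[OF a W(3)[OF z s(1)]] s(2) by (simp add: F.E.conv_unique)
qed

abbreviation P2 :: "('c, ('e \<times> (nat \<Rightarrow> ('e dual \<times> 'f) \<Rightarrow>\<^sub>0 complex) set) \<Rightarrow>\<^sub>0 complex) hmodule" where
  "P2 \<equiv> pre_tensor C E FT lact"

lemma P2_keys:
  assumes "t \<in> carrier P2" "p \<in> Poly_Mapping.keys t"
  shows "fst p \<in> carrier E" "snd p \<in> carrier FT"
  using assms by (auto simp: pre_tensor_simps)

text \<open>The map \<open>u\<close> on formal combinations of elementary tensors.\<close>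

definition U :: "('e \<times> (nat \<Rightarrow> ('e dual \<times> 'f) \<Rightarrow>\<^sub>0 complex) set \<Rightarrow>\<^sub>0 complex) \<Rightarrow> 'f" where
  "U = lin_ext F (\<lambda>p. W (fst p) (snd p))"

lemma U_linear: "linear_map P2 F U"
  unfolding U_def by (rule lin_ext_pre_tensor_linear[OF F.E.cvec_axioms]) auto

lemma U_ip:
  assumes s: "s \<in> carrier P2" and t: "t \<in> carrier P2"
  shows "ip F (U s) (U t) = ip P2 s t"
proof -
  note keys = P2_keys[OF s] P2_keys[OF t]
  have "ip F (U s) (U t) = form C (\<lambda>p q. ip F (W (fst p) (snd p)) (W (fst q) (snd q))) s t"
    unfolding U_def by (rule F.ip_lin_ext) (use keys in simp_all)
  also have "\<dots> = form C (\<lambda>p q. ip FT (snd p) (lact (ip E (fst p) (fst q)) (snd q))) s t"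
    by (rule F.B.form_cong) (use keys in \<open>simp_all add: W_ip F.B.kernel_on_def\<close>)
  finally show ?thesis by (simp add: pre_tensor_simps)
qed

text \<open>The semi-inner product of \<open>E \<odot> F\<^sub>\<theta>\<close> is positive since \<open>U\<close> pulls it back from \<open>F\<close>.\<close>

lemma P2_semi_hilbert: "semi_hilbert C P2"
proof (rule pre_tensor_semi_hilbert[OF FT_hilbert])
  fix x x' \<xi> \<eta> assume x: "x \<in> carrier E" "x' \<in> carrier E" and \<xi>: "\<xi> \<in> carrier FT"
  then have b: "ip E x x' \<in> carrier B" by simp
  show "lact (ip E x x') \<xi> \<in> carrier FT" using b \<xi> by simp
  show "ip FT (lact (ip E x x') \<xi>) \<eta> = ip FT \<xi> (lact (ip E x' x) \<eta>)" if "\<eta> \<in> carrier FT"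
    using lact_ip[OF b that \<xi>] x by (simp add: E.ip_invol)
  show "lact (ip E x x') (ract FT \<xi> c) = ract FT (lact (ip E x x') \<xi>) c" if "c \<in> carrier C" for c
    using FT.Ba_ract[OF _ \<xi> that] lact_adj(1)[OF b] by (simp add: Ba_simps(1))
next
  fix t assume t: "t \<in> carrier P2"
  show "cstar_pos C (ip P2 t t)"
    using F.ip_pos[OF linear_mapD(1)[OF U_linear t]] by (simp add: U_ip[OF t t])
qed

end

sublocale strict_rep \<subseteq> P2: semi_hilbert C P2
  by (rule P2_semi_hilbert)

context strict_rep
begin

abbreviation G :: "('c, (nat \<Rightarrow> ('e \<times> (nat \<Rightarrow> ('e dual \<times> 'f) \<Rightarrow>\<^sub>0 complex) set) \<Rightarrow>\<^sub>0 complex) set) hmodule" where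
  "G \<equiv> tensor C E FT lact"

lemma G_eq: "G = P2.EC"
  by (simp add: tensor_def)

lemma G_hilbert: "hilbert_cs C G"
  unfolding G_eq by (rule P2.completion_hilbert)

end

sublocale strict_rep \<subseteq> G: hilbert_cs C G
  by (rule G_hilbert)

context strict_rep
begin

lemma G_cl: "\<xi> \<in> carrier G \<longleftrightarrow> (\<exists>s\<in>P2.Cs. \<xi> = P2.cl s)"
  by (auto simp: G_eq P2.EC_simps(1))

lemma U_norm: "t \<in> carrier P2 \<Longrightarrow> hnorm C F (U t) = hnorm C P2 t"
  by (simp add: hnorm_def U_ip)

definition u :: "(nat \<Rightarrow> ('e \<times> (nat \<Rightarrow> ('e dual \<times> 'f) \<Rightarrow>\<^sub>0 complex) set) \<Rightarrow>\<^sub>0 complex) set \<Rightarrow> 'f" where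
  "u = (SOME u. linear_map G F u \<and> u \<in> extensional (carrier G) \<and>
     (\<forall>s\<in>P2.Cs. F.E.conv (\<lambda>n. U (s n)) (u (P2.cl s))))"

lemma u:
  shows "linear_map G F u" "u \<in> extensional (carrier G)"
    "s \<in> P2.Cs \<Longrightarrow> F.E.conv (\<lambda>n. U (s n)) (u (P2.cl s))"
proof -
  have "hnorm C F (U t) \<le> 1 * hnorm C P2 t" if "t \<in> carrier P2" for t using U_norm[OF that] by simp
  from P2.bounded_extension[OF F.hilbert_cs_axioms U_linear this]
  obtain T where "linear_map P2.EC F T" "T \<in> extensional (carrier P2.EC)"
    "\<And>s. s \<in> P2.Cs \<Longrightarrow> F.E.conv (\<lambda>n. U (s n)) (T (P2.cl s))" by metis
  then have "\<exists>u. linear_map G F u \<and> u \<in> extensional (carrier G) \<and>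
     (\<forall>s\<in>P2.Cs. F.E.conv (\<lambda>n. U (s n)) (u (P2.cl s)))"
    unfolding G_eq by blast
  then have *: "linear_map G F u \<and> u \<in> extensional (carrier G) \<and>
     (\<forall>s\<in>P2.Cs. F.E.conv (\<lambda>n. U (s n)) (u (P2.cl s)))"
    unfolding u_def by (rule someI_ex)
  show "linear_map G F u" "u \<in> extensional (carrier G)"
    "s \<in> P2.Cs \<Longrightarrow> F.E.conv (\<lambda>n. U (s n)) (u (P2.cl s))"
    using * by blast+
qed

lemma u_closed [simp]: "\<xi> \<in> carrier G \<Longrightarrow> u \<xi> \<in> carrier F"
  using linear_mapD(1)[OF u(1)] .

lemma u_ip:
  assumes \<xi>: "\<xi> \<in> carrier G" and \<eta>: "\<eta> \<in> carrier G"
  shows "ip F (u \<xi>) (u \<eta>) = ip G \<xi> \<eta>"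
proof -
  obtain s t where st: "s \<in> P2.Cs" "\<xi> = P2.cl s" "t \<in> P2.Cs" "\<eta> = P2.cl t"
    using \<xi> \<eta> G_cl by metis
  have "F.B.conv (\<lambda>n. ip F (U (s n)) (U (t n))) (ip F (u \<xi>) (u \<eta>))"
    unfolding st by (rule F.conv_ip[OF u(3)[OF st(1)] u(3)[OF st(3)]])
  then have "F.B.conv (\<lambda>n. ip P2 (s n) (t n)) (ip F (u \<xi>) (u \<eta>))"
    using U_ip[OF P2.E.cauchyD[OF st(1)] P2.E.cauchyD[OF st(3)]] by simp
  then show ?thesis
    using P2.conv_ip_cl[OF st(1,3)] unfolding G_eq st by (rule F.B.conv_unique)
qed

lemma u_norm: "\<xi> \<in> carrier G \<Longrightarrow> hnorm C F (u \<xi>) = hnorm C G \<xi>"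
  by (simp add: hnorm_def u_ip)

lemma u_elem:
  assumes x: "x \<in> carrier E" and \<xi>: "\<xi> \<in> carrier FT"
  shows "u (elem_tensor C E FT lact x \<xi>) = W x \<xi>"
proof -
  have "Poly_Mapping.single (x, \<xi>) 1 \<in> carrier P2" using x \<xi> by (simp add: pre_tensor_simps)
  from u(3)[OF P2.E.cauchy_const[OF this]]
  have "F.E.conv (\<lambda>n. W x \<xi>) (u (elem_tensor C E FT lact x \<xi>))"
    using x \<xi> by (simp add: U_def elem_tensor_def)
  then show ?thesis using F.E.conv_unique[OF _ F.E.conv_const[of "W x \<xi>"]] x \<xi> by simp
qed

lemma elem_closed [simp]:
  "x \<in> carrier E \<Longrightarrow> \<xi> \<in> carrier FT \<Longrightarrow> elem_tensor C E FT lact x \<xi> \<in> carrier G"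
  unfolding G_eq elem_tensor_def by (rule P2.emb_closed) (simp add: pre_tensor_simps)

lemma u_formula:
  assumes "x \<in> carrier E" "x' \<in> carrier E" "y \<in> carrier F"
  shows "u (elem_tensor C E FT lact x (F_theta_elem C E F \<theta> x' y)) = \<theta> (R x x') y"
  using assms by (simp add: u_elem W_elem)

lemma u_conv: "G.E.conv s \<xi> \<Longrightarrow> F.E.conv (\<lambda>n. u (s n)) (u \<xi>)"
  by (rule conv_bounded_map[OF G.E.seminormed_axioms F.E.seminormed_axioms u(1), of 1]) (simp_all add: u_norm)

lemma u_diff: "\<xi> \<in> carrier G \<Longrightarrow> \<eta> \<in> carrier G \<Longrightarrow> u (\<xi> \<ominus>\<^bsub>G\<^esub> \<eta>) = u \<xi> \<ominus>\<^bsub>F\<^esub> u \<eta>"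
  by (rule linear_map_diff[OF G.E.cvec_axioms F.E.cvec_axioms u(1)])

lemma u_inj:
  assumes "\<xi> \<in> carrier G" "\<eta> \<in> carrier G" "u \<xi> = u \<eta>"
  shows "\<xi> = \<eta>"
proof -
  have "hnorm C G (\<xi> \<ominus>\<^bsub>G\<^esub> \<eta>) = 0"
    using u_norm[of "\<xi> \<ominus>\<^bsub>G\<^esub> \<eta>"] u_diff[OF assms(1,2)] assms by simp
  then show ?thesis using G.E.norm_eq_zero[of "\<xi> \<ominus>\<^bsub>G\<^esub> \<eta>"] G.E.diff_eq_zero assms by simp
qed

lemma u_range_closed:
  assumes s: "\<And>n. s n \<in> u ` carrier G" and y: "F.E.conv s y"
  shows "y \<in> u ` carrier G"
proof -
  define \<xi> where "\<xi> n = inv_into (carrier G) u (s n)" for n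
  have \<xi>: "\<xi> n \<in> carrier G" "s n = u (\<xi> n)" for n
    unfolding \<xi>_def using inv_into_into[OF s] f_inv_into_f[OF s] by simp_all
  have "\<xi> \<in> cauchy_seqs G (hnorm C G)"
  proof (rule G.E.cauchy_dominated[OF F.E.conv_imp_cauchy[OF y], where K = 1])
    show "hnorm C G (\<xi> m \<ominus>\<^bsub>G\<^esub> \<xi> n) \<le> 1 * hnorm C F (s m \<ominus>\<^bsub>F\<^esub> s n)" for m n
      using u_norm[of "\<xi> m \<ominus>\<^bsub>G\<^esub> \<xi> n"] u_diff[of "\<xi> m" "\<xi> n"] \<xi> by simp
  qed (use \<xi> in simp_all)
  then obtain \<eta> where \<eta>: "G.E.conv \<xi> \<eta>" by (rule G.E_convergent)
  have "s = (\<lambda>n. u (\<xi> n))" using \<xi>(2) by (rule ext)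
  then have "F.E.conv s (u \<eta>)" using u_conv[OF \<eta>] by simp
  then have "y = u \<eta>" by (rule F.E.conv_unique[OF y])
  then show ?thesis using tendsD(2)[OF \<eta>] by blast
qed

lemma u_range_subspace: "subspace_of F (u ` carrier G)"
  unfolding subspace_of_def
proof (intro conjI ballI allI)
  show "\<zero>\<^bsub>F\<^esub> \<in> u ` carrier G"
    using linear_map_zero[OF G.E.cvec_axioms F.E.cvec_axioms u(1)] G.E.M.zero_closed by (metis imageI)
  fix y assume "y \<in> u ` carrier G"
  then obtain \<xi> where \<xi>: "\<xi> \<in> carrier G" "y = u \<xi>" by blast
  show "c \<odot>\<^bsub>F\<^esub> y \<in> u ` carrier G" for c
    using linear_mapD(3)[OF u(1) \<xi>(1), of c] \<xi> by (auto intro!: image_eqI[of _ u "c \<odot>\<^bsub>G\<^esub> \<xi>"])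
  fix y' assume "y' \<in> u ` carrier G"
  then obtain \<eta> where \<eta>: "\<eta> \<in> carrier G" "y' = u \<eta>" by blast
  show "y \<oplus>\<^bsub>F\<^esub> y' \<in> u ` carrier G"
    using linear_mapD(2)[OF u(1) \<xi>(1) \<eta>(1)] \<xi> \<eta> by (auto intro!: image_eqI[of _ u "\<xi> \<oplus>\<^bsub>G\<^esub> \<eta>"])
qed auto

text \<open>
  The range contains all \<open>\<theta>(x\<^sub>1 x\<^sub>2\<^sup>*) y\<close>, hence all \<open>\<theta>(k) y\<close> with \<open>k\<close> compact.  This is where
  strictness enters: by it the compact operators act nondegenerately.
\<close>

lemma u_surj: "u ` carrier G = carrier F"
proof
  show "u ` carrier G \<subseteq> carrier F" by auto
  show "carrier F \<subseteq> u ` carrier G"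
  proof
    fix y assume y: "y \<in> carrier F"
    define S where "S = {a \<in> carrier (Ba B E). \<theta> a y \<in> u ` carrier G}"
    have S: "subspace_of (Ba B E) S"
      using u_range_subspace y linear_mapD(1)[OF u(1)] rep_scale[of "\<zero>\<^bsub>Ba B E\<^esub>" y 0]
      unfolding subspace_of_def S_def by (auto simp: rep_add rep_scale)
    have fin: "finite_rank B E \<subseteq> S"
      unfolding finite_rank_def
    proof (rule BE.lin_span_subset[OF S], safe)
      fix x x' assume x: "x \<in> carrier E" "x' \<in> carrier E"
      then have "u (elem_tensor C E FT lact x (F_theta_elem C E F \<theta> x' y)) = \<theta> (R x x') y"
        using y by (intro u_formula)
      then show "R x x' \<in> S"
        unfolding S_def using x y
        by (auto intro!: image_eqI[of _ u "elem_tensor C E FT lact x (F_theta_elem C E F \<theta> x' y)"])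
    qed
    have limit: "d \<in> S" if s: "\<And>n. s n \<in> S" "BE.conv s d" for s d
    proof -
      have "F.E.conv (\<lambda>n. \<theta> (s n) y) (\<theta> d y)"
      proof (rule conv_bounded_map[OF BE.seminormed_axioms F.E.seminormed_axioms _ _ s(2)])
        show "linear_map (Ba B E) F (\<lambda>a. \<theta> a y)" using y by (auto simp: linear_map_def rep_add rep_scale)
        show "hnorm C F (\<theta> a y) \<le> bnd * hnorm C F y * cnorm (Ba B E) a" if "a \<in> carrier (Ba B E)" for a
          using bnd(2)[OF that y] by (simp add: mult_ac)
      qed
      then show ?thesis
        using u_range_closed[of "\<lambda>n. \<theta> (s n) y"] s(1) tendsD(2)[OF s(2)] by (simp add: S_def)
    qed
    have "S \<subseteq> carrier (Ba B E)" unfolding S_def by blast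
    then have compact: "carrier (compacts B E) \<subseteq> S"
      unfolding E.carrier_compacts by (rule BE.norm_closure_least[OF fin _ limit])
    have "y \<in> norm_closure F (hnorm C F) (u ` carrier G)"
      unfolding norm_closure_def
    proof (intro CollectI conjI allI impI y)
      fix e :: real assume "e > 0"
      with y obtain d where d: "d \<in> carrier (compacts B E)" "hnorm C F (y \<ominus>\<^bsub>F\<^esub> \<theta> d y) < e"
        by (rule approximate_identity)
      then show "\<exists>s\<in>u ` carrier G. hnorm C F (y \<ominus>\<^bsub>F\<^esub> s) < e"
        using compact by (intro bexI[of _ "\<theta> d y"]) (auto simp: S_def)
    qed
    moreover have "u ` carrier G \<subseteq> carrier F" by (rule image_subsetI) simp
    ultimately obtain s where "\<forall>n. s n \<in> u ` carrier G" "F.E.conv s y"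
      using F.E.norm_closure_conv by blast
    then show "y \<in> u ` carrier G" using u_range_closed[of s y] by simp
  qed
qed

lemma u_unitary:
  shows "unitary G F u" and "y \<in> carrier F \<Longrightarrow> hm_adjoint G F u y \<in> carrier G \<and> u (hm_adjoint G F u y) = y"
proof -
  interpret GF: hilbert_pair C G F by unfold_locales
  define v where "v = inv_into (carrier G) u"
  have v: "v y \<in> carrier G" "u (v y) = y" if "y \<in> carrier F" for y
    using inv_into_into[of y u "carrier G"] f_inv_into_f[of y u "carrier G"] that
    by (simp_all add: v_def u_surj)
  have adj_ip: "ip F (u \<xi>) y = ip G \<xi> (v y)" if "\<xi> \<in> carrier G" "y \<in> carrier F" for \<xi> y
    using u_ip[OF that(1) v(1)[OF that(2)]] v(2)[OF that(2)] by simp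
  have adj: "u \<in> adjointable G F" "hm_adjoint G F u = restrict v (carrier F)"
    by (rule GF.adjointableI[of u v], simp_all add: u(2) v adj_ip)+
  have vu: "v (u \<xi>) = \<xi>" if "\<xi> \<in> carrier G" for \<xi>
    using u_inj[OF v(1) that] v(2) that by simp
  show "unitary G F u"
    unfolding unitary_def adj(2) using adj(1) v vu by (auto simp: compose_def fun_eq_iff)
  show "hm_adjoint G F u y \<in> carrier G \<and> u (hm_adjoint G F u y) = y" if "y \<in> carrier F"
    unfolding adj(2) using v that by simp
qed

lemma u_tensor_id:
  assumes a: "a \<in> carrier (Ba B E)" and \<xi>: "\<xi> \<in> carrier G"
  shows "u (tensor_id C E FT lact a \<xi>) = \<theta> a (u \<xi>)"
proof -
  define T where "T = free_map (\<lambda>(x :: 'e, \<xi> :: (nat \<Rightarrow> ('e dual \<times> 'f) \<Rightarrow>\<^sub>0 complex) set). (a x, \<xi>))"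
  have T: "T t \<in> carrier P2" if t: "t \<in> carrier P2" for t
  proof -
    have "(\<lambda>(x, \<xi>). (a x, \<xi>)) ` Poly_Mapping.keys t \<subseteq> carrier E \<times> carrier FT"
      using P2_keys[OF t] a by (force simp: case_prod_beta)
    then show ?thesis
      using keys_free_map[of "\<lambda>(x, \<xi>). (a x, \<xi>)" t] unfolding T_def pre_tensor_simps(1) by blast
  qed
  have T_lin: "linear_map P2 P2 T"
    using T by (auto simp: linear_map_def pre_tensor_simps(3,4) T_def free_map_add free_map_scale)
  have UT: "U (T t) = \<theta> a (U t)" if t: "t \<in> carrier P2" for t
  proof -
    note keys = P2_keys[OF t]
    have "U (T t) = lin_ext F (\<lambda>p. W (fst ((\<lambda>(x, \<xi>). (a x, \<xi>)) p)) (snd ((\<lambda>(x, \<xi>). (a x, \<xi>)) p))) t"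
      unfolding U_def T_def by (rule F.E.lin_ext_free_map) (use keys a in \<open>simp add: case_prod_beta\<close>)
    also have "\<dots> = lin_ext F (\<lambda>p. \<theta> a (W (fst p) (snd p))) t"
      by (rule F.E.lin_ext_cong) (use keys a in \<open>simp_all add: case_prod_beta W_Ba\<close>)
    also have "\<dots> = \<theta> a (U t)"
      unfolding U_def
      by (rule linear_map_lin_ext[OF F.E.cvec_axioms F.E.cvec_axioms rep_linear_map[OF a], symmetric]) (use keys in simp)
    finally show ?thesis .
  qed
  obtain s where s: "s \<in> P2.Cs" "\<xi> = P2.cl s" using \<xi> G_cl by metis
  have lip: "hnorm C P2 (T x \<ominus>\<^bsub>P2\<^esub> T y) \<le> cnorm (Ba C F) (\<theta> a) * hnorm C P2 (x \<ominus>\<^bsub>P2\<^esub> y)"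
    if xy: "x \<in> carrier P2" "y \<in> carrier P2" for x y
  proof -
    have d: "x \<ominus>\<^bsub>P2\<^esub> y \<in> carrier P2" using xy by (rule P2.E.diff_closed)
    have "hnorm C P2 (T x \<ominus>\<^bsub>P2\<^esub> T y) = hnorm C F (\<theta> a (U (x \<ominus>\<^bsub>P2\<^esub> y)))"
      using linear_map_diff[OF P2.E.cvec_axioms P2.E.cvec_axioms T_lin xy] U_norm[OF T[OF d]] UT[OF d] by simp
    also have "\<dots> \<le> cnorm (Ba C F) (\<theta> a) * hnorm C F (U (x \<ominus>\<^bsub>P2\<^esub> y))"
      by (rule F.opn_bound[OF rep_adj[OF a] linear_mapD(1)[OF U_linear d]])
    finally show ?thesis using U_norm[OF d] by simp
  qed
  have "tensor_id C E FT lact a \<xi> = P2.cl (\<lambda>n. T (class_rep \<xi> n))"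
    using \<xi> by (simp add: tensor_id_def T_def)
  also have "\<dots> = P2.cl (\<lambda>n. T (s n))" unfolding s(2) by (rule P2.cl_map(2)[OF T lip s(1)])
  finally have "F.E.conv (\<lambda>n. U (T (s n))) (u (tensor_id C E FT lact a \<xi>))"
    using u(3)[OF P2.cl_map(1)[OF T lip s(1)]] by simp
  then have "F.E.conv (\<lambda>n. \<theta> a (U (s n))) (u (tensor_id C E FT lact a \<xi>))"
    using UT[OF P2.E.cauchyD[OF s(1)]] by simp
  then show ?thesis
    using rep_conv[OF a u(3)[OF s(1)]] unfolding s(2) by (rule F.E.conv_unique)
qed

lemma u_intertwines:
  assumes a: "a \<in> carrier (Ba B E)"
  shows "\<theta> a = compose (carrier F) u (compose (carrier F) (tensor_id C E FT lact a) (hm_adjoint G F u))"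
proof
  fix y
  show "\<theta> a y = compose (carrier F) u (compose (carrier F) (tensor_id C E FT lact a) (hm_adjoint G F u)) y"
  proof (cases "y \<in> carrier F")
    case True
    then show ?thesis using u_unitary(2)[OF True] u_tensor_id[OF a] by simp
  next
    case False
    have "\<theta> a \<in> extensional (carrier F)" using rep_adj[OF a] unfolding adjointable_def PiE_def by blast
    then have "\<theta> a y = undefined" using False by (rule extensional_arb)
    also have "\<dots> = compose (carrier F) u (compose (carrier F) (tensor_id C E FT lact a) (hm_adjoint G F u)) y"
      unfolding compose_def using False by (simp only: restrict_apply if_False)
    finally show ?thesis .
  qed
qed

text \<open>
  The formula determines a bounded linear map: for fixed \<open>x\<close>, it prescribes \<open>\<xi> \<mapsto> v (x \<odot> \<xi>)\<close> on
  the elementary tensors \<open>\<xi>\<close> of \<open>F\<^sub>\<theta>\<close>, hence on all of \<open>F\<^sub>\<theta>\<close>.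
\<close>

lemma u_unique:
  assumes ext: "v \<in> extensional (carrier G)" and lin: "linear_map G F v"
    and bd: "\<And>\<xi>. \<xi> \<in> carrier G \<Longrightarrow> hnorm C F (v \<xi>) \<le> K * hnorm C G \<xi>"
    and v: "\<And>x x' y. x \<in> carrier E \<Longrightarrow> x' \<in> carrier E \<Longrightarrow> y \<in> carrier F \<Longrightarrow>
      v (elem_tensor C E FT lact x (F_theta_elem C E F \<theta> x' y)) = \<theta> (R x x') y"
  shows "v = u"
proof -
  have elem: "v (elem_tensor C E FT lact x \<xi>) = W x \<xi>" if x: "x \<in> carrier E" and \<xi>: "\<xi> \<in> carrier FT" for x \<xi>
  proof -
    define j where "j = elem_tensor C E FT lact x"
    have j [simp]: "j \<xi> \<in> carrier G" "u (j \<xi>) = W x \<xi>" if "\<xi> \<in> carrier FT" for \<xi>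
      using x that by (simp_all add: j_def u_elem)
    have j_lin: "linear_map FT G j"
      unfolding linear_map_def
    proof (intro conjI ballI allI Pi_I)
      fix \<xi> assume [simp]: "\<xi> \<in> carrier FT"
      show "j \<xi> \<in> carrier G" by simp
      show "j (c \<odot>\<^bsub>FT\<^esub> \<xi>) = c \<odot>\<^bsub>G\<^esub> j \<xi>" for c
        by (rule u_inj) (simp_all add: linear_mapD(3)[OF u(1)] linear_mapD(3)[OF W(1)[OF x]])
      fix \<eta> assume [simp]: "\<eta> \<in> carrier FT"
      show "j (\<xi> \<oplus>\<^bsub>FT\<^esub> \<eta>) = j \<xi> \<oplus>\<^bsub>G\<^esub> j \<eta>"
        by (rule u_inj) (simp_all add: linear_mapD(2)[OF u(1)] linear_mapD(2)[OF W(1)[OF x]])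
    qed
    obtain L where L: "\<And>\<xi>. \<xi> \<in> carrier FT \<Longrightarrow> hnorm C F (W x \<xi>) \<le> L * hnorm C FT \<xi>"
      using W(2)[OF x] by blast
    have "v (j \<xi>) = W x \<xi>"
    proof (rule tensor_map_unique[of C "dual_module E" F \<theta> C F "\<lambda>\<xi>. v (j \<xi>)" "W x" "\<bar>K\<bar> * L" L])
      show "linear_map (tensor C (dual_module E) F \<theta>) F (\<lambda>\<xi>. v (j \<xi>))"
        using lin j_lin unfolding F_theta_def[symmetric] linear_map_def by auto
      show "linear_map (tensor C (dual_module E) F \<theta>) F (W x)"
        using W(1)[OF x] unfolding F_theta_def .
      fix \<xi> assume "\<xi> \<in> carrier (tensor C (dual_module E) F \<theta>)"
      then have \<xi>: "\<xi> \<in> carrier FT" by (simp add: F_theta_def)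
      show "hnorm C F (W x \<xi>) \<le> L * hnorm C (tensor C (dual_module E) F \<theta>) \<xi>"
        using L[OF \<xi>] by (simp add: F_theta_def)
      have "hnorm C F (v (j \<xi>)) \<le> \<bar>K\<bar> * hnorm C G (j \<xi>)"
        using bd[of "j \<xi>"] \<xi> mult_right_mono[OF abs_ge_self[of K], of "hnorm C G (j \<xi>)"] by simp
      also have "\<dots> \<le> \<bar>K\<bar> * (L * hnorm C FT \<xi>)"
        using L[OF \<xi>] u_norm[of "j \<xi>"] \<xi> by (intro mult_left_mono) simp_all
      finally show "hnorm C F (v (j \<xi>)) \<le> \<bar>K\<bar> * L * hnorm C (tensor C (dual_module E) F \<theta>) \<xi>"
        by (simp add: F_theta_def mult.assoc)
    next
      fix \<zeta> y assume "\<zeta> \<in> carrier (dual_module E)" and y: "y \<in> carrier F"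
      then obtain x' where x': "\<zeta> = Star x'" "x' \<in> carrier E" by auto
      show "v (j (elem_tensor C (dual_module E) F \<theta> \<zeta> y)) = W x (elem_tensor C (dual_module E) F \<theta> \<zeta> y)"
        using v[OF x x'(2) y] W_elem[OF x x'(2) y] by (simp add: x'(1) F_theta_elem_def j_def)
    qed (use \<xi> P1_semi_hilbert F.hilbert_cs_axioms in \<open>simp_all add: F_theta_def\<close>)
    then show ?thesis by (simp add: j_def)
  qed
  have "v \<xi> = u \<xi>" if "\<xi> \<in> carrier G" for \<xi>
    by (rule tensor_map_unique[OF P2_semi_hilbert F.hilbert_cs_axioms lin u(1) bd, of 1])
      (use that in \<open>simp_all add: u_norm elem u_elem\<close>)
  then show ?thesis using ext u(2) by (metis extensionalityI)
qed

end

theorem theorem1p4: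
  fixes B :: "'b cstar" and C :: "'c cstar"
    and E :: "('b, 'e) hmodule" and F :: "('c, 'f) hmodule"
    and \<theta> :: "('e \<Rightarrow> 'e) \<Rightarrow> 'f \<Rightarrow> 'f"
  assumes E: "hilbert_module B E"
    and F: "hilbert_module C F"
    and hom: "star_hom (Ba B E) (Ba C F) \<theta>"
    and unital: "\<theta> \<one>\<^bsub>Ba B E\<^esub> = \<one>\<^bsub>Ba C F\<^esub>"
    and strict: "strict_map B E C F \<theta>"
  shows "let F\<^sub>\<theta> = F_theta C E F \<theta>;
             lact = F_theta_lact B C E F \<theta>;
             G = tensor C E F\<^sub>\<theta> lact;
             formula = (\<lambda>u. \<forall>x\<^sub>1\<in>carrier E. \<forall>x\<^sub>2\<in>carrier E. \<forall>y\<in>carrier F.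
               u (elem_tensor C E F\<^sub>\<theta> lact x\<^sub>1 (F_theta_elem C E F \<theta> x\<^sub>2 y))
                 = \<theta> (rank_one E x\<^sub>1 x\<^sub>2) y)
         in
           correspondence (Ba B E) C F \<theta> \<and>
           correspondence (compacts B E) C F \<theta> \<and>
           correspondence B C F\<^sub>\<theta> lact \<and>
           (\<exists>u. unitary G F u \<and> formula u \<and>
              (\<forall>v\<in>extensional (carrier G).
                 bounded_linear_map G (hnorm C G) F (hnorm C F) v \<and> formula v \<longrightarrow> v = u) \<and>
              (\<forall>a\<in>carrier (Ba B E).
                 \<theta> a = compose (carrier F) u
                         (compose (carrier F) (tensor_id C E F\<^sub>\<theta> lact a) (hm_adjoint G F u))))"
proof -
  interpret E: hilbert_cs B E by (rule hilbert_cs_if_hilbert_module[OF E])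
  interpret F: hilbert_cs C F by (rule hilbert_cs_if_hilbert_module[OF F])
  interpret strict_rep B E C F \<theta>
    by unfold_locales (rule hom unital strict)+
  show ?thesis
    unfolding Let_def
  proof (intro conjI Ba_correspondence compacts_correspondence FT_correspondence exI[of _ u] ballI impI)
    show "unitary G F u" by (rule u_unitary(1))
    fix v assume ext: "v \<in> extensional (carrier G)"
      and v: "bounded_linear_map G (hnorm C G) F (hnorm C F) v \<and>
        (\<forall>x\<^sub>1\<in>carrier E. \<forall>x\<^sub>2\<in>carrier E. \<forall>y\<in>carrier F.
          v (elem_tensor C E FT lact x\<^sub>1 (F_theta_elem C E F \<theta> x\<^sub>2 y)) = \<theta> (rank_one E x\<^sub>1 x\<^sub>2) y)"
    then obtain K where K: "\<And>\<xi>. \<xi> \<in> carrier G \<Longrightarrow> hnorm C F (v \<xi>) \<le> K * hnorm C G \<xi>"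
      unfolding bounded_linear_map_def by blast
    have "linear_map G F v" using v unfolding bounded_linear_map_def linear_map_def by blast
    then show "v = u" using conjunct2[OF v] by (intro u_unique[OF ext _ K]) simp_all
  qed (simp_all add: u_formula u_intertwines[symmetric])
qed


end
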